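(* Let $(H\rightrightarrows E;G\rightrightarrows M)$ be a quasi LA-groupoid with core $C$. Then the $2$-term complex $$\Gamma(C)\xrightarrow{\ \delta_H\ }\Gamma_{mul}(H),\qquad \delta_H(u)=u^r-u^l,$$ inherits a canonical $L_2$-algebra structure.
   Context: A VB-groupoid $(H\rightrightarrows E;G\rightrightarrows M)$ is a Lie groupoid $H\rightrightarrows E$ with vector bundle structures over a Lie groupoid $G\rightrightarrows M$ such that the graph of $\mathtt m_H$ is a vector subbundle over the graph of $\mathtt m_G$; core $C=\mathtt u_G^*\ker\mathtt s_H$; dual VB-groupoid $H^*\rightrightarrows C^*$. $\Gamma_{mul}(H)$ is the space of multiplicative sections: sections of $H\to G$ that are groupoid morphisms $G\to H$ over a section $M\to E$. For $u\in\Gamma(C)$, $u^r(g)=\mathtt m_H(u(\mathtt t(g)),0_g)$ and $u^l(g)=-\mathtt m_H(0_g,u(\mathtt s(g))^{-1})$. A quasi LA-groupoid structure on $H$: a degree $1$ multiplicative vector field $Q$ on the $1$-graded groupoid $H[1]\rightrightarrows E[1]$ (functions $\Gamma(\wedge^\bullet H^* )$) and $q\in\Gamma^2(A_H[1])$ with $Q^2=q^l-q^r$, $[Q,q^r]=0$ ($q^r$, $q^l$ right- and left-invariant extensions, normalized so that $q^l-q^r$ is multiplicative). $Q$ is equivalent to an anchor and a skew bracket $[\cdot,\cdot]_H$ on $\Gamma(H)$ satisfying Leibniz (pre-Lie algebroid), compatible with the groupoid structure. Dually, the quasi LA-groupoid is equivalent to a linear quasi-Poisson structure on $H^*\rightrightarrows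 C^*$: a linear multiplicative bivector $\Pi$ and a linear $\pi\in\Gamma(\wedge^3A_{H^*})$ with $\tfrac12[\Pi,\Pi]=\pi^l-\pi^r$, $[\Pi,\pi^r]=0$. An $L_2$-algebra on a $2$-term complex $\partial:\mathfrak h\to\mathfrak g$ is a skew bracket $[\cdot,\cdot]_2$ on $\mathfrak g$, a bilinear map $[\cdot,\cdot]_2:\mathfrak g\times\mathfrak h\to\mathfrak h$ and a skew trilinear $[\cdot,\cdot,\cdot]_3:\wedge^3\mathfrak g\to\mathfrak h$ forming a $2$-term $L_\infty$-algebra (semistrict Lie $2$-algebra). The canonical structure meant here: $[X,Y]_2=[X,Y]_H$ for $X,Y\in\Gamma_{mul}(H)$; $[X,c]_2\in\Gamma(C)$ is determined by $([X,c]_2)^r=[X,c^r]_H$; and $[X,Y,Z]_3\in\Gamma(C)$ is determined, up to the overall sign fixed by the sign convention for $\delta_H$, by $\pi^r(d\ell_X,d\ell_Y,d\ell_Z)=\mathtt t_{H^*}^*\ell_{[X,Y,Z]_3}$, where $\ell$ denotes the linear function on the dual bundle associated to a section. Equivalently, it is the restriction to linear functions of the $L_2$-algebra on $C^\infty(C^* )\to C^\infty_{mul}(H^* )$ determined by the quasi-Poisson structure. *)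

theory Defs
  imports "HOL-Analysis.Analysis" "HOL-Algebra.Module"
begin

section \<open>Smooth manifolds and smooth maps\<close>

primrec C_k_on :: "nat \<Rightarrow> 'v::euclidean_space set \<Rightarrow> ('v \<Rightarrow> 'w::euclidean_space) \<Rightarrow> bool" where
  "C_k_on 0 U F \<longleftrightarrow> continuous_on U F"
| "C_k_on (Suc k) U F \<longleftrightarrow>
     (\<forall>x\<in>U. F differentiable (at x)) \<and> (\<forall>v. C_k_on k U (\<lambda>x. frechet_derivative F (at x) v))"

definition C_inf_on :: "'v::euclidean_space set \<Rightarrow> ('v \<Rightarrow> 'w::euclidean_space) \<Rightarrow> bool" where
  "C_inf_on U F \<longleftrightarrow> open U \<and> (\<forall>k. C_k_on k U F)"

text \<open>A \<open>space\<close> is a set \<open>pts X\<close> of points inside a manifold given by an atlas \<open>charts X\<close>.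
  It is itself a manifold if the chart domains cover exactly \<open>pts X\<close> (predicate \<open>manifold\<close>);
  otherwise it is a subset of a manifold (such as the set of composable pairs), with smoothness of
  maps on it meaning local smooth extendability in ambient charts.

  A chart takes values in a type \<open>'v\<close> of class \<open>euclidean_space\<close>. As such types have dimension
  at least \<open>1\<close>, the image of a chart of an \<open>n\<close>-manifold is required to be a relatively open subset of
  some \<open>n\<close>-dimensional linear subspace of \<open>'v\<close>. This admits \<open>n = 0\<close>, and
  manifolds of different dimensions can share the type \<open>'v\<close>.\<close>

record ('a, 'v) space =
  pts :: "'a set"
  charts :: "('a set \<times> ('a \<Rightarrow> 'v)) set"

definition sub :: "('a, 'v) space \<Rightarrow> 'a set \<Rightarrow> ('a, 'v) space" where
  "sub X S = \<lparr>pts = S, charts = charts X\<rparr>"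

definition prod_space :: "('a, 'v) space \<Rightarrow> ('b, 'w) space \<Rightarrow> ('a \<times> 'b, 'v \<times> 'w) space"
    (infixr \<open>\<times>\<^sub>M\<close> 80) where
  "X \<times>\<^sub>M Y = \<lparr>pts = pts X \<times> pts Y,
     charts = {(U \<times> V, map_prod \<phi> \<psi>) | U \<phi> V \<psi>. (U, \<phi>) \<in> charts X \<and> (V, \<psi>) \<in> charts Y}\<rparr>"

definition euclid :: "('v, 'v::euclidean_space) space" where
  "euclid = \<lparr>pts = UNIV, charts = {(UNIV, id)}\<rparr>"

definition mtop :: "('a, 'v::euclidean_space) space \<Rightarrow> 'a topology" where
  "mtop X = topology_generated_by {{x \<in> pts X \<inter> U. \<phi> x \<in> N} | U \<phi> N. (U, \<phi>) \<in> charts X \<and> open N}"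

text \<open>\<open>F\<close> represents \<open>f\<close> in the given charts on the neighbourhood \<open>N\<close> of the image of \<open>x\<close>.\<close>

definition local_rep ::
  "('a, 'v::euclidean_space) space \<Rightarrow> ('a \<Rightarrow> 'b) \<Rightarrow> 'a \<Rightarrow> 'a set \<times> ('a \<Rightarrow> 'v) \<Rightarrow> 'b set \<times> ('b \<Rightarrow> 'w::euclidean_space)
    \<Rightarrow> 'v set \<Rightarrow> ('v \<Rightarrow> 'w) \<Rightarrow> bool" where
  "local_rep X f x c d N F \<longleftrightarrow>
     x \<in> fst c \<and> snd c x \<in> N \<and> C_inf_on N F \<and>
     (\<forall>x' \<in> pts X \<inter> fst c. snd c x' \<in> N \<longrightarrow> f x' \<in> fst d \<and> snd d (f x') = F (snd c x'))"

definition smooth_map ::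
  "('a, 'v::euclidean_space) space \<Rightarrow> ('b, 'w::euclidean_space) space \<Rightarrow> ('a \<Rightarrow> 'b) \<Rightarrow> bool" where
  "smooth_map X Y f \<longleftrightarrow> f \<in> pts X \<rightarrow> pts Y \<and>
     (\<forall>x\<in>pts X. \<exists>c\<in>charts X. \<exists>d\<in>charts Y. \<exists>N F. local_rep X f x c d N F)"

definition manifold :: "('a, 'v::euclidean_space) space \<Rightarrow> bool" where
  "manifold X \<longleftrightarrow>
     pts X = (\<Union>c\<in>charts X. fst c) \<and>
     (\<exists>n. \<forall>(U, \<phi>)\<in>charts X. inj_on \<phi> U \<and>
        (\<exists>W. subspace W \<and> dim W = n \<and> openin (top_of_set W) (\<phi> ` U))) \<and>
     (\<forall>c\<in>charts X. \<forall>d\<in>charts X. \<forall>x\<in>fst c \<inter> fst d. \<exists>N F. local_rep X id x c d N F) \<and>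
     Hausdorff_space (mtop X) \<and> second_countable (mtop X)"

text \<open>The tangent space at a point, read in a chart \<open>(U, \<phi>)\<close> of a manifold, is \<open>span (\<phi> ` U)\<close>;
  only the restriction of \<open>D\<close> to it is determined by \<open>f\<close>.\<close>

definition submersion ::
  "('a, 'v::euclidean_space) space \<Rightarrow> ('b, 'w::euclidean_space) space \<Rightarrow> ('a \<Rightarrow> 'b) \<Rightarrow> bool" where
  "submersion X Y f \<longleftrightarrow> smooth_map X Y f \<and>
     (\<forall>x\<in>pts X. \<exists>c\<in>charts X. \<exists>d\<in>charts Y. \<exists>N F D. local_rep X f x c d N F \<and>
        (F has_derivative D) (at (snd c x)) \<and> D ` span (snd c ` fst c) = span (snd d ` fst d))"


section \<open>Vector bundles\<close>

record ('b, 'v, 't, 'w) vbundle =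
  bas :: "('b, 'v) space"
  tot :: "('t, 'w) space"
  proj :: "'t \<Rightarrow> 'b"
  vadd :: "'t \<Rightarrow> 't \<Rightarrow> 't"
  vscl :: "real \<Rightarrow> 't \<Rightarrow> 't"
  vzer :: "'b \<Rightarrow> 't"

definition fibre :: "('b, 'v, 't, 'w) vbundle \<Rightarrow> 'b \<Rightarrow> 't set" where
  "fibre B b = {h \<in> pts (tot B). proj B h = b}"

definition vector_bundle ::
  "('b, 'v::euclidean_space, 't, 'w::euclidean_space) vbundle \<Rightarrow> bool" where
  "vector_bundle B \<longleftrightarrow>
     smooth_map (tot B) (bas B) (proj B) \<and>
     (\<forall>b\<in>pts (bas B). vzer B b \<in> fibre B b \<and>
        (\<forall>h\<in>fibre B b. \<forall>k\<in>fibre B b. vadd B h k \<in> fibre B b) \<and>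
        (\<forall>a. \<forall>h\<in>fibre B b. vscl B a h \<in> fibre B b)) \<and>
     (\<exists>r. \<forall>b\<^sub>0\<in>pts (bas B). \<exists>T W \<psi>.
        openin (mtop (bas B)) T \<and> b\<^sub>0 \<in> T \<and> subspace W \<and> dim W = r \<and>
        (\<forall>b\<in>T. bij_betw \<psi> (fibre B b) W \<and> \<psi> (vzer B b) = 0 \<and>
           (\<forall>h\<in>fibre B b. \<forall>k\<in>fibre B b. \<psi> (vadd B h k) = \<psi> h + \<psi> k) \<and>
           (\<forall>a. \<forall>h\<in>fibre B b. \<psi> (vscl B a h) = a *\<^sub>R \<psi> h)) \<and>
        smooth_map (sub (tot B) {h \<in> pts (tot B). proj B h \<in> T}) (euclid :: ('w, 'w) space) \<psi> \<and>
        smooth_map (sub (bas B \<times>\<^sub>M (euclid :: ('w, 'w) space)) (T \<times> W)) (tot B)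
          (\<lambda>(b, w). inv_into (fibre B b) \<psi> w))"

definition fibre_linear ::
  "('b, 'v, 't, 'w) vbundle \<Rightarrow> ('b2, 'v2, 't2, 'w2) vbundle \<Rightarrow> ('t \<Rightarrow> 't2) \<Rightarrow> ('b \<Rightarrow> 'b2) \<Rightarrow> bool" where
  "fibre_linear B B' F f \<longleftrightarrow> (\<forall>b\<in>pts (bas B).
     (\<forall>h\<in>fibre B b. F h \<in> fibre B' (f b)) \<and>
     (\<forall>h\<in>fibre B b. \<forall>k\<in>fibre B b. F (vadd B h k) = vadd B' (F h) (F k)) \<and>
     (\<forall>a. \<forall>h\<in>fibre B b. F (vscl B a h) = vscl B' a (F h)))"

definition sections :: "('b, 'v::euclidean_space, 't, 'w::euclidean_space) vbundle \<Rightarrow> ('b \<Rightarrow> 't) set" where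
  "sections B = {X \<in> extensional (pts (bas B)).
     smooth_map (bas B) (tot B) X \<and> (\<forall>b\<in>pts (bas B). X b \<in> fibre B b)}"

definition real_field :: "real ring" where
  "real_field = \<lparr>carrier = UNIV, monoid.mult = (*), one = 1, zero = 0, add = (+)\<rparr>"

text \<open>HOL-Algebra modules are records extending rings; the fields \<open>mult\<close> and \<open>one\<close> play no role.\<close>

definition section_space ::
  "('b, 'v::euclidean_space, 't, 'w::euclidean_space) vbundle \<Rightarrow> (real, 'b \<Rightarrow> 't) module" where
  "section_space B = \<lparr>carrier = sections B, monoid.mult = undefined, one = undefined,
     zero = restrict (vzer B) (pts (bas B)),
     add = (\<lambda>X Y. \<lambda>b\<in>pts (bas B). vadd B (X b) (Y b)),
     smult = (\<lambda>a X. \<lambda>b\<in>pts (bas B). vscl B a (X b))\<rparr>"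


section \<open>The graded algebra of functions on the shifted bundle\<close>

text \<open>The elements of \<open>\<Gamma>(\<wedge>\<^sup>\<bullet> B\<^sup>*)\<close>: an inhomogeneous form \<open>\<omega>\<close> assigns to a base point \<open>b\<close> and a list
  of \<open>k\<close> vectors in the fibre at \<open>b\<close> the value of its degree \<open>k\<close> component, and is \<open>0\<close> on all
  other arguments.\<close>

type_synonym ('b, 't) form = "'b \<Rightarrow> 't list \<Rightarrow> real"

definition forms :: "('b, 'v::euclidean_space, 't, 'w::euclidean_space) vbundle \<Rightarrow> ('b, 't) form set" where
  "forms B = {\<omega>.
     (\<forall>b hs. \<omega> b hs \<noteq> 0 \<longrightarrow> b \<in> pts (bas B) \<and> set hs \<subseteq> fibre B b) \<and>
     (\<forall>b\<in>pts (bas B). \<forall>xs\<in>lists (fibre B b). \<forall>ys\<in>lists (fibre B b). \<forall>h\<in>fibre B b.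
        (\<forall>k\<in>fibre B b. \<omega> b (xs @ vadd B h k # ys) = \<omega> b (xs @ h # ys) + \<omega> b (xs @ k # ys)) \<and>
        (\<forall>a. \<omega> b (xs @ vscl B a h # ys) = a * \<omega> b (xs @ h # ys)) \<and>
        (\<forall>zs\<in>lists (fibre B b). \<omega> b (xs @ h # ys @ h # zs) = 0)) \<and>
     (\<forall>Xs\<in>lists (sections B).
        smooth_map (bas B) (euclid :: (real, real) space) (\<lambda>b. \<omega> b (map (\<lambda>X. X b) Xs)))}"

definition k_forms ::
  "('b, 'v::euclidean_space, 't, 'w::euclidean_space) vbundle \<Rightarrow> nat \<Rightarrow> ('b, 't) form set" where
  "k_forms B k = {\<omega> \<in> forms B. \<forall>b hs. \<omega> b hs \<noteq> 0 \<longrightarrow> length hs = k}"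

text \<open>Sum over all shuffles; \<open>A\<close> is the set of positions of the arguments passed to \<open>\<omega>\<close>.\<close>

definition wedge :: "('b, 't) form \<Rightarrow> ('b, 't) form \<Rightarrow> ('b, 't) form" where
  "wedge \<omega> \<eta> = (\<lambda>b hs. \<Sum>A\<in>Pow {..<length hs}.
     (- 1) ^ card {(i, j). i \<in> A \<and> j \<in> {..<length hs} - A \<and> j < i} *
     \<omega> b (nths hs A) * \<eta> b (nths hs ({..<length hs} - A)))"

definition contract ::
  "('b, 'v, 't, 'w) vbundle \<Rightarrow> ('b \<Rightarrow> 't) \<Rightarrow> ('b, 't) form \<Rightarrow> ('b, 't) form" where
  "contract B X \<omega> = (\<lambda>b hs. if b \<in> pts (bas B) then \<omega> b (X b # hs) else 0)"

definition pullback ::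
  "('b, 'v, 't, 'w) vbundle \<Rightarrow> ('t \<Rightarrow> 't2) \<Rightarrow> ('b \<Rightarrow> 'b2) \<Rightarrow> ('b2, 't2) form \<Rightarrow> ('b, 't) form" where
  "pullback B F f \<omega> = (\<lambda>b hs.
     if b \<in> pts (bas B) \<and> set hs \<subseteq> fibre B b then \<omega> (f b) (map F hs) else 0)"

text \<open>Degree \<open>d\<close> derivations \<open>D\<close> from the functions on \<open>B[1]\<close> to those on \<open>B'[1]\<close> along an algebra
  morphism \<open>\<Phi>\<close> between these algebras.\<close>

definition derivation_along ::
  "('b, 'v::euclidean_space, 't, 'w::euclidean_space) vbundle \<Rightarrow>
   ('b2, 'v2::euclidean_space, 't2, 'w2::euclidean_space) vbundle \<Rightarrow>
   (('b, 't) form \<Rightarrow> ('b2, 't2) form) \<Rightarrow> nat \<Rightarrow> (('b, 't) form \<Rightarrow> ('b2, 't2) form) \<Rightarrow> bool" where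
  "derivation_along B B' \<Phi> d D \<longleftrightarrow>
     D \<in> forms B \<rightarrow> forms B' \<and>
     (\<forall>k. D \<in> k_forms B k \<rightarrow> k_forms B' (k + d)) \<and>
     (\<forall>\<omega>\<in>forms B. \<forall>\<eta>\<in>forms B. \<forall>a.
        D (\<lambda>b hs. a * \<omega> b hs + \<eta> b hs) = (\<lambda>b hs. a * D \<omega> b hs + D \<eta> b hs)) \<and>
     (\<forall>k. \<forall>\<omega>\<in>k_forms B k. \<forall>\<eta>\<in>forms B.
        D (wedge \<omega> \<eta>) = (\<lambda>b hs. wedge (D \<omega>) (\<Phi> \<eta>) b hs + (- 1) ^ (d * k) * wedge (\<Phi> \<omega>) (D \<eta>) b hs))"

abbreviation vector_field ::
  "('b, 'v::euclidean_space, 't, 'w::euclidean_space) vbundle \<Rightarrow> nat \<Rightarrow>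
   (('b, 't) form \<Rightarrow> ('b, 't) form) \<Rightarrow> bool" where
  "vector_field B d D \<equiv> derivation_along B B (\<lambda>\<omega>. \<omega>) d D"

text \<open>Graded commutator of operators of degrees \<open>d\<close> and \<open>e\<close>. As only the parities matter, the degree
  \<open>-1\<close> of a contraction is entered as \<open>1\<close>.\<close>

definition gcomm ::
  "nat \<Rightarrow> nat \<Rightarrow> (('b, 't) form \<Rightarrow> ('b, 't) form) \<Rightarrow> (('b, 't) form \<Rightarrow> ('b, 't) form) \<Rightarrow>
   ('b, 't) form \<Rightarrow> ('b, 't) form" where
  "gcomm d e D D' \<omega> = (\<lambda>b hs. D (D' \<omega>) b hs - (- 1) ^ (d * e) * D' (D \<omega>) b hs)"


section \<open>Lie groupoids and VB-groupoids\<close>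

record ('a, 'o, 'v) gpd =
  arr :: "('a, 'v) space"
  obj :: "('o, 'v) space"
  src :: "'a \<Rightarrow> 'o"
  tgt :: "'a \<Rightarrow> 'o"
  unt :: "'o \<Rightarrow> 'a"
  ivs :: "'a \<Rightarrow> 'a"
  mul :: "'a \<Rightarrow> 'a \<Rightarrow> 'a"

definition composable :: "('a, 'o, 'v) gpd \<Rightarrow> ('a \<times> 'a) set" where
  "composable G = {(g, h). g \<in> pts (arr G) \<and> h \<in> pts (arr G) \<and> src G g = tgt G h}"

definition groupoid :: "('a, 'o, 'v) gpd \<Rightarrow> bool" where
  "groupoid G \<longleftrightarrow>
     src G \<in> pts (arr G) \<rightarrow> pts (obj G) \<and> tgt G \<in> pts (arr G) \<rightarrow> pts (obj G) \<and>
     (\<forall>x\<in>pts (obj G). unt G x \<in> pts (arr G) \<and> src G (unt G x) = x \<and> tgt G (unt G x) = x) \<and>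
     (\<forall>(g, h)\<in>composable G. mul G g h \<in> pts (arr G) \<and>
        src G (mul G g h) = src G h \<and> tgt G (mul G g h) = tgt G g) \<and>
     (\<forall>g h k. (g, h) \<in> composable G \<and> (h, k) \<in> composable G \<longrightarrow>
        mul G (mul G g h) k = mul G g (mul G h k)) \<and>
     (\<forall>g\<in>pts (arr G). mul G (unt G (tgt G g)) g = g \<and> mul G g (unt G (src G g)) = g) \<and>
     (\<forall>g\<in>pts (arr G). ivs G g \<in> pts (arr G) \<and> src G (ivs G g) = tgt G g \<and> tgt G (ivs G g) = src G g \<and>
        mul G g (ivs G g) = unt G (tgt G g) \<and> mul G (ivs G g) g = unt G (src G g))"

definition Lie_groupoid :: "('a, 'o, 'v::euclidean_space) gpd \<Rightarrow> bool" where
  "Lie_groupoid G \<longleftrightarrow> groupoid G \<and> manifold (arr G) \<and> manifold (obj G) \<and>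
     submersion (arr G) (obj G) (src G) \<and> submersion (arr G) (obj G) (tgt G) \<and>
     smooth_map (obj G) (arr G) (unt G) \<and> smooth_map (arr G) (arr G) (ivs G) \<and>
     smooth_map (sub (arr G \<times>\<^sub>M arr G) (composable G)) (arr G) (\<lambda>(g, h). mul G g h)"

definition gpd_morphism ::
  "('a, 'o, 'v) gpd \<Rightarrow> ('a2, 'o2, 'v2) gpd \<Rightarrow> ('a \<Rightarrow> 'a2) \<Rightarrow> ('o \<Rightarrow> 'o2) \<Rightarrow> bool" where
  "gpd_morphism G H F f \<longleftrightarrow>
     F \<in> pts (arr G) \<rightarrow> pts (arr H) \<and> f \<in> pts (obj G) \<rightarrow> pts (obj H) \<and>
     (\<forall>g\<in>pts (arr G). src H (F g) = f (src G g) \<and> tgt H (F g) = f (tgt G g)) \<and>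
     (\<forall>x\<in>pts (obj G). F (unt G x) = unt H (f x)) \<and>
     (\<forall>(g, h)\<in>composable G. F (mul G g h) = mul H (F g) (F h))"

text \<open>The data of \<open>(H \<rightrightarrows> E; G \<rightrightarrows> M)\<close>: the groupoids \<open>Hg\<close> (\<open>H \<rightrightarrows> E\<close>) and \<open>Gg\<close> (\<open>G \<rightrightarrows> M\<close>), and the
  vector bundles \<open>Hb\<close> (\<open>H \<rightarrow> G\<close>) and \<open>Eb\<close> (\<open>E \<rightarrow> M\<close>).\<close>

record ('h, 'e, 'g, 'm, 'v) vbg =
  Hg :: "('h, 'e, 'v) gpd"
  Gg :: "('g, 'm, 'v) gpd"
  Hb :: "('g, 'v, 'h, 'v) vbundle"
  Eb :: "('m, 'v, 'e, 'v) vbundle"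

definition mul_graph_bundle ::
  "('h, 'e, 'g, 'm, 'v) vbg \<Rightarrow>
   ('g \<times> 'g \<times> 'g, 'v \<times> 'v \<times> 'v, 'h \<times> 'h \<times> 'h, 'v \<times> 'v \<times> 'v) vbundle" where
  "mul_graph_bundle V = (let G = Gg V; H = Hg V; B = Hb V in
     \<lparr>bas = sub (arr G \<times>\<^sub>M arr G \<times>\<^sub>M arr G) {(g, h, mul G g h) | g h. (g, h) \<in> composable G},
      tot = sub (arr H \<times>\<^sub>M arr H \<times>\<^sub>M arr H) {(g, h, mul H g h) | g h. (g, h) \<in> composable H},
      proj = map_prod (proj B) (map_prod (proj B) (proj B)),
      vadd = (\<lambda>(h\<^sub>1, h\<^sub>2, h\<^sub>3) (k\<^sub>1, k\<^sub>2, k\<^sub>3). (vadd B h\<^sub>1 k\<^sub>1, vadd B h\<^sub>2 k\<^sub>2, vadd B h\<^sub>3 k\<^sub>3)),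
      vscl = (\<lambda>a. map_prod (vscl B a) (map_prod (vscl B a) (vscl B a))),
      vzer = map_prod (vzer B) (map_prod (vzer B) (vzer B))\<rparr>)"

text \<open>The last condition says that the graph of \<open>m\<^sub>H\<close>, with the operations of \<open>H \<times> H \<times> H\<close>, is a
  vector subbundle over the graph of \<open>m\<^sub>G\<close>. Linearity of the source, target and
  unit maps expresses that the linear structure of \<open>E\<close> is the one induced from \<open>H\<close>.\<close>

definition VB_groupoid :: "('h, 'e, 'g, 'm, 'v::euclidean_space) vbg \<Rightarrow> bool" where
  "VB_groupoid V \<longleftrightarrow>
     Lie_groupoid (Hg V) \<and> Lie_groupoid (Gg V) \<and>
     bas (Hb V) = arr (Gg V) \<and> tot (Hb V) = arr (Hg V) \<and> vector_bundle (Hb V) \<and>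
     bas (Eb V) = obj (Gg V) \<and> tot (Eb V) = obj (Hg V) \<and> vector_bundle (Eb V) \<and>
     gpd_morphism (Hg V) (Gg V) (proj (Hb V)) (proj (Eb V)) \<and>
     fibre_linear (Hb V) (Eb V) (src (Hg V)) (src (Gg V)) \<and>
     fibre_linear (Hb V) (Eb V) (tgt (Hg V)) (tgt (Gg V)) \<and>
     fibre_linear (Eb V) (Hb V) (unt (Hg V)) (unt (Gg V)) \<and>
     vector_bundle (mul_graph_bundle V)"

definition core :: "('h, 'e, 'g, 'm, 'v) vbg \<Rightarrow> ('m, 'v, 'h, 'v) vbundle" where
  "core V = (let G = Gg V; H = Hg V; B = Hb V in
     \<lparr>bas = obj G,
      tot = sub (arr H) {c. \<exists>x\<in>pts (obj G). c \<in> fibre B (unt G x) \<and> src H c = vzer (Eb V) x},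
      proj = (\<lambda>c. src G (proj B c)), vadd = vadd B, vscl = vscl B, vzer = (\<lambda>x. vzer B (unt G x))\<rparr>)"

definition right_inv :: "('h, 'e, 'g, 'm, 'v) vbg \<Rightarrow> ('m \<Rightarrow> 'h) \<Rightarrow> 'g \<Rightarrow> 'h" where
  "right_inv V u = (\<lambda>g\<in>pts (arr (Gg V)). mul (Hg V) (u (tgt (Gg V) g)) (vzer (Hb V) g))"

definition left_inv :: "('h, 'e, 'g, 'm, 'v) vbg \<Rightarrow> ('m \<Rightarrow> 'h) \<Rightarrow> 'g \<Rightarrow> 'h" where
  "left_inv V u = (\<lambda>g\<in>pts (arr (Gg V)).
     vscl (Hb V) (- 1) (mul (Hg V) (vzer (Hb V) g) (ivs (Hg V) (u (src (Gg V) g)))))"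

definition delta :: "('h, 'e, 'g, 'm, 'v) vbg \<Rightarrow> ('m \<Rightarrow> 'h) \<Rightarrow> 'g \<Rightarrow> 'h" where
  "delta V u = (\<lambda>g\<in>pts (arr (Gg V)).
     vadd (Hb V) (right_inv V u g) (vscl (Hb V) (- 1) (left_inv V u g)))"

definition mul_sections :: "('h, 'e, 'g, 'm, 'v::euclidean_space) vbg \<Rightarrow> ('g \<Rightarrow> 'h) set" where
  "mul_sections V = {X \<in> sections (Hb V). \<exists>x\<in>sections (Eb V). gpd_morphism (Gg V) (Hg V) X x}"

definition core_space :: "('h, 'e, 'g, 'm, 'v::euclidean_space) vbg \<Rightarrow> (real, 'm \<Rightarrow> 'h) module" where
  "core_space V = section_space (core V)"

definition mul_space :: "('h, 'e, 'g, 'm, 'v::euclidean_space) vbg \<Rightarrow> (real, 'g \<Rightarrow> 'h) module" where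
  "mul_space V = (section_space (Hb V))\<lparr>carrier := mul_sections V\<rparr>"


section \<open>Vector fields on the graded groupoid and quasi LA-groupoids\<close>

text \<open>The bundle \<open>H\<^sup>(\<^sup>2\<^sup>) \<rightarrow> G\<^sup>(\<^sup>2\<^sup>)\<close>; the functions on the composable pairs of \<open>H[1] \<rightrightarrows> E[1]\<close> are its forms.\<close>

definition comp_bundle ::
  "('h, 'e, 'g, 'm, 'v) vbg \<Rightarrow> ('g \<times> 'g, 'v \<times> 'v, 'h \<times> 'h, 'v \<times> 'v) vbundle" where
  "comp_bundle V = (let B = Hb V in
     \<lparr>bas = sub (arr (Gg V) \<times>\<^sub>M arr (Gg V)) (composable (Gg V)),
      tot = sub (arr (Hg V) \<times>\<^sub>M arr (Hg V)) (composable (Hg V)),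
      proj = map_prod (proj B) (proj B),
      vadd = (\<lambda>(h\<^sub>1, h\<^sub>2) (k\<^sub>1, k\<^sub>2). (vadd B h\<^sub>1 k\<^sub>1, vadd B h\<^sub>2 k\<^sub>2)),
      vscl = (\<lambda>a. map_prod (vscl B a) (vscl B a)),
      vzer = map_prod (vzer B) (vzer B)\<rparr>)"

definition pull_src :: "('h, 'e, 'g, 'm, 'v) vbg \<Rightarrow> ('m, 'e) form \<Rightarrow> ('g, 'h) form" where
  "pull_src V = pullback (Hb V) (src (Hg V)) (src (Gg V))"

definition pull_tgt :: "('h, 'e, 'g, 'm, 'v) vbg \<Rightarrow> ('m, 'e) form \<Rightarrow> ('g, 'h) form" where
  "pull_tgt V = pullback (Hb V) (tgt (Hg V)) (tgt (Gg V))"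

definition pull_unt :: "('h, 'e, 'g, 'm, 'v) vbg \<Rightarrow> ('g, 'h) form \<Rightarrow> ('m, 'e) form" where
  "pull_unt V = pullback (Eb V) (unt (Hg V)) (unt (Gg V))"

definition pull_ivs :: "('h, 'e, 'g, 'm, 'v) vbg \<Rightarrow> ('g, 'h) form \<Rightarrow> ('g, 'h) form" where
  "pull_ivs V = pullback (Hb V) (ivs (Hg V)) (ivs (Gg V))"

definition pull_fst :: "('h, 'e, 'g, 'm, 'v) vbg \<Rightarrow> ('g, 'h) form \<Rightarrow> ('g \<times> 'g, 'h \<times> 'h) form" where
  "pull_fst V = pullback (comp_bundle V) fst fst"

definition pull_snd :: "('h, 'e, 'g, 'm, 'v) vbg \<Rightarrow> ('g, 'h) form \<Rightarrow> ('g \<times> 'g, 'h \<times> 'h) form" where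
  "pull_snd V = pullback (comp_bundle V) snd snd"

definition pull_mul :: "('h, 'e, 'g, 'm, 'v) vbg \<Rightarrow> ('g, 'h) form \<Rightarrow> ('g \<times> 'g, 'h \<times> 'h) form" where
  "pull_mul V = pullback (comp_bundle V) (\<lambda>(h, k). mul (Hg V) h k) (\<lambda>(g, h). mul (Gg V) g h)"

text \<open>\<open>Q\<close> is a groupoid morphism from \<open>H[1]\<close> to its (shifted) tangent groupoid over a vector field \<open>Q\<^sub>E\<close> on
  \<open>E[1]\<close>; \<open>Q\<^sub>2\<close> is the vector field \<open>(Q, Q)\<close> on the composable pairs.\<close>

definition multiplicative_vf ::
  "('h, 'e, 'g, 'm, 'v::euclidean_space) vbg \<Rightarrow> nat \<Rightarrow> (('g, 'h) form \<Rightarrow> ('g, 'h) form) \<Rightarrow> bool" where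
  "multiplicative_vf V d Q \<longleftrightarrow> vector_field (Hb V) d Q \<and>
     (\<exists>Q\<^sub>E. vector_field (Eb V) d Q\<^sub>E \<and>
        (\<forall>\<omega>\<in>forms (Eb V). Q (pull_src V \<omega>) = pull_src V (Q\<^sub>E \<omega>) \<and> Q (pull_tgt V \<omega>) = pull_tgt V (Q\<^sub>E \<omega>)) \<and>
        (\<forall>\<omega>\<in>forms (Hb V). Q\<^sub>E (pull_unt V \<omega>) = pull_unt V (Q \<omega>))) \<and>
     (\<exists>Q\<^sub>2. vector_field (comp_bundle V) d Q\<^sub>2 \<and> (\<forall>\<omega>\<in>forms (Hb V).
        Q\<^sub>2 (pull_fst V \<omega>) = pull_fst V (Q \<omega>) \<and>
        Q\<^sub>2 (pull_snd V \<omega>) = pull_snd V (Q \<omega>) \<and>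
        Q\<^sub>2 (pull_mul V \<omega>) = pull_mul V (Q \<omega>)))"

text \<open>Degree \<open>d\<close> sections of the Lie algebroid \<open>A\<close> of \<open>H[1] \<rightrightarrows> E[1]\<close>: vector fields along the units that are tangent
  to the source fibres.\<close>

definition algebroid_section ::
  "('h, 'e, 'g, 'm, 'v::euclidean_space) vbg \<Rightarrow> nat \<Rightarrow> (('g, 'h) form \<Rightarrow> ('m, 'e) form) \<Rightarrow> bool" where
  "algebroid_section V d q \<longleftrightarrow> derivation_along (Hb V) (Eb V) (pull_unt V) d q \<and>
     (\<forall>\<omega>\<in>forms (Eb V). q (pull_src V \<omega>) = (\<lambda>b hs. 0))"

text \<open>Right invariance of \<open>R\<close> means \<open>R(gh) = R(g) \<cdot> 0\<^sub>h\<close>, i.e. the vector field \<open>R\<^sub>2 = (R, 0)\<close> on the composable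
  pairs is related to \<open>R\<close> by the multiplication.\<close>

definition right_invariant_vf ::
  "('h, 'e, 'g, 'm, 'v::euclidean_space) vbg \<Rightarrow> nat \<Rightarrow> (('g, 'h) form \<Rightarrow> ('g, 'h) form) \<Rightarrow> bool" where
  "right_invariant_vf V d R \<longleftrightarrow> vector_field (Hb V) d R \<and>
     (\<forall>\<omega>\<in>forms (Eb V). R (pull_src V \<omega>) = (\<lambda>b hs. 0)) \<and>
     (\<exists>R\<^sub>2. vector_field (comp_bundle V) d R\<^sub>2 \<and> (\<forall>\<omega>\<in>forms (Hb V).
        R\<^sub>2 (pull_fst V \<omega>) = pull_fst V (R \<omega>) \<and>
        R\<^sub>2 (pull_snd V \<omega>) = (\<lambda>b hs. 0) \<and>
        R\<^sub>2 (pull_mul V \<omega>) = pull_mul V (R \<omega>)))"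

definition right_extension ::
  "('h, 'e, 'g, 'm, 'v::euclidean_space) vbg \<Rightarrow> nat \<Rightarrow> (('g, 'h) form \<Rightarrow> ('m, 'e) form) \<Rightarrow>
   (('g, 'h) form \<Rightarrow> ('g, 'h) form) \<Rightarrow> bool" where
  "right_extension V d q R \<longleftrightarrow>
     right_invariant_vf V d R \<and> (\<forall>\<omega>\<in>forms (Hb V). pull_unt V (R \<omega>) = q \<omega>)"

text \<open>The left-invariant extension \<open>q\<^sup>l = - i\<^sub>* q\<^sup>r\<close>, with \<open>i\<close> the inversion; with this sign
  \<open>q\<^sup>l - q\<^sup>r\<close> is multiplicative, in accordance with \<open>u\<^sup>l(g) = - 0\<^sub>g \<cdot> u(s(g))\<^sup>-\<^sup>1\<close>.\<close>

definition left_extension ::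
  "('h, 'e, 'g, 'm, 'v) vbg \<Rightarrow> (('g, 'h) form \<Rightarrow> ('g, 'h) form) \<Rightarrow> ('g, 'h) form \<Rightarrow> ('g, 'h) form" where
  "left_extension V qr \<omega> = (\<lambda>b hs. - pull_ivs V (qr (pull_ivs V \<omega>)) b hs)"

text \<open>The right-invariant extension \<open>qr\<close> of \<open>q\<close> is uniquely determined by \<open>q\<close>; it is carried along as
  a name for \<open>q\<^sup>r\<close>.\<close>

definition quasi_LA_groupoid ::
  "('h, 'e, 'g, 'm, 'v::euclidean_space) vbg \<Rightarrow> (('g, 'h) form \<Rightarrow> ('g, 'h) form) \<Rightarrow>
   (('g, 'h) form \<Rightarrow> ('m, 'e) form) \<Rightarrow> (('g, 'h) form \<Rightarrow> ('g, 'h) form) \<Rightarrow> bool" where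
  "quasi_LA_groupoid V Q q qr \<longleftrightarrow> VB_groupoid V \<and>
     multiplicative_vf V 1 Q \<and> algebroid_section V 2 q \<and> right_extension V 2 q qr \<and>
     (\<forall>\<omega>\<in>forms (Hb V). Q (Q \<omega>) = (\<lambda>b hs. left_extension V qr \<omega> b hs - qr \<omega> b hs)) \<and>
     (\<forall>\<omega>\<in>forms (Hb V). gcomm 1 2 Q qr \<omega> = (\<lambda>b hs. 0))"


section \<open>The brackets\<close>

text \<open>The bracket \<open>Z = [X, Y]\<^sub>H\<close> is the derived bracket
  \<open>\<iota>\<^sub>Z = [[\<iota>\<^sub>X, Q], \<iota>\<^sub>Y]\<close> of the degree 1 vector field \<open>Q\<close>.\<close>

definition is_LA_bracket ::
  "('h, 'e, 'g, 'm, 'v::euclidean_space) vbg \<Rightarrow> (('g, 'h) form \<Rightarrow> ('g, 'h) form) \<Rightarrow>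
   ('g \<Rightarrow> 'h) \<Rightarrow> ('g \<Rightarrow> 'h) \<Rightarrow> ('g \<Rightarrow> 'h) \<Rightarrow> bool" where
  "is_LA_bracket V Q X Y Z \<longleftrightarrow> Z \<in> sections (Hb V) \<and>
     (\<forall>\<omega>\<in>forms (Hb V). contract (Hb V) Z \<omega> =
        gcomm 0 1 (gcomm 1 1 (contract (Hb V) X) Q) (contract (Hb V) Y) \<omega>)"

definition LA_bracket ::
  "('h, 'e, 'g, 'm, 'v::euclidean_space) vbg \<Rightarrow> (('g, 'h) form \<Rightarrow> ('g, 'h) form) \<Rightarrow>
   ('g \<Rightarrow> 'h) \<Rightarrow> ('g \<Rightarrow> 'h) \<Rightarrow> 'g \<Rightarrow> 'h" where
  "LA_bracket V Q X Y = (THE Z. is_LA_bracket V Q X Y Z)"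

text \<open>Likewise a degree 2 vector field \<open>R\<close> on \<open>H[1]\<close> gives the section \<open>W\<close> of \<open>H\<close> with
  \<open>\<iota>\<^sub>W = [[[R, \<iota>\<^sub>X], \<iota>\<^sub>Y], \<iota>\<^sub>Z]\<close>, and the linear trivector on \<open>H\<^sup>*\<close> dual to \<open>R\<close> takes the value \<open>\<ell>\<^sub>W\<close> on
  \<open>(d\<ell>\<^sub>X, d\<ell>\<^sub>Y, d\<ell>\<^sub>Z)\<close>.\<close>

definition is_ternary ::
  "('h, 'e, 'g, 'm, 'v::euclidean_space) vbg \<Rightarrow> (('g, 'h) form \<Rightarrow> ('g, 'h) form) \<Rightarrow>
   ('g \<Rightarrow> 'h) \<Rightarrow> ('g \<Rightarrow> 'h) \<Rightarrow> ('g \<Rightarrow> 'h) \<Rightarrow> ('g \<Rightarrow> 'h) \<Rightarrow> bool" where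
  "is_ternary V R X Y Z W \<longleftrightarrow> W \<in> sections (Hb V) \<and>
     (\<forall>\<omega>\<in>forms (Hb V). contract (Hb V) W \<omega> =
        gcomm 0 1 (gcomm 1 1 (gcomm 2 1 R (contract (Hb V) X)) (contract (Hb V) Y)) (contract (Hb V) Z) \<omega>)"

text \<open>Points of the dual bundle are pairs \<open>(b, \<xi>)\<close> with \<open>\<xi>\<close> a linear form on the fibre at \<open>b\<close>.\<close>

definition dual_pts :: "('b, 'v, 't, 'w) vbundle \<Rightarrow> ('b \<times> ('t \<Rightarrow> real)) set" where
  "dual_pts B = {(b, \<xi>). b \<in> pts (bas B) \<and>
     (\<forall>h\<in>fibre B b. \<forall>k\<in>fibre B b. \<xi> (vadd B h k) = \<xi> h + \<xi> k) \<and>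
     (\<forall>a. \<forall>h\<in>fibre B b. \<xi> (vscl B a h) = a * \<xi> h)}"

definition ell :: "('b \<Rightarrow> 't) \<Rightarrow> 'b \<times> ('t \<Rightarrow> real) \<Rightarrow> real" where
  "ell X = (\<lambda>(b, \<xi>). \<xi> (X b))"

text \<open>The target map \<open>H\<^sup>* \<rightarrow> C\<^sup>*\<close> of the dual VB-groupoid.\<close>

definition tgt_dual ::
  "('h, 'e, 'g, 'm, 'v) vbg \<Rightarrow> 'g \<times> ('h \<Rightarrow> real) \<Rightarrow> 'm \<times> ('h \<Rightarrow> real)" where
  "tgt_dual V = (\<lambda>(g, \<xi>). (tgt (Gg V) g, \<lambda>c. \<xi> (mul (Hg V) c (vzer (Hb V) g))))"

definition pi_r ::
  "('h, 'e, 'g, 'm, 'v::euclidean_space) vbg \<Rightarrow> (('g, 'h) form \<Rightarrow> ('g, 'h) form) \<Rightarrow>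
   ('g \<Rightarrow> 'h) \<Rightarrow> ('g \<Rightarrow> 'h) \<Rightarrow> ('g \<Rightarrow> 'h) \<Rightarrow> 'g \<times> ('h \<Rightarrow> real) \<Rightarrow> real" where
  "pi_r V qr X Y Z = ell (THE W. is_ternary V qr X Y Z W)"

definition is_action ::
  "('h, 'e, 'g, 'm, 'v::euclidean_space) vbg \<Rightarrow> (('g, 'h) form \<Rightarrow> ('g, 'h) form) \<Rightarrow>
   ('g \<Rightarrow> 'h) \<Rightarrow> ('m \<Rightarrow> 'h) \<Rightarrow> ('m \<Rightarrow> 'h) \<Rightarrow> bool" where
  "is_action V Q X c c' \<longleftrightarrow> c' \<in> sections (core V) \<and>
     right_inv V c' = LA_bracket V Q X (right_inv V c)"

definition action :: "('h, 'e, 'g, 'm, 'v::euclidean_space) vbg \<Rightarrow> (('g, 'h) form \<Rightarrow> ('g, 'h) form) \<Rightarrow>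
   ('g \<Rightarrow> 'h) \<Rightarrow> ('m \<Rightarrow> 'h) \<Rightarrow> 'm \<Rightarrow> 'h" where
  "action V Q X c = (THE c'. is_action V Q X c c')"

definition is_triple ::
  "('h, 'e, 'g, 'm, 'v::euclidean_space) vbg \<Rightarrow> (('g, 'h) form \<Rightarrow> ('g, 'h) form) \<Rightarrow>
   ('g \<Rightarrow> 'h) \<Rightarrow> ('g \<Rightarrow> 'h) \<Rightarrow> ('g \<Rightarrow> 'h) \<Rightarrow> ('m \<Rightarrow> 'h) \<Rightarrow> bool" where
  "is_triple V qr X Y Z c \<longleftrightarrow> c \<in> sections (core V) \<and>
     (\<forall>p\<in>dual_pts (Hb V). pi_r V qr X Y Z p = ell c (tgt_dual V p))"

definition triple :: "('h, 'e, 'g, 'm, 'v::euclidean_space) vbg \<Rightarrow> (('g, 'h) form \<Rightarrow> ('g, 'h) form) \<Rightarrow>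
   ('g \<Rightarrow> 'h) \<Rightarrow> ('g \<Rightarrow> 'h) \<Rightarrow> ('g \<Rightarrow> 'h) \<Rightarrow> 'm \<Rightarrow> 'h" where
  "triple V qr X Y Z = (THE c. is_triple V qr X Y Z c)"


section \<open>\<open>L\<^sub>2\<close>-algebras\<close>

definition linear_on :: "(real, 'a) module \<Rightarrow> (real, 'b) module \<Rightarrow> ('a \<Rightarrow> 'b) \<Rightarrow> bool" where
  "linear_on M N f \<longleftrightarrow> f \<in> carrier M \<rightarrow> carrier N \<and>
     (\<forall>x\<in>carrier M. \<forall>y\<in>carrier M. f (x \<oplus>\<^bsub>M\<^esub> y) = f x \<oplus>\<^bsub>N\<^esub> f y) \<and>
     (\<forall>a. \<forall>x\<in>carrier M. f (a \<odot>\<^bsub>M\<^esub> x) = a \<odot>\<^bsub>N\<^esub> f x)"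

text \<open>2-term \<open>L\<^sub>\<infinity>\<close>-algebras \<open>\<partial> : \<hh> \<rightarrow> \<gg>\<close> in the sign conventions of Baez and Crans. The bracket
  \<open>[u, x]\<close> of \<open>u \<in> \<hh>\<close> and \<open>x \<in> \<gg>\<close> is \<open>- [x, u] = - act x u\<close>, and the bracket on \<open>\<hh>\<close> vanishes.\<close>

locale L2_algebra =
  fixes h :: "(real, 'h) module" and g :: "(real, 'g) module"
    and bd :: "'h \<Rightarrow> 'g" and br :: "'g \<Rightarrow> 'g \<Rightarrow> 'g" and act :: "'g \<Rightarrow> 'h \<Rightarrow> 'h"
    and tri :: "'g \<Rightarrow> 'g \<Rightarrow> 'g \<Rightarrow> 'h"
  assumes module_h: "Module.module real_field h"
    and module_g: "Module.module real_field g"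
    and bd_linear: "linear_on h g bd"
    and br_linear: "\<And>x. x \<in> carrier g \<Longrightarrow> linear_on g g (br x)"
    and br_skew: "\<And>x y. \<lbrakk>x \<in> carrier g; y \<in> carrier g\<rbrakk> \<Longrightarrow> br y x = \<ominus>\<^bsub>g\<^esub> br x y"
    and act_linear_right: "\<And>x. x \<in> carrier g \<Longrightarrow> linear_on h h (act x)"
    and act_linear_left: "\<And>u. u \<in> carrier h \<Longrightarrow> linear_on g h (\<lambda>x. act x u)"
    and tri_linear: "\<And>x y. \<lbrakk>x \<in> carrier g; y \<in> carrier g\<rbrakk> \<Longrightarrow> linear_on g h (tri x y)"
    and tri_skew: "\<And>x y z. \<lbrakk>x \<in> carrier g; y \<in> carrier g; z \<in> carrier g\<rbrakk> \<Longrightarrow>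
      tri y x z = \<ominus>\<^bsub>h\<^esub> tri x y z \<and> tri x z y = \<ominus>\<^bsub>h\<^esub> tri x y z"
    and bd_act: "\<And>x u. \<lbrakk>x \<in> carrier g; u \<in> carrier h\<rbrakk> \<Longrightarrow> bd (act x u) = br x (bd u)"
    and act_bd: "\<And>u v. \<lbrakk>u \<in> carrier h; v \<in> carrier h\<rbrakk> \<Longrightarrow> act (bd u) v = \<ominus>\<^bsub>h\<^esub> act (bd v) u"
    and jacobi: "\<And>x y z. \<lbrakk>x \<in> carrier g; y \<in> carrier g; z \<in> carrier g\<rbrakk> \<Longrightarrow>
      bd (tri x y z) = br x (br y z) \<oplus>\<^bsub>g\<^esub> br y (br z x) \<oplus>\<^bsub>g\<^esub> br z (br x y)"
    and jacobi_act: "\<And>x y u. \<lbrakk>x \<in> carrier g; y \<in> carrier g; u \<in> carrier h\<rbrakk> \<Longrightarrow>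
      tri x y (bd u) = act x (act y u) \<ominus>\<^bsub>h\<^esub> act y (act x u) \<ominus>\<^bsub>h\<^esub> act (br x y) u"
    and coherence: "\<And>w x y z. \<lbrakk>w \<in> carrier g; x \<in> carrier g; y \<in> carrier g; z \<in> carrier g\<rbrakk> \<Longrightarrow>
      act w (tri x y z) \<ominus>\<^bsub>h\<^esub> act x (tri w y z) \<oplus>\<^bsub>h\<^esub> act y (tri w x z) \<ominus>\<^bsub>h\<^esub> act z (tri w x y) =
      tri (br w x) y z \<ominus>\<^bsub>h\<^esub> tri (br w y) x z \<oplus>\<^bsub>h\<^esub> tri (br w z) x y
      \<oplus>\<^bsub>h\<^esub> tri (br x y) w z \<ominus>\<^bsub>h\<^esub> tri (br x z) w y \<oplus>\<^bsub>h\<^esub> tri (br y z) w x"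

end

theory Submission
  imports Defs "HOL-Computational_Algebra.Polynomial" "HOL-Library.Function_Algebras"
begin

text \<open>Sections of a vector bundle correspond to the degree \<open>-1\<close> derivations of its algebra of
  forms: a derivation of degree \<open>-1\<close> is the contraction with a unique section. Local frames,
  extended to global sections and forms by bump functions, reduce this to linear algebra in the
  fibres. It yields the brackets on \<open>\<Gamma>(H)\<close> as derived brackets of \<open>Q\<close> and \<open>q\<^sup>r\<close>, and the Jacobi and
  coherence identities become formal consequences of \<open>Q\<^sup>2 = q\<^sup>l - q\<^sup>r\<close> and \<open>[Q, q\<^sup>r] = 0\<close>.

  The same correspondence on the bundle of composable pairs \<open>H\<^sup>(\<^sup>2\<^sup>) \<rightarrow> G\<^sup>(\<^sup>2\<^sup>)\<close> shows that the operations
  preserve triples of sections \<open>(X\<^sub>1, X\<^sub>0, X)\<close> with \<open>X(gh) = X\<^sub>1(g) X\<^sub>0(h)\<close>. Multiplicative sections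
  are the triples \<open>(X, X, X)\<close>, right-invariant ones \<open>(X, 0, X)\<close> and left-invariant ones \<open>(0, X,
  X)\<close>, and a triple \<open>(0, 0, X)\<close> has \<open>X = 0\<close>. Hence brackets of right- with left-invariant sections
  vanish, and the operations of the \<open>L\<^sub>2\<close>-algebra are well defined. Finally \<open>u\<^sup>l\<close> is minus the image
  of \<open>u\<^sup>r\<close> under the inversion, which also exchanges \<open>q\<^sup>r\<close> and \<open>-q\<^sup>l\<close>; so \<open>\<delta>\<^sub>H\<close> of the ternary bracket
  is the Jacobiator.\<close>

section \<open>Smooth functions on Euclidean spaces\<close>

text \<open>Two obstacles shape the argument. The composable pairs are available only as a subset of
  a product of manifolds, and the bundle over them is known only through the graph of the
  multiplication. Smoothness is therefore organized around properties that pass to subsets and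
  products (\<open>smooth_space\<close>, \<open>has_bumps\<close>), and a bundle enters only through
  \<open>framed_bundle\<close>: global sections and one-forms that are a frame up to a cut-off
  function. Secondly, multiplicativity of \<open>Q\<close> speaks of source, target, units and
  products, whereas the differential involves inverses. The relation [X, i_* u^r] = i_* [X, u]^r is
  recovered in \<open>br_push_ivs\<close> from the multiplicativity of [X, delta u], by comparing
  values at units. Identities between brackets are proved for contraction operators, where they are
  expansions of words in Q, q^r and anticommuting letters, and are transferred to sections because
  one-forms separate points. Identities between core sections are checked in the sections of H,
  through the injective map u -> u^r.\<close>

lemma C_k_on_cong:
  assumes "open U" "\<And>x. x \<in> U \<Longrightarrow> F x = G x" "C_k_on k U F"
  shows "C_k_on k U G"
  using assms(2,3)
proof (induction k arbitrary: F G)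
  case 0
  then show ?case by (simp cong: continuous_on_cong)
next
  case (Suc k)
  have d: "G differentiable (at x)" "frechet_derivative G (at x) = frechet_derivative F (at x)"
    if x: "x \<in> U" for x
  proof -
    have F: "F differentiable (at x)" using Suc.prems(2) x by simp
    then have "(F has_derivative frechet_derivative F (at x)) (at x)"
      by (simp add: frechet_derivative_works)
    then have "(G has_derivative frechet_derivative F (at x)) (at x)"
      by (rule has_derivative_transform_within_open[OF _ assms(1) x]) (use Suc.prems(1) in auto)
    then show "G differentiable (at x)" "frechet_derivative G (at x) = frechet_derivative F (at x)"
      using frechet_derivative_at[of G _ x] by (auto simp only: differentiable_def)
  qed
  have "C_k_on k U (\<lambda>x. frechet_derivative G (at x) v)" for v
    by (rule Suc.IH[of "\<lambda>x. frechet_derivative F (at x) v"]) (use d Suc.prems in auto)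
  then show ?case using d by simp
qed

text \<open>\<open>frechet_derivative\<close> is a choice, but derivatives at points of an open set
  are unique. Hence any explicit family \<open>D\<close> of derivatives may serve to gain one order
  of differentiability.\<close>

lemma C_k_on_SucI:
  assumes "open U" "\<And>x. x \<in> U \<Longrightarrow> (F has_derivative D x) (at x)" "\<And>v. C_k_on k U (\<lambda>x. D x v)"
  shows "C_k_on (Suc k) U F"
proof -
  have "frechet_derivative F (at x) = D x" if "x \<in> U" for x
    using frechet_derivative_at[OF assms(2)[OF that]] by simp
  then have "C_k_on k U (\<lambda>x. frechet_derivative F (at x) v)" for v
    by (intro C_k_on_cong[OF assms(1) _ assms(3)[of v]]) auto
  then show ?thesis using assms(2) by (auto simp: differentiable_def)
qed

lemma C_k_on_SucD:
  assumes "C_k_on (Suc k) U F"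
  shows "x \<in> U \<Longrightarrow> (F has_derivative frechet_derivative F (at x)) (at x)"
    and "C_k_on k U (\<lambda>x. frechet_derivative F (at x) v)"
  using assms by (auto simp: frechet_derivative_works)

lemma C_k_on_imp_continuous: "C_k_on k U F \<Longrightarrow> continuous_on U F"
proof (cases k)
  case (Suc n)
  assume "C_k_on k U F"
  then have "\<forall>x\<in>U. F differentiable (at x)" using Suc by simp
  then show ?thesis
    by (simp add: continuous_at_imp_continuous_on differentiable_imp_continuous_within)
qed simp

lemma C_k_on_Suc: "C_k_on (Suc k) U F \<Longrightarrow> C_k_on k U F"
proof (induction k arbitrary: F)
  case 0
  then show ?case using C_k_on_imp_continuous C_k_on.simps(1) by blast
next
  case (Suc k)
  note F = Suc.prems[unfolded C_k_on.simps(2)[of "Suc k"]]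
  have "C_k_on k U (\<lambda>x. frechet_derivative F (at x) v)" for v
    using F Suc.IH by blast
  then show ?case using F unfolding C_k_on.simps(2)[of k] by blast
qed

lemma C_k_on_subset: "C_k_on k U F \<Longrightarrow> V \<subseteq> U \<Longrightarrow> C_k_on k V F"
  by (induction k arbitrary: F) (auto intro: continuous_on_subset)

lemma C_k_on_const: "open U \<Longrightarrow> C_k_on k U (\<lambda>x. c)"
proof (induction k arbitrary: c)
  case (Suc k)
  show ?case by (rule C_k_on_SucI[where D="\<lambda>x v. 0"]) (use Suc in auto)
qed simp

lemma C_k_on_linear:
  assumes "open U" "bounded_linear F"
  shows "C_k_on k U F"
proof (cases k)
  case 0
  then show ?thesis using assms by (simp add: linear_continuous_on)
next
  case (Suc n)
  show ?thesis unfolding Suc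
    by (rule C_k_on_SucI[where D="\<lambda>x. F"])
      (use assms in \<open>auto intro: C_k_on_const bounded_linear_imp_has_derivative\<close>)
qed

lemma C_k_on_add:
  assumes "open U" "C_k_on k U F" "C_k_on k U G"
  shows "C_k_on k U (\<lambda>x. F x + G x)"
  using assms(2,3)
proof (induction k arbitrary: F G)
  case 0
  then show ?case by (simp add: continuous_on_add)
next
  case (Suc k)
  note F = C_k_on_SucD[OF Suc.prems(1)] and G = C_k_on_SucD[OF Suc.prems(2)]
  show ?case
    by (rule C_k_on_SucI[OF assms(1) has_derivative_add[OF F(1) G(1)]])
      (auto intro: Suc.IH F G)
qed

lemma C_k_on_sum:
  assumes "open U" "\<And>i. i \<in> I \<Longrightarrow> C_k_on k U (F i)"
  shows "C_k_on k U (\<lambda>x. \<Sum>i\<in>I. F i x)"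
  using assms(2)
  by (induction I rule: infinite_finite_induct) (auto intro: C_k_on_const C_k_on_add assms(1))

text \<open>The Leibniz rule leaves one factor undifferentiated in each summand, so the induction
  hypothesis is also applied to the original functions, lowered by one order with
  \<open>C_k_on_Suc\<close>.\<close>

lemma C_k_on_scaleR:
  assumes "open U" "C_k_on k U f" "C_k_on k U G"
  shows "C_k_on k U (\<lambda>x. f x *\<^sub>R G x)"
  using assms(2,3)
proof (induction k arbitrary: f G)
  case 0
  then show ?case by (simp add: continuous_on_scaleR)
next
  case (Suc k)
  note F = C_k_on_SucD[OF Suc.prems(1)] and G = C_k_on_SucD[OF Suc.prems(2)]
  show ?case
    by (rule C_k_on_SucI[OF assms(1) has_derivative_scaleR[OF F(1) G(1)]])
      (auto intro!: C_k_on_add assms(1) Suc.IH F G C_k_on_Suc[OF Suc.prems(1)] C_k_on_Suc[OF Suc.prems(2)])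
qed

lemma C_k_on_mult:
  assumes "open U" "C_k_on k U f" "C_k_on k U (g :: 'v::euclidean_space \<Rightarrow> real)"
  shows "C_k_on k U (\<lambda>x. f x * g x)"
  using C_k_on_scaleR[OF assms] by simp

lemma C_k_on_compose_linear:
  assumes "open U" "C_k_on k U F" "bounded_linear L"
  shows "C_k_on k U (\<lambda>x. L (F x))"
  using assms(2)
proof (induction k arbitrary: F)
  case 0
  then show ?case using assms(3)
    by (auto intro: continuous_on_compose2[OF linear_continuous_on[OF assms(3), of UNIV]])
next
  case (Suc k)
  note F = C_k_on_SucD[OF Suc.prems(1)]
  show ?case
    by (rule C_k_on_SucI[OF assms(1) bounded_linear.has_derivative[OF assms(3) F(1)]])
      (auto intro: Suc.IH F)
qed

lemma C_k_on_compose: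
  assumes "open U" "open V" "C_k_on k V F" "C_k_on k U G" "G ` U \<subseteq> V"
  shows "C_k_on k U (\<lambda>x. F (G x))"
  using assms(3,4)
proof (induction k arbitrary: F)
  case 0
  then show ?case using assms(5) by (auto intro: continuous_on_compose2)
next
  case (Suc k)
  note F = C_k_on_SucD[OF Suc.prems(1)] and G = C_k_on_SucD[OF Suc.prems(2)]
  \<comment> \<open>The definition controls derivatives in a fixed direction only, while the chain
    rule produces the derivative of F in the moving direction G'(x) v. Expanding this direction in
    \<open>Basis\<close> gives a finite sum of scalar functions times derivatives of F in fixed
    directions.\<close>
  let ?D = "\<lambda>x v. \<Sum>j\<in>Basis. (frechet_derivative G (at x) v \<bullet> j) *\<^sub>R frechet_derivative F (at (G x)) j"
  have D: "((\<lambda>x. F (G x)) has_derivative ?D x) (at x)" if x: "x \<in> U" for x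
  proof -
    have gx: "G x \<in> V" using x assms(5) by auto
    let ?F = "frechet_derivative F (at (G x))" and ?G = "frechet_derivative G (at x)"
    have eq: "?F w = (\<Sum>j\<in>Basis. (w \<bullet> j) *\<^sub>R ?F j)" for w
    proof -
      have l: "linear ?F" using F(1)[OF gx] has_derivative_linear by blast
      have "?F w = ?F (\<Sum>j\<in>Basis. (w \<bullet> j) *\<^sub>R j)" by (simp add: euclidean_representation)
      also have "\<dots> = (\<Sum>j\<in>Basis. (w \<bullet> j) *\<^sub>R ?F j)"
        by (simp add: linear_sum[OF l] linear_cmul[OF l])
      finally show ?thesis .
    qed
    have "(\<lambda>v. ?F (?G v)) = ?D x" by (rule ext) (rule eq)
    then show ?thesis using has_derivative_compose[OF G(1)[OF x] F(1)[OF gx]] by simp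
  qed
  have "C_k_on k U (\<lambda>x. ?D x v)" for v
    by (intro C_k_on_sum C_k_on_scaleR assms(1) C_k_on_compose_linear[OF assms(1) G(2)]
        Suc.IH F(2) C_k_on_Suc[OF Suc.prems(2)] bounded_linear_inner_left)
  with D show ?case by (rule C_k_on_SucI[OF assms(1)])
qed

lemma C_k_on_Pair:
  assumes "open U" "C_k_on k U F" "C_k_on k U G"
  shows "C_k_on k U (\<lambda>x. (F x, G x))"
proof -
  have "C_k_on k U (\<lambda>x. (F x, 0) + (0, G x))"
    by (intro C_k_on_add assms(1) C_k_on_compose_linear[OF assms(1,2)] C_k_on_compose_linear[OF assms(1,3)])
      (auto intro!: bounded_linear_Pair bounded_linear_ident bounded_linear_zero)
  then show ?thesis by simp
qed

text \<open>The derivative is - \<open>inverse x * v * inverse x\<close>, again a product of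
  functions already treated, so the order increases by induction.\<close>

lemma C_k_on_inverse: "C_k_on k {0<..} (\<lambda>t::real. inverse t)"
proof (induction k)
  case 0
  then show ?case by (auto intro: continuous_intros)
next
  case (Suc k)
  have "C_k_on k {0<..} (\<lambda>x. - (inverse x * v * inverse x))" for v :: real
    using C_k_on_mult[OF _ C_k_on_mult[OF _ Suc C_k_on_const] Suc, of "- v"] by simp
  then show ?case
    by (intro C_k_on_SucI[where D="\<lambda>x h. - (inverse x * h * inverse x)"])
      (auto intro!: has_derivative_inverse' )
qed

subsection \<open>Cutoff functions\<close>

text \<open>For p = 1 this is exp(-1/t), extended by 0. The polynomial factors in 1/t make the
  family closed under differentiation, which is what an induction on the order of differentiability
  needs.\<close>

definition flat_poly :: "real poly \<Rightarrow> real \<Rightarrow> real" where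
  "flat_poly p t = (if t > 0 then poly p (inverse t) * exp (- inverse t) else 0)"

lemma tendsto_poly_exp: "((\<lambda>y. poly p y * exp (- y)) \<longlongrightarrow> (0::real)) at_top"
proof -
  have "((\<lambda>y. \<Sum>i\<le>degree p. coeff p i * (y ^ i / exp y)) \<longlongrightarrow> (\<Sum>i\<le>degree p. coeff p i * 0)) at_top"
    by (intro tendsto_sum tendsto_mult tendsto_const tendsto_power_div_exp_0)
  then show ?thesis by (simp add: poly_altdef sum_distrib_right exp_minus divide_inverse mult.assoc)
qed

text \<open>For t > 0 differentiation turns p(1/t) exp(-1/t) into (1/t)^2 (p - p')(1/t) exp(-1/t);
  the two \<open>pCons 0\<close> are the factor (1/t)^2. The delicate point is t = 0.\<close>

lemma flat_poly_deriv:
  "(flat_poly p has_real_derivative flat_poly (pCons 0 (pCons 0 (p - pderiv p))) t) (at t)"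
proof (cases "t > 0" "t < 0" rule: case_split[case_product case_split])
  case True_True
  then show ?thesis by simp
next
  case True_False
  then have t: "t > 0" by simp
  have "((\<lambda>t. poly p (inverse t) * exp (- inverse t)) has_real_derivative
      flat_poly (pCons 0 (pCons 0 (p - pderiv p))) t) (at t)"
    using t
    by (auto intro!: derivative_eq_intros DERIV_chain2[OF poly_DERIV] simp: flat_poly_def)
      (simp add: field_simps power2_eq_square)
  then show ?thesis
    by (rule has_field_derivative_transform_within_open[of _ _ _ "{0<..}"])
      (use t in \<open>auto simp: flat_poly_def\<close>)
next
  case False_True
  have "((\<lambda>t. 0) has_real_derivative flat_poly (pCons 0 (pCons 0 (p - pderiv p))) t) (at t)"
    using False_True by (auto simp: flat_poly_def)
  then show ?thesis
    by (rule has_field_derivative_transform_within_open[of _ _ _ "{..<0}"])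
      (use False_True in \<open>auto simp: flat_poly_def\<close>)
next
  case False_False
  then have t: "t = 0" by simp
  \<comment> \<open>With y = 1/h the difference quotient is y p(y) exp(-y) for y tending to
    infinity; \<open>pCons 0 p\<close> supplies the factor y.\<close>
  have "((\<lambda>h. flat_poly p h / h) \<longlongrightarrow> 0) (at_right 0)"
  proof -
    have "((\<lambda>h. poly (pCons 0 p) (inverse h) * exp (- inverse h)) \<longlongrightarrow> 0) (at_right (0::real))"
      using tendsto_poly_exp[of "pCons 0 p"] by (simp add: filterlim_at_right_to_top)
    then show ?thesis
      by (rule Lim_transform_eventually)
        (auto simp: flat_poly_def eventually_at_right_field field_simps intro!: exI[of _ 1])
  qed
  moreover have "((\<lambda>h. flat_poly p h / h) \<longlongrightarrow> 0) (at_left 0)"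
    by (rule Lim_transform_eventually[OF tendsto_const])
      (auto simp: flat_poly_def eventually_at_left_field intro!: exI[of _ "-1"])
  ultimately have "((\<lambda>h. flat_poly p h / h) \<longlongrightarrow> 0) (at 0)"
    by (simp add: filterlim_split_at)
  then show ?thesis by (simp add: t DERIV_def flat_poly_def)
qed

lemma C_k_on_flat_poly: "C_k_on k UNIV (flat_poly p)"
proof (induction k arbitrary: p)
  case 0
  show ?case
    using DERIV_isCont[OF flat_poly_deriv[of p]] by (simp add: continuous_on_eq_continuous_at)
next
  case (Suc k)
  show ?case
    by (rule C_k_on_SucI[where D="\<lambda>x v. flat_poly (pCons 0 (pCons 0 (p - pderiv p))) x * v"])
      (use flat_poly_deriv in \<open>auto simp: has_field_derivative_def intro!: C_k_on_mult Suc C_k_on_const\<close>)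
qed

text \<open>The denominator is positive everywhere because t and 1 - t are never both nonpositive.
  The quotient rises smoothly from 0 to 1 over the unit interval.\<close>

definition smooth_step :: "real \<Rightarrow> real" where
  "smooth_step t = flat_poly 1 t * inverse (flat_poly 1 t + flat_poly 1 (1 - t))"

lemma smooth_step_0: "t \<le> 0 \<Longrightarrow> smooth_step t = 0"
  by (simp add: smooth_step_def flat_poly_def)

lemma smooth_step_1: "t \<ge> 1 \<Longrightarrow> smooth_step t = 1"
  by (simp add: smooth_step_def flat_poly_def)

lemma C_k_on_smooth_step: "C_k_on k UNIV smooth_step"
proof -
  have 1: "C_k_on k UNIV (\<lambda>t. flat_poly 1 (1 - t))"
  proof -
    have "C_k_on k UNIV (\<lambda>t::real. 1 + - t)"
      by (intro C_k_on_add C_k_on_const C_k_on_linear)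
        (auto intro: bounded_linear_minus bounded_linear_ident)
    then show ?thesis using C_k_on_compose[OF _ _ C_k_on_flat_poly[of k 1], of UNIV] by simp
  qed
  have pos: "flat_poly 1 t + flat_poly 1 (1 - t) > 0" for t
    by (auto simp: flat_poly_def add_pos_pos not_less)
  have "C_k_on k UNIV (\<lambda>t. inverse (flat_poly 1 t + flat_poly 1 (1 - t)))"
    by (rule C_k_on_compose[OF _ _ C_k_on_inverse[of k] C_k_on_add[OF _ C_k_on_flat_poly 1]])
      (use pos in auto)
  then show ?thesis
    unfolding smooth_step_def[abs_def] by (intro C_k_on_mult C_k_on_flat_poly) auto
qed

lemma ball_cutoff:
  fixes a :: "'v::euclidean_space"
  assumes "e > 0"
  obtains f :: "'v \<Rightarrow> real" where "\<And>k. C_k_on k UNIV f" "\<And>x. x \<in> ball a e \<Longrightarrow> f x = 1"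
    "\<And>x. x \<notin> cball a (2 * e) \<Longrightarrow> f x = 0"
proof
  \<comment> \<open>The squared norm keeps the function smooth at the centre. The argument of the
    step is at least 1 where the distance to \<open>a\<close> is at most e, and at most -2 where it
    is at least 2 e.\<close>
  let ?f = "\<lambda>x. smooth_step (2 - (1 / e\<^sup>2) * ((x - a) \<bullet> (x - a)))"
  show "C_k_on k UNIV ?f" for k
  proof -
    have 1: "C_k_on k UNIV (\<lambda>x. x - a)"
      using C_k_on_add[OF _ C_k_on_linear[OF _ bounded_linear_ident] C_k_on_const, of UNIV k "- a"] by simp
    have "C_k_on k UNIV (\<lambda>x. \<Sum>j\<in>Basis. ((x - a) \<bullet> j) * ((x - a) \<bullet> j))"
      by (intro C_k_on_sum C_k_on_mult C_k_on_compose_linear[OF _ 1] bounded_linear_inner_left) auto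
    then have "C_k_on k UNIV (\<lambda>x. (x - a) \<bullet> (x - a))"
      by (simp add: euclidean_inner[symmetric])
    then have "C_k_on k UNIV (\<lambda>x. 2 + (- (1 / e\<^sup>2)) * ((x - a) \<bullet> (x - a)))"
      by (intro C_k_on_add C_k_on_mult C_k_on_const) auto
    then have "C_k_on k UNIV (\<lambda>x. smooth_step (2 + (- (1 / e\<^sup>2)) * ((x - a) \<bullet> (x - a))))"
      by (intro C_k_on_compose[OF _ _ C_k_on_smooth_step]) auto
    then show ?thesis by simp
  qed
  show "?f x = 1" if "x \<in> ball a e" for x
  proof (rule smooth_step_1)
    have "norm (x - a) ^ 2 \<le> e ^ 2"
      using that by (intro power_mono) (auto simp: dist_norm norm_minus_commute)
    then show "1 \<le> 2 - (1 / e\<^sup>2) * ((x - a) \<bullet> (x - a))"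
      using assms by (simp add: power2_norm_eq_inner divide_le_eq)
  qed
  show "?f x = 0" if "x \<notin> cball a (2 * e)" for x
  proof (rule smooth_step_0)
    have "norm (x - a) ^ 2 \<ge> (2 * e) ^ 2"
      using that assms by (intro power_mono) (auto simp: dist_norm norm_minus_commute)
    then have "4 * e\<^sup>2 \<le> (x - a) \<bullet> (x - a)" by (simp add: power2_norm_eq_inner power_mult_distrib)
    then have "2 * e\<^sup>2 \<le> (x - a) \<bullet> (x - a)" using zero_le_power2[of e] by linarith
    then show "2 - (1 / e\<^sup>2) * ((x - a) \<bullet> (x - a)) \<le> 0"
      using zero_less_power[OF assms, of 2] by (simp add: le_divide_eq)
  qed
qed

section \<open>Smooth maps between spaces\<close>

lemma C_inf_on_subset: "C_inf_on U F \<Longrightarrow> open V \<Longrightarrow> V \<subseteq> U \<Longrightarrow> C_inf_on V F"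
  unfolding C_inf_on_def using C_k_on_subset by blast

lemma C_inf_on_UNIV: "C_inf_on UNIV F \<longleftrightarrow> (\<forall>k. C_k_on k UNIV F)"
  by (simp add: C_inf_on_def)

lemma C_inf_on_continuous: "C_inf_on U F \<Longrightarrow> continuous_on U F"
  unfolding C_inf_on_def using C_k_on_imp_continuous by blast

lemma C_inf_on_open_vimage: "C_inf_on U F \<Longrightarrow> open V \<Longrightarrow> open (U \<inter> F -` V)"
  by (simp add: C_inf_on_continuous C_inf_on_def continuous_open_preimage)

lemma C_inf_on_compose:
  assumes "C_inf_on V F" "C_inf_on U G"
  shows "C_inf_on (U \<inter> G -` V) (\<lambda>x. F (G x))"
proof -
  have o: "open (U \<inter> G -` V)" using assms by (intro C_inf_on_open_vimage) (auto simp: C_inf_on_def)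
  have "C_k_on k (U \<inter> G -` V) (\<lambda>x. F (G x))" for k
    by (rule C_k_on_compose[OF o, of V])
      (use assms in \<open>auto simp: C_inf_on_def intro: C_k_on_subset\<close>)
  with o show ?thesis by (simp add: C_inf_on_def)
qed

lemma C_inf_on_Pair: "C_inf_on U F \<Longrightarrow> C_inf_on U G \<Longrightarrow> C_inf_on U (\<lambda>x. (F x, G x))"
  by (simp add: C_inf_on_def C_k_on_Pair)

lemma C_inf_on_linear: "bounded_linear F \<Longrightarrow> C_inf_on UNIV F"
  by (simp add: C_inf_on_def C_k_on_linear)

lemma C_inf_on_const: "C_inf_on UNIV (\<lambda>x. c)"
  by (simp add: C_inf_on_def C_k_on_const)

lemma C_inf_on_mult_pair: "C_inf_on UNIV (\<lambda>p::real \<times> real. fst p * snd p)"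
  unfolding C_inf_on_UNIV by (intro allI C_k_on_mult C_k_on_linear) (auto intro: bounded_linear_fst
      bounded_linear_snd)

text \<open>The part of the definition of a manifold that is inherited by products and subsets.\<close>

definition smooth_space :: "('a, 'v::euclidean_space) space \<Rightarrow> bool" where
  "smooth_space X \<longleftrightarrow> pts X \<subseteq> (\<Union>c\<in>charts X. fst c) \<and>
    (\<forall>c\<in>charts X. \<forall>d\<in>charts X. \<forall>x\<in>pts X \<inter> fst c \<inter> fst d. \<exists>N F. local_rep X id x c d N F)"

lemma manifold_smooth_space: "manifold X \<Longrightarrow> smooth_space X"
  unfolding manifold_def smooth_space_def by blast

lemma smooth_space_chart:
  assumes "smooth_space X" "x \<in> pts X"
  shows "\<exists>c\<in>charts X. x \<in> fst c"
  using assms unfolding smooth_space_def by blast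

lemma smooth_space_transition:
  assumes "smooth_space X" "c \<in> charts X" "d \<in> charts X" "x \<in> pts X" "x \<in> fst c" "x \<in> fst d"
  obtains N F where "local_rep X id x c d N F"
  using assms unfolding smooth_space_def by blast

lemma local_rep_compose:
  assumes "local_rep X f x c d N F" "local_rep Y g (f x) d e M G" "f \<in> pts X \<rightarrow> pts Y" "x \<in> pts X"
  shows "local_rep X (\<lambda>x. g (f x)) x c e (N \<inter> F -` M) (\<lambda>x. G (F x))"
  using assms C_inf_on_compose[of M G N F] unfolding local_rep_def
  by (auto simp: Pi_iff)

lemma local_rep_mono: "local_rep X f x c d N F \<Longrightarrow> pts Y \<subseteq> pts X \<Longrightarrow> local_rep Y f x c d N F"
  unfolding local_rep_def by blast

lemma local_rep_restrict:
  "local_rep X f x c d N F \<Longrightarrow> open M \<Longrightarrow> snd c x \<in> M \<Longrightarrow> local_rep X f x c d (N \<inter> M) F"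
  unfolding local_rep_def by (auto simp: C_inf_on_def intro: C_k_on_subset)

lemma smooth_map_in: "smooth_map X Y f \<Longrightarrow> x \<in> pts X \<Longrightarrow> f x \<in> pts Y"
  unfolding smooth_map_def by blast

text \<open>Smoothness provides some pair of charts at x; transition maps on both sides move the
  representative to the prescribed pair.\<close>

lemma smooth_map_rep:
  assumes X: "smooth_space X" and Y: "smooth_space Y" and f: "smooth_map X Y f"
    and x: "x \<in> pts X" and c: "c \<in> charts X" "x \<in> fst c" and d: "d \<in> charts Y" "f x \<in> fst d"
  obtains N F where "local_rep X f x c d N F"
proof -
  from f x obtain c' d' N F where r: "c' \<in> charts X" "d' \<in> charts Y" "local_rep X f x c' d' N F"
    unfolding smooth_map_def by blast
  have m: "f \<in> pts X \<rightarrow> pts Y" using f unfolding smooth_map_def by blast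
  have snd_in: "x \<in> fst c'" "f x \<in> fst d'" using r(3) x unfolding local_rep_def by auto
  obtain N1 F1 where r1: "local_rep X id x c c' N1 F1"
    using X x c r(1) snd_in unfolding smooth_space_def by blast
  obtain N2 F2 where r2: "local_rep Y id (f x) d' d N2 F2"
    using Y m x d r(2) snd_in unfolding smooth_space_def by blast
  have "local_rep X (\<lambda>x. f (id x)) x c d' (N1 \<inter> F1 -` N) (\<lambda>x. F (F1 x))"
    by (rule local_rep_compose[OF r1]) (use r(3) x in auto)
  then have "local_rep X f x c d' (N1 \<inter> F1 -` N) (\<lambda>x. F (F1 x))" by simp
  from local_rep_compose[OF this r2 m x] show ?thesis using that by simp
qed

lemma smooth_mapI:
  assumes "f \<in> pts X \<rightarrow> pts Y"
    and "\<And>x. x \<in> pts X \<Longrightarrow> \<exists>c\<in>charts X. \<exists>d\<in>charts Y. \<exists>N F. local_rep X f x c d N F"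
  shows "smooth_map X Y f"
  using assms unfolding smooth_map_def by blast

text \<open>The charts of Y supplied by f and by g at the point f x may differ, so a transition map
  of Y is inserted between the two representatives.\<close>

lemma smooth_map_compose:
  assumes Y: "smooth_space Y" and f: "smooth_map X Y f" and g: "smooth_map Y Z g"
  shows "smooth_map X Z (\<lambda>x. g (f x))"
proof (rule smooth_mapI)
  show "(\<lambda>x. g (f x)) \<in> pts X \<rightarrow> pts Z" using f g unfolding smooth_map_def by blast
  fix x assume x: "x \<in> pts X"
  have m: "f \<in> pts X \<rightarrow> pts Y" using f unfolding smooth_map_def by blast
  from f x obtain c d N F where r: "c \<in> charts X" "d \<in> charts Y" "local_rep X f x c d N F"
    unfolding smooth_map_def by blast
  from g m x obtain d' e M G where s: "d' \<in> charts Y" "e \<in> charts Z" "local_rep Y g (f x) d' e M G"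
    unfolding smooth_map_def by blast
  have "f x \<in> fst d" "f x \<in> fst d'" using r s x unfolding local_rep_def by auto
  then obtain N2 F2 where t: "local_rep Y id (f x) d d' N2 F2"
    using Y m x r(2) s(1) unfolding smooth_space_def by blast
  have "local_rep X (\<lambda>x. id (f x)) x c d' (N \<inter> F -` N2) (\<lambda>x. F2 (F x))"
    by (rule local_rep_compose[OF r(3) t m x])
  then have "local_rep X f x c d' (N \<inter> F -` N2) (\<lambda>x. F2 (F x))" by simp
  from local_rep_compose[OF this s(3) m x] show
      "\<exists>c\<in>charts X. \<exists>d\<in>charts Z. \<exists>N F. local_rep X (\<lambda>x. g (f x)) x c d N F"
    using r s by blast
qed

lemma smooth_map_cong:
  assumes "\<And>x. x \<in> pts X \<Longrightarrow> f x = g x" "smooth_map X Y f"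
  shows "smooth_map X Y g"
proof (rule smooth_mapI)
  show "g \<in> pts X \<rightarrow> pts Y" using assms(1) smooth_map_in[OF assms(2)] by force
  fix x assume x: "x \<in> pts X"
  then obtain c d N F where "c \<in> charts X" "d \<in> charts Y" "local_rep X f x c d N F"
    using assms(2) unfolding smooth_map_def by blast
  moreover from this have "local_rep X g x c d N F"
    unfolding local_rep_def using assms(1) by auto
  ultimately show "\<exists>c\<in>charts X. \<exists>d\<in>charts Y. \<exists>N F. local_rep X g x c d N F" by blast
qed

lemma pts_sub[simp]: "pts (sub X S) = S" and charts_sub[simp]: "charts (sub X S) = charts X"
  by (auto simp: sub_def)

lemma pts_prod[simp]: "pts (X \<times>\<^sub>M Y) = pts X \<times> pts Y"
  by (simp add: prod_space_def)

lemma pts_euclid[simp]: "pts euclid = UNIV" and charts_euclid[simp]: "charts euclid = {(UNIV, id)}"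
  by (auto simp: euclid_def)

lemma smooth_map_sub: "smooth_map X Y f \<Longrightarrow> S \<subseteq> pts X \<Longrightarrow> smooth_map (sub X S) Y f"
  using local_rep_mono[of X f _ _ _ _ _ "sub X S"] unfolding smooth_map_def
  by (simp add: Pi_iff subset_iff) blast

lemma smooth_map_into_sub: "smooth_map X Y f \<Longrightarrow> f \<in> pts X \<rightarrow> S \<Longrightarrow> smooth_map X (sub Y S) f"
  unfolding smooth_map_def by simp

lemma smooth_map_from_sub: "smooth_map X (sub Y S) f \<Longrightarrow> S \<subseteq> pts Y \<Longrightarrow> smooth_map X Y f"
  unfolding smooth_map_def by auto

lemma smooth_map_charts_cong: "pts X = pts X' \<Longrightarrow> charts X = charts X' \<Longrightarrow> smooth_map X Y f \<Longrightarrow> smooth_map X' Y f"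
  unfolding smooth_map_def local_rep_def by simp

lemma sub_sub[simp]: "sub (sub X S) T = sub X T"
  by (simp add: sub_def)

lemma smooth_space_sub: "smooth_space X \<Longrightarrow> S \<subseteq> pts X \<Longrightarrow> smooth_space (sub X S)"
  using local_rep_mono[of X id _ _ _ _ _ "sub X S"] unfolding smooth_space_def
  by (simp add: subset_iff) blast

lemma smooth_space_euclid: "smooth_space (euclid :: ('v::euclidean_space, 'v) space)"
  unfolding smooth_space_def
  using C_inf_on_linear[OF bounded_linear_ident, folded id_def]
  by (auto simp: local_rep_def intro!: exI[of _ UNIV] exI[of _ id])

lemma local_rep_prod:
  assumes "local_rep X f x c d N F" "local_rep Y g y c' d' N' F'"
  shows "local_rep (X \<times>\<^sub>M Y) (map_prod f g) (x, y) (fst c \<times> fst c', map_prod (snd c) (snd c'))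
    (fst d \<times> fst d', map_prod (snd d) (snd d')) (N \<times> N') (map_prod F F')"
proof -
  have "C_inf_on (N \<times> N') (map_prod F F')"
  proof -
    have op: "open N" "open N'" using assms unfolding local_rep_def C_inf_on_def by auto
    have "C_inf_on (UNIV \<inter> fst -` N) (\<lambda>p. F (fst p))" "C_inf_on (UNIV \<inter> snd -` N') (\<lambda>p. F' (snd p))"
      using assms unfolding local_rep_def
      by (blast intro: C_inf_on_compose[OF _ C_inf_on_linear] bounded_linear_fst bounded_linear_snd)+
    then have "C_inf_on (N \<times> N') (\<lambda>p. (F (fst p), F' (snd p)))"
      using op by (intro C_inf_on_Pair) (auto elim!: C_inf_on_subset simp: open_Times)
    then show ?thesis by (simp add: map_prod_def split_def)
  qed
  with assms show ?thesis unfolding local_rep_def by auto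
qed

lemma charts_prodI: "c \<in> charts X \<Longrightarrow> d \<in> charts Y \<Longrightarrow>
    (fst c \<times> fst d, map_prod (snd c) (snd d)) \<in> charts (X \<times>\<^sub>M Y)"
  unfolding prod_space_def by (cases c, cases d) auto

lemma charts_prodE:
  assumes "e \<in> charts (X \<times>\<^sub>M Y)"
  obtains c d where "c \<in> charts X" "d \<in> charts Y" "e = (fst c \<times> fst d, map_prod (snd c) (snd d))"
  using assms unfolding prod_space_def by force

lemma smooth_space_prod:
  assumes "smooth_space X" "smooth_space Y"
  shows "smooth_space (X \<times>\<^sub>M Y)"
  unfolding smooth_space_def
proof (intro conjI ballI)
  show "pts (X \<times>\<^sub>M Y) \<subseteq> (\<Union>c\<in>charts (X \<times>\<^sub>M Y). fst c)"
  proof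
    fix p assume p: "p \<in> pts (X \<times>\<^sub>M Y)"
    obtain c where "c \<in> charts X" "fst p \<in> fst c" using smooth_space_chart[OF assms(1), of "fst p"] p by auto
    moreover obtain d where "d \<in> charts Y" "snd p \<in> fst d" using smooth_space_chart[OF assms(2), of "snd p"] p
        by auto
    ultimately show "p \<in> (\<Union>c\<in>charts (X \<times>\<^sub>M Y). fst c)"
      by (intro UN_I[OF charts_prodI]) (auto simp: mem_Times_iff)
  qed
  fix e e' p
  assume e: "e \<in> charts (X \<times>\<^sub>M Y)" and e': "e' \<in> charts (X \<times>\<^sub>M Y)" and p: "p \<in> pts (X \<times>\<^sub>M Y) \<inter> fst e \<inter> fst e'"
  obtain c d where c: "c \<in> charts X" "d \<in> charts Y" "e = (fst c \<times> fst d, map_prod (snd c) (snd d))"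
    using charts_prodE[OF e] by blast
  obtain c' d' where c': "c' \<in> charts X" "d' \<in> charts Y" "e' = (fst c' \<times> fst d', map_prod (snd c') (snd d'))"
    using charts_prodE[OF e'] by blast
  have p': "fst p \<in> pts X" "snd p \<in> pts Y" "fst p \<in> fst c" "snd p \<in> fst d" "fst p \<in> fst c'" "snd p \<in> fst d'"
    using p unfolding c(3) c'(3) by auto
  obtain N F where 1: "local_rep X id (fst p) c c' N F"
    using smooth_space_transition[OF assms(1) c(1) c'(1) p'(1,3,5)] .
  obtain N' F' where 2: "local_rep Y id (snd p) d d' N' F'"
    using smooth_space_transition[OF assms(2) c(2) c'(2) p'(2,4,6)] .
  from local_rep_prod[OF 1 2] have "local_rep (X \<times>\<^sub>M Y) id p e e' (N \<times> N') (map_prod F F')"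
    by (simp only: c(3)[symmetric] c'(3)[symmetric] prod.map_id0 prod.collapse)
  then show "\<exists>N F. local_rep (X \<times>\<^sub>M Y) id p e e' N F" by blast
qed

lemma smooth_map_id:
  assumes X: "smooth_space X"
  shows "smooth_map X X (\<lambda>x. x)"
proof (rule smooth_mapI)
  fix x assume x: "x \<in> pts X"
  obtain c where c: "c \<in> charts X" "x \<in> fst c" using smooth_space_chart[OF X x] by auto
  obtain N F where "local_rep X id x c c N F" using smooth_space_transition[OF X c(1) c(1) x c(2) c(2)] .
  then show "\<exists>c\<in>charts X. \<exists>d\<in>charts X. \<exists>N F. local_rep X (\<lambda>x. x) x c d N F"
    using c(1) unfolding id_def by blast
qed simp

lemma smooth_map_fst: "smooth_space X \<Longrightarrow> smooth_space Y \<Longrightarrow> smooth_map (X \<times>\<^sub>M Y) X fst"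
proof (rule smooth_mapI)
  assume X: "smooth_space X" and Y: "smooth_space Y"
  fix p assume p: "p \<in> pts (X \<times>\<^sub>M Y)"
  obtain c where c: "c \<in> charts X" "fst p \<in> fst c" using smooth_space_chart[OF X, of "fst p"] p by auto
  obtain d where d: "d \<in> charts Y" "snd p \<in> fst d" using smooth_space_chart[OF Y, of "snd p"] p by auto
  have "local_rep (X \<times>\<^sub>M Y) fst p (fst c \<times> fst d, map_prod (snd c) (snd d)) c UNIV fst"
    using c d by (auto simp: local_rep_def mem_Times_iff intro!: C_inf_on_linear bounded_linear_fst)
  then show "\<exists>c\<in>charts (X \<times>\<^sub>M Y). \<exists>d\<in>charts X. \<exists>N F. local_rep (X \<times>\<^sub>M Y) fst p c d N F"
    using charts_prodI[OF c(1) d(1)] c(1) d(1) by blast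
qed auto

lemma smooth_map_snd: "smooth_space X \<Longrightarrow> smooth_space Y \<Longrightarrow> smooth_map (X \<times>\<^sub>M Y) Y snd"
proof (rule smooth_mapI)
  assume X: "smooth_space X" and Y: "smooth_space Y"
  fix p assume p: "p \<in> pts (X \<times>\<^sub>M Y)"
  obtain c where c: "c \<in> charts X" "fst p \<in> fst c" using smooth_space_chart[OF X, of "fst p"] p by auto
  obtain d where d: "d \<in> charts Y" "snd p \<in> fst d" using smooth_space_chart[OF Y, of "snd p"] p by auto
  have "local_rep (X \<times>\<^sub>M Y) snd p (fst c \<times> fst d, map_prod (snd c) (snd d)) d UNIV snd"
    using c d by (auto simp: local_rep_def mem_Times_iff intro!: C_inf_on_linear bounded_linear_snd)
  then show "\<exists>c\<in>charts (X \<times>\<^sub>M Y). \<exists>d\<in>charts Y. \<exists>N F. local_rep (X \<times>\<^sub>M Y) snd p c d N F"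
    using charts_prodI[OF c(1) d(1)] c(1) d(1) by blast
qed auto

lemma smooth_map_Pair:
  assumes X: "smooth_space X" "smooth_space Y" "smooth_space Z"
    and f: "smooth_map X Y f" and g: "smooth_map X Z g"
  shows "smooth_map X (Y \<times>\<^sub>M Z) (\<lambda>x. (f x, g x))"
proof (rule smooth_mapI)
  show "(\<lambda>x. (f x, g x)) \<in> pts X \<rightarrow> pts (Y \<times>\<^sub>M Z)"
    using smooth_map_in[OF f] smooth_map_in[OF g] by simp
  fix x assume x: "x \<in> pts X"
  obtain c where c: "c \<in> charts X" "x \<in> fst c" using smooth_space_chart[OF X(1), of "x"] x by auto
  obtain d where d: "d \<in> charts Y" "f x \<in> fst d" using smooth_space_chart[OF X(2), of
      "f x"] smooth_map_in[OF f x] by auto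
  obtain e where e: "e \<in> charts Z" "g x \<in> fst e" using smooth_space_chart[OF X(3), of
      "g x"] smooth_map_in[OF g x] by auto
  obtain N F where 1: "local_rep X f x c d N F" using smooth_map_rep[OF X(1,2) f x c d] .
  obtain M G where 2: "local_rep X g x c e M G" using smooth_map_rep[OF X(1,3) g x c e] .
  have "C_inf_on (N \<inter> M) (\<lambda>x. (F x, G x))"
  proof (rule C_inf_on_Pair)
    have op: "open (N \<inter> M)" using 1 2 unfolding local_rep_def C_inf_on_def by blast
    show "C_inf_on (N \<inter> M) F" using C_inf_on_subset[OF _ op] 1 unfolding local_rep_def by blast
    show "C_inf_on (N \<inter> M) G" using C_inf_on_subset[OF _ op] 2 unfolding local_rep_def by blast
  qed
  then have "local_rep X (\<lambda>x. (f x, g x)) x c (fst d \<times> fst e, map_prod (snd d) (snd e)) (N \<inter> M) (\<lambda>x. (F x,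
      G x))"
    using 1 2 unfolding local_rep_def by simp
  then show "\<exists>c\<in>charts X. \<exists>d\<in>charts (Y \<times>\<^sub>M Z). \<exists>N F. local_rep X (\<lambda>x. (f x, g x)) x c d N F"
    using c(1) charts_prodI[OF d(1) e(1)] by blast
qed

section \<open>Smooth functions with values in a Euclidean space\<close>

lemma charts_euclid_prod:
  "charts ((euclid :: ('v::euclidean_space, 'v) space) \<times>\<^sub>M (euclid :: ('w::euclidean_space, 'w) space)) =
      charts euclid"
  by (auto simp: prod_space_def prod.map_id0)

lemma smooth_map_C_inf:
  assumes "C_inf_on UNIV F"
  shows "smooth_map (euclid :: ('v::euclidean_space, 'v) space) (euclid :: ('w::euclidean_space, 'w) space) F"
proof (rule smooth_mapI)
  fix x :: 'v
  have "local_rep euclid F x (UNIV, id) (UNIV, id) UNIV F" using assms by (simp add: local_rep_def)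
  then show "\<exists>c\<in>charts euclid. \<exists>d\<in>charts euclid. \<exists>N G. local_rep euclid F x c d N G"
    unfolding charts_euclid by blast
qed simp

text \<open>Sums, products and scalar multiples of smooth functions all come from this one case,
  with \<open>F\<close> the corresponding operation on the product Euclidean space.\<close>

lemma smooth_map_C_inf2:
  assumes X: "smooth_space X"
    and f: "smooth_map X (euclid :: ('u::euclidean_space, 'u) space) f"
    and g: "smooth_map X (euclid :: ('v::euclidean_space, 'v) space) g"
    and F: "C_inf_on UNIV (F :: 'u \<times> 'v \<Rightarrow> 'w::euclidean_space)"
  shows "smooth_map X (euclid :: ('w, 'w) space) (\<lambda>x. F (f x, g x))"
proof -
  have "smooth_map X ((euclid :: ('u, 'u) space) \<times>\<^sub>M (euclid :: ('v, 'v) space)) (\<lambda>x. (f x, g x))"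
    by (intro smooth_map_Pair assms smooth_space_euclid)
  moreover have "smooth_map ((euclid :: ('u, 'u) space) \<times>\<^sub>M (euclid :: ('v, 'v) space)) (euclid :: ('w,
      'w) space) F"
    using smooth_map_C_inf[OF F] by (rule smooth_map_charts_cong[rotated 2]) (auto simp: charts_euclid_prod)
  ultimately show ?thesis
    by (rule smooth_map_compose[rotated]) (intro smooth_space_prod smooth_space_euclid)
qed

abbreviation smooth_fun :: "('a, 'v::euclidean_space) space \<Rightarrow> ('a \<Rightarrow> 'w::euclidean_space) \<Rightarrow> bool" where
  "smooth_fun X f \<equiv> smooth_map X (euclid :: ('w, 'w) space) f"

lemma smooth_fun_C_inf: "smooth_fun X f \<Longrightarrow> C_inf_on UNIV F \<Longrightarrow> smooth_fun X (\<lambda>x. F (f x))"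
  by (rule smooth_map_compose[OF smooth_space_euclid _ smooth_map_C_inf])

lemma smooth_fun_const:
  fixes c :: "'w::euclidean_space"
  assumes X: "smooth_space X"
  shows "smooth_fun X (\<lambda>x. c)"
proof (rule smooth_mapI)
  fix x assume x: "x \<in> pts X"
  obtain d where d: "d \<in> charts X" "x \<in> fst d" using smooth_space_chart[OF X x] by auto
  have "local_rep X (\<lambda>x. c) x d (UNIV, id) UNIV (\<lambda>_. c)"
    using d C_inf_on_const by (auto simp: local_rep_def)
  then show "\<exists>d\<in>charts X. \<exists>e\<in>charts euclid. \<exists>N F. local_rep X (\<lambda>x. c) x d e N F"
    using d(1) unfolding charts_euclid by blast
qed simp

lemma smooth_fun_add:
  fixes f g :: "'a \<Rightarrow> 'w::euclidean_space"
  assumes "smooth_space X" "smooth_fun X f" "smooth_fun X g"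
  shows "smooth_fun X (\<lambda>x. f x + g x)"
proof -
  have "C_inf_on UNIV (\<lambda>p::'w \<times> 'w. fst p + snd p)"
    by (intro C_inf_on_linear bounded_linear_add bounded_linear_fst bounded_linear_snd)
  from smooth_map_C_inf2[OF assms this] show ?thesis by simp
qed

lemma smooth_fun_mult:
  fixes f g :: "'a \<Rightarrow> real"
  assumes "smooth_space X" "smooth_fun X f" "smooth_fun X g"
  shows "smooth_fun X (\<lambda>x. f x * g x)"
  using smooth_map_C_inf2[OF assms C_inf_on_mult_pair] by simp

lemma smooth_fun_scaleR:
  fixes f :: "'a \<Rightarrow> real" and g :: "'a \<Rightarrow> 'w::euclidean_space"
  assumes "smooth_space X" "smooth_fun X f" "smooth_fun X g"
  shows "smooth_fun X (\<lambda>x. f x *\<^sub>R g x)"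
proof -
  have "C_inf_on UNIV (\<lambda>p::real \<times> 'w. fst p *\<^sub>R snd p)"
    unfolding C_inf_on_UNIV
    by (intro allI C_k_on_scaleR C_k_on_linear) (auto intro: bounded_linear_fst bounded_linear_snd)
  from smooth_map_C_inf2[OF assms this] show ?thesis by simp
qed

lemma smooth_fun_sum:
  assumes "smooth_space X" "\<And>i. i \<in> I \<Longrightarrow> smooth_fun X (f i)"
  shows "smooth_fun X (\<lambda>x. \<Sum>i\<in>I. f i x)"
  using assms(2)
  by (induction I rule: infinite_finite_induct) (auto intro: smooth_fun_const smooth_fun_add assms(1))

subsection \<open>The topology\<close>

lemma openin_chart: "c \<in> charts X \<Longrightarrow> open N \<Longrightarrow> openin (mtop X) {x \<in> pts X \<inter> fst c. snd c x \<in> N}"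
  unfolding mtop_def by (rule topology_generated_by_Basis) (cases c, force)

lemma topspace_mtop: "smooth_space X \<Longrightarrow> topspace (mtop X) = pts X"
proof
  show "topspace (mtop X) \<subseteq> pts X" unfolding mtop_def topology_generated_by_topspace by auto
  assume X: "smooth_space X"
  show "pts X \<subseteq> topspace (mtop X)"
  proof
    fix x assume x: "x \<in> pts X"
    obtain c where c: "c \<in> charts X" "x \<in> fst c" using smooth_space_chart[OF X, of "x"] x by auto
    show "x \<in> topspace (mtop X)"
      using openin_subset[OF openin_chart[OF c(1), of UNIV]] x c by auto
  qed
qed

lemma openin_pts: "smooth_space X \<Longrightarrow> openin (mtop X) T \<Longrightarrow> T \<subseteq> pts X"
  using openin_subset topspace_mtop by metis

text \<open>Induction over the generation of the topology. Only the basic sets involve another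
  chart, and there the transition map, continuous in coordinates, pulls the open set back to the
  chart \<open>c\<close>.\<close>

lemma openin_chart_nbhd:
  assumes X: "smooth_space X" and "openin (mtop X) T" "x \<in> T" and c: "c \<in> charts X" "x \<in> fst c"
  shows "\<exists>N. open N \<and> snd c x \<in> N \<and> {y \<in> pts X \<inter> fst c. snd c y \<in> N} \<subseteq> T"
proof -
  have "generate_topology_on {{x \<in> pts X \<inter> U. \<phi> x \<in> N} | U \<phi> N. (U, \<phi>) \<in> charts X \<and> open N} T"
    using assms(2) unfolding mtop_def openin_topology_generated_by_iff .
  then show ?thesis using assms(3)
  proof (induction rule: generate_topology_on.induct)
    case Empty
    then show ?case by simp
  next
    case (Int A B)
    obtain N where N: "open N" "snd c x \<in> N" "{y \<in> pts X \<inter> fst c. snd c y \<in> N} \<subseteq> A" using Int by auto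
    obtain M where M: "open M" "snd c x \<in> M" "{y \<in> pts X \<inter> fst c. snd c y \<in> M} \<subseteq> B" using Int by auto
    show ?case by (rule exI[of _ "N \<inter> M"]) (use N M in auto)
  next
    case (UN K)
    then obtain k where k: "k \<in> K" "x \<in> k" by auto
    from UN.IH[OF this] show ?case using k by blast
  next
    case (Basis s)
    then obtain U \<phi> M where s: "s = {x \<in> pts X \<inter> U. \<phi> x \<in> M}" "(U, \<phi>) \<in> charts X" "open M" by blast
    obtain N F where "local_rep X id x c (U, \<phi>) N F"
      using smooth_space_transition[OF X c(1) s(2), of x] c(2) s(1) Basis.prems by auto
    then show ?case using s Basis
      by (intro exI[of _ "N \<inter> F -` M"]) (auto simp: local_rep_def intro: C_inf_on_open_vimage)
  qed
qed

lemma openin_smooth_vimage: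
  assumes X: "smooth_space X" and Y: "smooth_space Y" and f: "smooth_map X Y f" and T: "openin (mtop Y) T"
  shows "openin (mtop X) {x \<in> pts X. f x \<in> T}"
proof (subst openin_subopen, intro ballI)
  fix x assume x: "x \<in> {x \<in> pts X. f x \<in> T}"
  obtain c d N F where r: "c \<in> charts X" "d \<in> charts Y" "local_rep X f x c d N F"
    using f x unfolding smooth_map_def by blast
  have fx: "f x \<in> T" "f x \<in> fst d" "x \<in> fst c" using r x unfolding local_rep_def by auto
  obtain M where M: "open M" "snd d (f x) \<in> M" "{y \<in> pts Y \<inter> fst d. snd d y \<in> M} \<subseteq> T"
    using openin_chart_nbhd[OF Y T fx(1) r(2) fx(2)] by blast
  have op: "open (N \<inter> F -` M)" using r(3) M(1) by (auto simp: local_rep_def intro: C_inf_on_open_vimage)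
  show "\<exists>S. openin (mtop X) S \<and> x \<in> S \<and> S \<subseteq> {x \<in> pts X. f x \<in> T}"
  proof (intro exI conjI)
    show "openin (mtop X) {y \<in> pts X \<inter> fst c. snd c y \<in> N \<inter> F -` M}" by (rule openin_chart[OF r(1) op])
    show "x \<in> {y \<in> pts X \<inter> fst c. snd c y \<in> N \<inter> F -` M}"
      using r x fx M unfolding local_rep_def by auto
    show "{y \<in> pts X \<inter> fst c. snd c y \<in> N \<inter> F -` M} \<subseteq> {x \<in> pts X. f x \<in> T}"
      using r(3) M(3) smooth_map_in[OF f] unfolding local_rep_def by auto
  qed
qed

lemma openin_euclid: "open T \<Longrightarrow> openin (mtop (euclid :: ('v::euclidean_space, 'v) space)) T"
  using openin_chart[of "(UNIV, id)" euclid T] by simp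

text \<open>A representative on \<open>sub X T\<close> is valid at points of T only. Shrinking its
  domain to a chart neighbourhood contained in T makes it valid on X.\<close>

lemma smooth_map_local:
  assumes X: "smooth_space X"
    and "\<And>x. x \<in> pts X \<Longrightarrow> \<exists>T. openin (mtop X) T \<and> x \<in> T \<and> smooth_map (sub X T) Y f"
  shows "smooth_map X Y f"
proof (rule smooth_mapI)
  show "f \<in> pts X \<rightarrow> pts Y" using assms(2) smooth_map_in by fastforce
  fix x assume x: "x \<in> pts X"
  obtain T where T: "openin (mtop X) T" "x \<in> T" "smooth_map (sub X T) Y f" using assms(2)[OF x] by blast
  then obtain c d N F where r: "c \<in> charts X" "d \<in> charts Y" "local_rep (sub X T) f x c d N F"
    unfolding smooth_map_def by auto
  then have c: "x \<in> fst c" unfolding local_rep_def by auto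
  obtain M where M: "open M" "snd c x \<in> M" "{y \<in> pts X \<inter> fst c. snd c y \<in> M} \<subseteq> T"
    using openin_chart_nbhd[OF X T(1,2) r(1) c] by blast
  have "local_rep X f x c d (N \<inter> M) F"
    using local_rep_restrict[OF r(3) M(1,2)] M(3) unfolding local_rep_def by auto
  then show "\<exists>c\<in>charts X. \<exists>d\<in>charts Y. \<exists>N F. local_rep X f x c d N F" using r by blast
qed

subsection \<open>Bump functions\<close>

text \<open>A property of the space, not of manifolds alone, because subsets and products inherit
  it; this is how the composable pairs obtain bump functions. Mere vanishing outside T is improved
  to vanishing on an open set in \<open>has_bumps_obtain\<close>.\<close>

definition has_bumps :: "('a, 'v::euclidean_space) space \<Rightarrow> bool" where
  "has_bumps X \<longleftrightarrow> (\<forall>T x. openin (mtop X) T \<longrightarrow> x \<in> T \<longrightarrow>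
    (\<exists>f::'a \<Rightarrow> real. smooth_fun X f \<and> f x = 1 \<and> (\<forall>y\<in>pts X - T. f y = 0)))"

lemma has_bumpsD:
  assumes "has_bumps X" "openin (mtop X) T" "x \<in> T"
  shows "\<exists>f::'a \<Rightarrow> real. smooth_fun X f \<and> f x = 1 \<and> (\<forall>y\<in>pts X - T. f y = 0)"
  using assms unfolding has_bumps_def by blast

lemma has_bumps_chart:
  assumes "has_bumps X" "c \<in> charts X" "open N" "x \<in> pts X" "x \<in> fst c" "snd c x \<in> N"
  shows "\<exists>f::'a \<Rightarrow> real. smooth_fun X f \<and> f x = 1 \<and> (\<forall>y\<in>pts X - {x \<in> pts X \<inter> fst c. snd c x \<in> N}. f y = 0)"
  by (rule has_bumpsD[OF assms(1) openin_chart[OF assms(2,3)]]) (use assms in auto)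

lemma has_bumps_obtain:
  assumes X: "smooth_space X" "has_bumps X" and T: "openin (mtop X) T" "x \<in> T"
  obtains f :: "'a \<Rightarrow> real" and P R where "smooth_fun X f" "openin (mtop X) P" "x \<in> P" "P \<subseteq> T" "\<And>y. y \<in> P \<Longrightarrow>
      f y = 1"
    "openin (mtop X) R" "pts X \<subseteq> T \<union> R" "\<And>y. y \<in> R \<Longrightarrow> f y = 0"
proof -
  obtain h :: "'a \<Rightarrow> real" where h: "smooth_fun X h" "h x = 1" "\<And>y. y \<in> pts X - T \<Longrightarrow> h y = 0"
    using X(2) T unfolding has_bumps_def by metis
  \<comment> \<open>The value is 1 where h is at least 2/3 and 0 where h is at most 1/3. So the new
    function is constant near x and vanishes on an open set that covers X together with T, as
    extension by zero requires.\<close>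
  let ?f = "\<lambda>y. smooth_step (3 * h y - 1)"
  have C: "C_inf_on UNIV (\<lambda>t. smooth_step (3 * t - 1))"
  proof -
    have "C_k_on k UNIV (\<lambda>t::real. 3 * t + (- 1))" for k
      by (intro C_k_on_add C_k_on_linear C_k_on_const bounded_linear_mult_right) auto
    then have "C_k_on k UNIV (\<lambda>t. smooth_step (3 * t + (- 1)))" for k
      by (intro C_k_on_compose[OF _ _ C_k_on_smooth_step]) auto
    then show ?thesis by (simp add: C_inf_on_UNIV)
  qed
  have v: "openin (mtop X) {y \<in> pts X. h y \<in> S}" if "open S" for S
    using openin_smooth_vimage[OF X(1) smooth_space_euclid h(1) openin_euclid[OF that]] .
  show ?thesis
  proof (rule that[of ?f "{y \<in> pts X. h y \<in> {2/3<..}}" "{y \<in> pts X. h y \<in> {..<1/3}}"])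
    show "smooth_fun X ?f" using smooth_fun_C_inf[OF h(1) C] .
    show "x \<in> {y \<in> pts X. h y \<in> {2/3<..}}" using h(2) T openin_pts[OF X(1)] by auto
    show "{y \<in> pts X. h y \<in> {2/3<..}} \<subseteq> T" using h(3) by force
    show "pts X \<subseteq> T \<union> {y \<in> pts X. h y \<in> {..<1/3}}" using h(3) by auto
    show "openin (mtop X) {y \<in> pts X. h y \<in> {2/3<..}}" "openin (mtop X) {y \<in> pts X. h y \<in> {..<1/3}}"
        by (intro v; simp)+
  qed (auto intro: smooth_step_0 smooth_step_1)
qed

text \<open>Relatively open sets are read in ambient charts, so an ambient bump function over the
  same coordinate neighbourhood \<open>N\<close> restricts to the required one.\<close>

lemma has_bumps_sub:
  assumes X: "smooth_space X" "has_bumps X" and S: "S \<subseteq> pts X"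
  shows "has_bumps (sub X S)"
  unfolding has_bumps_def
proof (intro allI impI)
  fix T x assume T: "openin (mtop (sub X S)) T" "x \<in> T"
  have SS: "smooth_space (sub X S)" by (rule smooth_space_sub[OF X(1) S])
  have x: "x \<in> S" using openin_pts[OF SS T(1)] T(2) by auto
  obtain c where c: "c \<in> charts X" "x \<in> fst c" using smooth_space_chart[OF X(1), of "x"] x S by blast
  obtain N where N: "open N" "snd c x \<in> N" "{y \<in> S \<inter> fst c. snd c y \<in> N} \<subseteq> T"
    using openin_chart_nbhd[OF SS T, of c] c unfolding pts_sub charts_sub by blast
  obtain f :: "'a \<Rightarrow> real" where f: "smooth_fun X f" "f x = 1"
      "\<forall>y\<in>pts X - {x \<in> pts X \<inter> fst c. snd c x \<in> N}. f y = 0"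
    using has_bumps_chart[OF X(2) c(1) N(1) _ c(2) N(2)] x S by blast
  show "\<exists>f::'a \<Rightarrow> real. smooth_fun (sub X S) f \<and> f x = 1 \<and> (\<forall>y\<in>pts (sub X S) - T. f y = 0)"
    using smooth_map_sub[OF f(1) S] f N S by (intro exI[of _ f]) auto
qed

lemma has_bumps_prod:
  assumes X: "smooth_space X" "has_bumps X" and Y: "smooth_space Y" "has_bumps Y"
  shows "has_bumps (X \<times>\<^sub>M Y)"
  unfolding has_bumps_def
proof (intro allI impI)
  fix T p assume T: "openin (mtop (X \<times>\<^sub>M Y)) T" "p \<in> T"
  have XY: "smooth_space (X \<times>\<^sub>M Y)" by (rule smooth_space_prod[OF X(1) Y(1)])
  obtain x y where p: "p = (x, y)" "x \<in> pts X" "y \<in> pts Y" using openin_pts[OF XY T(1)] T(2) by (cases p) auto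
  obtain c where c: "c \<in> charts X" "x \<in> fst c" using smooth_space_chart[OF X(1), of "x"] p by auto
  obtain d where d: "d \<in> charts Y" "y \<in> fst d" using smooth_space_chart[OF Y(1), of "y"] p by auto
  obtain N where N: "open N" "(snd c x, snd d y) \<in> N"
    "{q \<in> pts X \<times> pts Y \<inter> (fst c \<times> fst d). map_prod (snd c) (snd d) q \<in> N} \<subseteq> T"
    using openin_chart_nbhd[OF XY T charts_prodI[OF c(1) d(1)]] c(2) d(2) unfolding p(1) by auto
  from open_prod_elim[OF N(1,2)] obtain A B
    where "open A" "open B" "(snd c x, snd d y) \<in> A \<times> B" and AB_N: "A \<times> B \<subseteq> N" .
  then have AB: "open A" "open B" "snd c x \<in> A" "snd d y \<in> B" by auto
  obtain f :: "'a \<Rightarrow> real" where f: "smooth_fun X f" "f x = 1"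
      "\<forall>y\<in>pts X - {x \<in> pts X \<inter> fst c. snd c x \<in> A}. f y = 0"
    using has_bumps_chart[OF X(2) c(1) AB(1) p(2) c(2) AB(3)] by blast
  obtain g :: "'c \<Rightarrow> real" where g: "smooth_fun Y g" "g y = 1"
      "\<forall>z\<in>pts Y - {x \<in> pts Y \<inter> fst d. snd d x \<in> B}. g z = 0"
    using has_bumps_chart[OF Y(2) d(1) AB(2) p(3) d(2) AB(4)] by blast
  have "smooth_fun (X \<times>\<^sub>M Y) (\<lambda>q. f (fst q) * g (snd q))"
    by (intro smooth_fun_mult XY smooth_map_compose[OF X(1) smooth_map_fst[OF X(1) Y(1)] f(1)]
        smooth_map_compose[OF Y(1) smooth_map_snd[OF X(1) Y(1)] g(1)])
  moreover have "f (fst q) * g (snd q) = 0" if q: "q \<in> pts (X \<times>\<^sub>M Y) - T" for q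
  proof -
    have "\<not> (fst q \<in> fst c \<and> snd c (fst q) \<in> A \<and> snd q \<in> fst d \<and> snd d (snd q) \<in> B)"
      using q N(3) AB_N by (cases q) (auto simp: subset_iff)
    then have "f (fst q) = 0 \<or> g (snd q) = 0" using f(3) g(3) q by auto
    then show ?thesis by auto
  qed
  ultimately show "\<exists>f::'a \<times> 'c \<Rightarrow> real. smooth_fun (X \<times>\<^sub>M Y) f \<and> f p = 1 \<and> (\<forall>y\<in>pts (X \<times>\<^sub>M Y) - T. f y = 0)"
    using f(2) g(2) p by (intro exI[of _ "\<lambda>q. f (fst q) * g (snd q)"]) auto
qed

lemma manifold_chart:
  assumes "manifold X" "(U, \<phi>) \<in> charts X"
  shows "U \<subseteq> pts X" "inj_on \<phi> U" "\<exists>W. subspace W \<and> openin (top_of_set W) (\<phi> ` U)"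
proof -
  note M = assms(1)[unfolded manifold_def]
  show "U \<subseteq> pts X" using M assms(2) by (metis UN_upper fst_conv)
  from M obtain n where "\<forall>(U, \<phi>)\<in>charts X. inj_on \<phi> U \<and> (\<exists>W. subspace W \<and> dim W = n \<and>
      openin (top_of_set W) (\<phi> ` U))"
    by blast
  then show "inj_on \<phi> U" "\<exists>W. subspace W \<and> openin (top_of_set W) (\<phi> ` U)" using assms(2) by fast+
qed

text \<open>The inverse of a chart is continuous on the image, hence carries \<open>K\<close> to a
  compact set. In a Hausdorff space that set is closed, which allows functions supported in it to be
  extended by zero.\<close>

lemma compactin_chart_preimage:
  assumes M: "manifold X" and c: "(U, \<phi>) \<in> charts X" and K: "compact K" "K \<subseteq> \<phi> ` U"
  shows "compactin (mtop X) {x \<in> U. \<phi> x \<in> K}"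
proof -
  note S = manifold_smooth_space[OF M]
  note U = manifold_chart(1,2)[OF M c]
  have "continuous_map (top_of_set K) (mtop X) (inv_into U \<phi>)"
    unfolding mtop_def
  proof (rule continuous_on_generated_topo)
    fix s assume "s \<in> {{x \<in> pts X \<inter> U. \<phi> x \<in> N} |U \<phi> N. (U, \<phi>) \<in> charts X \<and> open N}"
    then obtain V \<psi> N where s: "s = {x \<in> pts X \<inter> V. \<psi> x \<in> N}" "(V, \<psi>) \<in> charts X" "open N" by blast
    have so: "openin (mtop X) s" using openin_chart[OF s(2,3)] s(1) by simp
    have "openin (top_of_set K) (inv_into U \<phi> -` s \<inter> K)"
    proof (subst openin_subopen, intro ballI)
      fix y assume y: "y \<in> inv_into U \<phi> -` s \<inter> K"
      define x where "x = inv_into U \<phi> y"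
      have x: "x \<in> U" "\<phi> x = y" "x \<in> s" using y K(2) unfolding x_def
          by (auto simp: inv_into_into f_inv_into_f)
      obtain A where A: "open A" "\<phi> x \<in> A" "{z \<in> pts X \<inter> U. \<phi> z \<in> A} \<subseteq> s"
        using openin_chart_nbhd[OF S so x(3) c] x by auto
      have "K \<inter> A \<subseteq> inv_into U \<phi> -` s \<inter> K"
        using A(3) K(2) U(1) by (auto simp: inv_into_into f_inv_into_f subset_iff)
      then show "\<exists>T. openin (top_of_set K) T \<and> y \<in> T \<and> T \<subseteq> inv_into U \<phi> -` s \<inter> K"
        using A x y by (intro exI[of _ "K \<inter> A"]) (auto simp: openin_open_Int)
    qed
    then show "openin (top_of_set K) (inv_into U \<phi> -` s \<inter> topspace (top_of_set K))" by simp
  next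
    show "inv_into U \<phi> ` topspace (top_of_set K) \<subseteq> \<Union> {{x \<in> pts X \<inter> U. \<phi> x \<in> N} |U \<phi> N. (U, \<phi>) \<in> charts X \<and>
        open N}"
    proof
      fix x assume "x \<in> inv_into U \<phi> ` topspace (top_of_set K)"
      then have "x \<in> pts X \<inter> U" using K(2) U(1) inv_into_into[of _ \<phi> U] by auto
      then show "x \<in> \<Union> {{x \<in> pts X \<inter> U. \<phi> x \<in> N} |U \<phi> N. (U, \<phi>) \<in> charts X \<and> open N}"
        using c by (intro UnionI[of "{x \<in> pts X \<inter> U. \<phi> x \<in> UNIV}"]) blast+
    qed
  qed
  then have "compactin (mtop X) (inv_into U \<phi> ` K)"
    by (rule image_compactin[rotated]) (simp add: K(1) compactin_subtopology)
  moreover have "inv_into U \<phi> ` K = {x \<in> U. \<phi> x \<in> K}"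
  proof
    show "inv_into U \<phi> ` K \<subseteq> {x \<in> U. \<phi> x \<in> K}"
      using K(2) by (auto simp: inv_into_into f_inv_into_f subset_iff)
    show "{x \<in> U. \<phi> x \<in> K} \<subseteq> inv_into U \<phi> ` K"
      using inv_into_f_f[OF U(2)] by force
  qed
  ultimately show ?thesis by simp
qed

lemma manifold_has_bumps:
  assumes M: "manifold X"
  shows "has_bumps X"
  unfolding has_bumps_def
proof (intro allI impI)
  fix T x assume T: "openin (mtop X) T" "x \<in> T"
  note S = manifold_smooth_space[OF M]
  have x: "x \<in> pts X" using openin_pts[OF S T(1)] T(2) by auto
  obtain U \<phi> where c: "(U, \<phi>) \<in> charts X" "x \<in> U" using smooth_space_chart[OF S x] by auto
  note U = manifold_chart(1)[OF M c(1)]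
  obtain W where W: "subspace W" "openin (top_of_set W) (\<phi> ` U)" using manifold_chart(3)[OF M c(1)] by blast
  obtain B where B: "open B" "\<phi> ` U = W \<inter> B" using W(2) unfolding openin_open by blast
  obtain N where N: "open N" "\<phi> x \<in> N" "{y \<in> pts X \<inter> U. \<phi> y \<in> N} \<subseteq> T"
    using openin_chart_nbhd[OF S T c(1)] c by auto
  have "open (N \<inter> B)" "\<phi> x \<in> N \<inter> B" using B N c by auto
  then obtain e where e: "e > 0" "cball (\<phi> x) e \<subseteq> N \<inter> B" using open_contains_cball by meson
  \<comment> \<open>The intersection with \<open>W\<close> accounts for chart images that are open
    only in a subspace. The ball lies in \<open>B\<close>, so \<open>K\<close> stays in the chart
    image, and in \<open>N\<close>, so its preimage stays in \<open>T\<close>.\<close>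
  define K where "K = W \<inter> cball (\<phi> x) e"
  have K: "compact K" "K \<subseteq> \<phi> ` U" using e B closed_subspace[OF W(1)] unfolding K_def by auto
  define L where "L = {y \<in> U. \<phi> y \<in> K}"
  have "closedin (mtop X) L"
    unfolding L_def using compactin_chart_preimage[OF M c(1) K] M
    by (intro compactin_imp_closedin) (auto simp: manifold_def)
  then have R: "openin (mtop X) (pts X - L)" using topspace_mtop[OF S] by (metis closedin_def)
  \<comment> \<open>Radius e/2 makes the cut-off vanish outside the ball of radius e that defines
    \<open>K\<close>.\<close>
  obtain f :: "'b \<Rightarrow> real" where f: "\<And>k. C_k_on k UNIV f" "\<And>z. z \<in> ball (\<phi> x) (e / 2) \<Longrightarrow> f z = 1"
    "\<And>z. z \<notin> cball (\<phi> x) (2 * (e / 2)) \<Longrightarrow> f z = 0" using ball_cutoff[of "e / 2" "\<phi> x"] e(1) by auto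
  define h where "h = (\<lambda>y. if y \<in> U then f (\<phi> y) else 0)"
  have h0: "h y = 0" if "y \<in> pts X - L" for y
    using that f(3) B unfolding h_def L_def K_def by auto
  have "smooth_fun X h"
  proof (rule smooth_map_local[OF S])
    fix y assume y: "y \<in> pts X"
    show "\<exists>T. openin (mtop X) T \<and> y \<in> T \<and> smooth_map (sub X T) euclid h"
    proof (cases "y \<in> U")
      case True
      have "openin (mtop X) {x \<in> pts X \<inter> U. \<phi> x \<in> UNIV}" using openin_chart[OF c(1), of UNIV] by simp
      then have o: "openin (mtop X) U" using U by (simp add: Int_absorb1 Collect_conj_eq)
      have "local_rep (sub X U) h z (U, \<phi>) (UNIV, id) UNIV f" if "z \<in> U" for z
        unfolding local_rep_def using f(1) that by (auto simp: C_inf_on_UNIV h_def)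
      then have "smooth_map (sub X U) euclid h" by (intro smooth_mapI) (use c in \<open>auto intro!: bexI[of _
          "(U, \<phi>)"]\<close>)
      then show ?thesis using o True by blast
    next
      case False
      have "smooth_map (sub X (pts X - L)) euclid h"
        by (rule smooth_map_cong[OF _ smooth_fun_const[OF smooth_space_sub[OF S], of
            "pts X - L" 0]]) (use h0 in auto)
      then show ?thesis using R False y L_def by blast
    qed
  qed
  moreover have "h x = 1" using f(2) c e by (simp add: h_def)
  moreover have "L \<subseteq> T" using N(3) e(2) U unfolding L_def K_def by blast
  ultimately show "\<exists>f::'a \<Rightarrow> real. smooth_fun X f \<and> f x = 1 \<and> (\<forall>y\<in>pts X - T. f y = 0)"
    using h0 by (intro exI[of _ h]) auto
qed

section \<open>Vector bundles with local frames\<close>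

lemma orthonormal_frame:
  fixes W :: "'f::euclidean_space set"
  assumes "subspace W" "dim W = r"
  obtains w :: "nat \<Rightarrow> 'f" where "\<And>i. i < r \<Longrightarrow> w i \<in> W"
    "\<And>i j. i < r \<Longrightarrow> j < r \<Longrightarrow> w i \<bullet> w j = (if i = j then 1 else 0)"
    "\<And>v. v \<in> W \<Longrightarrow> (\<Sum>i<r. (v \<bullet> w i) *\<^sub>R w i) = v"
proof -
  obtain S where S: "S \<subseteq> W" "pairwise orthogonal S" "\<And>x. x \<in> S \<Longrightarrow> norm x = 1"
    "independent S" "card S = dim W" "span S = W"
    using orthonormal_basis_subspace[OF assms(1)] by metis
  have "finite S" using S(4) by (simp add: independent_imp_finite)
  then obtain w where w: "bij_betw w {..<r} S"
    using ex_bij_betw_nat_finite[of S] S(5) assms(2) by (auto simp: atLeast0LessThan)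
  show ?thesis
  proof (rule that[of w])
    have wS: "w i \<in> S" if "i < r" for i using w that by (auto simp: bij_betw_def)
    show "w i \<in> W" if "i < r" for i using wS[OF that] S(1) by auto
    show "w i \<bullet> w j = (if i = j then 1 else 0)" if "i < r" "j < r" for i j
    proof (cases "i = j")
      case True
      then show ?thesis using S(3)[OF wS[OF that(1)]] by (simp add: norm_eq_1)
    next
      case False
      then have "w i \<noteq> w j" using w that by (auto simp: bij_betw_def inj_on_def)
      then show ?thesis using S(2) wS that False by (auto simp: pairwise_def orthogonal_def)
    qed
    show "(\<Sum>i<r. (v \<bullet> w i) *\<^sub>R w i) = v" if "v \<in> W" for v
      using orthonormal_basis_expand[OF S(2,3) _ \<open>finite S\<close>, of v] that S(6)
        sum.reindex_bij_betw[OF w, of "\<lambda>x. (v \<bullet> x) *\<^sub>R x"] by simp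
  qed
qed

definition fibre_functional :: "('b, 'v, 't, 'w) vbundle \<Rightarrow> 'b \<Rightarrow> ('t \<Rightarrow> real) \<Rightarrow> bool" where
  "fibre_functional B b \<xi> \<longleftrightarrow> (\<forall>h\<in>fibre B b. \<forall>k\<in>fibre B b. \<xi> (vadd B h k) = \<xi> h + \<xi> k) \<and>
    (\<forall>a. \<forall>h\<in>fibre B b. \<xi> (vscl B a h) = a * \<xi> h)"

definition one_form :: "('b, 'v, 't, 'w) vbundle \<Rightarrow> ('b \<Rightarrow> 't \<Rightarrow> real) \<Rightarrow> ('b, 't) form" where
  "one_form B \<alpha> = (\<lambda>b hs. case hs of [h] \<Rightarrow> if b \<in> pts (bas B) \<and> h \<in> fibre B b then \<alpha> b h else 0 | _ \<Rightarrow> 0)"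

lemma one_form_single[simp]: "b \<in> pts (bas B) \<Longrightarrow> h \<in> fibre B b \<Longrightarrow> one_form B \<alpha> b [h] = \<alpha> b h"
  by (simp add: one_form_def)

lemma one_form_length: "length hs \<noteq> 1 \<Longrightarrow> one_form B \<alpha> b hs = 0"
  by (auto simp: one_form_def split: list.splits)

lemma one_form_in_k_forms:
  assumes S: "smooth_space (bas B)"
    and closed: "\<And>b h k a. b \<in> pts (bas B) \<Longrightarrow> h \<in> fibre B b \<Longrightarrow> k \<in> fibre B b \<Longrightarrow> vadd B h k \<in> fibre B b"
      "\<And>b h a. b \<in> pts (bas B) \<Longrightarrow> h \<in> fibre B b \<Longrightarrow> vscl B a h \<in> fibre B b"
    and lin: "\<And>b. b \<in> pts (bas B) \<Longrightarrow> fibre_functional B b (\<alpha> b)"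
    and sm: "\<And>X. X \<in> sections B \<Longrightarrow> smooth_fun (bas B) (\<lambda>b. \<alpha> b (X b))"
  shows "one_form B \<alpha> \<in> k_forms B 1"
proof -
  have nz: "one_form B \<alpha> b hs \<noteq> 0 \<Longrightarrow> b \<in> pts (bas B) \<and> set hs \<subseteq> fibre B b \<and> length hs = 1" for b hs
    by (auto simp: one_form_def split: list.splits if_splits)
  have "one_form B \<alpha> b (xs @ vadd B h k # ys) = one_form B \<alpha> b (xs @ h # ys) + one_form B \<alpha> b (xs @ k # ys)"
    "one_form B \<alpha> b (xs @ vscl B a h # ys) = a * one_form B \<alpha> b (xs @ h # ys)"
    if "b \<in> pts (bas B)" "h \<in> fibre B b" "k \<in> fibre B b" for b xs h k ys a
    using that lin[OF that(1)] closed unfolding fibre_functional_def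
    by (cases "xs = [] \<and> ys = []"; force simp: one_form_length)+
  moreover have "one_form B \<alpha> b (xs @ h # ys @ h # zs) = 0" for b xs h ys zs
    by (rule one_form_length) simp
  moreover have "smooth_fun (bas B) (\<lambda>b. one_form B \<alpha> b (map (\<lambda>X. X b) Xs))" if "Xs \<in> lists (sections B)"
      for Xs
  proof (cases "length Xs = 1")
    case True
    then obtain X where X: "Xs = [X]" by (auto simp: length_Suc_conv)
    with that have "X \<in> sections B" by simp
    then show ?thesis
      by (intro smooth_map_cong[OF _ sm[of X]]) (auto simp: X sections_def)
  next
    case False
    then show ?thesis using smooth_fun_const[OF S, of 0] by (simp add: one_form_length)
  qed
  ultimately show ?thesis
    using nz unfolding k_forms_def forms_def by blast
qed

text \<open>The open sets T and R cover X, and on R both branches of the case distinction are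
  zero.\<close>

lemma smooth_fun_cutoff:
  fixes f :: "'a \<Rightarrow> real" and g :: "'a \<Rightarrow> 'w::euclidean_space"
  assumes X: "smooth_space X" and T: "openin (mtop X) T" and R: "openin (mtop X) R" "pts X \<subseteq> T \<union> R"
    and f: "smooth_fun X f" "\<And>y. y \<in> R \<Longrightarrow> f y = 0" and g: "smooth_fun (sub X T) g"
  shows "smooth_fun X (\<lambda>x. if x \<in> T then f x *\<^sub>R g x else 0)"
proof (rule smooth_map_local[OF X])
  fix x assume x: "x \<in> pts X"
  show "\<exists>T'. openin (mtop X) T' \<and> x \<in> T' \<and> smooth_fun (sub X T') (\<lambda>x. if x \<in> T then f x *\<^sub>R g x else 0)"
  proof (cases "x \<in> T")
    case True
    have "smooth_fun (sub X T) (\<lambda>x. f x *\<^sub>R g x)"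
      by (intro smooth_fun_scaleR smooth_space_sub[OF X] smooth_map_sub[OF f(1)] g openin_pts[OF X T])
    then have "smooth_fun (sub X T) (\<lambda>x. if x \<in> T then f x *\<^sub>R g x else 0)"
      by (rule smooth_map_cong[rotated]) simp
    then show ?thesis using T True by blast
  next
    case False
    have "smooth_fun (sub X R) (\<lambda>x. 0 :: 'w)"
      by (intro smooth_fun_const smooth_space_sub[OF X] openin_pts[OF X R(1)])
    then have "smooth_fun (sub X R) (\<lambda>x. if x \<in> T then f x *\<^sub>R g x else 0)"
      by (rule smooth_map_cong[rotated]) (simp add: f(2))
    then show ?thesis using R x False by blast
  qed
qed

text \<open>As in the definition of \<open>vector_bundle\<close>, but with a model space that is independent of the
  charts of the total space.\<close>

definition local_triv ::
  "('b, 'v::euclidean_space, 't, 'w::euclidean_space) vbundle \<Rightarrow> 'b set \<Rightarrow> 'f::euclidean_space set \<Rightarrow> ('t \<Rightarrow> 'f) \<Rightarrow>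
      bool" where
  "local_triv B T W \<psi> \<longleftrightarrow> openin (mtop (bas B)) T \<and> subspace W \<and>
    (\<forall>b\<in>T. bij_betw \<psi> (fibre B b) W \<and> \<psi> (vzer B b) = 0 \<and>
      (\<forall>h\<in>fibre B b. \<forall>k\<in>fibre B b. \<psi> (vadd B h k) = \<psi> h + \<psi> k) \<and>
      (\<forall>a. \<forall>h\<in>fibre B b. \<psi> (vscl B a h) = a *\<^sub>R \<psi> h)) \<and>
    smooth_fun (sub (tot B) {h \<in> pts (tot B). proj B h \<in> T}) \<psi> \<and>
    smooth_map (sub (bas B \<times>\<^sub>M (euclid :: ('f, 'f) space)) (T \<times> W)) (tot B) (\<lambda>(b, w). inv_into (fibre B b) \<psi>
        w)"

text \<open>What is used of a vector bundle. Local frames are multiplied by cut-offs, so that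
  \<open>e i\<close> and \<open>\<theta> i\<close> are global and the sum of the tensors of
  \<open>\<theta> i\<close> with \<open>e i\<close> is \<rho> times the identity, where \<rho> = 1
  near the chosen point. Derivations act on global forms only, and global frames are objects to
  which they can be applied.\<close>

locale framed_bundle =
  fixes B :: "('b, 'v::euclidean_space, 't, 'w::euclidean_space) vbundle" and r :: nat
  assumes base: "smooth_space (bas B)" "has_bumps (bas B)"
    and total: "smooth_space (tot B)"
    and proj_smooth: "smooth_map (tot B) (bas B) (proj B)"
    and vzer_in: "b \<in> pts (bas B) \<Longrightarrow> vzer B b \<in> fibre B b"
    and vadd_in: "b \<in> pts (bas B) \<Longrightarrow> h \<in> fibre B b \<Longrightarrow> k \<in> fibre B b \<Longrightarrow> vadd B h k \<in> fibre B b"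
    and vscl_in: "b \<in> pts (bas B) \<Longrightarrow> h \<in> fibre B b \<Longrightarrow> vscl B a h \<in> fibre B b"
    and vadd_comm: "b \<in> pts (bas B) \<Longrightarrow> h \<in> fibre B b \<Longrightarrow> k \<in> fibre B b \<Longrightarrow> vadd B h k = vadd B k h"
    and vadd_assoc: "b \<in> pts (bas B) \<Longrightarrow> h \<in> fibre B b \<Longrightarrow> k \<in> fibre B b \<Longrightarrow> l \<in> fibre B b \<Longrightarrow>
      vadd B (vadd B h k) l = vadd B h (vadd B k l)"
    and vadd_zero: "b \<in> pts (bas B) \<Longrightarrow> h \<in> fibre B b \<Longrightarrow> vadd B (vzer B b) h = h"
    and vscl_zero: "b \<in> pts (bas B) \<Longrightarrow> h \<in> fibre B b \<Longrightarrow> vscl B 0 h = vzer B b"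
    and vscl_one: "b \<in> pts (bas B) \<Longrightarrow> h \<in> fibre B b \<Longrightarrow> vscl B 1 h = h"
    and vscl_vscl: "b \<in> pts (bas B) \<Longrightarrow> h \<in> fibre B b \<Longrightarrow> vscl B a (vscl B c h) = vscl B (a * c) h"
    and vscl_add_left: "b \<in> pts (bas B) \<Longrightarrow> h \<in> fibre B b \<Longrightarrow> vscl B (a + c) h = vadd B (vscl B a h) (vscl B c h)"
    and vscl_add_right: "b \<in> pts (bas B) \<Longrightarrow> h \<in> fibre B b \<Longrightarrow> k \<in> fibre B b \<Longrightarrow>
      vscl B a (vadd B h k) = vadd B (vscl B a h) (vscl B a k)"
    and frame: "b\<^sub>0 \<in> pts (bas B) \<Longrightarrow> \<exists>e \<theta> \<rho> P. (\<forall>i<r. e i \<in> sections B \<and> \<theta> i \<in> k_forms B 1) \<and>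
      smooth_fun (bas B) \<rho> \<and> openin (mtop (bas B)) P \<and> b\<^sub>0 \<in> P \<and> (\<forall>b\<in>P. \<rho> b = (1::real)) \<and>
      (\<forall>b\<in>pts (bas B). \<forall>h\<in>fibre B b. \<forall>\<xi>. fibre_functional B b \<xi> \<longrightarrow> \<rho> b * \<xi> h = (\<Sum>i<r. \<theta> i b [h] * \<xi> (e i b))) \<and>
      (\<forall>c. \<exists>z\<in>fibre B b\<^sub>0. \<forall>i<r. \<theta> i b\<^sub>0 [z] = c i) \<and>
      (\<forall>h\<in>fibre B b\<^sub>0. (\<forall>i<r. \<theta> i b\<^sub>0 [h] = 0) \<longrightarrow> h = vzer B b\<^sub>0)"
    and one_form_smooth: "\<alpha> \<in> k_forms B 1 \<Longrightarrow> smooth_fun (tot B) (\<lambda>h. \<alpha> (proj B h) [h])"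
    and section_smooth: "(\<And>b. b \<in> pts (bas B) \<Longrightarrow> Z b \<in> fibre B b) \<Longrightarrow>
      (\<And>\<alpha>. \<alpha> \<in> k_forms B 1 \<Longrightarrow> smooth_fun (bas B) (\<lambda>b. \<alpha> b [Z b])) \<Longrightarrow> smooth_map (bas B) (tot B) Z"

text \<open>The model space of the trivializations has a type of its own: over the composable pairs
  the trivializations come from the graph of the multiplication and take values in a triple product,
  whereas the charts of the total space take values in a double product.\<close>

locale trivialized_bundle =
  fixes B :: "('b, 'v::euclidean_space, 't, 'w::euclidean_space) vbundle" and r :: nat
    and model :: "'f::euclidean_space itself"
  assumes base: "smooth_space (bas B)" "has_bumps (bas B)"
    and total: "smooth_space (tot B)"
    and proj_smooth: "smooth_map (tot B) (bas B) (proj B)"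
    and vzer_in: "b \<in> pts (bas B) \<Longrightarrow> vzer B b \<in> fibre B b"
    and vadd_in: "b \<in> pts (bas B) \<Longrightarrow> h \<in> fibre B b \<Longrightarrow> k \<in> fibre B b \<Longrightarrow> vadd B h k \<in> fibre B b"
    and vscl_in: "b \<in> pts (bas B) \<Longrightarrow> h \<in> fibre B b \<Longrightarrow> vscl B a h \<in> fibre B b"
    and triv: "b \<in> pts (bas B) \<Longrightarrow> \<exists>T (W :: 'f set) \<psi>. b \<in> T \<and> dim W = r \<and> local_triv B T W \<psi>"
begin

lemma local_trivD:
  assumes "local_triv B T W \<psi>"
  shows "openin (mtop (bas B)) T" "subspace W"
    "\<And>b. b \<in> T \<Longrightarrow> bij_betw \<psi> (fibre B b) W" "\<And>b. b \<in> T \<Longrightarrow> \<psi> (vzer B b) = 0"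
    "\<And>b h k. b \<in> T \<Longrightarrow> h \<in> fibre B b \<Longrightarrow> k \<in> fibre B b \<Longrightarrow> \<psi> (vadd B h k) = \<psi> h + \<psi> k"
    "\<And>b h a. b \<in> T \<Longrightarrow> h \<in> fibre B b \<Longrightarrow> \<psi> (vscl B a h) = a *\<^sub>R \<psi> h"
    "smooth_fun (sub (tot B) {h \<in> pts (tot B). proj B h \<in> T}) \<psi>"
  using assms unfolding local_triv_def by blast+

lemma fibre_inj:
  assumes "b \<in> pts (bas B)"
  obtains \<psi> :: "'t \<Rightarrow> 'f" where "inj_on \<psi> (fibre B b)" "\<psi> (vzer B b) = 0"
    "\<And>h k. h \<in> fibre B b \<Longrightarrow> k \<in> fibre B b \<Longrightarrow> \<psi> (vadd B h k) = \<psi> h + \<psi> k"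
    "\<And>a h. h \<in> fibre B b \<Longrightarrow> \<psi> (vscl B a h) = a *\<^sub>R \<psi> h"
proof -
  from triv[OF assms] obtain T and W :: "'f set" and \<psi> where "b \<in> T" "local_triv B T W \<psi>" by blast
  then show ?thesis
    using that[of \<psi>] local_trivD(3-6)[of T W \<psi> b] by (simp add: bij_betw_def)
qed

lemma inv_triv_smooth:
  fixes W :: "'f set"
  assumes t: "local_triv B T W \<psi>" and T': "openin (mtop (bas B)) T'" "T' \<subseteq> T"
    and g: "smooth_fun (sub (bas B) T') g" "\<And>b. b \<in> T' \<Longrightarrow> g b \<in> W"
  shows "smooth_map (sub (bas B) T') (tot B) (\<lambda>b. inv_into (fibre B b) \<psi> (g b))"
proof -
  let ?E = "euclid :: ('f, 'f) space"
  have P: "smooth_space (bas B \<times>\<^sub>M ?E)" by (intro smooth_space_prod base smooth_space_euclid)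
  have TB: "T \<subseteq> pts (bas B)" using t openin_pts[OF base(1)] unfolding local_triv_def by blast
  have T'B: "T' \<subseteq> pts (bas B)" using TB T'(2) by simp
  have "smooth_map (sub (bas B) T') (bas B \<times>\<^sub>M ?E) (\<lambda>b. (b, g b))"
    by (intro smooth_map_Pair smooth_space_sub base smooth_space_euclid T'B g(1)
        smooth_map_sub[OF smooth_map_id])
  then have "smooth_map (sub (bas B) T') (sub (bas B \<times>\<^sub>M ?E) (T \<times> W)) (\<lambda>b. (b, g b))"
    by (rule smooth_map_into_sub) (use g(2) T'(2) in auto)
  moreover have "smooth_map (sub (bas B \<times>\<^sub>M ?E) (T \<times> W)) (tot B) (\<lambda>(b, w). inv_into (fibre B b) \<psi> w)"
    using t unfolding local_triv_def by blast
  moreover have "smooth_space (sub (bas B \<times>\<^sub>M ?E) (T \<times> W))"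
    by (rule smooth_space_sub[OF P]) (use TB in auto)
  ultimately show ?thesis using smooth_map_compose by fastforce
qed

lemma inv_triv:
  assumes "local_triv B T W \<psi>" "b \<in> T"
  shows "w \<in> W \<Longrightarrow> inv_into (fibre B b) \<psi> w \<in> fibre B b" "w \<in> W \<Longrightarrow> \<psi> (inv_into (fibre B b) \<psi> w) = w"
    "h \<in> fibre B b \<Longrightarrow> inv_into (fibre B b) \<psi> (\<psi> h) = h" "h \<in> fibre B b \<Longrightarrow> \<psi> h \<in> W"
  using local_trivD(3)[OF assms] unfolding bij_betw_def
  by (auto simp: inv_into_into f_inv_into_f inv_into_f_f)

lemma zero_smooth: "smooth_map (bas B) (tot B) (vzer B)"
proof (rule smooth_map_local[OF base(1)])
  fix b assume b: "b \<in> pts (bas B)"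
  from triv[OF b] obtain T and W :: "'f set" and \<psi> where t: "b \<in> T" "local_triv B T W \<psi>" by blast
  have TB: "T \<subseteq> pts (bas B)" using local_trivD(1)[OF t(2)] openin_pts[OF base(1)] by blast
  have "smooth_map (sub (bas B) T) (tot B) (\<lambda>b. inv_into (fibre B b) \<psi> 0)"
    by (rule inv_triv_smooth[OF t(2) local_trivD(1)[OF t(2)] subset_refl])
      (use smooth_fun_const[OF smooth_space_sub[OF base(1) TB]] subspace_0[OF local_trivD(2)[OF t(2)]] in
          auto)
  then have "smooth_map (sub (bas B) T) (tot B) (vzer B)"
  proof (rule smooth_map_cong[rotated])
    fix x assume "x \<in> pts (sub (bas B) T)"
    then have "x \<in> T" by simp
    then show "inv_into (fibre B x) \<psi> 0 = vzer B x"
      using inv_triv(3)[OF t(2), of x "vzer B x"] local_trivD(4)[OF t(2)] vzer_in[of x] TB by auto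
  qed
  then show "\<exists>T. openin (mtop (bas B)) T \<and> b \<in> T \<and> smooth_map (sub (bas B) T) (tot B) (vzer B)"
    using local_trivD(1)[OF t(2)] t(1) by blast
qed

text \<open>Transported to \<open>W\<close> by the inverse trivialization, \<xi> is a linear
  functional, so it is determined by its values on the spanning vectors \<open>w i\<close>.\<close>

lemma functional_expand:
  assumes t: "local_triv B T W \<psi>" "b \<in> T" and b: "b \<in> pts (bas B)"
    and w: "\<And>i. i < r \<Longrightarrow> w i \<in> W" "\<And>v. v \<in> W \<Longrightarrow> (\<Sum>i<r. (v \<bullet> w i) *\<^sub>R w i) = v"
    and \<xi>: "fibre_functional B b \<xi>" and h: "h \<in> fibre B b"
  shows "\<xi> h = (\<Sum>i<r. (\<psi> h \<bullet> w i) * \<xi> (inv_into (fibre B b) \<psi> (w i)))"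
proof -
  let ?i = "inv_into (fibre B b) \<psi>"
  note W = local_trivD(2)[OF t(1)] and iv = inv_triv[OF t]
  have add: "\<xi> (?i (u + v)) = \<xi> (?i u) + \<xi> (?i v)" if "u \<in> W" "v \<in> W" for u v
  proof -
    have "?i (u + v) = vadd B (?i u) (?i v)"
      using iv(3)[OF vadd_in[OF b iv(1)[OF that(1)] iv(1)[OF that(2)]]]
        local_trivD(5)[OF t iv(1)[OF that(1)] iv(1)[OF that(2)]] iv(2) that by simp
    then show ?thesis using \<xi> iv(1) that unfolding fibre_functional_def by simp
  qed
  have scl: "\<xi> (?i (a *\<^sub>R u)) = a * \<xi> (?i u)" if "u \<in> W" for a u
  proof -
    have "?i (a *\<^sub>R u) = vscl B a (?i u)"
      using iv(3)[OF vscl_in[OF b iv(1)[OF that]], of a]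
        local_trivD(6)[OF t iv(1)[OF that]] iv(2) that by simp
    then show ?thesis using \<xi> iv(1) that unfolding fibre_functional_def by simp
  qed
  have "\<xi> (?i (\<Sum>i<n. c i *\<^sub>R w i)) = (\<Sum>i<n. c i * \<xi> (?i (w i)))" if "n \<le> r" for n c
    using that
  proof (induction n)
    case 0
    show ?case using scl[OF subspace_0[OF W], of 0] by simp
  next
    case (Suc n)
    have "(\<Sum>i<n. c i *\<^sub>R w i) \<in> W" "c n *\<^sub>R w n \<in> W"
      using Suc.prems w(1) by (auto intro!: subspace_sum[OF W] subspace_scale[OF W])
    then show ?case using Suc add scl w(1) by simp
  qed
  from this[of r "\<lambda>i. \<psi> h \<bullet> w i"] show ?thesis using w(2)[OF iv(4)[OF h]] iv(3)[OF h] by simp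
qed

lemma cutoff_triv:
  assumes "b\<^sub>0 \<in> pts (bas B)"
  obtains T and W :: "'f set" and \<psi> w f P R where "local_triv B T W \<psi>" "b\<^sub>0 \<in> T"
    "\<And>i. i < r \<Longrightarrow> w i \<in> W" "\<And>v. v \<in> W \<Longrightarrow> (\<Sum>i<r. (v \<bullet> w i) *\<^sub>R w i) = v"
    "\<And>i j. i < r \<Longrightarrow> j < r \<Longrightarrow> w i \<bullet> w j = (if i = j then 1 else 0)"
    "smooth_fun (bas B) (f :: 'b \<Rightarrow> real)" "openin (mtop (bas B)) P" "b\<^sub>0 \<in> P" "P \<subseteq> T" "\<And>y. y \<in> P \<Longrightarrow> f y = 1"
    "openin (mtop (bas B)) R" "pts (bas B) \<subseteq> T \<union> R" "\<And>y. y \<in> R \<Longrightarrow> f y = 0"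
proof -
  from triv[OF assms] obtain T and W :: "'f set" and \<psi>
    where t: "b\<^sub>0 \<in> T" "dim W = r" "local_triv B T W \<psi>" by blast
  obtain w where w: "\<And>i. i < r \<Longrightarrow> w i \<in> W"
    "\<And>i j. i < r \<Longrightarrow> j < r \<Longrightarrow> w i \<bullet> w j = (if i = j then 1 else 0)"
    "\<And>v. v \<in> W \<Longrightarrow> (\<Sum>i<r. (v \<bullet> w i) *\<^sub>R w i) = v"
    by (rule orthonormal_frame[OF local_trivD(2)[OF t(3)] t(2)]) (rule that; assumption)
  obtain f :: "'b \<Rightarrow> real" and P R where f: "smooth_fun (bas B) f" "openin (mtop (bas B)) P" "b\<^sub>0 \<in> P" "P \<subseteq> T"
    "\<And>y. y \<in> P \<Longrightarrow> f y = 1" "openin (mtop (bas B)) R" "pts (bas B) \<subseteq> T \<union> R" "\<And>y. y \<in> R \<Longrightarrow> f y = 0"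
    by (rule has_bumps_obtain[OF base local_trivD(1)[OF t(3)] t(1)]) (rule that; assumption)
  show ?thesis by (rule that[OF t(3,1) w(1,3,2) f])
qed

lemma smooth_fun_triv_section:
  assumes t: "local_triv B T W \<psi>" and X: "smooth_map (bas B) (tot B) X" "\<And>b. b \<in> pts (bas B) \<Longrightarrow>
      X b \<in> fibre B b"
  shows "smooth_fun (sub (bas B) T) (\<lambda>b. \<psi> (X b) \<bullet> v)"
proof -
  let ?S = "{h \<in> pts (tot B). proj B h \<in> T}"
  have TB: "T \<subseteq> pts (bas B)" using local_trivD(1)[OF t] openin_pts[OF base(1)] by blast
  have "smooth_map (sub (bas B) T) (sub (tot B) ?S) X"
    by (rule smooth_map_into_sub[OF smooth_map_sub[OF X(1) TB]]) (use X(2) TB in \<open>auto simp: fibre_def\<close>)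
  then have "smooth_fun (sub (bas B) T) (\<lambda>b. \<psi> (X b))"
    by (rule smooth_map_compose[OF smooth_space_sub[OF total] _ local_trivD(7)[OF t], rotated]) auto
  then show ?thesis
    by (rule smooth_fun_C_inf) (intro C_inf_on_linear bounded_linear_inner_left)
qed

lemma frame_triv:
  assumes b0: "b\<^sub>0 \<in> pts (bas B)"
  obtains e \<theta> \<rho> P T and W :: "'f set" and \<psi> w where
    "\<And>i. i < r \<Longrightarrow> e i \<in> sections B" "\<And>i. i < r \<Longrightarrow> \<theta> i \<in> k_forms B 1"
    "smooth_fun (bas B) \<rho>" "openin (mtop (bas B)) P" "b\<^sub>0 \<in> P" "\<And>b. b \<in> P \<Longrightarrow> \<rho> b = (1::real)"
    "\<And>b h \<xi>. b \<in> pts (bas B) \<Longrightarrow> h \<in> fibre B b \<Longrightarrow> fibre_functional B b \<xi> \<Longrightarrow>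
        \<rho> b * \<xi> h = (\<Sum>i<r. \<theta> i b [h] * \<xi> (e i b))"
    "\<And>c. \<exists>z\<in>fibre B b\<^sub>0. \<forall>i<r. \<theta> i b\<^sub>0 [z] = c i"
    "\<And>h. h \<in> fibre B b\<^sub>0 \<Longrightarrow> \<forall>i<r. \<theta> i b\<^sub>0 [h] = 0 \<Longrightarrow> h = vzer B b\<^sub>0"
    "local_triv B T W \<psi>" "P \<subseteq> T" "\<And>i. i < r \<Longrightarrow> w i \<in> W" "\<And>v. v \<in> W \<Longrightarrow> (\<Sum>i<r. (v \<bullet> w i) *\<^sub>R w i) = v"
    "\<And>b h i. b \<in> P \<Longrightarrow> h \<in> fibre B b \<Longrightarrow> i < r \<Longrightarrow> \<theta> i b [h] = \<psi> h \<bullet> w i"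
proof -
  obtain T and W :: "'f set" and \<psi> w f P R where t: "local_triv B T W \<psi>" "b\<^sub>0 \<in> T"
    and w: "\<And>i. i < r \<Longrightarrow> w i \<in> W" "\<And>v. v \<in> W \<Longrightarrow> (\<Sum>i<r. (v \<bullet> w i) *\<^sub>R w i) = v"
    and wd: "\<And>i j. i < r \<Longrightarrow> j < r \<Longrightarrow> w i \<bullet> w j = (if i = j then 1 else 0)"
    and f: "smooth_fun (bas B) (f :: 'b \<Rightarrow> real)" and P: "openin (mtop (bas B)) P" "b\<^sub>0 \<in> P" "P \<subseteq> T"
        "\<And>y. y \<in> P \<Longrightarrow> f y = 1"
    and R: "openin (mtop (bas B)) R" "pts (bas B) \<subseteq> T \<union> R" "\<And>y. y \<in> R \<Longrightarrow> f y = 0"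
    by (rule cutoff_triv[OF b0]) (rule that; assumption)
  have TB: "T \<subseteq> pts (bas B)" using local_trivD(1)[OF t(1)] openin_pts[OF base(1)] by blast
  note W = local_trivD(2)[OF t(1)]
  have fR: "f b = 0" if "b \<in> pts (bas B)" "b \<notin> T" for b using R that by auto
  \<comment> \<open>Both the frame and the coframe carry the cut-off f, so that both extend by zero
    to the whole base. Their pairing therefore produces the square of f, which is the function
    \<rho> of the conclusion.\<close>
  define e where "e = (\<lambda>i. \<lambda>b\<in>pts (bas B). if b \<in> T then inv_into (fibre B b) \<psi> (f b *\<^sub>R w i) else vzer B b)"
  define \<theta> where "\<theta> = (\<lambda>i. one_form B (\<lambda>b h. if b \<in> T then f b * (\<psi> h \<bullet> w i) else 0))"
  have e: "e i \<in> sections B" if i: "i < r" for i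
  proof -
    have fw: "f b *\<^sub>R w i \<in> W" for b by (rule subspace_scale[OF W w(1)[OF i]])
    have "smooth_map (bas B) (tot B) (e i)"
    proof (rule smooth_map_local[OF base(1)])
      fix b assume b: "b \<in> pts (bas B)"
      show "\<exists>T. openin (mtop (bas B)) T \<and> b \<in> T \<and> smooth_map (sub (bas B) T) (tot B) (e i)"
      proof (cases "b \<in> T")
        case True
        have "smooth_map (sub (bas B) T) (tot B) (\<lambda>b. inv_into (fibre B b) \<psi> (f b *\<^sub>R w i))"
          by (rule inv_triv_smooth[OF t(1) local_trivD(1)[OF t(1)] subset_refl _ fw])
            (intro smooth_fun_scaleR smooth_fun_const smooth_space_sub base(1) TB smooth_map_sub[OF f])
        then have "smooth_map (sub (bas B) T) (tot B) (e i)"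
          by (rule smooth_map_cong[rotated]) (use TB in \<open>auto simp: e_def\<close>)
        then show ?thesis using local_trivD(1)[OF t(1)] True by blast
      next
        case False
        have RB: "R \<subseteq> pts (bas B)" using R(1) openin_pts[OF base(1)] by blast
        have "smooth_map (sub (bas B) R) (tot B) (e i)"
        proof (rule smooth_map_cong[OF _ smooth_map_sub[OF zero_smooth RB]])
          fix x assume "x \<in> pts (sub (bas B) R)"
          then have x: "x \<in> R" "x \<in> pts (bas B)" using RB by auto
          then show "vzer B x = e i x"
            using R(3)[OF x(1)] inv_triv(3)[OF t(1), of x "vzer B x"] local_trivD(4)[OF t(1), of x] vzer_in[OF
                x(2)]
            by (simp add: e_def)
        qed
        then show ?thesis using R b False by blast
      qed
    qed
    moreover have "e i b \<in> fibre B b" if "b \<in> pts (bas B)" for b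
      using that inv_triv(1)[OF t(1) _ fw] vzer_in by (simp add: e_def)
    ultimately show ?thesis by (simp add: sections_def e_def)
  qed
  have \<theta>: "\<theta> i \<in> k_forms B 1" if i: "i < r" for i
    unfolding \<theta>_def
  proof (rule one_form_in_k_forms[OF base(1) vadd_in vscl_in])
    fix b assume "b \<in> pts (bas B)"
    show "fibre_functional B b (\<lambda>h. if b \<in> T then f b * (\<psi> h \<bullet> w i) else 0)"
      using local_trivD(5,6)[OF t(1), of b] by (auto simp: fibre_functional_def inner_add_left distrib_left)
  next
    fix X assume "X \<in> sections B"
    then have X: "smooth_map (bas B) (tot B) X" "\<And>b. b \<in> pts (bas B) \<Longrightarrow> X b \<in> fibre B b"
        by (auto simp: sections_def)
    show "smooth_fun (bas B) (\<lambda>b. if b \<in> T then f b * (\<psi> (X b) \<bullet> w i) else 0)"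
      using smooth_fun_cutoff[OF base(1) local_trivD(1)[OF t(1)] R(1,2) f R(3) smooth_fun_triv_section[OF t(1)
          X, of "w i"]]
      unfolding real_scaleR_def .
  qed auto
  have \<theta>_single: "\<theta> i b [h] = (if b \<in> T then f b * (\<psi> h \<bullet> w i) else 0)" if "b \<in> pts (bas B)" "h \<in> fibre B b"
      for i b h
    using that by (simp add: \<theta>_def)
  have exp: "(f b * f b) * \<xi> h = (\<Sum>i<r. \<theta> i b [h] * \<xi> (e i b))"
    if b: "b \<in> pts (bas B)" and h: "h \<in> fibre B b" and \<xi>: "fibre_functional B b \<xi>" for b h \<xi>
  proof (cases "b \<in> T")
    case True
    have "e i b = vscl B (f b) (inv_into (fibre B b) \<psi> (w i))" if "i < r" for i
      using inv_triv(3)[OF t(1) True vscl_in[OF b inv_triv(1)[OF t(1) True w(1)[OF that]]], of "f b"]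
        local_trivD(6)[OF t(1) True inv_triv(1)[OF t(1) True w(1)[OF that]]] inv_triv(2)[OF t(1) True w(1)[OF
            that]] True b
      by (simp add: e_def)
    then have "\<xi> (e i b) = f b * \<xi> (inv_into (fibre B b) \<psi> (w i))" if "i < r" for i
      using \<xi> inv_triv(1)[OF t(1) True w(1)[OF that]] that by (simp add: fibre_functional_def)
    then show ?thesis
      using functional_expand[OF t(1) True b w \<xi> h] True b h by (simp add: \<theta>_single sum_distrib_left mult_ac)
  next
    case False
    then show ?thesis using fR b h by (simp add: \<theta>_single)
  qed
  have ex: "\<exists>z\<in>fibre B b\<^sub>0. \<forall>i<r. \<theta> i b\<^sub>0 [z] = c i" for c
  proof (intro bexI allI impI)
    let ?v = "\<Sum>j<r. c j *\<^sub>R w j"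
    have v: "?v \<in> W" by (intro subspace_sum[OF W] subspace_scale[OF W] w(1)) simp
    show z: "inv_into (fibre B b\<^sub>0) \<psi> ?v \<in> fibre B b\<^sub>0" by (rule inv_triv(1)[OF t v])
    fix i assume i: "i < r"
    have "?v \<bullet> w i = (\<Sum>j<r. c j * (if j = i then 1 else 0))"
      unfolding inner_sum_left by (intro sum.cong) (use wd i in auto)
    also have "\<dots> = c i" using i by (simp add: if_distrib cong: if_cong)
    finally show "\<theta> i b\<^sub>0 [inv_into (fibre B b\<^sub>0) \<psi> ?v] = c i"
      using t(2) P inv_triv(2)[OF t v] by (simp add: \<theta>_single[OF b0 z])
  qed
  have sep: "h = vzer B b\<^sub>0" if h: "h \<in> fibre B b\<^sub>0" and 0: "\<forall>i<r. \<theta> i b\<^sub>0 [h] = 0" for h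
  proof -
    have "\<psi> h = (\<Sum>i<r. (\<psi> h \<bullet> w i) *\<^sub>R w i)" using w(2)[OF inv_triv(4)[OF t h]] by simp
    also have "\<dots> = (\<Sum>i<r. 0)" using 0 t(2) P by (intro sum.cong) (auto simp: \<theta>_single[OF b0 h])
    finally have "\<psi> h = \<psi> (vzer B b\<^sub>0)" using local_trivD(4)[OF t] by simp
    then show ?thesis using inv_triv(3)[OF t h] inv_triv(3)[OF t vzer_in[OF b0]] by metis
  qed
  have \<rho>: "smooth_fun (bas B) (\<lambda>b. f b * f b)" by (intro smooth_fun_mult base f)
  have PT: "\<theta> i b [h] = \<psi> h \<bullet> w i" if "b \<in> P" "h \<in> fibre B b" "i < r" for b h i
  proof -
    have "b \<in> T" "b \<in> pts (bas B)" "f b = 1" using that(1) P(3,4) TB by blast+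
    then show ?thesis using that(2) by (simp add: \<theta>_single)
  qed
  show ?thesis
    by (rule that[of e \<theta> "\<lambda>b. f b * f b" P T W \<psi> w, OF e \<theta> \<rho> P(1,2) _ exp ex sep t(1) P(3) w PT]) (simp_all
        add: P(4))
qed

lemma one_form_functional:
  assumes "\<alpha> \<in> forms B" "b \<in> pts (bas B)"
  shows "fibre_functional B b (\<lambda>h. \<alpha> b [h])"
proof -
  note a = assms[unfolded forms_def]
  have 1: "\<forall>xs\<in>lists (fibre B b). \<forall>ys\<in>lists (fibre B b). \<forall>h\<in>fibre B b.
        (\<forall>k\<in>fibre B b. \<alpha> b (xs @ vadd B h k # ys) = \<alpha> b (xs @ h # ys) + \<alpha> b (xs @ k # ys)) \<and>
        (\<forall>a. \<alpha> b (xs @ vscl B a h # ys) = a * \<alpha> b (xs @ h # ys))"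
    using a by blast
  show ?thesis unfolding fibre_functional_def using 1[rule_format, of "[]" "[]"] by simp
qed

text \<open>Membership in \<open>k_forms\<close> gives smoothness along sections. Near a given
  point, \<alpha>(h) is the sum of the fibre coordinates of h times the smooth functions \<alpha>(e
  i), which gives smoothness on the total space.\<close>

lemma one_form_total_smooth:
  assumes \<alpha>: "\<alpha> \<in> k_forms B 1"
  shows "smooth_fun (tot B) (\<lambda>h. \<alpha> (proj B h) [h])"
proof (rule smooth_map_local[OF total])
  fix h\<^sub>0 assume h0: "h\<^sub>0 \<in> pts (tot B)"
  have b0: "proj B h\<^sub>0 \<in> pts (bas B)" by (rule smooth_map_in[OF proj_smooth h0])
  obtain e \<theta> \<rho> P T and W :: "'f set" and \<psi> w where e: "\<And>i. i < r \<Longrightarrow> e i \<in> sections B"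
    and P: "openin (mtop (bas B)) P" "proj B h\<^sub>0 \<in> P" "\<And>b. b \<in> P \<Longrightarrow> \<rho> b = (1::real)"
    and exp: "\<And>b h \<xi>. b \<in> pts (bas B) \<Longrightarrow> h \<in> fibre B b \<Longrightarrow> fibre_functional B b \<xi> \<Longrightarrow>
        \<rho> b * \<xi> h = (\<Sum>i<r. \<theta> i b [h] * \<xi> (e i b))"
    and t: "local_triv B T W \<psi>" "P \<subseteq> T"
    and PT: "\<And>b h i. b \<in> P \<Longrightarrow> h \<in> fibre B b \<Longrightarrow> i < r \<Longrightarrow> \<theta> i b [h] = \<psi> h \<bullet> w i"
    by (rule frame_triv[OF b0]) (rule that; assumption)
  have af: "\<alpha> \<in> forms B" using \<alpha> by (simp add: k_forms_def)
  let ?S = "{h \<in> pts (tot B). proj B h \<in> P}"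
  have oS: "openin (mtop (tot B)) ?S" by (rule openin_smooth_vimage[OF total base(1) proj_smooth P(1)])
  have SS: "smooth_space (sub (tot B) ?S)" by (rule smooth_space_sub[OF total]) auto
  have \<psi>: "smooth_fun (sub (tot B) ?S) \<psi>"
    using smooth_map_sub[OF local_trivD(7)[OF t(1)], of ?S] t(2) by (auto simp: subset_iff)
  have pr: "smooth_map (sub (tot B) ?S) (bas B) (proj B)" by (rule smooth_map_sub[OF proj_smooth]) auto
  have c: "smooth_fun (bas B) (\<lambda>b. \<alpha> b [e i b])" if i: "i < r" for i
  proof -
    have "\<forall>Xs\<in>lists (sections B). smooth_fun (bas B) (\<lambda>b. \<alpha> b (map (\<lambda>X. X b) Xs))"
      using af unfolding forms_def by blast
    from this[rule_format, of "[e i]"] e[OF i] show ?thesis by simp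
  qed
  have "smooth_fun (sub (tot B) ?S) (\<lambda>h. \<Sum>i<r. (\<psi> h \<bullet> w i) * \<alpha> (proj B h) [e i (proj B h)])"
    by (intro smooth_fun_sum smooth_fun_mult SS smooth_fun_C_inf[OF \<psi>] C_inf_on_linear
        bounded_linear_inner_left
        smooth_map_compose[OF base(1) pr c]) auto
  then have "smooth_fun (sub (tot B) ?S) (\<lambda>h. \<alpha> (proj B h) [h])"
  proof (rule smooth_map_cong[rotated])
    fix h assume "h \<in> pts (sub (tot B) ?S)"
    then have h: "h \<in> pts (tot B)" "proj B h \<in> P" by auto
    then have b: "proj B h \<in> pts (bas B)" "h \<in> fibre B (proj B h)"
      using smooth_map_in[OF proj_smooth] by (auto simp: fibre_def)
    show "(\<Sum>i<r. (\<psi> h \<bullet> w i) * \<alpha> (proj B h) [e i (proj B h)]) = \<alpha> (proj B h) [h]"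
      using exp[OF b one_form_functional[OF af b(1)]] P(3)[OF h(2)] PT[OF h(2) b(2)] by simp
  qed
  then show "\<exists>T. openin (mtop (tot B)) T \<and> h\<^sub>0 \<in> T \<and> smooth_fun (sub (tot B) T) (\<lambda>h. \<alpha> (proj B h) [h])"
    using oS h0 P(2) by blast
qed

text \<open>Near each point Z is recovered from its smooth coordinates \<theta> i (Z) through the
  smooth inverse of the trivialization.\<close>

lemma section_smoothI:
  assumes Z: "\<And>b. b \<in> pts (bas B) \<Longrightarrow> Z b \<in> fibre B b"
    and sm: "\<And>\<alpha>. \<alpha> \<in> k_forms B 1 \<Longrightarrow> smooth_fun (bas B) (\<lambda>b. \<alpha> b [Z b])"
  shows "smooth_map (bas B) (tot B) Z"
proof (rule smooth_map_local[OF base(1)])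
  fix b\<^sub>0 assume b0: "b\<^sub>0 \<in> pts (bas B)"
  obtain e \<theta> \<rho> P T and W :: "'f set" and \<psi> w where \<theta>: "\<And>i. i < r \<Longrightarrow> \<theta> i \<in> k_forms B 1"
    and P: "openin (mtop (bas B)) P" "b\<^sub>0 \<in> P"
    and t: "local_triv B T W \<psi>" "P \<subseteq> T"
    and w: "\<And>i. i < r \<Longrightarrow> w i \<in> W" "\<And>v. v \<in> W \<Longrightarrow> (\<Sum>i<r. (v \<bullet> w i) *\<^sub>R w i) = v"
    and PT: "\<And>b h i. b \<in> P \<Longrightarrow> h \<in> fibre B b \<Longrightarrow> i < r \<Longrightarrow> \<theta> i b [h] = \<psi> h \<bullet> w i"
    by (rule frame_triv[OF b0]) (rule that; assumption)
  have PB: "P \<subseteq> pts (bas B)" using P(1) openin_pts[OF base(1)] by blast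
  note W = local_trivD(2)[OF t(1)]
  have "smooth_fun (sub (bas B) P) (\<lambda>b. \<Sum>i<r. \<theta> i b [Z b] *\<^sub>R w i)"
    by (intro smooth_fun_sum smooth_fun_scaleR smooth_fun_const smooth_space_sub[OF base(1) PB]
        smooth_map_sub[OF sm[OF \<theta>] PB]) auto
  then have "smooth_map (sub (bas B) P) (tot B) (\<lambda>b. inv_into (fibre B b) \<psi> (\<Sum>i<r. \<theta> i b [Z b] *\<^sub>R w i))"
    by (rule inv_triv_smooth[OF t(1) P(1) t(2)]) (auto intro!: subspace_sum[OF W] subspace_scale[OF W] w)
  then have "smooth_map (sub (bas B) P) (tot B) Z"
  proof (rule smooth_map_cong[rotated])
    fix b assume "b \<in> pts (sub (bas B) P)"
    then have b: "b \<in> P" "b \<in> T" and z: "Z b \<in> fibre B b" using t(2) Z PB by auto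
    have "(\<Sum>i<r. \<theta> i b [Z b] *\<^sub>R w i) = \<psi> (Z b)"
      using PT[OF b(1) z] w(2)[OF inv_triv(4)[OF t(1) b(2) z]] by simp
    then show "inv_into (fibre B b) \<psi> (\<Sum>i<r. \<theta> i b [Z b] *\<^sub>R w i) = Z b"
      using inv_triv(3)[OF t(1) b(2) z] by simp
  qed
  then show "\<exists>T. openin (mtop (bas B)) T \<and> b\<^sub>0 \<in> T \<and> smooth_map (sub (bas B) T) (tot B) Z"
    using P by blast
qed

lemma framed: "framed_bundle B r"
proof
  fix b\<^sub>0 assume b: "b\<^sub>0 \<in> pts (bas B)"
  \<comment> \<open>The vector space laws of the fibre are pulled back along an injective \<psi>
    that carries the fibre operations to those of the model space.\<close>
  obtain \<psi> :: "'t \<Rightarrow> 'f" where \<psi>: "inj_on \<psi> (fibre B b\<^sub>0)" "\<psi> (vzer B b\<^sub>0) = 0"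
    "\<And>h k. h \<in> fibre B b\<^sub>0 \<Longrightarrow> k \<in> fibre B b\<^sub>0 \<Longrightarrow> \<psi> (vadd B h k) = \<psi> h + \<psi> k"
    "\<And>a h. h \<in> fibre B b\<^sub>0 \<Longrightarrow> \<psi> (vscl B a h) = a *\<^sub>R \<psi> h"
    by (rule fibre_inj[OF b]) (rule that; assumption)
  note cl = vzer_in[OF b] vadd_in[OF b] vscl_in[OF b]
  fix h k l a c assume h: "h \<in> fibre B b\<^sub>0"
  show "vadd B (vzer B b\<^sub>0) h = h" "vscl B 0 h = vzer B b\<^sub>0" "vscl B 1 h = h" "vscl B a (vscl B c h) =
      vscl B (a * c) h"
    "vscl B (a + c) h = vadd B (vscl B a h) (vscl B c h)"
    by (rule inj_onD[OF \<psi>(1)]; simp add: \<psi> cl h scaleR_add_left)+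
  assume k: "k \<in> fibre B b\<^sub>0"
  show "vadd B h k = vadd B k h" "vscl B a (vadd B h k) = vadd B (vscl B a h) (vscl B a k)"
    by (rule inj_onD[OF \<psi>(1)]; simp add: \<psi> cl h k scaleR_add_right add.commute)+
  assume l: "l \<in> fibre B b\<^sub>0"
  show "vadd B (vadd B h k) l = vadd B h (vadd B k l)"
    by (rule inj_onD[OF \<psi>(1)]; simp add: \<psi> cl h k l add.assoc)
next
  fix b\<^sub>0 assume b0: "b\<^sub>0 \<in> pts (bas B)"
  obtain e \<theta> \<rho> P T and W :: "'f set" and \<psi> w where
    "\<And>i. i < r \<Longrightarrow> e i \<in> sections B" "\<And>i. i < r \<Longrightarrow> \<theta> i \<in> k_forms B 1"
    "smooth_fun (bas B) \<rho>" "openin (mtop (bas B)) P" "b\<^sub>0 \<in> P" "\<And>b. b \<in> P \<Longrightarrow> \<rho> b = (1::real)"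
    "\<And>b h \<xi>. b \<in> pts (bas B) \<Longrightarrow> h \<in> fibre B b \<Longrightarrow> fibre_functional B b \<xi> \<Longrightarrow>
        \<rho> b * \<xi> h = (\<Sum>i<r. \<theta> i b [h] * \<xi> (e i b))"
    "\<And>c. \<exists>z\<in>fibre B b\<^sub>0. \<forall>i<r. \<theta> i b\<^sub>0 [z] = c i"
    "\<And>h. h \<in> fibre B b\<^sub>0 \<Longrightarrow> \<forall>i<r. \<theta> i b\<^sub>0 [h] = 0 \<Longrightarrow> h = vzer B b\<^sub>0"
    by (rule frame_triv[OF b0]) (rule that; assumption)
  then show "\<exists>e \<theta> \<rho> P. (\<forall>i<r. e i \<in> sections B \<and> \<theta> i \<in> k_forms B 1) \<and>
      smooth_fun (bas B) \<rho> \<and> openin (mtop (bas B)) P \<and> b\<^sub>0 \<in> P \<and> (\<forall>b\<in>P. \<rho> b = (1::real)) \<and>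
      (\<forall>b\<in>pts (bas B). \<forall>h\<in>fibre B b. \<forall>\<xi>. fibre_functional B b \<xi> \<longrightarrow> \<rho> b * \<xi> h = (\<Sum>i<r. \<theta> i b [h] * \<xi> (e i b))) \<and>
      (\<forall>c. \<exists>z\<in>fibre B b\<^sub>0. \<forall>i<r. \<theta> i b\<^sub>0 [z] = c i) \<and>
      (\<forall>h\<in>fibre B b\<^sub>0. (\<forall>i<r. \<theta> i b\<^sub>0 [h] = 0) \<longrightarrow> h = vzer B b\<^sub>0)"
    by (intro exI[of _ e] exI[of _ \<theta>] exI[of _ \<rho>] exI[of _ P]) simp
qed (auto intro: base total proj_smooth vzer_in vadd_in vscl_in one_form_total_smooth section_smoothI)

end

lemma vector_bundle_local_triv:
  fixes B :: "('b, 'v::euclidean_space, 't, 'w::euclidean_space) vbundle"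
  assumes V: "vector_bundle B"
  shows "\<exists>r. \<forall>b\<^sub>0\<in>pts (bas B). \<exists>T (W :: 'w set) \<psi>. b\<^sub>0 \<in> T \<and> dim W = r \<and> local_triv B T W \<psi>"
  using V[unfolded vector_bundle_def, THEN conjunct2, THEN conjunct2] unfolding local_triv_def
  apply (elim exE)
  subgoal for r
    apply (rule exI[of _ r])
    apply (intro ballI)
    apply (drule bspec, assumption)
    apply (elim exE conjE)
    subgoal for b T W \<psi>
      by (rule exI[of _ T], rule exI[of _ W], rule exI[of _ \<psi>]) simp
    done
  done

lemma vector_bundle_framed:
  fixes B :: "('b, 'v::euclidean_space, 't, 'w::euclidean_space) vbundle"
  assumes V: "vector_bundle B" and "smooth_space (bas B)" "has_bumps (bas B)" "smooth_space (tot B)"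
  obtains r where "framed_bundle B r"
proof -
  obtain r where r: "\<forall>b\<in>pts (bas B). \<exists>T (W :: 'w set) \<psi>. b \<in> T \<and> dim W = r \<and> local_triv B T W \<psi>"
    using vector_bundle_local_triv[OF V] ..
  have "trivialized_bundle TYPE('w) B r"
  proof (rule trivialized_bundle.intro)
    note V' = V[unfolded vector_bundle_def]
    show "smooth_map (tot B) (bas B) (proj B)" using V' by blast
    fix b assume b: "b \<in> pts (bas B)"
    show "vzer B b \<in> fibre B b" using V' b by blast
    show "\<exists>T (W :: 'w set) \<psi>. b \<in> T \<and> dim W = r \<and> local_triv B T W \<psi>" by (rule r[rule_format, OF b])
    fix h assume h: "h \<in> fibre B b"
    show "vscl B a h \<in> fibre B b" for a using V' b h by blast
    fix k assume k: "k \<in> fibre B b"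
    show "vadd B h k \<in> fibre B b" using V' b h k by blast
  qed (use assms in auto)
  then show ?thesis using that trivialized_bundle.framed by blast
qed

section \<open>Alternating maps and the wedge product\<close>

text \<open>Only adjacent repetitions are required to give 0. This is the form that an induction
  over the argument list can check for wedge products; \<open>alt_map_repeat\<close> recovers
  arbitrary repetitions.\<close>

definition alt_map :: "('b, 'v, 't, 'w) vbundle \<Rightarrow> 'b \<Rightarrow> ('t list \<Rightarrow> real) \<Rightarrow> bool" where
  "alt_map B b f \<longleftrightarrow> (\<forall>xs\<in>lists (fibre B b). \<forall>ys\<in>lists (fibre B b). \<forall>h\<in>fibre B b.
    (\<forall>k\<in>fibre B b. f (xs @ vadd B h k # ys) = f (xs @ h # ys) + f (xs @ k # ys)) \<and>
    (\<forall>a. f (xs @ vscl B a h # ys) = a * f (xs @ h # ys)) \<and>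
    f (xs @ h # h # ys) = 0)"

lemma alt_mapD:
  assumes "alt_map B b f" "xs \<in> lists (fibre B b)" "ys \<in> lists (fibre B b)" "h \<in> fibre B b"
  shows "k \<in> fibre B b \<Longrightarrow> f (xs @ vadd B h k # ys) = f (xs @ h # ys) + f (xs @ k # ys)"
    "f (xs @ vscl B a h # ys) = a * f (xs @ h # ys)" "f (xs @ h # h # ys) = 0"
  using assms unfolding alt_map_def by blast+

lemma alt_map_Cons: "alt_map B b f \<Longrightarrow> x \<in> fibre B b \<Longrightarrow> alt_map B b (\<lambda>l. f (x # l))"
  unfolding alt_map_def by (metis Cons_in_lists_iff append_Cons)

lemma alt_map_sign: "alt_map B b f \<Longrightarrow> alt_map B b (\<lambda>l. (- 1) ^ length l * f l)"
  unfolding alt_map_def by (simp add: distrib_left)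

text \<open>Polarization: expand f at two adjacent arguments both equal to h + k.\<close>

lemma alt_map_skew:
  assumes f: "alt_map B b f" and "\<And>h k. h \<in> fibre B b \<Longrightarrow> k \<in> fibre B b \<Longrightarrow> vadd B h k \<in> fibre B b"
    and xs: "xs \<in> lists (fibre B b)" "ys \<in> lists (fibre B b)" and h: "h \<in> fibre B b" "k \<in> fibre B b"
  shows "f (xs @ h # k # ys) = - f (xs @ k # h # ys)"
proof -
  let ?s = "vadd B h k"
  have s: "?s \<in> fibre B b" using assms by blast
  have "0 = f (xs @ ?s # ?s # ys)" using alt_mapD(3)[OF f xs s] by simp
  also have "\<dots> = f (xs @ h # ?s # ys) + f (xs @ k # ?s # ys)"
    using alt_mapD(1)[OF f xs(1) _ h, of "?s # ys"] xs s by simp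
  also have "f (xs @ h # ?s # ys) = f (xs @ h # h # ys) + f (xs @ h # k # ys)"
    using alt_mapD(1)[OF f _ xs(2) h, of "xs @ [h]"] xs h by simp
  also have "f (xs @ k # ?s # ys) = f (xs @ k # h # ys) + f (xs @ k # k # ys)"
    using alt_mapD(1)[OF f _ xs(2) h, of "xs @ [k]"] xs h by simp
  finally show ?thesis using alt_mapD(3)[OF f xs h(1)] alt_mapD(3)[OF f xs h(2)] by simp
qed

text \<open>Transpositions carry the first copy of h next to the second.\<close>

lemma alt_map_repeat:
  assumes f: "alt_map B b f" and cl: "\<And>h k. h \<in> fibre B b \<Longrightarrow> k \<in> fibre B b \<Longrightarrow> vadd B h k \<in> fibre B b"
    and "xs \<in> lists (fibre B b)" "ys \<in> lists (fibre B b)" "zs \<in> lists (fibre B b)" "h \<in> fibre B b"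
  shows "f (xs @ h # ys @ h # zs) = 0"
  using assms(3-)
proof (induction ys arbitrary: xs)
  case Nil
  then show ?case using alt_mapD(3)[OF f] by simp
next
  case (Cons y ys)
  have "f (xs @ h # y # (ys @ h # zs)) = - f (xs @ y # h # (ys @ h # zs))"
    by (rule alt_map_skew[OF f cl]) (use Cons.prems in auto)
  also have "f (xs @ y # h # (ys @ h # zs)) = f ((xs @ [y]) @ h # ys @ h # zs)" by simp
  also have "\<dots> = 0" by (rule Cons.IH) (use Cons.prems in auto)
  finally show ?case by simp
qed

text \<open>The wedge product at one base point, for arbitrary functions on lists. Induction over
  the arguments contracts f and g with single vectors, and the results are no longer given by global
  forms.\<close>

definition wedge_at :: "('t list \<Rightarrow> real) \<Rightarrow> ('t list \<Rightarrow> real) \<Rightarrow> 't list \<Rightarrow> real" where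
  "wedge_at f g hs = (\<Sum>A\<in>Pow {..<length hs}.
     (- 1) ^ card {(i, j). i \<in> A \<and> j \<in> {..<length hs} - A \<and> j < i} *
     f (nths hs A) * g (nths hs ({..<length hs} - A)))"

lemma wedge_wedge_at: "wedge \<omega> \<eta> b hs = wedge_at (\<omega> b) (\<eta> b) hs"
  by (simp add: wedge_def wedge_at_def)

lemma wedge_at_Nil[simp]: "wedge_at f g [] = f [] * g []"
  by (simp add: wedge_at_def)

text \<open>The first argument goes either to f or to g. In the second case it precedes every
  argument given to f, one inversion for each, hence the sign (-1)^length on f. This contraction
  rule replaces sums over shuffles by induction over the argument list.\<close>

lemma wedge_at_Cons:
  "wedge_at f g (x # hs) = wedge_at (\<lambda>l. f (x # l)) g hs + wedge_at (\<lambda>l. (- 1) ^ length l * f l) (\<lambda>l. g (x #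
      l)) hs"
proof -
  define n where "n = length hs"
  define F where "F = (\<lambda>A. (- 1) ^ card {(i, j). i \<in> A \<and> j \<in> {..<Suc n} - A \<and> j < i} *
     f (nths (x # hs) A) * g (nths (x # hs) ({..<Suc n} - A)))"
  have S: "{..<Suc n} = insert 0 (Suc ` {..<n})" by (rule lessThan_Suc_eq_insert_0)
  have "wedge_at f g (x # hs) = sum F (Pow {..<Suc n})" by (simp add: wedge_at_def F_def n_def)
  also have "Pow {..<Suc n} = Pow (Suc ` {..<n}) \<union> insert 0 ` Pow (Suc ` {..<n})"
    unfolding S by (rule Pow_insert)
  also have "sum F \<dots> = sum F (Pow (Suc ` {..<n})) + sum F (insert 0 ` Pow (Suc ` {..<n}))"
    by (rule sum.union_disjoint) auto
  also have "sum F (insert 0 ` Pow (Suc ` {..<n})) = (\<Sum>A\<in>Pow (Suc ` {..<n}). F (insert 0 A))"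
    by (rule sum.reindex_cong[OF _ refl refl]) (auto simp: inj_on_def)
  also have P: "Pow (Suc ` {..<n}) = (`) Suc ` Pow {..<n}"
    by (rule image_Pow_surj[symmetric]) simp
  also have "(\<Sum>A\<in>(`) Suc ` Pow {..<n}. F (insert 0 A)) = (\<Sum>A\<in>Pow {..<n}. F (insert 0 (Suc ` A)))"
    by (rule sum.reindex_cong[OF _ refl refl]) (auto simp: inj_on_def inj_image_eq_iff)
  also have "sum F ((`) Suc ` Pow {..<n}) = (\<Sum>A\<in>Pow {..<n}. F (Suc ` A))"
    by (rule sum.reindex_cong[OF _ refl refl]) (auto simp: inj_on_def inj_image_eq_iff)
  also have "(\<Sum>A\<in>Pow {..<n}. F (insert 0 (Suc ` A))) = wedge_at (\<lambda>l. f (x # l)) g hs"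
    unfolding wedge_at_def n_def[symmetric]
  proof (rule sum.cong[OF refl])
    fix A assume A: "A \<in> Pow {..<n}"
    have 1: "{j. Suc j \<in> insert 0 (Suc ` A)} = A" "{j. Suc j \<in> {..<Suc n} - insert 0 (Suc ` A)} = {..<n} - A"
        by auto
    have "{(i, j). i \<in> insert 0 (Suc ` A) \<and> j \<in> {..<Suc n} - insert 0 (Suc ` A) \<and> j < i} =
      map_prod Suc Suc ` {(i, j). i \<in> A \<and> j \<in> {..<n} - A \<and> j < i}" (is "?L = _ ` ?R")
      by (auto simp: S image_iff)
    then have "card ?L = card ?R" by (simp add: card_image inj_on_def)
    then show "F (insert 0 (Suc ` A)) = (- 1) ^ card ?R * f (x # nths hs A) * g (nths hs ({..<n} - A))"
      unfolding F_def nths_Cons 1 by simp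
  qed
  also have "(\<Sum>A\<in>Pow {..<n}. F (Suc ` A)) = wedge_at (\<lambda>l. (- 1) ^ length l * f l) (\<lambda>l. g (x # l)) hs"
    unfolding wedge_at_def n_def[symmetric]
  proof (rule sum.cong[OF refl])
    fix A assume A: "A \<in> Pow {..<n}"
    have 1: "{j. Suc j \<in> Suc ` A} = A" "{j. Suc j \<in> {..<Suc n} - Suc ` A} = {..<n} - A" by auto
    let ?R = "{(i, j). i \<in> A \<and> j \<in> {..<n} - A \<and> j < i}"
    have fin: "finite A" using A finite_subset by auto
    have finR: "finite ?R" by (rule finite_subset[of _ "A \<times> {..<n}"]) (use fin in auto)
    let ?L = "{(i, j). i \<in> Suc ` A \<and> j \<in> {..<Suc n} - Suc ` A \<and> j < i}"
    \<comment> \<open>Besides the shifted old inversions, position 0 forms one new inversion with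
      every element of A.\<close>
    have L: "?L = map_prod Suc Suc ` ?R \<union> (\<lambda>i. (Suc i, 0)) ` A"
      by (auto simp: S image_iff)
    have c: "card ?L = card ?R + card A"
      unfolding L by (subst card_Un_disjoint) (use fin finR in \<open>auto simp: card_image inj_on_def\<close>)
    have "length (nths hs A) = card A"
      using A by (auto simp: length_nths n_def intro!: arg_cong[of _ _ card])
    then show "F (Suc ` A) = (- 1) ^ card ?R * ((- 1) ^ length (nths hs A) * f (nths hs A)) * g (x # nths hs
        ({..<n} - A))"
      unfolding F_def nths_Cons 1 c by (simp add: power_add)
  qed
  finally show ?thesis by simp
qed

lemma wedge_at_cong:
  assumes "\<And>l. set l \<subseteq> set hs \<Longrightarrow> f l = f' l" "\<And>l. set l \<subseteq> set hs \<Longrightarrow> g l = g' l"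
  shows "wedge_at f g hs = wedge_at f' g' hs"
  unfolding wedge_at_def using assms by (intro sum.cong) (auto simp: set_nths_subset)

lemma wedge_at_add_left: "wedge_at (\<lambda>l. f l + f' l) g hs = wedge_at f g hs + wedge_at f' g hs"
  and wedge_at_add_right: "wedge_at f (\<lambda>l. g l + g' l) hs = wedge_at f g hs + wedge_at f g' hs"
  and wedge_at_scale_left: "wedge_at (\<lambda>l. a * f l) g hs = a * wedge_at f g hs"
  and wedge_at_scale_right: "wedge_at f (\<lambda>l. a * g l) hs = a * wedge_at f g hs"
  by (simp_all add: wedge_at_def sum.distrib sum_distrib_left algebra_simps)

lemma wedge_at_minus_left: "wedge_at (\<lambda>l. - f l) g hs = - wedge_at f g hs"
  using wedge_at_scale_left[of "-1" f g hs] by simp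

lemma wedge_at_minus_right: "wedge_at f (\<lambda>l. - g l) hs = - wedge_at f g hs"
  using wedge_at_scale_right[of f "-1" g hs] by simp

lemma wedge_at_zero_left: "wedge_at (\<lambda>l. 0) g hs = 0"
  by (simp add: wedge_at_def)

text \<open>Each leading argument is absorbed into one of the factors by
  \<open>wedge_at_Cons\<close>. The alternating property survives both contraction and the sign
  twist, so the induction hypothesis applies to both summands.\<close>

lemma wedge_at_add:
  assumes "alt_map B b f" "alt_map B b g" "xs \<in> lists (fibre B b)" "ys \<in> lists (fibre B b)" "h \<in> fibre B b"
      "k \<in> fibre B b"
    and s: "vadd B h k \<in> fibre B b"
  shows "wedge_at f g (xs @ vadd B h k # ys) = wedge_at f g (xs @ h # ys) + wedge_at f g (xs @ k # ys)"
  using assms(1-6)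
proof (induction xs arbitrary: f g)
  case Nil
  have ys: "set l \<subseteq> set ys \<Longrightarrow> l \<in> lists (fibre B b)" for l using Nil.prems(4) by auto
  have "wedge_at (\<lambda>l. f (vadd B h k # l)) g ys = wedge_at (\<lambda>l. f (h # l) + f (k # l)) g ys"
    by (rule wedge_at_cong) (use alt_mapD(1)[OF Nil.prems(1), of "[]"] Nil.prems(5,6) ys in auto)
  moreover have "wedge_at f' (\<lambda>l. g (vadd B h k # l)) ys = wedge_at f' (\<lambda>l. g (h # l) + g (k # l)) ys" for f'
    by (rule wedge_at_cong) (use alt_mapD(1)[OF Nil.prems(2), of "[]"] Nil.prems(5,6) ys in auto)
  ultimately show ?case by (simp add: wedge_at_Cons wedge_at_add_left wedge_at_add_right)
next
  case (Cons x xs)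
  then have x: "x \<in> fibre B b" "xs \<in> lists (fibre B b)" by auto
  show ?case
    using Cons.IH[OF alt_map_Cons[OF Cons.prems(1) x(1)] Cons.prems(2) x(2) Cons.prems(4-6)]
      Cons.IH[OF alt_map_sign[OF Cons.prems(1)] alt_map_Cons[OF Cons.prems(2) x(1)] x(2) Cons.prems(4-6)]
    by (simp add: wedge_at_Cons)
qed

lemma wedge_at_scl:
  assumes "alt_map B b f" "alt_map B b g" "xs \<in> lists (fibre B b)" "ys \<in> lists (fibre B b)" "h \<in> fibre B b"
  shows "wedge_at f g (xs @ vscl B a h # ys) = a * wedge_at f g (xs @ h # ys)"
  using assms
proof (induction xs arbitrary: f g)
  case Nil
  have ys: "set l \<subseteq> set ys \<Longrightarrow> l \<in> lists (fibre B b)" for l using Nil.prems(4) by auto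
  have "wedge_at (\<lambda>l. f (vscl B a h # l)) g ys = wedge_at (\<lambda>l. a * f (h # l)) g ys"
    by (rule wedge_at_cong) (use alt_mapD(2)[OF Nil.prems(1), of "[]"] Nil.prems(5) ys in auto)
  moreover have "wedge_at f' (\<lambda>l. g (vscl B a h # l)) ys = wedge_at f' (\<lambda>l. a * g (h # l)) ys" for f'
    by (rule wedge_at_cong) (use alt_mapD(2)[OF Nil.prems(2), of "[]"] Nil.prems(5) ys in auto)
  ultimately show ?case by (simp add: wedge_at_Cons wedge_at_scale_left wedge_at_scale_right distrib_left)
next
  case (Cons x xs)
  then have x: "x \<in> fibre B b" "xs \<in> lists (fibre B b)" by auto
  show ?case
    using Cons.IH[OF alt_map_Cons[OF Cons.prems(1) x(1)] Cons.prems(2) x(2) Cons.prems(4-5)]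
      Cons.IH[OF alt_map_sign[OF Cons.prems(1)] alt_map_Cons[OF Cons.prems(2) x(1)] x(2) Cons.prems(4-5)]
    by (simp add: wedge_at_Cons distrib_left)
qed

text \<open>With both copies of h in front, the terms in which one factor receives both copies are
  zero, and the two mixed terms carry opposite signs.\<close>

lemma wedge_at_alt:
  assumes "alt_map B b f" "alt_map B b g" "xs \<in> lists (fibre B b)" "ys \<in> lists (fibre B b)" "h \<in> fibre B b"
  shows "wedge_at f g (xs @ h # h # ys) = 0"
  using assms
proof (induction xs arbitrary: f g)
  case Nil
  have ys: "set l \<subseteq> set ys \<Longrightarrow> l \<in> lists (fibre B b)" for l using Nil.prems(4) by auto
  have "wedge_at (\<lambda>l. f (h # h # l)) g ys = wedge_at (\<lambda>l. 0) g ys"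
    by (rule wedge_at_cong) (use alt_mapD(3)[OF Nil.prems(1), of "[]"] Nil.prems(5) ys in auto)
  moreover have "wedge_at f' (\<lambda>l. g (h # h # l)) ys = wedge_at f' (\<lambda>l. 0 * g l) ys" for f'
    by (rule wedge_at_cong) (use alt_mapD(3)[OF Nil.prems(2), of "[]"] Nil.prems(5) ys in auto)
  ultimately show ?case
    by (simp add: wedge_at_Cons wedge_at_zero_left wedge_at_scale_right[where a=0, simplified]
        wedge_at_minus_left)
next
  case (Cons x xs)
  then have x: "x \<in> fibre B b" "xs \<in> lists (fibre B b)" by auto
  show ?case
    using Cons.IH[OF alt_map_Cons[OF Cons.prems(1) x(1)] Cons.prems(2) x(2) Cons.prems(4-5)]
      Cons.IH[OF alt_map_sign[OF Cons.prems(1)] alt_map_Cons[OF Cons.prems(2) x(1)] x(2) Cons.prems(4-5)]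
    by (simp add: wedge_at_Cons)
qed

lemma wedge_at_const:
  assumes "\<And>l. l \<noteq> [] \<Longrightarrow> f l = 0"
  shows "wedge_at f g hs = f [] * g hs"
  using assms
proof (induction hs arbitrary: f g)
  case (Cons x hs)
  have "wedge_at (\<lambda>l. f (x # l)) g hs = 0" using Cons.prems by (simp add: wedge_at_zero_left)
  moreover have "wedge_at (\<lambda>l. (- 1) ^ length l * f l) (\<lambda>l. g (x # l)) hs = f [] * g (x # hs)"
    using Cons.IH[of "\<lambda>l. (- 1) ^ length l * f l" "\<lambda>l. g (x # l)"] Cons.prems by simp
  ultimately show ?case by (simp add: wedge_at_Cons)
qed simp

lemma wedge_at_one_form:
  assumes "\<And>l. length l \<noteq> 1 \<Longrightarrow> f l = 0"
  shows "wedge_at f g (x # hs) = f [x] * g hs - wedge_at f (\<lambda>l. g (x # l)) hs"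
proof -
  have "wedge_at (\<lambda>l. f (x # l)) g hs = f [x] * g hs"
    by (rule wedge_at_const) (auto intro: assms)
  moreover have "(\<lambda>l. (- 1) ^ length l * f l) = (\<lambda>l. - f l)"
  proof (rule ext)
    show "(- 1) ^ length l * f l = - f l" for l
      using assms[of l] by (cases "length l = 1") simp_all
  qed
  ultimately show ?thesis by (simp add: wedge_at_Cons wedge_at_minus_left)
qed

section \<open>Forms on a bundle\<close>

text \<open>Functions as 0-forms, so that the Leibniz rule also governs multiplication by
  functions.\<close>

definition fun_form :: "('b, 'v, 't, 'w) vbundle \<Rightarrow> ('b \<Rightarrow> real) \<Rightarrow> ('b, 't) form" where
  "fun_form B f = (\<lambda>b hs. if b \<in> pts (bas B) \<and> hs = [] then f b else 0)"

definition fmul :: "('b \<Rightarrow> real) \<Rightarrow> ('b, 't) form \<Rightarrow> ('b, 't) form" where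
  "fmul f \<omega> = (\<lambda>b hs. f b * \<omega> b hs)"

context framed_bundle
begin

lemma formsI:
  assumes "\<And>b hs. \<omega> b hs \<noteq> 0 \<Longrightarrow> b \<in> pts (bas B) \<and> set hs \<subseteq> fibre B b"
    and alt: "\<And>b. b \<in> pts (bas B) \<Longrightarrow> alt_map B b (\<omega> b)"
    and "\<And>Xs. Xs \<in> lists (sections B) \<Longrightarrow> smooth_fun (bas B) (\<lambda>b. \<omega> b (map (\<lambda>X. X b) Xs))"
  shows "\<omega> \<in> forms B"
  unfolding forms_def mem_Collect_eq
proof (intro conjI ballI)
  fix b xs ys h
  assume b: "b \<in> pts (bas B)" and *: "xs \<in> lists (fibre B b)" "ys \<in> lists (fibre B b)" "h \<in> fibre B b"
  show "\<omega> b (xs @ vadd B h k # ys) = \<omega> b (xs @ h # ys) + \<omega> b (xs @ k # ys)" if "k \<in> fibre B b" for k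
    using alt_mapD[OF alt[OF b] *] that by blast
  show "\<forall>a. \<omega> b (xs @ vscl B a h # ys) = a * \<omega> b (xs @ h # ys)"
    using alt_mapD[OF alt[OF b] *] by blast
  show "\<omega> b (xs @ h # ys @ h # zs) = 0" if "zs \<in> lists (fibre B b)" for zs
    by (rule alt_map_repeat[OF alt[OF b] vadd_in[OF b]]) (use * that in auto)
qed (use assms in auto)

lemma forms_zero: "\<omega> \<in> forms B \<Longrightarrow> \<not> (b \<in> pts (bas B) \<and> set hs \<subseteq> fibre B b) \<Longrightarrow> \<omega> b hs = 0"
  unfolding forms_def by blast

lemma forms_alt:
  assumes "\<omega> \<in> forms B" "b \<in> pts (bas B)"
  shows "alt_map B b (\<omega> b)"
proof -
  have *: "(\<forall>k\<in>fibre B b. \<omega> b (xs @ vadd B h k # ys) = \<omega> b (xs @ h # ys) + \<omega> b (xs @ k # ys)) \<and>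
        (\<forall>a. \<omega> b (xs @ vscl B a h # ys) = a * \<omega> b (xs @ h # ys)) \<and>
        (\<forall>zs\<in>lists (fibre B b). \<omega> b (xs @ h # ys @ h # zs) = 0)"
    if "xs\<in>lists (fibre B b)" "ys\<in>lists (fibre B b)" "h\<in>fibre B b" for xs ys h
    using assms that unfolding forms_def mem_Collect_eq by blast
  have "\<omega> b (xs @ h # h # ys) = 0" if "xs\<in>lists (fibre B b)" "ys\<in>lists (fibre B b)" "h\<in>fibre B b" for xs ys h
    using *[of xs "[]" h] that by simp
  then show ?thesis unfolding alt_map_def using * by blast
qed

lemma forms_smooth:
  "\<omega> \<in> forms B \<Longrightarrow> Xs \<in> lists (sections B) \<Longrightarrow> smooth_fun (bas B) (\<lambda>b. \<omega> b (map (\<lambda>X. X b) Xs))"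
  unfolding forms_def by blast

lemma forms_functional:
  assumes "\<omega> \<in> forms B" "b \<in> pts (bas B)" "xs \<in> lists (fibre B b)" "ys \<in> lists (fibre B b)"
  shows "fibre_functional B b (\<lambda>h. \<omega> b (xs @ h # ys))"
  using alt_mapD(1,2)[OF forms_alt[OF assms(1,2)] assms(3,4)] by (simp add: fibre_functional_def)

lemma k_forms_forms: "\<omega> \<in> k_forms B k \<Longrightarrow> \<omega> \<in> forms B"
  by (simp add: k_forms_def)

lemma k_forms_length: "\<omega> \<in> k_forms B k \<Longrightarrow> length hs \<noteq> k \<Longrightarrow> \<omega> b hs = 0"
  by (auto simp: k_forms_def)

lemma k_formsI: "\<omega> \<in> forms B \<Longrightarrow> (\<And>b hs. length hs \<noteq> k \<Longrightarrow> \<omega> b hs = 0) \<Longrightarrow> \<omega> \<in> k_forms B k"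
  by (auto simp: k_forms_def)

lemma section_in: "X \<in> sections B \<Longrightarrow> b \<in> pts (bas B) \<Longrightarrow> X b \<in> fibre B b"
  by (simp add: sections_def)

lemma forms_zero_in: "(0 :: ('b, 't) form) \<in> forms B"
  by (rule formsI) (auto simp: alt_map_def intro: smooth_fun_const base)

lemma forms_comb:
  assumes "\<omega> \<in> forms B" "\<eta> \<in> forms B"
  shows "(\<lambda>b hs. a * \<omega> b hs + \<eta> b hs) \<in> forms B"
proof (rule formsI)
  fix b assume b: "b \<in> pts (bas B)"
  show "alt_map B b (\<lambda>hs. a * \<omega> b hs + \<eta> b hs)"
    using forms_alt[OF assms(1) b] forms_alt[OF assms(2) b] unfolding alt_map_def by (simp add: algebra_simps)
next
  fix Xs assume Xs: "Xs \<in> lists (sections B)"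
  show "smooth_fun (bas B) (\<lambda>b. a * \<omega> b (map (\<lambda>X. X b) Xs) + \<eta> b (map (\<lambda>X. X b) Xs))"
    by (intro smooth_fun_add smooth_fun_mult smooth_fun_const base forms_smooth assms Xs)
next
  fix b hs assume "a * \<omega> b hs + \<eta> b hs \<noteq> 0"
  then show "b \<in> pts (bas B) \<and> set hs \<subseteq> fibre B b"
    using forms_zero[OF assms(1), of b hs] forms_zero[OF assms(2), of b hs]
    by (cases "b \<in> pts (bas B) \<and> set hs \<subseteq> fibre B b") auto
qed

lemma forms_add: "\<omega> \<in> forms B \<Longrightarrow> \<eta> \<in> forms B \<Longrightarrow> \<omega> + \<eta> \<in> forms B"
  using forms_comb[of \<omega> \<eta> 1] by (simp add: plus_fun_def)

lemma forms_uminus: "\<omega> \<in> forms B \<Longrightarrow> - \<omega> \<in> forms B"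
  using forms_comb[of \<omega> 0 "- 1"] forms_zero_in by (simp add: fun_Compl_def)

lemma forms_diff: "\<omega> \<in> forms B \<Longrightarrow> \<eta> \<in> forms B \<Longrightarrow> \<omega> - \<eta> \<in> forms B"
  using forms_add[OF _ forms_uminus, of \<omega> \<eta>] by simp

lemma forms_sum: "(\<And>i. i \<in> I \<Longrightarrow> \<omega> i \<in> forms B) \<Longrightarrow> sum \<omega> I \<in> forms B"
  by (induction I rule: infinite_finite_induct) (auto intro: forms_zero_in forms_add)

lemma forms_fmul:
  assumes f: "smooth_fun (bas B) f" and \<omega>: "\<omega> \<in> forms B"
  shows "fmul f \<omega> \<in> forms B"
proof (rule formsI)
  fix b assume b: "b \<in> pts (bas B)"
  show "alt_map B b (fmul f \<omega> b)"
    using forms_alt[OF \<omega> b] unfolding alt_map_def fmul_def by (simp add: algebra_simps)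
next
  fix Xs assume Xs: "Xs \<in> lists (sections B)"
  show "smooth_fun (bas B) (\<lambda>b. fmul f \<omega> b (map (\<lambda>X. X b) Xs))"
    unfolding fmul_def by (intro smooth_fun_mult base f forms_smooth[OF \<omega> Xs])
next
  fix b hs assume "fmul f \<omega> b hs \<noteq> 0"
  then show "b \<in> pts (bas B) \<and> set hs \<subseteq> fibre B b" using forms_zero[OF \<omega>, of b hs] by (auto simp: fmul_def)
qed

lemma forms_wedge:
  assumes \<omega>: "\<omega> \<in> forms B" and \<eta>: "\<eta> \<in> forms B"
  shows "wedge \<omega> \<eta> \<in> forms B"
proof (rule formsI)
  fix b assume b: "b \<in> pts (bas B)"
  note a = forms_alt[OF \<omega> b] forms_alt[OF \<eta> b]
  show "alt_map B b (wedge \<omega> \<eta> b)"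
    unfolding alt_map_def wedge_wedge_at
    by (intro ballI conjI allI wedge_at_add[OF a] wedge_at_scl[OF a] wedge_at_alt[OF a] vadd_in[OF b])
next
  fix Xs assume Xs: "Xs \<in> lists (sections B)"
  have "nths Xs A \<in> lists (sections B)" for A using Xs set_nths_subset[of Xs A] by auto
  then show "smooth_fun (bas B) (\<lambda>b. wedge \<omega> \<eta> b (map (\<lambda>X. X b) Xs))"
    unfolding wedge_def nths_map length_map
    by (intro smooth_fun_sum smooth_fun_mult smooth_fun_const base forms_smooth[OF \<omega>] forms_smooth[OF \<eta>])
next
  fix b hs assume nz: "wedge \<omega> \<eta> b hs \<noteq> 0"
  \<comment> \<open>Some summand is nonzero; its two complementary sublists then lie in the fibre,
    and together they exhaust \<open>hs\<close>.\<close>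
  then obtain A where "A \<in> Pow {..<length hs}"
    "(- 1) ^ card {(i, j). i \<in> A \<and> j \<in> {..<length hs} - A \<and> j < i} *
     \<omega> b (nths hs A) * \<eta> b (nths hs ({..<length hs} - A)) \<noteq> 0"
    unfolding wedge_def by (rule sum.not_neutral_contains_not_neutral)
  then have A: "\<omega> b (nths hs A) \<noteq> 0" "\<eta> b (nths hs ({..<length hs} - A)) \<noteq> 0" by simp_all
  have b: "b \<in> pts (bas B) \<and> set (nths hs A) \<subseteq> fibre B b"
    using forms_zero[OF \<omega>, of b "nths hs A"] A(1) by argo
  have b': "b \<in> pts (bas B) \<and> set (nths hs ({..<length hs} - A)) \<subseteq> fibre B b"
    using forms_zero[OF \<eta>, of b "nths hs ({..<length hs} - A)"] A(2) by argo
  have "set hs \<subseteq> set (nths hs A) \<union> set (nths hs ({..<length hs} - A))"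
    by (auto simp: set_nths in_set_conv_nth) blast
  with b b' show "b \<in> pts (bas B) \<and> set hs \<subseteq> fibre B b" by blast
qed

lemma forms_contract:
  assumes X: "X \<in> sections B" and \<omega>: "\<omega> \<in> forms B"
  shows "contract B X \<omega> \<in> forms B"
proof (rule formsI)
  fix b assume b: "b \<in> pts (bas B)"
  have "alt_map B b (\<lambda>l. \<omega> b (X b # l))" by (rule alt_map_Cons[OF forms_alt[OF \<omega> b] section_in[OF X b]])
  then show "alt_map B b (contract B X \<omega> b)" using b by (simp add: contract_def)
next
  fix Xs assume Xs: "Xs \<in> lists (sections B)"
  show "smooth_fun (bas B) (\<lambda>b. contract B X \<omega> b (map (\<lambda>X. X b) Xs))"
    by (rule smooth_map_cong[OF _ forms_smooth[OF \<omega>, of "X # Xs"]]) (use X Xs in \<open>auto simp: contract_def\<close>)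
next
  fix b hs assume "contract B X \<omega> b hs \<noteq> 0"
  then show "b \<in> pts (bas B) \<and> set hs \<subseteq> fibre B b"
    using forms_zero[OF \<omega>, of b "X b # hs"] by (auto simp: contract_def split: if_splits)
qed

lemma fun_form_in: "smooth_fun (bas B) f \<Longrightarrow> fun_form B f \<in> k_forms B 0"
proof (rule k_formsI[OF formsI])
  assume f: "smooth_fun (bas B) f"
  fix Xs :: "('b \<Rightarrow> 't) list"
  show "smooth_fun (bas B) (\<lambda>b. fun_form B f b (map (\<lambda>X. X b) Xs))"
  proof (cases "Xs = []")
    case True
    show ?thesis by (rule smooth_map_cong[OF _ f]) (simp add: fun_form_def True)
  next
    case False
    then show ?thesis using smooth_fun_const[OF base(1), of 0] by (simp add: fun_form_def)
  qed
qed (auto simp: fun_form_def alt_map_def split: if_splits)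

lemma wedge_fun_form: "\<omega> \<in> forms B \<Longrightarrow> wedge (fun_form B f) \<omega> = fmul f \<omega>"
proof (intro ext)
  fix b hs assume \<omega>: "\<omega> \<in> forms B"
  have "wedge (fun_form B f) \<omega> b hs = fun_form B f b [] * \<omega> b hs"
    unfolding wedge_wedge_at by (rule wedge_at_const) (simp add: fun_form_def)
  then show "wedge (fun_form B f) \<omega> b hs = fmul f \<omega> b hs"
    using forms_zero[OF \<omega>, of b hs] by (auto simp: fun_form_def fmul_def)
qed

lemma k_forms_contract:
  assumes X: "X \<in> sections B" and \<omega>: "\<omega> \<in> k_forms B (Suc k)"
  shows "contract B X \<omega> \<in> k_forms B k"
  by (rule k_formsI[OF forms_contract[OF X k_forms_forms[OF \<omega>]]])
    (use k_forms_length[OF \<omega>] in \<open>auto simp: contract_def\<close>)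

lemma contract_0_form: "\<omega> \<in> k_forms B 0 \<Longrightarrow> contract B X \<omega> = 0"
  by (intro ext) (simp add: contract_def k_forms_length)

text \<open>This is \<open>wedge_at_Cons\<close> with a homogeneous first factor: \<omega> is
  nonzero on lists of length k only, so the sign (-1)^length becomes the constant (-1)^k.\<close>

lemma contract_wedge:
  assumes \<omega>: "\<omega> \<in> k_forms B k"
  shows "contract B X (wedge \<omega> \<eta>) = (\<lambda>b hs. wedge (contract B X \<omega>) \<eta> b hs + (- 1) ^ k * wedge \<omega> (contract B X
      \<eta>) b hs)"
proof (intro ext)
  fix b hs
  show "contract B X (wedge \<omega> \<eta>) b hs = wedge (contract B X \<omega>) \<eta> b hs + (- 1) ^ k * wedge \<omega> (contract B X \<eta>) b
      hs"
  proof (cases "b \<in> pts (bas B)")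
    case True
    have "(\<lambda>l. (- 1) ^ length l * \<omega> b l) = (\<lambda>l. (- 1) ^ k * \<omega> b l)"
    proof (rule ext)
      show "(- 1) ^ length l * \<omega> b l = (- 1) ^ k * \<omega> b l" for l
        using k_forms_length[OF \<omega>, of l b] by (cases "length l = k") simp_all
    qed
    then show ?thesis using True by (simp add: contract_def wedge_wedge_at wedge_at_Cons wedge_at_scale_left)
  next
    case False
    then have "\<omega> b = (\<lambda>l. 0)" using forms_zero[OF k_forms_forms[OF \<omega>]] by blast
    then show ?thesis using False by (simp add: contract_def wedge_wedge_at wedge_at_zero_left)
  qed
qed

end

section \<open>Graded derivations\<close>

text \<open>Derivations of degree \<open>s\<close>, which may be negative, and of parity \<open>p\<close>.\<close>

definition graded_derivation ::
  "('b, 'v::euclidean_space, 't, 'w::euclidean_space) vbundle \<Rightarrow> int \<Rightarrow> nat \<Rightarrow> (('b, 't) form \<Rightarrow> ('b,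
      't) form) \<Rightarrow> bool" where
  "graded_derivation B s p D \<longleftrightarrow> (even s \<longleftrightarrow> even p) \<and>
     (\<forall>\<omega>\<in>forms B. D \<omega> \<in> forms B) \<and>
     (\<forall>k. \<forall>\<omega>\<in>k_forms B k. if int k + s \<ge> 0 then D \<omega> \<in> k_forms B (nat (int k + s)) else D \<omega> = 0) \<and>
     (\<forall>\<omega>\<in>forms B. \<forall>\<eta>\<in>forms B. D (\<omega> + \<eta>) = D \<omega> + D \<eta>) \<and>
     (\<forall>k. \<forall>\<omega>\<in>k_forms B k. \<forall>\<eta>\<in>forms B. D (wedge \<omega> \<eta>) = wedge (D \<omega>) \<eta> + (\<lambda>b hs. (- 1) ^ (p * k) * wedge \<omega> (D \<eta>)
         b hs))"

lemma wedge_zero_left: "wedge 0 \<eta> = 0"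
  by (intro ext) (simp add: wedge_wedge_at wedge_at_zero_left zero_fun_def)

lemma gcomm_even: "even (d * e) \<Longrightarrow> gcomm d e D D' \<omega> = D (D' \<omega>) - D' (D \<omega>)"
  by (intro ext) (simp add: gcomm_def)

lemma gcomm_odd: "odd (d * e) \<Longrightarrow> gcomm d e D D' \<omega> = D (D' \<omega>) + D' (D \<omega>)"
  by (intro ext) (simp add: gcomm_def)

lemma sum_fun2_apply: "(sum f I) b hs = (\<Sum>i\<in>I. f i b hs)"
  by (induction I rule: infinite_finite_induct) auto

context framed_bundle
begin

lemma k_forms_add: "\<omega> \<in> k_forms B k \<Longrightarrow> \<eta> \<in> k_forms B k \<Longrightarrow> \<omega> + \<eta> \<in> k_forms B k"
  by (intro k_formsI forms_add) (auto intro: k_forms_forms simp: k_forms_length)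

lemma k_forms_diff: "\<omega> \<in> k_forms B k \<Longrightarrow> \<eta> \<in> k_forms B k \<Longrightarrow> \<omega> - \<eta> \<in> k_forms B k"
  by (intro k_formsI forms_diff) (auto intro: k_forms_forms simp: k_forms_length)

lemma graded_derivationD:
  assumes "graded_derivation B s p D"
  shows "even s \<longleftrightarrow> even p" "\<omega> \<in> forms B \<Longrightarrow> D \<omega> \<in> forms B"
    "\<omega> \<in> k_forms B k \<Longrightarrow> int k + s \<ge> 0 \<Longrightarrow> D \<omega> \<in> k_forms B (nat (int k + s))"
    "\<omega> \<in> k_forms B k \<Longrightarrow> int k + s < 0 \<Longrightarrow> D \<omega> = 0"
    "\<omega> \<in> forms B \<Longrightarrow> \<eta> \<in> forms B \<Longrightarrow> D (\<omega> + \<eta>) = D \<omega> + D \<eta>"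
    "\<omega> \<in> k_forms B k \<Longrightarrow> \<eta> \<in> forms B \<Longrightarrow>
        D (wedge \<omega> \<eta>) = wedge (D \<omega>) \<eta> + (\<lambda>b hs. (- 1) ^ (p * k) * wedge \<omega> (D \<eta>) b hs)"
proof -
  note a = assms[unfolded graded_derivation_def]
  from a show "even s \<longleftrightarrow> even p" by blast
  from a show "\<omega> \<in> forms B \<Longrightarrow> D \<omega> \<in> forms B" by blast
  from a have k: "\<forall>k. \<forall>\<omega>\<in>k_forms B k. if int k + s \<ge> 0 then D \<omega> \<in> k_forms B (nat (int k + s)) else D \<omega> = 0"
      by blast
  then show "\<omega> \<in> k_forms B k \<Longrightarrow> int k + s \<ge> 0 \<Longrightarrow> D \<omega> \<in> k_forms B (nat (int k + s))"
    "\<omega> \<in> k_forms B k \<Longrightarrow> int k + s < 0 \<Longrightarrow> D \<omega> = 0" by (metis, metis not_less)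
  from a show "\<omega> \<in> forms B \<Longrightarrow> \<eta> \<in> forms B \<Longrightarrow> D (\<omega> + \<eta>) = D \<omega> + D \<eta>" by blast
  from a show "\<omega> \<in> k_forms B k \<Longrightarrow> \<eta> \<in> forms B \<Longrightarrow>
      D (wedge \<omega> \<eta>) = wedge (D \<omega>) \<eta> + (\<lambda>b hs. (- 1) ^ (p * k) * wedge \<omega> (D \<eta>) b hs)"
    by blast
qed

lemma derivation_zero: "graded_derivation B s p D \<Longrightarrow> D 0 = 0"
  using graded_derivationD(5)[of s p D 0 0] forms_zero_in by (simp add: add_cancel_right_left)

lemma derivation_uminus:
  assumes "graded_derivation B s p D" "\<omega> \<in> forms B"
  shows "D (- \<omega>) = - D \<omega>"
  using graded_derivationD(5)[OF assms forms_uminus[OF assms(2)]] derivation_zero[OF assms(1)]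
  by (metis add.right_inverse minus_unique)

lemma derivation_diff:
  assumes "graded_derivation B s p D" "\<omega> \<in> forms B" "\<eta> \<in> forms B"
  shows "D (\<omega> - \<eta>) = D \<omega> - D \<eta>"
  using graded_derivationD(5)[OF assms(1,2) forms_uminus[OF assms(3)]] derivation_uminus[OF assms(1,3)]
  by simp

lemma derivation_sum:
  assumes "graded_derivation B s p D" "\<And>i. i \<in> I \<Longrightarrow> \<omega> i \<in> forms B"
  shows "D (sum \<omega> I) = (\<Sum>i\<in>I. D (\<omega> i))"
  using assms(2)
  by (induction I rule: infinite_finite_induct)
    (simp_all add: derivation_zero[OF assms(1)] graded_derivationD(5)[OF assms(1)] forms_sum)

lemma vector_field_graded:
  assumes "vector_field B d D"
  shows "graded_derivation B (int d) d D"
proof -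
  note a = assms[unfolded derivation_along_def]
  have f: "\<And>\<omega>. \<omega> \<in> forms B \<Longrightarrow> D \<omega> \<in> forms B" using a by blast
  have k: "\<And>\<omega> k. \<omega> \<in> k_forms B k \<Longrightarrow> D \<omega> \<in> k_forms B (k + d)" using a by blast
  have l: "D (\<lambda>b hs. a * \<omega> b hs + \<eta> b hs) = (\<lambda>b hs. a * D \<omega> b hs + D \<eta> b hs)"
    if "\<omega> \<in> forms B" "\<eta> \<in> forms B" for \<omega> \<eta> a using a that by blast
  have w: "D (wedge \<omega> \<eta>) = (\<lambda>b hs. wedge (D \<omega>) \<eta> b hs + (- 1) ^ (d * k) * wedge \<omega> (D \<eta>) b hs)"
    if "\<omega> \<in> k_forms B k" "\<eta> \<in> forms B" for \<omega> \<eta> k using a that by blast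
  have "D (\<omega> + \<eta>) = D \<omega> + D \<eta>" if "\<omega> \<in> forms B" "\<eta> \<in> forms B" for \<omega> \<eta>
    using l[OF that, of 1] by (simp add: plus_fun_def)
  moreover have "nat (int n + int d) = n + d" for n by simp
  ultimately show ?thesis
    unfolding graded_derivation_def using f k w by (simp add: plus_fun_def del: nat_add_distrib nat_int_add)
qed

lemma contract_add: "contract B X (\<omega> + \<eta>) = contract B X \<omega> + contract B X \<eta>"
  by (intro ext) (simp add: contract_def)

lemma contract_graded:
  assumes X: "X \<in> sections B"
  shows "graded_derivation B (- 1) 1 (contract B X)"
  unfolding graded_derivation_def
proof (intro conjI allI ballI)
  fix k \<omega> assume \<omega>: "\<omega> \<in> k_forms B k"
  show "if int k + - 1 \<ge> 0 then contract B X \<omega> \<in> k_forms B (nat (int k + - 1)) else contract B X \<omega> = 0"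
  proof (cases k)
    case 0
    then show ?thesis using contract_0_form \<omega> by simp
  next
    case (Suc n)
    then show ?thesis using k_forms_contract[OF X, of \<omega> n] \<omega> by simp
  qed
  show "contract B X (wedge \<omega> \<eta>) = wedge (contract B X \<omega>) \<eta> + (\<lambda>b hs. (- 1) ^ (1 * k) * wedge \<omega> (contract B X
      \<eta>) b hs)" for \<eta>
    using contract_wedge[OF \<omega>] by (simp add: plus_fun_def)
qed (auto intro: forms_contract X contract_add)

text \<open>Preparation for the graded commutator: there the two middle terms cancel against those
  of the composition in the opposite order, and a Leibniz rule remains.\<close>

lemma graded_derivation_compose_leibniz:
  assumes D: "graded_derivation B s p D" and D': "graded_derivation B s' p' D'"
    and \<omega>: "\<omega> \<in> k_forms B k" and \<eta>: "\<eta> \<in> forms B"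
  shows "D (D' (wedge \<omega> \<eta>)) = wedge (D (D' \<omega>)) \<eta>
    + (\<lambda>b hs. (- 1) ^ (p * (k + p')) * wedge (D' \<omega>) (D \<eta>) b hs)
    + (\<lambda>b hs. (- 1) ^ (p' * k) * wedge (D \<omega>) (D' \<eta>) b hs)
    + (\<lambda>b hs. (- 1) ^ (p' * k + p * k) * wedge \<omega> (D (D' \<eta>)) b hs)"
proof -
  note d = graded_derivationD[OF D] and d' = graded_derivationD[OF D']
  have wf: "\<omega> \<in> forms B" by (rule k_forms_forms[OF \<omega>])
  have sgn: "(\<lambda>b hs. (- 1) ^ n * \<alpha> b hs) = (if even n then \<alpha> else - \<alpha>)" for n and \<alpha> :: "('b, 't) form"
    by (auto simp: fun_Compl_def)
  have fs: "(if even n then \<alpha> else - \<alpha>) \<in> forms B" if "\<alpha> \<in> forms B" for n :: nat and \<alpha>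
    using that forms_uminus by auto
  have Ds: "D (if even n then \<alpha> else - \<alpha>) = (if even n then D \<alpha> else - D \<alpha>)" if "\<alpha> \<in> forms B" for n :: nat
      and \<alpha>
    using that derivation_uminus[OF D] by auto
  have 1: "D (wedge (D' \<omega>) \<eta>) = wedge (D (D' \<omega>)) \<eta> + (\<lambda>b hs. (- 1) ^ (p * (k + p')) * wedge (D' \<omega>) (D \<eta>) b
      hs)"
  proof (cases "int k + s' < 0")
    case True
    show ?thesis
      unfolding d'(4)[OF \<omega> True] wedge_zero_left derivation_zero[OF D] by (intro ext) simp
  next
    case False
    then have ge: "int k + s' \<ge> 0" by simp
    \<comment> \<open>The sign depends on the degree of \<open>D' \<omega>\<close> modulo 2 only,
      and s' and p' have the same parity.\<close>
    have "even (nat (int k + s')) \<longleftrightarrow> even (k + p')" using ge d'(1) by (simp add: even_nat_iff)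
    then have "even (p * nat (int k + s')) \<longleftrightarrow> even (p * (k + p'))" by simp
    then show ?thesis using d(6)[OF d'(3)[OF \<omega> ge] \<eta>] by (simp add: sgn)
  qed
  have 2: "D (wedge \<omega> (D' \<eta>)) = wedge (D \<omega>) (D' \<eta>) + (\<lambda>b hs. (- 1) ^ (p * k) * wedge \<omega> (D (D' \<eta>)) b hs)"
    by (rule d(6)[OF \<omega> d'(2)[OF \<eta>]])
  have "D (D' (wedge \<omega> \<eta>)) = D (wedge (D' \<omega>) \<eta>) + D (\<lambda>b hs. (- 1) ^ (p' * k) * wedge \<omega> (D' \<eta>) b hs)"
    unfolding d'(6)[OF \<omega> \<eta>] sgn by (intro d(5) fs forms_wedge d'(2) wf \<eta>)
  also have "D (\<lambda>b hs. (- 1) ^ (p' * k) * wedge \<omega> (D' \<eta>) b hs) =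
      (\<lambda>b hs. (- 1) ^ (p' * k) * D (wedge \<omega> (D' \<eta>)) b hs)"
    unfolding sgn by (intro Ds forms_wedge d'(2) wf \<eta>)
  finally show ?thesis unfolding 1 2
    by (intro ext) (simp add: algebra_simps power_add)
qed

lemma gcomm_graded:
  assumes D: "graded_derivation B s p D" and D': "graded_derivation B s' p' D'"
  shows "graded_derivation B (s + s') (p + p') (gcomm p p' D D')"
proof -
  note d = graded_derivationD[OF D] and d' = graded_derivationD[OF D']
  have g: "gcomm p p' D D' \<omega> = (if even (p * p') then D (D' \<omega>) - D' (D \<omega>) else D (D' \<omega>) + D' (D \<omega>))" for \<omega>
    by (cases "even (p * p')") (simp_all add: gcomm_even gcomm_odd)
  show ?thesis
    unfolding graded_derivation_def
  proof (intro conjI allI ballI)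
    show "even (s + s') \<longleftrightarrow> even (p + p')" using d(1) d'(1) by simp
    show "gcomm p p' D D' \<omega> \<in> forms B" if "\<omega> \<in> forms B" for \<omega>
      unfolding g using that d(2) d'(2) by (auto intro: forms_diff forms_add)
    show "gcomm p p' D D' (\<omega> + \<eta>) = gcomm p p' D D' \<omega> + gcomm p p' D D' \<eta>" if "\<omega> \<in> forms B" "\<eta> \<in> forms B"
        for \<omega> \<eta>
      unfolding g using that d(2,5) d'(2,5) by simp
  next
    fix k \<omega> assume \<omega>: "\<omega> \<in> k_forms B k"
    have one: "if int k + (u + u') \<ge> 0 then E (E' \<omega>) \<in> k_forms B (nat (int k + (u + u'))) else E (E' \<omega>) = 0"
      if E: "graded_derivation B u m E" "graded_derivation B u' m' E'" for E E' u u' m m'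
    proof (cases "int k + u' \<ge> 0")
      case True
      note 1 = graded_derivationD(3)[OF E(2) \<omega> True]
      show ?thesis using graded_derivationD(3,4)[OF E(1) 1] True by (auto simp: add.assoc add.commute[of u])
    next
      case False
      then have "E (E' \<omega>) = 0" using graded_derivationD(4)[OF E(2) \<omega>] derivation_zero[OF E(1)] by simp
      then show ?thesis using forms_zero_in by (auto intro: k_formsI)
    qed
    show "if int k + (s + s') \<ge> 0 then gcomm p p' D D' \<omega> \<in> k_forms B (nat (int k + (s + s'))) else gcomm p p'
        D D' \<omega> = 0"
      using one[OF D D'] one[OF D' D] unfolding g
      by (auto simp: add.commute[of s'] intro: k_forms_diff k_forms_add)
    fix \<eta> assume \<eta>: "\<eta> \<in> forms B"
    have G: "gcomm p p' D D' \<alpha> b hs = D (D' \<alpha>) b hs - (- 1) ^ (p * p') * D' (D \<alpha>) b hs" for \<alpha> b hs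
      by (simp add: gcomm_def)
    have W: "wedge (gcomm p p' D D' \<omega>) \<eta> b hs =
        wedge (D (D' \<omega>)) \<eta> b hs - (- 1) ^ (p * p') * wedge (D' (D \<omega>)) \<eta> b hs"
      "wedge \<omega> (gcomm p p' D D' \<eta>) b hs =
          wedge \<omega> (D (D' \<eta>)) b hs - (- 1) ^ (p * p') * wedge \<omega> (D' (D \<eta>)) b hs" for b hs
      unfolding wedge_wedge_at gcomm_def
      using wedge_at_add_left[of "D (D' \<omega>) b" "\<lambda>l. (- ((- 1) ^ (p * p'))) * D' (D \<omega>) b l" "\<eta> b" hs]
        wedge_at_add_right[of "\<omega> b" "D (D' \<eta>) b" "\<lambda>l. (- ((- 1) ^ (p * p'))) * D' (D \<eta>) b l" hs]
      by (simp_all add: wedge_at_scale_left[of "- ((- 1) ^ (p * p'))"] wedge_at_scale_right[of _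
          "- ((- 1) ^ (p * p'))"]
          wedge_at_scale_left wedge_at_scale_right wedge_at_minus_left wedge_at_minus_right)
    have sg: "(- 1 :: real) ^ (p * p') * (- 1) ^ (p * p') = 1"
      by (metis power_add power_minus1_even mult_2)
    show "gcomm p p' D D' (wedge \<omega> \<eta>) = wedge (gcomm p p' D D' \<omega>) \<eta> +
      (\<lambda>b hs. (- 1) ^ ((p + p') * k) * wedge \<omega> (gcomm p p' D D' \<eta>) b hs)"
    proof (intro ext)
      fix b hs
      show "gcomm p p' D D' (wedge \<omega> \<eta>) b hs = (wedge (gcomm p p' D D' \<omega>) \<eta> +
        (\<lambda>b hs. (- 1) ^ ((p + p') * k) * wedge \<omega> (gcomm p p' D D' \<eta>) b hs)) b hs"
        using sg
        by (simp only: W G graded_derivation_compose_leibniz[OF D D' \<omega> \<eta>]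
            graded_derivation_compose_leibniz[OF D' D \<omega> \<eta>] plus_fun_apply)
          (simp add: power_add algebra_simps)
    qed
  qed
qed

subsection \<open>Derivations of degree -1 are contractions\<close>

lemma frame_obtain:
  assumes b0: "b\<^sub>0 \<in> pts (bas B)"
  obtains e \<theta> \<rho> where
    "\<And>i. i < r \<Longrightarrow> e i \<in> sections B" "\<And>i. i < r \<Longrightarrow> \<theta> i \<in> k_forms B 1"
    "smooth_fun (bas B) \<rho>" "\<rho> b\<^sub>0 = (1::real)"
    "\<And>b h \<xi>. b \<in> pts (bas B) \<Longrightarrow> h \<in> fibre B b \<Longrightarrow> fibre_functional B b \<xi> \<Longrightarrow>
        \<rho> b * \<xi> h = (\<Sum>i<r. \<theta> i b [h] * \<xi> (e i b))"
    "\<And>c. \<exists>z\<in>fibre B b\<^sub>0. \<forall>i<r. \<theta> i b\<^sub>0 [z] = c i"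
    "\<And>h. h \<in> fibre B b\<^sub>0 \<Longrightarrow> \<forall>i<r. \<theta> i b\<^sub>0 [h] = 0 \<Longrightarrow> h = vzer B b\<^sub>0"
    "\<exists>P. openin (mtop (bas B)) P \<and> b\<^sub>0 \<in> P \<and> (\<forall>b\<in>P. \<rho> b = 1)"
  using frame[OF b0]
  apply (elim exE conjE)
  subgoal for e \<theta> \<rho> P
    by (rule that[of e \<theta> \<rho>]; simp?; blast)
  done

lemma one_form_vadd:
  assumes "\<alpha> \<in> forms B" "b \<in> pts (bas B)" "h \<in> fibre B b"
  shows "k \<in> fibre B b \<Longrightarrow> \<alpha> b [vadd B h k] = \<alpha> b [h] + \<alpha> b [k]" "\<alpha> b [vscl B a h] = a * \<alpha> b [h]"
  using forms_functional[OF assms(1,2), of "[]" "[]"] assms(3) by (auto simp: fibre_functional_def)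

lemma vadd_neg:
  assumes "b \<in> pts (bas B)" "h \<in> fibre B b"
  shows "vadd B h (vscl B (- 1) h) = vzer B b"
  using vscl_add_left[OF assms, of 1 "- 1"] vscl_one[OF assms] vscl_zero[OF assms] by simp

lemma vadd_zero_right: "b \<in> pts (bas B) \<Longrightarrow> h \<in> fibre B b \<Longrightarrow> vadd B h (vzer B b) = h"
  using vadd_comm vadd_zero vzer_in by metis

lemma vadd_diff_eq:
  assumes b: "b \<in> pts (bas B)" and h: "h \<in> fibre B b" "k \<in> fibre B b"
    and 0: "vadd B h (vscl B (- 1) k) = vzer B b"
  shows "h = k"
proof -
  have n: "vscl B (- 1) k \<in> fibre B b" by (rule vscl_in[OF b h(2)])
  have "h = vadd B h (vadd B k (vscl B (- 1) k))" using vadd_neg[OF b h(2)] vadd_zero_right[OF b h(1)] by simp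
  also have "\<dots> = vadd B (vadd B h (vscl B (- 1) k)) k"
    using vadd_comm[OF b h(2) n] vadd_assoc[OF b h(1) n h(2)] by simp
  also have "\<dots> = k" using 0 vadd_zero[OF b h(2)] by simp
  finally show ?thesis .
qed

text \<open>The coframe forms vanish on h - k, and at the base point of the frame only the zero
  vector has this property.\<close>

lemma point_eqI:
  assumes b: "b \<in> pts (bas B)" and h: "h \<in> fibre B b" "k \<in> fibre B b"
    and eq: "\<And>\<alpha>. \<alpha> \<in> k_forms B 1 \<Longrightarrow> \<alpha> b [h] = \<alpha> b [k]"
  shows "h = k"
proof (rule vadd_diff_eq[OF b h])
  obtain e \<theta> \<rho> where \<theta>: "\<And>i. i < r \<Longrightarrow> \<theta> i \<in> k_forms B 1"
    and sep: "\<And>h. h \<in> fibre B b \<Longrightarrow> \<forall>i<r. \<theta> i b [h] = 0 \<Longrightarrow> h = vzer B b"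
    by (rule frame_obtain[OF b]) (rule that; assumption)
  have n: "vscl B (- 1) k \<in> fibre B b" by (rule vscl_in[OF b h(2)])
  show "vadd B h (vscl B (- 1) k) = vzer B b"
  proof (rule sep[OF vadd_in[OF b h(1) n]], intro allI impI)
    fix i assume "i < r"
    note t = \<theta>[OF this]
    show "\<theta> i b [vadd B h (vscl B (- 1) k)] = 0"
      using one_form_vadd(1)[OF k_forms_forms[OF t] b h(1) n] one_form_vadd(2)[OF k_forms_forms[OF t] b h(2)]
          eq[OF t] by simp
  qed
qed

lemma section_eqI:
  assumes X: "X \<in> sections B" "Y \<in> sections B"
    and eq: "\<And>\<alpha>. \<alpha> \<in> k_forms B 1 \<Longrightarrow> contract B X \<alpha> = contract B Y \<alpha>"
  shows "X = Y"
proof (rule extensionalityI)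
  show "X \<in> extensional (pts (bas B))" "Y \<in> extensional (pts (bas B))" using X by (auto simp: sections_def)
  fix b assume b: "b \<in> pts (bas B)"
  show "X b = Y b"
  proof (rule point_eqI[OF b section_in[OF X(1) b] section_in[OF X(2) b]])
    show "\<alpha> b [X b] = \<alpha> b [Y b]" if "\<alpha> \<in> k_forms B 1" for \<alpha>
      using fun_cong[OF fun_cong[OF eq[OF that], of b], of "[]"] b by (simp add: contract_def)
  qed
qed

lemma alt_map_functional:
  assumes "alt_map B b f" "xs \<in> lists (fibre B b)" "ys \<in> lists (fibre B b)"
  shows "fibre_functional B b (\<lambda>h. f (xs @ h # ys))"
  using alt_mapD(1,2)[OF assms] by (simp add: fibre_functional_def)

text \<open>The arguments are expanded one after another in the at most r frame vectors at b. By the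
  pigeonhole principle a list of more than r frame vectors contains a repetition.\<close>

lemma alt_map_vanish:
  assumes b: "b \<in> pts (bas B)" and f: "alt_map B b f" and hs: "hs \<in> lists (fibre B b)" "length hs > r"
  shows "f hs = 0"
proof -
  obtain e \<theta> \<rho> where e: "\<And>i. i < r \<Longrightarrow> e i \<in> sections B" and \<rho>: "\<rho> b = (1::real)"
    and exp: "\<And>b h \<xi>. b \<in> pts (bas B) \<Longrightarrow> h \<in> fibre B b \<Longrightarrow> fibre_functional B b \<xi> \<Longrightarrow>
        \<rho> b * \<xi> h = (\<Sum>i<r. \<theta> i b [h] * \<xi> (e i b))"
    by (rule frame_obtain[OF b]) (rule that; assumption)
  define E where "E = (\<lambda>i. e i b) ` {..<r}"
  have E: "E \<subseteq> fibre B b" "finite E" "card E \<le> r"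
    using section_in[OF e b] card_image_le[of "{..<r}" "\<lambda>i. e i b"] by (auto simp: E_def)
  have "f (ys @ xs) = 0" if "ys \<in> lists E" "xs \<in> lists (fibre B b)" "length (ys @ xs) > r" for xs ys
    using that
  proof (induction xs arbitrary: ys)
    case Nil
    have "card (set ys) \<le> card E" using Nil.prems(1) E(2) by (intro card_mono) auto
    then have "card (set ys) < length ys" using Nil.prems(3) E(3) by simp
    then have "\<not> distinct ys" by (metis distinct_card less_irrefl)
    then obtain as y bs cs where ys: "ys = as @ [y] @ bs @ [y] @ cs" using not_distinct_decomp by blast
    have "f (as @ y # bs @ y # cs) = 0"
      by (rule alt_map_repeat[OF f vadd_in[OF b]]) (use Nil.prems(1) E(1) ys in auto)
    then show ?case by (simp add: ys)
  next
    case (Cons x xs)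
    have x: "x \<in> fibre B b" "xs \<in> lists (fibre B b)" and ys: "ys \<in> lists (fibre B b)" using Cons.prems E(1)
        by auto
    have "f (ys @ x # xs) = (\<Sum>i<r. \<theta> i b [x] * f (ys @ e i b # xs))"
      using exp[OF b x(1) alt_map_functional[OF f ys x(2)]] \<rho> by simp
    also have "\<dots> = 0"
    proof (rule sum.neutral, intro ballI)
      fix i assume "i \<in> {..<r}"
      then have "f ((ys @ [e i b]) @ xs) = 0" using Cons.prems x by (intro Cons.IH) (auto simp: E_def)
      then show "\<theta> i b [x] * f (ys @ e i b # xs) = 0" by simp
    qed
    finally show ?case .
  qed
  from this[of "[]" hs] hs show ?thesis by simp
qed

definition component :: "nat \<Rightarrow> ('b, 't) form \<Rightarrow> ('b, 't) form" where
  "component k \<omega> = (\<lambda>b hs. if length hs = k then \<omega> b hs else 0)"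

lemma component_in:
  assumes \<omega>: "\<omega> \<in> forms B"
  shows "component k \<omega> \<in> k_forms B k"
proof (rule k_formsI[OF formsI])
  fix b assume b: "b \<in> pts (bas B)"
  show "alt_map B b (component k \<omega> b)"
    using forms_alt[OF \<omega> b] unfolding alt_map_def component_def by simp
next
  fix Xs assume Xs: "Xs \<in> lists (sections B)"
  show "smooth_fun (bas B) (\<lambda>b. component k \<omega> b (map (\<lambda>X. X b) Xs))"
    using forms_smooth[OF \<omega> Xs] smooth_fun_const[OF base(1)]
        by (cases "length Xs = k") (auto simp: component_def)
next
  fix b hs assume "component k \<omega> b hs \<noteq> 0"
  then show "b \<in> pts (bas B) \<and> set hs \<subseteq> fibre B b"
    using forms_zero[OF \<omega>, of b hs] by (auto simp: component_def split: if_splits)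
qed (simp add: component_def)

text \<open>Alternating maps vanish above the rank, so an inhomogeneous form is a finite sum of
  homogeneous ones. Derivations are additive on finite sums, and their Leibniz rule concerns a
  homogeneous first factor.\<close>

lemma forms_components:
  assumes \<omega>: "\<omega> \<in> forms B"
  shows "\<omega> = (\<Sum>k\<le>r. component k \<omega>)"
proof (intro ext)
  fix b hs
  have "(\<Sum>k\<le>r. component k \<omega> b hs) = (if length hs \<le> r then \<omega> b hs else 0)"
    by (simp add: component_def)
  also have "\<dots> = \<omega> b hs"
    using alt_map_vanish[OF _ forms_alt[OF \<omega>], of b hs] forms_zero[OF \<omega>, of b hs]
    by (cases "b \<in> pts (bas B) \<and> set hs \<subseteq> fibre B b") (simp_all add: in_lists_conv_set subset_iff)
  finally show "\<omega> b hs = (\<Sum>k\<le>r. component k \<omega>) b hs" by (simp add: sum_fun2_apply)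
qed

text \<open>Contracting with \<open>e i\<close> and multiplying by \<open>\<theta> i\<close> counts
  every argument once, so the sum multiplies a k-form by k; for a cut-off frame the factor is k
  \<rho>. The identity expresses forms of positive degree by one-forms and forms of lower
  degree.\<close>

lemma euler_identity:
  assumes \<theta>: "\<And>i. i < r \<Longrightarrow> \<theta> i \<in> k_forms B 1" and e: "\<And>i. i < r \<Longrightarrow> e i \<in> sections B"
    and exp: "\<And>b h \<xi>. b \<in> pts (bas B) \<Longrightarrow> h \<in> fibre B b \<Longrightarrow> fibre_functional B b \<xi> \<Longrightarrow>
        \<rho> b * \<xi> h = (\<Sum>i<r. \<theta> i b [h] * \<xi> (e i b))"
    and \<omega>: "\<omega> \<in> k_forms B k"
  shows "fmul (\<lambda>b. real k * \<rho> b) \<omega> = (\<Sum>i<r. wedge (\<theta> i) (contract B (e i) \<omega>))"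
proof (intro ext)
  fix b hs
  note \<omega>' = k_forms_forms[OF \<omega>]
  have AT: "(\<Sum>i<r. wedge_at (\<theta> i b) (\<lambda>l. f (e i b # l)) hs) = real (length hs) * \<rho> b * f hs"
    if b: "b \<in> pts (bas B)" and f: "alt_map B b f" and hs: "hs \<in> lists (fibre B b)" for f hs
    using f hs
  proof (induction hs arbitrary: f)
    case Nil
    then show ?case using k_forms_length[OF \<theta>] by simp
  next
    case (Cons x hs)
    have x: "x \<in> fibre B b" "hs \<in> lists (fibre B b)" using Cons.prems by auto
    \<comment> \<open>Exchanging \<open>e i b\<close> with x costs a sign. It cancels the sign of
      \<open>wedge_at_one_form\<close> and leaves the sum belonging to f contracted with x.\<close>
    have "wedge_at (\<theta> i b) (\<lambda>l. f (e i b # x # l)) hs = wedge_at (\<theta> i b) (\<lambda>l. - f (x # e i b # l)) hs"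
        if "i < r" for i
    proof (rule wedge_at_cong[OF refl])
      fix l assume "set l \<subseteq> set hs"
      then have "l \<in> lists (fibre B b)" using x by auto
      then show "f (e i b # x # l) = - f (x # e i b # l)"
        using alt_map_skew[OF Cons.prems(1) vadd_in[OF b], of "[]" l "e i b" x] section_in[OF e[OF that] b] x
            by simp
    qed
    then have "(\<Sum>i<r. wedge_at (\<theta> i b) (\<lambda>l. f (e i b # l)) (x # hs))
      = (\<Sum>i<r. \<theta> i b [x] * f (e i b # hs)) + (\<Sum>i<r. wedge_at (\<theta> i b) (\<lambda>l. f (x # e i b # l)) hs)"
      using k_forms_length[OF \<theta>] by (simp add: wedge_at_one_form wedge_at_minus_right sum.distrib)
    also have "(\<Sum>i<r. \<theta> i b [x] * f (e i b # hs)) = \<rho> b * f (x # hs)"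
      using exp[OF b x(1) alt_map_functional[OF Cons.prems(1), of "[]" hs]] x by simp
    also have "(\<Sum>i<r. wedge_at (\<theta> i b) (\<lambda>l. f (x # e i b # l)) hs) = real (length hs) * \<rho> b * f (x # hs)"
      by (rule Cons.IH[OF alt_map_Cons[OF Cons.prems(1) x(1)] x(2)])
    finally show ?case by (simp add: algebra_simps)
  qed
  show "fmul (\<lambda>b. real k * \<rho> b) \<omega> b hs = (\<Sum>i<r. wedge (\<theta> i) (contract B (e i) \<omega>)) b hs"
  proof (cases "b \<in> pts (bas B) \<and> set hs \<subseteq> fibre B b")
    case True
    then have "(\<Sum>i<r. wedge (\<theta> i) (contract B (e i) \<omega>)) b hs = real (length hs) * \<rho> b * \<omega> b hs"
      using AT[OF _ forms_alt[OF \<omega>'], of hs] by (auto simp: sum_fun2_apply wedge_wedge_at contract_def)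
    then show ?thesis using k_forms_length[OF \<omega>, of hs b] by (cases "length hs = k") (auto simp: fmul_def)
  next
    case False
    have "wedge (\<theta> i) (contract B (e i) \<omega>) b hs = 0" if "i < r" for i
      using forms_zero[OF forms_wedge[OF k_forms_forms[OF \<theta>[OF that]] forms_contract[OF e[OF that] \<omega>']]] False
          by blast
    then show ?thesis using forms_zero[OF \<omega>' False] by (simp add: sum_fun2_apply fmul_def)
  qed
qed

text \<open>The image of a function would have degree -1, so D annihilates functions and the Leibniz
  rule reduces to linearity over functions.\<close>

lemma derivation_fmul:
  assumes D: "graded_derivation B (- 1) p D" and f: "smooth_fun (bas B) f" and \<omega>: "\<omega> \<in> forms B"
  shows "D (fmul f \<omega>) = fmul f (D \<omega>)"
  using graded_derivationD(6)[OF D fun_form_in[OF f] \<omega>] graded_derivationD(4)[OF D fun_form_in[OF f]]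
    wedge_fun_form[OF \<omega>] wedge_fun_form[OF graded_derivationD(2)[OF D \<omega>]]
  by (simp add: wedge_zero_left)

text \<open>Induction on the degree. By the Euler identity, (k + 1) \<rho> \<omega> is a sum of
  products of one-forms with k-forms, and \<rho> = 1 at the point considered. Inhomogeneous forms
  follow by adding components.\<close>

lemma derivation_eqI:
  assumes D: "graded_derivation B (- 1) p D" and D': "graded_derivation B (- 1) p' D'"
    and eq: "\<And>\<alpha>. \<alpha> \<in> k_forms B 1 \<Longrightarrow> D \<alpha> = D' \<alpha>" and \<omega>: "\<omega> \<in> forms B"
  shows "D \<omega> = D' \<omega>"
proof -
  have sgn: "odd p" "odd p'" using graded_derivationD(1)[OF D] graded_derivationD(1)[OF D'] by auto
  have k: "D \<omega> = D' \<omega>" if "\<omega> \<in> k_forms B k" for k \<omega>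
    using that
  proof (induction k arbitrary: \<omega>)
    case 0
    then show ?case using graded_derivationD(4)[OF D] graded_derivationD(4)[OF D'] by force
  next
    case (Suc k)
    note \<omega>' = k_forms_forms[OF Suc.prems]
    show ?case
    proof (intro ext)
      fix b hs
      show "D \<omega> b hs = D' \<omega> b hs"
      proof (cases "b \<in> pts (bas B)")
        case True
        obtain e \<theta> \<rho> where e: "\<And>i. i < r \<Longrightarrow> e i \<in> sections B" and \<theta>: "\<And>i. i < r \<Longrightarrow> \<theta> i \<in> k_forms B 1"
          and \<rho>: "smooth_fun (bas B) \<rho>" "\<rho> b = (1::real)"
          and exp: "\<And>b h \<xi>. b \<in> pts (bas B) \<Longrightarrow> h \<in> fibre B b \<Longrightarrow> fibre_functional B b \<xi> \<Longrightarrow>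
              \<rho> b * \<xi> h = (\<Sum>i<r. \<theta> i b [h] * \<xi> (e i b))"
          by (rule frame_obtain[OF True]) (rule that; assumption)
        have F: "wedge (\<theta> i) (contract B (e i) \<omega>) \<in> forms B" if "i < r" for i
          using that by (intro forms_wedge k_forms_forms[OF \<theta>] forms_contract e \<omega>')
        have "D (wedge (\<theta> i) (contract B (e i) \<omega>)) = D' (wedge (\<theta> i) (contract B (e i) \<omega>))" if "i < r" for i
          using graded_derivationD(6)[OF D \<theta>[OF that] forms_contract[OF e[OF that] \<omega>']]
            graded_derivationD(6)[OF D' \<theta>[OF that] forms_contract[OF e[OF that] \<omega>']]
            eq[OF \<theta>[OF that]] Suc.IH[OF k_forms_contract[OF e[OF that] Suc.prems]] sgn by simp
        then have "D (\<Sum>i<r. wedge (\<theta> i) (contract B (e i) \<omega>)) = D' (\<Sum>i<r. wedge (\<theta> i) (contract B (e i) \<omega>))"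
          using derivation_sum[OF D, of "{..<r}"] derivation_sum[OF D', of "{..<r}"] F by simp
        moreover have "smooth_fun (bas B) (\<lambda>b. real (Suc k) * \<rho> b)"
          by (intro smooth_fun_mult smooth_fun_const base \<rho>)
        ultimately have "fmul (\<lambda>b. real (Suc k) * \<rho> b) (D \<omega>) = fmul (\<lambda>b. real (Suc k) * \<rho> b) (D' \<omega>)"
          by (simp only: euler_identity[OF \<theta> e exp Suc.prems, symmetric] derivation_fmul[OF D _ \<omega>']
              derivation_fmul[OF D' _ \<omega>'])
        from fun_cong[OF fun_cong[OF this, of b], of hs] show ?thesis using \<rho>(2) by (simp add: fmul_def)
      next
        case False
        then show ?thesis
          using forms_zero[OF graded_derivationD(2)[OF D \<omega>']] forms_zero[OF graded_derivationD(2)[OF D' \<omega>']]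
              by simp
      qed
    qed
  qed
  have c: "component k \<omega> \<in> forms B" for k by (rule k_forms_forms[OF component_in[OF \<omega>]])
  have "D (\<Sum>k\<le>r. component k \<omega>) = D' (\<Sum>k\<le>r. component k \<omega>)"
    using k[OF component_in[OF \<omega>]] c by (simp add: derivation_sum[OF D] derivation_sum[OF D'])
  then show ?thesis by (simp only: forms_components[OF \<omega>, symmetric])
qed

text \<open>On one-forms D is linear over functions, so at each point it is an element of the double
  dual of the fibre, that is, a vector. Agreement on one-forms then extends to all forms by
  \<open>derivation_eqI\<close>.\<close>

theorem derivation_contract:
  assumes D: "graded_derivation B (- 1) p D"
  obtains Z where "Z \<in> sections B" "\<And>\<omega>. \<omega> \<in> forms B \<Longrightarrow> contract B Z \<omega> = D \<omega>"
proof -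
  have ex: "\<exists>z. z \<in> fibre B b \<and> (\<forall>\<alpha>\<in>k_forms B 1. \<alpha> b [z] = D \<alpha> b [])" if b: "b \<in> pts (bas B)" for b
  proof -
    obtain e \<theta> \<rho> where e: "\<And>i. i < r \<Longrightarrow> e i \<in> sections B" and \<theta>: "\<And>i. i < r \<Longrightarrow> \<theta> i \<in> k_forms B 1"
      and \<rho>: "smooth_fun (bas B) \<rho>" "\<rho> b = (1::real)"
      and exp: "\<And>b h \<xi>. b \<in> pts (bas B) \<Longrightarrow> h \<in> fibre B b \<Longrightarrow> fibre_functional B b \<xi> \<Longrightarrow>
          \<rho> b * \<xi> h = (\<Sum>i<r. \<theta> i b [h] * \<xi> (e i b))"
      and z: "\<And>c. \<exists>z\<in>fibre B b. \<forall>i<r. \<theta> i b [z] = c i"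
      by (rule frame_obtain[OF b]) (rule that; assumption)
    \<comment> \<open>The vector is prescribed by its coordinates in one coframe. The expansion of
      \<rho> \<alpha> as the sum of \<alpha>(e i) times \<theta> i then yields the right value on
      every one-form.\<close>
    obtain z where z: "z \<in> fibre B b" "\<And>i. i < r \<Longrightarrow> \<theta> i b [z] = D (\<theta> i) b []"
      using z[of "\<lambda>i. D (\<theta> i) b []"] by blast
    have "\<alpha> b [z] = D \<alpha> b []" if \<alpha>: "\<alpha> \<in> k_forms B 1" for \<alpha>
    proof -
      note \<alpha>' = k_forms_forms[OF \<alpha>]
      have sm: "smooth_fun (bas B) (\<lambda>b. \<alpha> b [e i b])" if "i < r" for i
        using forms_smooth[OF \<alpha>', of "[e i]"] e[OF that] by simp
      have F: "fmul (\<lambda>b. \<alpha> b [e i b]) (\<theta> i) \<in> forms B" if "i < r" for i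
        by (rule forms_fmul[OF sm[OF that] k_forms_forms[OF \<theta>[OF that]]])
      have "fmul \<rho> \<alpha> = (\<Sum>i<r. fmul (\<lambda>b. \<alpha> b [e i b]) (\<theta> i))"
      proof (intro ext)
        fix b hs
        show "fmul \<rho> \<alpha> b hs = (\<Sum>i<r. fmul (\<lambda>b. \<alpha> b [e i b]) (\<theta> i)) b hs"
        proof (cases "b \<in> pts (bas B) \<and> set hs \<subseteq> fibre B b \<and> length hs = 1")
          case True
          then obtain h where h: "hs = [h]" by (auto simp: length_Suc_conv)
          then show ?thesis
            using exp[OF _ _ forms_functional[OF \<alpha>', of b "[]" "[]"], of h] True
            by (simp add: sum_fun2_apply fmul_def mult.commute)
        next
          case False
          have 0: "\<beta> b hs = 0" if "\<beta> \<in> k_forms B 1" for \<beta>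
            using False forms_zero[OF k_forms_forms[OF that]] k_forms_length[OF that] by blast
          show ?thesis using 0[OF \<alpha>] 0[OF \<theta>] by (simp add: sum_fun2_apply fmul_def)
        qed
      qed
      then have "fmul \<rho> (D \<alpha>) = (\<Sum>i<r. D (fmul (\<lambda>b. \<alpha> b [e i b]) (\<theta> i)))"
        using derivation_fmul[OF D \<rho>(1) \<alpha>'] derivation_sum[OF D, of "{..<r}"
            "\<lambda>i. fmul (\<lambda>b. \<alpha> b [e i b]) (\<theta> i)"] F by simp
      also have "\<dots> = (\<Sum>i<r. fmul (\<lambda>b. \<alpha> b [e i b]) (D (\<theta> i)))"
        using derivation_fmul[OF D sm k_forms_forms[OF \<theta>]] by simp
      finally have "fmul \<rho> (D \<alpha>) b [] = (\<Sum>i<r. fmul (\<lambda>b. \<alpha> b [e i b]) (D (\<theta> i))) b []" by simp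
      then have "D \<alpha> b [] = (\<Sum>i<r. \<theta> i b [z] * \<alpha> b [e i b])"
        using \<rho>(2) z(2) by (simp add: fmul_def sum_fun2_apply mult.commute)
      then show ?thesis
        using exp[OF b z(1) forms_functional[OF \<alpha>' b, of "[]" "[]"]] \<rho>(2) by simp
    qed
    then show ?thesis using z(1) by blast
  qed
  \<comment> \<open>Any choice serves: smoothness of Z is tested on one-forms, where the values are
    those of D.\<close>
  define Z where "Z = (\<lambda>b\<in>pts (bas B). SOME z. z \<in> fibre B b \<and> (\<forall>\<alpha>\<in>k_forms B 1. \<alpha> b [z] = D \<alpha> b []))"
  have Z: "Z b \<in> fibre B b" "\<And>\<alpha>. \<alpha> \<in> k_forms B 1 \<Longrightarrow> \<alpha> b [Z b] = D \<alpha> b []" if "b \<in> pts (bas B)" for b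
    using someI_ex[OF ex[OF that]] that by (auto simp: Z_def)
  have "smooth_map (bas B) (tot B) Z"
  proof (rule section_smooth[OF Z(1)])
    fix \<alpha> assume \<alpha>: "\<alpha> \<in> k_forms B 1"
    have "D \<alpha> \<in> forms B" by (rule graded_derivationD(2)[OF D k_forms_forms[OF \<alpha>]])
    then show "smooth_fun (bas B) (\<lambda>b. \<alpha> b [Z b])"
      by (intro smooth_map_cong[OF _ forms_smooth[of "D \<alpha>" "[]"]]) (use Z(2) \<alpha> in auto)
  qed
  then have ZS: "Z \<in> sections B" using Z(1) by (simp add: sections_def Z_def)
  have "contract B Z \<alpha> = D \<alpha>" if \<alpha>: "\<alpha> \<in> k_forms B 1" for \<alpha>
  proof (intro ext)
    fix b hs
    have 0: "D \<alpha> \<in> k_forms B 0" using graded_derivationD(3)[OF D \<alpha>] by simp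
    show "contract B Z \<alpha> b hs = D \<alpha> b hs"
    proof (cases "b \<in> pts (bas B) \<and> hs = []")
      case True
      then show ?thesis using Z(2)[OF _ \<alpha>] by (simp add: contract_def)
    next
      case False
      then show ?thesis
        using k_forms_length[OF 0] k_forms_length[OF \<alpha>] forms_zero[OF k_forms_forms[OF 0], of b hs]
        by (auto simp: contract_def)
    qed
  qed
  then have "contract B Z \<omega> = D \<omega>" if "\<omega> \<in> forms B" for \<omega>
    by (rule derivation_eqI[OF contract_graded[OF ZS] D _ that])
  then show ?thesis using that ZS by blast
qed

end

section \<open>Pullbacks of forms\<close>

text \<open>The difficulty is smoothness: F composed with X is a section along f, which need not be
  induced by a section of B', while forms on B' are smooth on sections of B' by definition.\<close>

lemma pullback_forms:
  fixes B :: "('b, 'v::euclidean_space, 't, 'w::euclidean_space) vbundle"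
    and B' :: "('b2, 'v2::euclidean_space, 't2, 'w2::euclidean_space) vbundle"
  assumes "framed_bundle B r" "framed_bundle B' r'"
    and F: "smooth_map (tot B) (tot B') F" and f: "smooth_map (bas B) (bas B') f"
    and lin: "fibre_linear B B' F f" and \<omega>: "\<omega> \<in> forms B'"
  shows "pullback B F f \<omega> \<in> forms B"
proof -
  interpret B: framed_bundle B r by fact
  interpret B': framed_bundle B' r' by fact
  have Fin: "F h \<in> fibre B' (f b)" if "b \<in> pts (bas B)" "h \<in> fibre B b" for b h
    using lin that unfolding fibre_linear_def by blast
  have Fadd: "F (vadd B h k) = vadd B' (F h) (F k)" if "b \<in> pts (bas B)" "h \<in> fibre B b" "k \<in> fibre B b"
      for b h k
    using lin that unfolding fibre_linear_def by blast
  have Fscl: "F (vscl B a h) = vscl B' a (F h)" if "b \<in> pts (bas B)" "h \<in> fibre B b" for b h a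
    using lin that unfolding fibre_linear_def by blast
  have fin: "f b \<in> pts (bas B')" if "b \<in> pts (bas B)" for b by (rule smooth_map_in[OF f that])
  \<comment> \<open>\<open>Ys\<close> holds the arguments already replaced by sections of B'. Each
    further F(X) is expanded near a point in a frame of B', with the smooth coefficients \<theta> i
    (F(X)).\<close>
  have sm: "smooth_fun (bas B) (\<lambda>b. \<omega> (f b) (map (\<lambda>Y. Y (f b)) Ys @ map (\<lambda>X. F (X b)) Xs))"
    if "Ys \<in> lists (sections B')" "Xs \<in> lists (sections B)" for Ys Xs
    using that
  proof (induction Xs arbitrary: Ys)
    case Nil
    then show ?case using smooth_map_compose[OF B'.base(1) f B'.forms_smooth[OF \<omega> Nil.prems(1)]] by simp
  next
    case (Cons X Xs)
    have X: "X \<in> sections B" "Xs \<in> lists (sections B)" using Cons.prems by auto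
    have FX: "smooth_map (bas B) (tot B') (\<lambda>b. F (X b))"
      by (rule smooth_map_compose[OF B.total _ F]) (use X(1) in \<open>simp add: sections_def\<close>)
    show ?case
    proof (rule smooth_map_local[OF B.base(1)])
      fix b\<^sub>0 assume b0: "b\<^sub>0 \<in> pts (bas B)"
      obtain e \<theta> \<rho> where e: "\<And>i. i < r' \<Longrightarrow> e i \<in> sections B'" and \<theta>: "\<And>i. i < r' \<Longrightarrow> \<theta> i \<in> k_forms B' 1"
        and exp: "\<And>b h \<xi>. b \<in> pts (bas B') \<Longrightarrow> h \<in> fibre B' b \<Longrightarrow> fibre_functional B' b \<xi> \<Longrightarrow>
            \<rho> b * \<xi> h = (\<Sum>i<r'. \<theta> i b [h] * \<xi> (e i b))"
        and P: "\<exists>P. openin (mtop (bas B')) P \<and> f b\<^sub>0 \<in> P \<and> (\<forall>b\<in>P. \<rho> b = (1::real))"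
        by (rule B'.frame_obtain[OF fin[OF b0]]) (rule that; assumption)
      from P obtain P where P: "openin (mtop (bas B')) P" "f b\<^sub>0 \<in> P" "\<And>b. b \<in> P \<Longrightarrow> \<rho> b = (1::real)" by blast
      let ?S = "{b \<in> pts (bas B). f b \<in> P}"
      have oS: "openin (mtop (bas B)) ?S" by (rule openin_smooth_vimage[OF B.base(1) B'.base(1) f P(1)])
      have th: "smooth_fun (bas B) (\<lambda>b. \<theta> i (f b) [F (X b)])" if "i < r'" for i
      proof (rule smooth_map_cong[OF _ smooth_map_compose[OF B'.total FX B'.one_form_smooth[OF \<theta>[OF that]]]])
        fix b assume "b \<in> pts (bas B)"
        then show "\<theta> i (proj B' (F (X b))) [F (X b)] = \<theta> i (f b) [F (X b)]"
          using Fin[OF _ B.section_in[OF X(1)]] by (simp add: fibre_def)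
      qed
      have "smooth_fun (bas B) (\<lambda>b. \<Sum>i<r'. \<theta> i (f b) [F (X b)] * \<omega> (f b) (map (\<lambda>Y. Y (f b)) (Ys @ [e i]) @ map
          (\<lambda>X. F (X b)) Xs))"
        by (intro smooth_fun_sum smooth_fun_mult B.base th Cons.IH) (use Cons.prems X e in auto)
      then have "smooth_fun (sub (bas B) ?S) (\<lambda>b. \<Sum>i<r'. \<theta> i (f b) [F (X b)] * \<omega> (f b) (map (\<lambda>Y. Y (f b)) (Ys
          @ [e i]) @ map (\<lambda>X. F (X b)) Xs))"
        by (rule smooth_map_sub) auto
      then have "smooth_fun (sub (bas B) ?S) (\<lambda>b. \<omega> (f b) (map (\<lambda>Y. Y (f b)) Ys @ map (\<lambda>X. F (X b)) (X #
          Xs)))"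
      proof (rule smooth_map_cong[rotated])
        fix b assume "b \<in> pts (sub (bas B) ?S)"
        then have b: "b \<in> pts (bas B)" "f b \<in> P" by auto
        have l: "map (\<lambda>Y. Y (f b)) Ys \<in> lists (fibre B' (f b))"
            "map (\<lambda>X. F (X b)) Xs \<in> lists (fibre B' (f b))"
          using Cons.prems(1) X(2) B'.section_in[OF _ fin[OF b(1)]] Fin[OF b(1) B.section_in[OF _ b(1)]]
              by auto
        show "(\<Sum>i<r'. \<theta> i (f b) [F (X b)] * \<omega> (f b) (map (\<lambda>Y. Y (f b)) (Ys @ [e i]) @ map (\<lambda>X. F (X b)) Xs)) =
          \<omega> (f b) (map (\<lambda>Y. Y (f b)) Ys @ map (\<lambda>X. F (X b)) (X # Xs))"
          using exp[OF fin[OF b(1)] Fin[OF b(1) B.section_in[OF X(1) b(1)]] B'.forms_functional[OF \<omega> fin[OF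
              b(1)] l]] P(3)[OF b(2)]
          by simp
      qed
      then show "\<exists>T. openin (mtop (bas B)) T \<and> b\<^sub>0 \<in> T \<and>
          smooth_fun (sub (bas B) T) (\<lambda>b. \<omega> (f b) (map (\<lambda>Y. Y (f b)) Ys @ map (\<lambda>X. F (X b)) (X # Xs)))"
        using oS b0 P(2) by blast
    qed
  qed
  show ?thesis
  proof (rule B.formsI)
    show "b \<in> pts (bas B) \<and> set hs \<subseteq> fibre B b" if "pullback B F f \<omega> b hs \<noteq> 0" for b hs
      using that by (auto simp: pullback_def split: if_splits)
  next
    fix b assume b: "b \<in> pts (bas B)"
    note a = B'.forms_alt[OF \<omega> fin[OF b]]
    have p: "pullback B F f \<omega> b hs = \<omega> (f b) (map F hs)" if "set hs \<subseteq> fibre B b" for hs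
      using b that by (simp add: pullback_def)
    show "alt_map B b (pullback B F f \<omega> b)"
      unfolding alt_map_def
    proof (intro ballI conjI allI)
      fix xs ys h assume *: "xs \<in> lists (fibre B b)" "ys \<in> lists (fibre B b)" and h: "h \<in> fibre B b"
      then have s: "set xs \<subseteq> fibre B b" "set ys \<subseteq> fibre B b" and m: "map F xs \<in> lists (fibre B' (f b))"
          "map F ys \<in> lists (fibre B' (f b))"
        using Fin[OF b] by auto
      note d = alt_mapD[OF a m Fin[OF b h]]
      show "pullback B F f \<omega> b (xs @ h # h # ys) = 0" using d(3) s h by (simp add: p)
      show "pullback B F f \<omega> b (xs @ vscl B c h # ys) = c * pullback B F f \<omega> b (xs @ h # ys)" for c
        using d(2) s h B.vscl_in[OF b h] Fscl[OF b h] by (simp add: p)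
      show "pullback B F f \<omega> b (xs @ vadd B h k # ys) =
          pullback B F f \<omega> b (xs @ h # ys) + pullback B F f \<omega> b (xs @ k # ys)"
        if k: "k \<in> fibre B b" for k
        using d(1)[OF Fin[OF b k]] s h k B.vadd_in[OF b h k] Fadd[OF b h k] by (simp add: p)
    qed
  next
    fix Xs assume Xs: "Xs \<in> lists (sections B)"
    show "smooth_fun (bas B) (\<lambda>b. pullback B F f \<omega> b (map (\<lambda>X. X b) Xs))"
    proof (rule smooth_map_cong[OF _ sm[of "[]" Xs]])
      fix b assume b: "b \<in> pts (bas B)"
      have "set (map (\<lambda>X. X b) Xs) \<subseteq> fibre B b" using Xs B.section_in[OF _ b] by auto
      then show "\<omega> (f b) (map (\<lambda>Y. Y (f b)) [] @ map (\<lambda>X. F (X b)) Xs) =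
          pullback B F f \<omega> b (map (\<lambda>X. X b) Xs)"
        using b by (simp add: pullback_def comp_def)
    qed (use Xs in auto)
  qed
qed

text \<open>With a pullback for \<Phi>, this is relatedness of vector fields by a bundle map. It
  passes to graded commutators, hence to derived brackets.\<close>

definition intertwines ::
  "('b2, 'v2::euclidean_space, 't2, 'w2::euclidean_space) vbundle \<Rightarrow> (('b2, 't2) form \<Rightarrow> ('b, 't) form) \<Rightarrow>
   (('b2, 't2) form \<Rightarrow> ('b2, 't2) form) \<Rightarrow> (('b, 't) form \<Rightarrow> ('b, 't) form) \<Rightarrow> bool" where
  "intertwines B' \<Phi> D D2 \<longleftrightarrow> (\<forall>\<omega>\<in>forms B'. D2 (\<Phi> \<omega>) = \<Phi> (D \<omega>))"

lemma intertwines_gcomm: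
  assumes "intertwines B' (pullback B F f) D D2" "intertwines B' (pullback B F f) D' D2'"
    and "\<And>\<omega>. \<omega> \<in> forms B' \<Longrightarrow> D \<omega> \<in> forms B'" "\<And>\<omega>. \<omega> \<in> forms B' \<Longrightarrow> D' \<omega> \<in> forms B'"
  shows "intertwines B' (pullback B F f) (gcomm d e D D') (gcomm d e D2 D2')"
  unfolding intertwines_def
proof
  fix \<omega> assume \<omega>: "\<omega> \<in> forms B'"
  have 1: "D2 (pullback B F f \<omega>) = pullback B F f (D \<omega>)" "D2' (pullback B F f \<omega>) = pullback B F f (D' \<omega>)"
    "D2' (pullback B F f (D \<omega>)) = pullback B F f (D' (D \<omega>))" "D2 (pullback B F f (D' \<omega>)) =
        pullback B F f (D (D' \<omega>))"
    using assms \<omega> unfolding intertwines_def by blast+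
  show "gcomm d e D2 D2' (pullback B F f \<omega>) = pullback B F f (gcomm d e D D' \<omega>)"
    unfolding gcomm_def 1 by (intro ext) (simp add: pullback_def)
qed

lemma intertwines_contract:
  assumes X: "\<And>b. b \<in> pts (bas B) \<Longrightarrow> X2 b \<in> fibre B b" "\<And>b. b \<in> pts (bas B) \<Longrightarrow> F (X2 b) = X (f b)"
    and f: "\<And>b. b \<in> pts (bas B) \<Longrightarrow> f b \<in> pts (bas B')"
  shows "intertwines B' (pullback B F f) (contract B' X) (contract B X2)"
  unfolding intertwines_def by (intro ballI ext) (use X f in \<open>auto simp: pullback_def contract_def\<close>)

section \<open>VB-groupoids\<close>

locale gpd_loc =
  fixes K :: "('a, 'o, 'k) gpd"
  assumes groupoid: "groupoid K"
begin

lemma src_in: "g \<in> pts (arr K) \<Longrightarrow> src K g \<in> pts (obj K)"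
  and tgt_in: "g \<in> pts (arr K) \<Longrightarrow> tgt K g \<in> pts (obj K)"
  and unt_in: "x \<in> pts (obj K) \<Longrightarrow> unt K x \<in> pts (arr K)"
  and src_unt: "x \<in> pts (obj K) \<Longrightarrow> src K (unt K x) = x"
  and tgt_unt: "x \<in> pts (obj K) \<Longrightarrow> tgt K (unt K x) = x"
  and mul_unt_left: "g \<in> pts (arr K) \<Longrightarrow> mul K (unt K (tgt K g)) g = g"
  and mul_unt_right: "g \<in> pts (arr K) \<Longrightarrow> mul K g (unt K (src K g)) = g"
  and ivs_in: "g \<in> pts (arr K) \<Longrightarrow> ivs K g \<in> pts (arr K)"
  and src_ivs: "g \<in> pts (arr K) \<Longrightarrow> src K (ivs K g) = tgt K g"
  and tgt_ivs: "g \<in> pts (arr K) \<Longrightarrow> tgt K (ivs K g) = src K g"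
  and mul_ivs_right: "g \<in> pts (arr K) \<Longrightarrow> mul K g (ivs K g) = unt K (tgt K g)"
  and mul_ivs_left: "g \<in> pts (arr K) \<Longrightarrow> mul K (ivs K g) g = unt K (src K g)"
  using groupoid unfolding groupoid_def by blast+

lemma mul_in: "(g, h) \<in> composable K \<Longrightarrow> mul K g h \<in> pts (arr K)"
  and src_mul: "(g, h) \<in> composable K \<Longrightarrow> src K (mul K g h) = src K h"
  and tgt_mul: "(g, h) \<in> composable K \<Longrightarrow> tgt K (mul K g h) = tgt K g"
  using groupoid unfolding groupoid_def by fast+

lemma mul_assoc: "(g, h) \<in> composable K \<Longrightarrow> (h, k) \<in> composable K \<Longrightarrow> mul K (mul K g h) k = mul K g (mul K h k)"
  using groupoid unfolding groupoid_def by blast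

lemma composableI: "g \<in> pts (arr K) \<Longrightarrow> h \<in> pts (arr K) \<Longrightarrow> src K g = tgt K h \<Longrightarrow> (g, h) \<in> composable K"
  by (simp add: composable_def)

lemma composableD: "(g, h) \<in> composable K \<Longrightarrow> g \<in> pts (arr K)" "(g, h) \<in> composable K \<Longrightarrow> h \<in> pts (arr K)"
  "(g, h) \<in> composable K \<Longrightarrow> src K g = tgt K h"
  by (auto simp: composable_def)

lemma inverse_unique:
  assumes "(g, h) \<in> composable K" "mul K g h = unt K (tgt K g)"
  shows "h = ivs K g"
proof -
  note g = composableD[OF assms(1)]
  have c: "(ivs K g, g) \<in> composable K" using g ivs_in src_ivs by (intro composableI) auto
  have "h = mul K (unt K (tgt K h)) h" using mul_unt_left g by simp
  also have "\<dots> = mul K (mul K (ivs K g) g) h" using mul_ivs_left g by simp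
  also have "\<dots> = mul K (ivs K g) (unt K (tgt K g))" using mul_assoc[OF c assms(1)] assms(2) by simp
  also have "\<dots> = ivs K g" using mul_unt_right[OF ivs_in[OF g(1)]] src_ivs[OF g(1)] by simp
  finally show ?thesis .
qed

lemma ivs_ivs: "g \<in> pts (arr K) \<Longrightarrow> ivs K (ivs K g) = g"
  using inverse_unique[of "ivs K g" g] composableI[OF ivs_in] src_ivs mul_ivs_left tgt_ivs by force

lemma idempotent_unit:
  assumes "(g, g) \<in> composable K" "mul K g g = g"
  shows "g = unt K (src K g)"
proof -
  note g = composableD[OF assms(1)]
  have c: "(ivs K g, g) \<in> composable K" using g ivs_in src_ivs by (intro composableI) auto
  have "g = mul K (mul K (ivs K g) g) g" using mul_ivs_left mul_unt_left g by simp
  also have "\<dots> = mul K (ivs K g) g" using mul_assoc[OF c assms(1)] assms(2) by simp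
  finally show ?thesis using mul_ivs_left g by simp
qed

lemma ivs_mul:
  assumes "(g, h) \<in> composable K"
  shows "ivs K (mul K g h) = mul K (ivs K h) (ivs K g)"
proof (rule inverse_unique[symmetric])
  note g = composableD[OF assms]
  have c1: "(ivs K h, ivs K g) \<in> composable K" using g
      by (intro composableI) (auto simp: ivs_in src_ivs tgt_ivs)
  have c2: "(h, ivs K h) \<in> composable K" using g by (intro composableI) (auto simp: ivs_in tgt_ivs)
  have c3: "(mul K g h, ivs K h) \<in> composable K" using g assms
      by (intro composableI) (auto simp: ivs_in tgt_ivs mul_in src_mul)
  show "(mul K g h, mul K (ivs K h) (ivs K g)) \<in> composable K"
    using g assms c1 by (intro composableI) (auto simp: mul_in src_mul tgt_mul tgt_ivs)
  have "mul K (mul K g h) (mul K (ivs K h) (ivs K g)) = mul K (mul K (mul K g h) (ivs K h)) (ivs K g)"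
    using mul_assoc[OF c3 c1] by simp
  also have "mul K (mul K g h) (ivs K h) = g"
    using mul_assoc[OF assms c2] mul_ivs_right[OF g(2)] mul_unt_right[OF g(1)] g(3) by simp
  finally show "mul K (mul K g h) (mul K (ivs K h) (ivs K g)) = unt K (tgt K (mul K g h))"
    using mul_ivs_right g tgt_mul[OF assms] by simp
qed

lemma ivs_unt: "x \<in> pts (obj K) \<Longrightarrow> ivs K (unt K x) = unt K x"
  using inverse_unique[of "unt K x" "unt K x"] mul_unt_left[of "unt K x"] unt_in src_unt tgt_unt composableI
      by force

end

text \<open>A fixed name for a rank, so that each bundle of a VB-groupoid interprets
  \<open>framed_bundle\<close> by a term depending on the bundle alone.\<close>

definition frame_rank :: "('b, 'v::euclidean_space, 't, 'w::euclidean_space) vbundle \<Rightarrow> nat" where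
  "frame_rank B = (SOME r. framed_bundle B r)"

lemma framed_rank: "framed_bundle B r \<Longrightarrow> framed_bundle B (frame_rank B)"
  unfolding frame_rank_def by (rule someI)

lemma smooth_map_mul_graph:
  assumes S: "smooth_space X" and f: "smooth_map (sub (X \<times>\<^sub>M X) S) X (\<lambda>(g, h). f g h)" and "S \<subseteq> pts X \<times> pts X"
  shows "smooth_map (sub (X \<times>\<^sub>M X) S) (sub (X \<times>\<^sub>M X \<times>\<^sub>M X) {(g, h, f g h) | g h. (g, h) \<in> S}) (\<lambda>(g, h). (g, h,
      f g h))"
proof (rule smooth_map_into_sub)
  have S2: "smooth_space (X \<times>\<^sub>M X)" by (intro smooth_space_prod S)
  have S3: "smooth_space (sub (X \<times>\<^sub>M X) S)" by (intro smooth_space_sub S2) (use assms(3) in simp)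
  have sub: "S \<subseteq> pts (X \<times>\<^sub>M X)" using assms(3) by simp
  have "smooth_map (sub (X \<times>\<^sub>M X) S) (X \<times>\<^sub>M X \<times>\<^sub>M X) (\<lambda>p. (fst p, snd p, (\<lambda>(g, h). f g h) p))"
    by (intro smooth_map_Pair S2 S3 S f smooth_map_sub[OF smooth_map_fst[OF S S] sub] smooth_map_sub[OF
        smooth_map_snd[OF S S] sub])
  then show "smooth_map (sub (X \<times>\<^sub>M X) S) (X \<times>\<^sub>M X \<times>\<^sub>M X) (\<lambda>(g, h). (g, h, f g h))"
    by (simp add: split_def)
qed auto

lemma smooth_map_fst_snd:
  assumes S: "smooth_space X" and "T \<subseteq> pts X \<times> pts X \<times> pts X" "\<And>g h k. (g, h, k) \<in> T \<Longrightarrow> (g, h) \<in> S"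
  shows "smooth_map (sub (X \<times>\<^sub>M X \<times>\<^sub>M X) T) (sub (X \<times>\<^sub>M X) S) (\<lambda>(g, h, k). (g, h))"
proof (rule smooth_map_into_sub)
  have S2: "smooth_space (X \<times>\<^sub>M X)" and S3: "smooth_space (X \<times>\<^sub>M X \<times>\<^sub>M X)" by (intro smooth_space_prod S)+
  have "smooth_map (X \<times>\<^sub>M X \<times>\<^sub>M X) (X \<times>\<^sub>M X) (\<lambda>p. (fst p, fst (snd p)))"
    by (intro smooth_map_Pair S3 S smooth_map_fst S2 smooth_map_compose[OF S2 smooth_map_snd[OF S S2]
        smooth_map_fst[OF S S]])
  then have "smooth_map (sub (X \<times>\<^sub>M X \<times>\<^sub>M X) T) (X \<times>\<^sub>M X) (\<lambda>p. (fst p, fst (snd p)))"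
    by (rule smooth_map_sub) (use assms(2) in simp)
  then show "smooth_map (sub (X \<times>\<^sub>M X \<times>\<^sub>M X) T) (X \<times>\<^sub>M X) (\<lambda>(g, h, k). (g, h))"
    by (simp add: split_def)
qed (use assms in auto)

locale vb_gpd =
  fixes V :: "('h, 'e, 'g, 'm, 'v::euclidean_space) vbg"
  assumes VB: "VB_groupoid V"
begin

lemma VB_unfold:
  shows Lie_H: "Lie_groupoid (Hg V)" and Lie_G: "Lie_groupoid (Gg V)"
    and bas_Hb: "bas (Hb V) = arr (Gg V)" and tot_Hb: "tot (Hb V) = arr (Hg V)"
        and vb_H: "vector_bundle (Hb V)"
    and bas_Eb: "bas (Eb V) = obj (Gg V)" and tot_Eb: "tot (Eb V) = obj (Hg V)"
        and vb_E: "vector_bundle (Eb V)"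
    and proj_morphism: "gpd_morphism (Hg V) (Gg V) (proj (Hb V)) (proj (Eb V))"
    and src_linear: "fibre_linear (Hb V) (Eb V) (src (Hg V)) (src (Gg V))"
    and tgt_linear: "fibre_linear (Hb V) (Eb V) (tgt (Hg V)) (tgt (Gg V))"
    and unt_linear: "fibre_linear (Eb V) (Hb V) (unt (Hg V)) (unt (Gg V))"
    and vb_graph: "vector_bundle (mul_graph_bundle V)"
  using VB unfolding VB_groupoid_def by blast+

sublocale H: gpd_loc "Hg V"
  by unfold_locales (use Lie_H in \<open>simp add: Lie_groupoid_def\<close>)

sublocale G: gpd_loc "Gg V"
  by unfold_locales (use Lie_G in \<open>simp add: Lie_groupoid_def\<close>)

lemma man: "manifold (arr (Hg V))" "manifold (arr (Gg V))" "manifold (obj (Hg V))" "manifold (obj (Gg V))"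
  using Lie_H Lie_G by (auto simp: Lie_groupoid_def)

lemmas ssp = man[THEN manifold_smooth_space]

lemma smooth_structure:
  "smooth_map (arr (Hg V)) (obj (Hg V)) (src (Hg V))" "smooth_map (arr (Hg V)) (obj (Hg V)) (tgt (Hg V))"
  "smooth_map (arr (Gg V)) (obj (Gg V)) (src (Gg V))" "smooth_map (arr (Gg V)) (obj (Gg V)) (tgt (Gg V))"
  "smooth_map (obj (Hg V)) (arr (Hg V)) (unt (Hg V))" "smooth_map (obj (Gg V)) (arr (Gg V)) (unt (Gg V))"
  "smooth_map (arr (Hg V)) (arr (Hg V)) (ivs (Hg V))" "smooth_map (arr (Gg V)) (arr (Gg V)) (ivs (Gg V))"
  "smooth_map (sub (arr (Hg V) \<times>\<^sub>M arr (Hg V)) (composable (Hg V))) (arr (Hg V)) (\<lambda>(g, h). mul (Hg V) g h)"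
  "smooth_map (sub (arr (Gg V) \<times>\<^sub>M arr (Gg V)) (composable (Gg V))) (arr (Gg V)) (\<lambda>(g, h). mul (Gg V) g h)"
  using Lie_H Lie_G unfolding Lie_groupoid_def submersion_def by blast+

sublocale B: framed_bundle "Hb V" "frame_rank (Hb V)"
  using vector_bundle_framed[OF vb_H] ssp(1,2) manifold_has_bumps[OF man(2)] framed_rank
  unfolding bas_Hb tot_Hb by metis

sublocale E: framed_bundle "Eb V" "frame_rank (Eb V)"
  using vector_bundle_framed[OF vb_E] ssp(3,4) manifold_has_bumps[OF man(4)] framed_rank
  unfolding bas_Eb tot_Eb by metis

lemma proj_gpd:
  "x \<in> pts (arr (Hg V)) \<Longrightarrow> proj (Hb V) x \<in> pts (arr (Gg V))"
  "e \<in> pts (obj (Hg V)) \<Longrightarrow> proj (Eb V) e \<in> pts (obj (Gg V))"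
  "x \<in> pts (arr (Hg V)) \<Longrightarrow> src (Gg V) (proj (Hb V) x) = proj (Eb V) (src (Hg V) x)"
  "x \<in> pts (arr (Hg V)) \<Longrightarrow> tgt (Gg V) (proj (Hb V) x) = proj (Eb V) (tgt (Hg V) x)"
  "e \<in> pts (obj (Hg V)) \<Longrightarrow> proj (Hb V) (unt (Hg V) e) = unt (Gg V) (proj (Eb V) e)"
  using proj_morphism unfolding gpd_morphism_def by auto

lemma proj_mul: "(x, y) \<in> composable (Hg V) \<Longrightarrow> proj (Hb V) (mul (Hg V) x y) =
    mul (Gg V) (proj (Hb V) x) (proj (Hb V) y)"
  using proj_morphism unfolding gpd_morphism_def by fast

lemma proj_composable: "(x, y) \<in> composable (Hg V) \<Longrightarrow> (proj (Hb V) x, proj (Hb V) y) \<in> composable (Gg V)"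
  unfolding composable_def using proj_gpd by auto

lemma fibre_Hb: "x \<in> fibre (Hb V) g \<longleftrightarrow> x \<in> pts (arr (Hg V)) \<and> proj (Hb V) x = g"
  by (simp add: fibre_def tot_Hb)

lemma fibre_Eb: "x \<in> fibre (Eb V) g \<longleftrightarrow> x \<in> pts (obj (Hg V)) \<and> proj (Eb V) x = g"
  by (simp add: fibre_def tot_Eb)

section \<open>Fibrewise linearity of the groupoid multiplication\<close>

lemma graph_bundle_simps:
  "pts (bas (mul_graph_bundle V)) = {(g, h, mul (Gg V) g h) | g h. (g, h) \<in> composable (Gg V)}"
  "pts (tot (mul_graph_bundle V)) = {(g, h, mul (Hg V) g h) | g h. (g, h) \<in> composable (Hg V)}"
  "proj (mul_graph_bundle V) (x, y, z) = (proj (Hb V) x, proj (Hb V) y, proj (Hb V) z)"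
  "vadd (mul_graph_bundle V) (x, y, z) (x', y', z') = (vadd (Hb V) x x', vadd (Hb V) y y', vadd (Hb V) z z')"
  "vscl (mul_graph_bundle V) a (x, y, z) = (vscl (Hb V) a x, vscl (Hb V) a y, vscl (Hb V) a z)"
  "vzer (mul_graph_bundle V) (g, h, k) = (vzer (Hb V) g, vzer (Hb V) h, vzer (Hb V) k)"
  by (simp_all add: mul_graph_bundle_def Let_def)

lemma graph_fibre: "(x, y, z) \<in> fibre (mul_graph_bundle V) (g, h, k) \<longleftrightarrow>
  (x, y) \<in> composable (Hg V) \<and> z = mul (Hg V) x y \<and> proj (Hb V) x = g \<and> proj (Hb V) y = h \<and> proj (Hb V) z = k"
  unfolding fibre_def graph_bundle_simps by (auto simp: graph_bundle_simps)

lemma graph_closed: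
  assumes "b \<in> pts (bas (mul_graph_bundle V))"
  shows "vzer (mul_graph_bundle V) b \<in> fibre (mul_graph_bundle V) b"
    "h \<in> fibre (mul_graph_bundle V) b \<Longrightarrow> k \<in> fibre (mul_graph_bundle V) b \<Longrightarrow>
        vadd (mul_graph_bundle V) h k \<in> fibre (mul_graph_bundle V) b"
    "h \<in> fibre (mul_graph_bundle V) b \<Longrightarrow> vscl (mul_graph_bundle V) a h \<in> fibre (mul_graph_bundle V) b"
  using vb_graph assms unfolding vector_bundle_def by blast+

lemma graph_base: "(g, h) \<in> composable (Gg V) \<Longrightarrow> (g, h, mul (Gg V) g h) \<in> pts (bas (mul_graph_bundle V))"
  unfolding graph_bundle_simps by blast

lemma graph_fibreI: "(x, y) \<in> composable (Hg V) \<Longrightarrow> (x, y, mul (Hg V) x y) \<in> fibre (mul_graph_bundle V)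
    (proj (Hb V) x, proj (Hb V) y, mul (Gg V) (proj (Hb V) x) (proj (Hb V) y))"
  by (simp add: graph_fibre proj_mul)

text \<open>The graph of the multiplication is closed under fibrewise addition; its third component
  gives the interchange law.\<close>

lemma interchange:
  assumes "(x, y) \<in> composable (Hg V)" "(x', y') \<in> composable (Hg V)"
    "proj (Hb V) x' = proj (Hb V) x" "proj (Hb V) y' = proj (Hb V) y"
  shows "(vadd (Hb V) x x', vadd (Hb V) y y') \<in> composable (Hg V)"
    "mul (Hg V) (vadd (Hb V) x x') (vadd (Hb V) y y') = vadd (Hb V) (mul (Hg V) x y) (mul (Hg V) x' y')"
  using graph_closed(2)[OF graph_base[OF proj_composable[OF assms(1)]] graph_fibreI[OF assms(1)]
      graph_fibreI[OF assms(2), unfolded assms(3,4)]]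
  by (simp_all add: graph_bundle_simps graph_fibre)

lemma interchange_scl:
  assumes "(x, y) \<in> composable (Hg V)"
  shows "(vscl (Hb V) a x, vscl (Hb V) a y) \<in> composable (Hg V)"
    "mul (Hg V) (vscl (Hb V) a x) (vscl (Hb V) a y) = vscl (Hb V) a (mul (Hg V) x y)"
  using graph_closed(3)[OF graph_base[OF proj_composable[OF assms(1)]] graph_fibreI[OF assms(1)], of a]
  by (simp_all add: graph_bundle_simps graph_fibre)

lemma zero_mul:
  assumes "(g, h) \<in> composable (Gg V)"
  shows "(vzer (Hb V) g, vzer (Hb V) h) \<in> composable (Hg V)"
    "mul (Hg V) (vzer (Hb V) g) (vzer (Hb V) h) = vzer (Hb V) (mul (Gg V) g h)"
  using graph_closed(1)[OF graph_base[OF assms]] by (simp_all add: graph_bundle_simps graph_fibre)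

lemma comp_bundle_simps:
  "pts (bas (comp_bundle V)) = composable (Gg V)" "pts (tot (comp_bundle V)) = composable (Hg V)"
  "bas (comp_bundle V) = sub (arr (Gg V) \<times>\<^sub>M arr (Gg V)) (composable (Gg V))"
  "tot (comp_bundle V) = sub (arr (Hg V) \<times>\<^sub>M arr (Hg V)) (composable (Hg V))"
  "proj (comp_bundle V) = map_prod (proj (Hb V)) (proj (Hb V))"
  "vadd (comp_bundle V) (x, y) (x', y') = (vadd (Hb V) x x', vadd (Hb V) y y')"
  "vscl (comp_bundle V) a (x, y) = (vscl (Hb V) a x, vscl (Hb V) a y)"
  "vzer (comp_bundle V) (g, h) = (vzer (Hb V) g, vzer (Hb V) h)"
  by (simp_all add: comp_bundle_def Let_def)

lemma comp_fibre: "(x, y) \<in> fibre (comp_bundle V) (g, h) \<longleftrightarrow>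
  (x, y) \<in> composable (Hg V) \<and> proj (Hb V) x = g \<and> proj (Hb V) y = h"
  by (auto simp: fibre_def comp_bundle_simps)

lemma comp_space:
  "smooth_space (bas (comp_bundle V))" "has_bumps (bas (comp_bundle V))" "smooth_space (tot (comp_bundle V))"
  unfolding comp_bundle_simps
  by (intro smooth_space_sub has_bumps_sub has_bumps_prod smooth_space_prod ssp manifold_has_bumps man;
      auto simp: composable_def)+

lemma comp_closed:
  assumes "b \<in> pts (bas (comp_bundle V))"
  shows "vzer (comp_bundle V) b \<in> fibre (comp_bundle V) b"
    "h \<in> fibre (comp_bundle V) b \<Longrightarrow> k \<in> fibre (comp_bundle V) b \<Longrightarrow>
        vadd (comp_bundle V) h k \<in> fibre (comp_bundle V) b"
    "h \<in> fibre (comp_bundle V) b \<Longrightarrow> vscl (comp_bundle V) a h \<in> fibre (comp_bundle V) b"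
proof -
  obtain g1 g2 where b: "b = (g1, g2)" "(g1, g2) \<in> composable (Gg V)" using assms
      by (cases b) (simp add: comp_bundle_simps)
  note g = G.composableD[OF b(2)]
  have g': "g1 \<in> pts (bas (Hb V))" "g2 \<in> pts (bas (Hb V))" using g by (simp_all add: bas_Hb)
  show "vzer (comp_bundle V) b \<in> fibre (comp_bundle V) b"
    using zero_mul(1)[OF b(2)] B.vzer_in[OF g'(1)] B.vzer_in[OF g'(2)]
    by (simp add: b(1) comp_bundle_simps comp_fibre fibre_Hb)
  assume h: "h \<in> fibre (comp_bundle V) b"
  obtain x y where x: "h = (x, y)" by fastforce
  have x': "(x, y) \<in> composable (Hg V)" "x \<in> fibre (Hb V) g1" "y \<in> fibre (Hb V) g2"
    using h H.composableD[of x y] by (auto simp: x b(1) comp_fibre fibre_Hb)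
  show "vscl (comp_bundle V) a h \<in> fibre (comp_bundle V) b"
    using interchange_scl(1)[OF x'(1), of a] B.vscl_in[OF g'(1) x'(2), of a] B.vscl_in[OF g'(2) x'(3), of a]
    by (simp add: x b(1) comp_bundle_simps comp_fibre fibre_Hb)
  assume k: "k \<in> fibre (comp_bundle V) b"
  obtain u v where u: "k = (u, v)" by fastforce
  have u': "(u, v) \<in> composable (Hg V)" "u \<in> fibre (Hb V) g1" "v \<in> fibre (Hb V) g2"
    using k H.composableD[of u v] by (auto simp: u b(1) comp_fibre fibre_Hb)
  show "vadd (comp_bundle V) h k \<in> fibre (comp_bundle V) b"
    using interchange(1)[OF x'(1) u'(1)] x' u' B.vadd_in[OF g'(1) x'(2) u'(2)] B.vadd_in[OF g'(2) x'(3) u'(3)]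
    by (simp add: x u b(1) comp_bundle_simps comp_fibre fibre_Hb)
qed

abbreviation mgraph :: "('x, 'o, 'k) gpd \<Rightarrow> 'x \<times> 'x \<Rightarrow> 'x \<times> 'x \<times> 'x" where
  "mgraph K \<equiv> (\<lambda>(g, h). (g, h, mul K g h))"

text \<open>The map (x, y) -> (x, y, xy) and the projection to the first two components are mutually
  inverse smooth bundle maps between the composable pairs and the graph. A trivialization of the
  graph is transported along them with the same model space \<open>W\<close>.\<close>

lemma comp_triv:
  fixes W :: "('v \<times> 'v \<times> 'v) set"
  assumes t: "local_triv (mul_graph_bundle V) T W \<psi>"
  shows "local_triv (comp_bundle V) {b \<in> composable (Gg V). mgraph (Gg V) b \<in> T} W (\<lambda>p. \<psi> (mgraph (Hg V) p))"
    (is "local_triv ?C ?T W ?\<psi>")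
proof -
  let ?M = "mul_graph_bundle V" and ?W = "euclid :: ('v \<times> 'v \<times> 'v, 'v \<times> 'v \<times> 'v) space"
  have basM: "bas ?M = sub (arr (Gg V) \<times>\<^sub>M arr (Gg V) \<times>\<^sub>M arr (Gg V)) {(g, h, mul (Gg V) g h) | g h. (g,
      h) \<in> composable (Gg V)}"
    and totM: "tot ?M = sub (arr (Hg V) \<times>\<^sub>M arr (Hg V) \<times>\<^sub>M arr (Hg V)) {(g, h, mul (Hg V) g h) | g h. (g,
        h) \<in> composable (Hg V)}"
    by (simp_all add: mul_graph_bundle_def Let_def)
  have S: "smooth_space (bas ?M)" "smooth_space (tot ?M)"
    unfolding basM totM by (intro smooth_space_sub smooth_space_prod ssp; auto
        simp: G.mul_in H.mul_in dest: G.composableD H.composableD)+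
  have mG: "smooth_map (bas ?C) (bas ?M) (mgraph (Gg V))" unfolding basM comp_bundle_simps
    by (rule smooth_map_mul_graph[OF ssp(2) smooth_structure(10)]) (auto simp: composable_def)
  have mH: "smooth_map (tot ?C) (tot ?M) (mgraph (Hg V))" unfolding totM comp_bundle_simps
    by (rule smooth_map_mul_graph[OF ssp(1) smooth_structure(9)]) (auto simp: composable_def)
  have pH: "smooth_map (tot ?M) (tot ?C) (\<lambda>(g, h, k). (g, h))" unfolding totM comp_bundle_simps
    by (rule smooth_map_fst_snd[OF ssp(1)]) (auto simp: H.mul_in dest: H.composableD)
  note td = t[unfolded local_triv_def]
  have oT: "openin (mtop (bas ?M)) T" and W: "subspace W" using td by blast+
  have TM: "T \<subseteq> pts (bas ?M)" by (rule openin_pts[OF S(1) oT])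
  have oT': "openin (mtop (bas ?C)) ?T"
    using openin_smooth_vimage[OF comp_space(1) S(1) mG oT] by (simp add: comp_bundle_simps)
  have TC: "?T \<subseteq> pts (bas ?C)" by (auto simp: comp_bundle_simps)
  have fib: "mgraph (Hg V) p \<in> fibre ?M (mgraph (Gg V) b)" if "b \<in> ?T" "p \<in> fibre ?C b" for b p
    using that by (cases b, cases p) (auto simp: comp_fibre graph_fibre proj_mul)
  have fib': "(\<lambda>(g, h, k). (g, h)) q \<in> fibre ?C b \<and> mgraph (Hg V) ((\<lambda>(g, h, k). (g, h)) q) = q"
    if "b \<in> ?T" "q \<in> fibre ?M (mgraph (Gg V) b)" for b q
    using that by (cases b, cases q) (auto simp: comp_fibre graph_fibre)
  have bij0: "bij_betw (mgraph (Hg V)) (fibre ?C b) (fibre ?M (mgraph (Gg V) b))" if "b \<in> ?T" for b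
    by (rule bij_betw_byWitness[where f'="\<lambda>(g, h, k). (g, h)"]) (use fib[OF that] fib'[OF that] in \<open>auto
        simp: split_def\<close>)
  have bijM: "bij_betw \<psi> (fibre ?M b) W" and zM: "\<psi> (vzer ?M b) = 0"
    and aM: "\<And>h k. h \<in> fibre ?M b \<Longrightarrow> k \<in> fibre ?M b \<Longrightarrow> \<psi> (vadd ?M h k) = \<psi> h + \<psi> k"
    and sM: "\<And>a h. h \<in> fibre ?M b \<Longrightarrow> \<psi> (vscl ?M a h) = a *\<^sub>R \<psi> h" if "b \<in> T" for b
    using td that by blast+
  have bij: "bij_betw ?\<psi> (fibre ?C b) W" if "b \<in> ?T" for b
    using bij_betw_trans[OF bij0[OF that] bijM] that by (auto simp: comp_def)
  have inv_eq: "inv_into (fibre ?C b) ?\<psi> w = (\<lambda>(g, h, k). (g, h)) (inv_into (fibre ?M (mgraph (Gg V) b)) \<psi> w)"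
    if b: "b \<in> ?T" and w: "w \<in> W" for b w
  proof (rule inv_into_f_eq)
    let ?q = "inv_into (fibre ?M (mgraph (Gg V) b)) \<psi> w"
    have im: "w \<in> \<psi> ` fibre ?M (mgraph (Gg V) b)" using bijM[of "mgraph (Gg V) b"] b w
        by (auto simp: bij_betw_def)
    have q: "?q \<in> fibre ?M (mgraph (Gg V) b)" "\<psi> ?q = w" using inv_into_into[OF im] f_inv_into_f[OF im]
        by auto
    show "inj_on ?\<psi> (fibre ?C b)" using bij[OF b] by (simp add: bij_betw_def)
    show "(\<lambda>(g, h, k). (g, h)) ?q \<in> fibre ?C b" using fib'[OF b q(1)] by blast
    show "?\<psi> ((\<lambda>(g, h, k). (g, h)) ?q) = w" using fib'[OF b q(1)] q(2) by simp
  qed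
  show ?thesis
    unfolding local_triv_def
  proof (intro conjI ballI allI oT' W bij)
    fix b assume b: "b \<in> ?T"
    obtain g1 g2 where g: "b = (g1, g2)" by fastforce
    have bc: "(g1, g2) \<in> composable (Gg V)" and bT: "(g1, g2, mul (Gg V) g1 g2) \<in> T" using b g by auto
    show "?\<psi> (vzer ?C b) = 0"
      using zM[OF bT] zero_mul(2)[OF bc] by (simp add: g comp_bundle_simps graph_bundle_simps)
    fix h assume h: "h \<in> fibre ?C b"
    obtain x y where x: "h = (x, y)" by fastforce
    have xy: "(x, y) \<in> composable (Hg V)" "proj (Hb V) x = g1" "proj (Hb V) y = g2" using h
        by (auto simp: x g comp_fibre)
    have hM: "(x, y, mul (Hg V) x y) \<in> fibre ?M (g1, g2, mul (Gg V) g1 g2)" using fib[OF b h]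
        by (simp add: x g)
    show "?\<psi> (vscl ?C a h) = a *\<^sub>R ?\<psi> h" for a
      using sM[OF bT hM, of a] interchange_scl(2)[OF xy(1), of a]
          by (simp add: x comp_bundle_simps graph_bundle_simps)
    fix k assume k: "k \<in> fibre ?C b"
    obtain u v where u: "k = (u, v)" by fastforce
    have uv: "(u, v) \<in> composable (Hg V)" "proj (Hb V) u = g1" "proj (Hb V) v = g2" using k
        by (auto simp: u g comp_fibre)
    have kM: "(u, v, mul (Hg V) u v) \<in> fibre ?M (g1, g2, mul (Gg V) g1 g2)" using fib[OF b k]
        by (simp add: u g)
    show "?\<psi> (vadd ?C h k) = ?\<psi> h + ?\<psi> k"
      using aM[OF bT hM kM] interchange(2)[OF xy(1) uv(1)] xy uv
          by (simp add: x u comp_bundle_simps graph_bundle_simps)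
  next
    let ?S = "{h \<in> pts (tot ?C). proj ?C h \<in> ?T}" and ?S' = "{h \<in> pts (tot ?M). proj ?M h \<in> T}"
    have "smooth_map (sub (tot ?C) ?S) (sub (tot ?M) ?S') (mgraph (Hg V))"
    proof (rule smooth_map_into_sub[OF smooth_map_sub[OF mH]])
      show "mgraph (Hg V) \<in> pts (sub (tot ?C) ?S) \<rightarrow> ?S'"
        by (auto simp: comp_bundle_simps graph_bundle_simps proj_mul)
    qed auto
    moreover have "smooth_fun (sub (tot ?M) ?S') \<psi>" using td by blast
    ultimately show "smooth_fun (sub (tot ?C) ?S) ?\<psi>"
      by (rule smooth_map_compose[rotated]) (intro smooth_space_sub S, auto)
  next
    let ?P = "sub (bas ?C \<times>\<^sub>M ?W) (?T \<times> W)" and ?P' = "sub (bas ?M \<times>\<^sub>M ?W) (T \<times> W)"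
    have PP: "?T \<times> W \<subseteq> pts (bas ?C \<times>\<^sub>M ?W)" using TC by auto
    have SP: "smooth_space (bas ?C \<times>\<^sub>M ?W)" by (intro smooth_space_prod comp_space smooth_space_euclid)
    define N where "N = (\<lambda>p :: ('g \<times> 'g) \<times> ('v \<times> 'v \<times> 'v). (mgraph (Gg V) (fst p), snd p))"
    define J where "J = (\<lambda>(b, w). inv_into (fibre ?M b) \<psi> w)"
    have "smooth_map ?P (bas ?M \<times>\<^sub>M ?W) N"
      unfolding N_def
      by (intro smooth_map_Pair smooth_space_sub[OF SP PP] S smooth_space_euclid
          smooth_map_compose[OF comp_space(1) smooth_map_sub[OF smooth_map_fst[OF comp_space(1)
              smooth_space_euclid] PP] mG]
          smooth_map_sub[OF smooth_map_snd[OF comp_space(1) smooth_space_euclid] PP])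
    then have N: "smooth_map ?P ?P' N"
      by (rule smooth_map_into_sub) (auto simp: N_def)
    have J: "smooth_map ?P' (tot ?M) J" using td unfolding J_def by blast
    have "smooth_space ?P'"
      by (intro smooth_space_sub smooth_space_prod S smooth_space_euclid) (use TM in auto)
    from smooth_map_compose[OF S(2) smooth_map_compose[OF this N J] pH]
    show "smooth_map ?P (tot ?C) (\<lambda>(b, w). inv_into (fibre ?C b) ?\<psi> w)"
    proof (rule smooth_map_cong[rotated])
      fix p assume p: "p \<in> pts ?P"
      then have "fst p \<in> ?T" "snd p \<in> W" by auto
      from inv_eq[OF this] show "(\<lambda>(g, h, k). (g, h)) (J (N p)) = (\<lambda>(b, w). inv_into (fibre ?C b) ?\<psi> w) p"
        by (simp add: J_def N_def split_def)
    qed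
  qed
qed

lemma comp_framed: "\<exists>r. framed_bundle (comp_bundle V) r"
proof -
  obtain r where r: "\<forall>b\<^sub>0\<in>pts (bas (mul_graph_bundle V)). \<exists>T (W :: ('v \<times> 'v \<times> 'v) set) \<psi>.
      b\<^sub>0 \<in> T \<and> dim W = r \<and> local_triv (mul_graph_bundle V) T W \<psi>"
    using vector_bundle_local_triv[OF vb_graph] ..
  have "trivialized_bundle TYPE('v \<times> 'v \<times> 'v) (comp_bundle V) r"
  proof (rule trivialized_bundle.intro[OF comp_space])
    show "smooth_map (tot (comp_bundle V)) (bas (comp_bundle V)) (proj (comp_bundle V))"
      unfolding comp_bundle_simps
    proof (rule smooth_map_into_sub)
      let ?HH = "arr (Hg V) \<times>\<^sub>M arr (Hg V)" and ?S = "composable (Hg V)"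
      have S: "?S \<subseteq> pts ?HH" by (auto simp: composable_def)
      have p: "smooth_map (arr (Hg V)) (arr (Gg V)) (proj (Hb V))" using B.proj_smooth
          by (simp add: bas_Hb tot_Hb)
      have "smooth_map (sub ?HH ?S) (arr (Gg V) \<times>\<^sub>M arr (Gg V)) (\<lambda>q. (proj (Hb V) (fst q),
          proj (Hb V) (snd q)))"
        by (intro smooth_map_Pair smooth_space_sub[OF smooth_space_prod S] ssp
            smooth_map_compose[OF ssp(1) smooth_map_sub[OF smooth_map_fst S] p]
            smooth_map_compose[OF ssp(1) smooth_map_sub[OF smooth_map_snd S] p])
      then show "smooth_map (sub ?HH ?S) (arr (Gg V) \<times>\<^sub>M arr (Gg V)) (map_prod (proj (Hb V)) (proj (Hb V)))"
        by (simp add: map_prod_def split_def)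
    qed (auto simp: proj_composable)
    fix b assume b: "b \<in> pts (bas (comp_bundle V))"
    then have "mgraph (Gg V) b \<in> pts (bas (mul_graph_bundle V))"
      using graph_base by (cases b) (simp add: comp_bundle_simps)
    from r[rule_format, OF this] obtain T and W :: "('v \<times> 'v \<times> 'v) set" and \<psi>
      where t: "mgraph (Gg V) b \<in> T" "dim W = r" "local_triv (mul_graph_bundle V) T W \<psi>" by blast
    show "\<exists>T (W :: ('v \<times> 'v \<times> 'v) set) \<psi>. b \<in> T \<and> dim W = r \<and> local_triv (comp_bundle V) T W \<psi>"
    proof (intro exI conjI)
      show "b \<in> {b \<in> composable (Gg V). mgraph (Gg V) b \<in> T}" using b t(1) by (simp add: comp_bundle_simps)
    qed (fact t(2), rule comp_triv[OF t(3)])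
  qed (use comp_closed in auto)
  then show ?thesis using trivialized_bundle.framed by blast
qed

sublocale C: framed_bundle "comp_bundle V" "frame_rank (comp_bundle V)"
  using comp_framed framed_rank by blast

end

section \<open>Derived brackets\<close>

definition additive_on :: "'a::ab_group_add set \<Rightarrow> ('a \<Rightarrow> 'a) \<Rightarrow> bool" where
  "additive_on F D \<longleftrightarrow> (\<forall>\<omega>\<in>F. D \<omega> \<in> F) \<and>
    (\<forall>\<omega>\<in>F. \<forall>\<eta>\<in>F. D (\<omega> + \<eta>) = D \<omega> + D \<eta> \<and> D (\<omega> - \<eta>) = D \<omega> - D \<eta>) \<and> (\<forall>\<omega>\<in>F. D (- \<omega>) = - D \<omega>)"

text \<open>The expansions of \<open>[[x, Q], y]\<close> for odd \<open>x\<close>, \<open>Q\<close>, \<open>y\<close> and of \<open>[[[R, x], y], z]\<close> for even \<open>R\<close>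
  and odd \<open>x\<close>, \<open>y\<close>, \<open>z\<close>.\<close>

definition derived_bracket :: "('a::ab_group_add \<Rightarrow> 'a) \<Rightarrow> ('a \<Rightarrow> 'a) \<Rightarrow> ('a \<Rightarrow> 'a) \<Rightarrow> 'a \<Rightarrow> 'a" where
  "derived_bracket Q x y \<omega> = x (Q (y \<omega>)) + Q (x (y \<omega>)) - y (x (Q \<omega>)) - y (Q (x \<omega>))"

definition derived_ternary :: "('a::ab_group_add \<Rightarrow> 'a) \<Rightarrow> ('a \<Rightarrow> 'a) \<Rightarrow> ('a \<Rightarrow> 'a) \<Rightarrow> ('a \<Rightarrow> 'a) \<Rightarrow> 'a \<Rightarrow> 'a" where
  "derived_ternary R x y z \<omega> = R (x (y (z \<omega>))) - x (R (y (z \<omega>))) + y (R (x (z \<omega>))) - y (x (R (z \<omega>)))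
    - z (R (x (y \<omega>))) + z (x (R (y \<omega>))) - z (y (R (x \<omega>))) + z (y (x (R \<omega>)))"

text \<open>Operators on forms are additive on genuine forms only, so the formal identities are
  proved for elements of a set closed under addition and negation.\<close>

locale operators =
  fixes F :: "'a::ab_group_add set"
  assumes closed: "\<And>a b. a \<in> F \<Longrightarrow> b \<in> F \<Longrightarrow> a + b \<in> F" "\<And>a b. a \<in> F \<Longrightarrow> b \<in> F \<Longrightarrow> a - b \<in> F" "\<And>a. a \<in> F \<Longrightarrow> - a \<in> F"
begin

lemma additive_onD:
  assumes "additive_on F D"
  shows "\<And>\<omega>. \<omega> \<in> F \<Longrightarrow> D \<omega> \<in> F" "\<And>\<omega> \<eta>. \<omega> \<in> F \<Longrightarrow> \<eta> \<in> F \<Longrightarrow> D (\<omega> + \<eta>) = D \<omega> + D \<eta>"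
    "\<And>\<omega> \<eta>. \<omega> \<in> F \<Longrightarrow> \<eta> \<in> F \<Longrightarrow> D (\<omega> - \<eta>) = D \<omega> - D \<eta>" "\<And>\<omega>. \<omega> \<in> F \<Longrightarrow> D (- \<omega>) = - D \<omega>"
  using assms by (auto simp: additive_on_def)

text \<open>The sum of the two derived brackets is the commutator of Q with xy + yx, which is
  zero.\<close>

lemma derived_bracket_skew:
  assumes "additive_on F Q" "additive_on F x" "additive_on F y" "\<And>\<omega>. \<omega> \<in> F \<Longrightarrow> y (x \<omega>) = - x (y \<omega>)" "\<omega> \<in> F"
  shows "derived_bracket Q y x \<omega> = - derived_bracket Q x y \<omega>"
proof -
  note L = additive_onD[OF assms(1)] additive_onD[OF assms(2)] additive_onD[OF assms(3)]
  show ?thesis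
    by (simp only: derived_bracket_def L assms(4,5) closed minus_minus) (simp add: algebra_simps)
qed

lemma derived_ternary_skew:
  assumes "additive_on F R" "additive_on F x" "additive_on F y" "additive_on F z"
    and "\<And>\<omega>. \<omega> \<in> F \<Longrightarrow> y (x \<omega>) = - x (y \<omega>)" "\<And>\<omega>. \<omega> \<in> F \<Longrightarrow> z (x \<omega>) = - x (z \<omega>)"
      "\<And>\<omega>. \<omega> \<in> F \<Longrightarrow> z (y \<omega>) = - y (z \<omega>)" and \<omega>: "\<omega> \<in> F"
  shows "derived_ternary R y x z \<omega> = - derived_ternary R x y z \<omega>"
    "derived_ternary R x z y \<omega> = - derived_ternary R x y z \<omega>"
proof -
  note L = additive_onD[OF assms(1)] additive_onD[OF assms(2)] additive_onD[OF assms(3)] additive_onD[OF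
      assms(4)]
  show "derived_ternary R y x z \<omega> = - derived_ternary R x y z \<omega>"
    "derived_ternary R x z y \<omega> = - derived_ternary R x y z \<omega>"
    by (simp only: derived_ternary_def L assms(5-) closed minus_minus, simp add: algebra_simps)+
qed

text \<open>The Jacobi identity of a derived bracket fails by the derived operation of the square of
  Q. For anticommuting letters x, y, z this is an identity between words and follows by
  expansion.\<close>

lemma derived_jacobi:
  assumes "additive_on F Q" "additive_on F x" "additive_on F y" "additive_on F z" "\<omega> \<in> F"
    and "\<And>\<omega>. \<omega> \<in> F \<Longrightarrow> y (x \<omega>) = - x (y \<omega>)"
    "\<And>\<omega>. \<omega> \<in> F \<Longrightarrow> z (x \<omega>) = - x (z \<omega>)" "\<And>\<omega>. \<omega> \<in> F \<Longrightarrow> z (y \<omega>) = - y (z \<omega>)"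
  shows "derived_bracket Q x (derived_bracket Q y z) \<omega> - derived_bracket Q y (derived_bracket Q x z) \<omega>
    - derived_bracket Q (derived_bracket Q x y) z \<omega> = - derived_ternary (\<lambda>\<omega>. Q (Q \<omega>)) x y z \<omega>"
proof -
  note L = additive_onD[OF assms(1)] additive_onD[OF assms(2)] additive_onD[OF assms(3)] additive_onD[OF
      assms(4)]
  show ?thesis
    by (simp only: derived_bracket_def derived_ternary_def L assms(5-) closed minus_minus) (simp add:
        algebra_simps)
qed

text \<open>Commutation of Q with R makes the ternary operation of R compatible with the bracket of
  Q. The summands on the right keep the slots in which the brackets arise in the expansion.\<close>

lemma derived_coherence:
  assumes ad: "additive_on F Q" "additive_on F R" "additive_on F w" "additive_on F x" "additive_on F y"
      "additive_on F z"
    and a: "\<And>\<omega>. \<omega> \<in> F \<Longrightarrow> x (w \<omega>) = - w (x \<omega>)" "\<And>\<omega>. \<omega> \<in> F \<Longrightarrow> y (w \<omega>) = - w (y \<omega>)"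
    "\<And>\<omega>. \<omega> \<in> F \<Longrightarrow> z (w \<omega>) = - w (z \<omega>)" "\<And>\<omega>. \<omega> \<in> F \<Longrightarrow> y (x \<omega>) = - x (y \<omega>)"
    "\<And>\<omega>. \<omega> \<in> F \<Longrightarrow> z (x \<omega>) = - x (z \<omega>)" "\<And>\<omega>. \<omega> \<in> F \<Longrightarrow> z (y \<omega>) = - y (z \<omega>)"
    and c: "\<And>\<omega>. \<omega> \<in> F \<Longrightarrow> R (Q \<omega>) = Q (R \<omega>)"
    and t: "\<And>\<omega>. \<omega> \<in> F \<Longrightarrow> derived_ternary R w x y (z \<omega>) + z (derived_ternary R w x y \<omega>) = 0"
    and \<omega>: "\<omega> \<in> F"
  shows "derived_bracket Q w (derived_ternary R x y z) \<omega> - derived_bracket Q x (derived_ternary R w y z) \<omega>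
    + derived_bracket Q y (derived_ternary R w x z) \<omega> - derived_bracket Q z (derived_ternary R w x y) \<omega> =
    derived_ternary R (derived_bracket Q w x) y z \<omega> + derived_ternary R x (derived_bracket Q w y) z \<omega>
    + derived_ternary R x y (derived_bracket Q w z) \<omega> + derived_ternary R w x (derived_bracket Q y z) \<omega>
    - derived_ternary R w (derived_bracket Q x y) z \<omega> - derived_ternary R w y (derived_bracket Q x z) \<omega>"
    (is "?l = ?r")
proof -
  note L = additive_onD[OF ad(1)] additive_onD[OF ad(2)] additive_onD[OF ad(3)]
    additive_onD[OF ad(4)] additive_onD[OF ad(5)] additive_onD[OF ad(6)]
  \<comment> \<open>With T the ternary operator of w, x, y, the two sides differ by the commutator
    of Q with T z + z T. The relations between the letters do not make it vanish; hypothesis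
    \<open>t\<close> does, and it holds when T is itself a contraction.\<close>
  have "?l + (Q (derived_ternary R w x y (z \<omega>) + z (derived_ternary R w x y \<omega>))
    - (derived_ternary R w x y (z (Q \<omega>)) + z (derived_ternary R w x y (Q \<omega>)))) = ?r"
    by (simp only: derived_bracket_def derived_ternary_def L closed a c \<omega> minus_minus) (simp only:
        algebra_simps)
  moreover have "Q 0 = 0" using additive_onD(3)[OF ad(1) \<omega> \<omega>] by simp
  ultimately show ?thesis using t[OF \<omega>] t[OF additive_onD(1)[OF ad(1) \<omega>]] by simp
qed

end

context framed_bundle
begin

sublocale operators "forms B"
  by unfold_locales (auto intro: forms_add forms_diff forms_uminus)

lemma graded_additive: "graded_derivation B s p D \<Longrightarrow> additive_on (forms B) D"
  unfolding additive_on_def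
  using graded_derivationD(2,5) derivation_diff derivation_uminus by blast

lemma contract_additive: "X \<in> sections B \<Longrightarrow> additive_on (forms B) (contract B X)"
  by (rule graded_additive[OF contract_graded])

lemma contract_anticommute:
  assumes "X \<in> sections B" "Y \<in> sections B" "\<omega> \<in> forms B"
  shows "contract B Y (contract B X \<omega>) = - contract B X (contract B Y \<omega>)"
proof (intro ext)
  fix b hs
  show "contract B Y (contract B X \<omega>) b hs = (- contract B X (contract B Y \<omega>)) b hs"
  proof (cases "b \<in> pts (bas B) \<and> set hs \<subseteq> fibre B b")
    case True
    then show ?thesis
      using alt_map_skew[OF forms_alt[OF assms(3)] vadd_in, of b "[]" hs "X b" "Y b"] section_in assms(1,2)
      by (auto simp: contract_def in_lists_conv_set subset_iff)
  next
    case False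
    then show ?thesis using forms_zero[OF assms(3), of b] by (auto simp: contract_def)
  qed
qed

lemma gcomm_derived_bracket:
  assumes "X \<in> sections B" "Y \<in> sections B" "additive_on (forms B) Q" "\<omega> \<in> forms B"
  shows "gcomm 0 1 (gcomm 1 1 (contract B X) Q) (contract B Y) \<omega> =
      derived_bracket Q (contract B X) (contract B Y) \<omega>"
  using additive_onD[OF contract_additive[OF assms(1)]] additive_onD[OF contract_additive[OF assms(2)]]
    additive_onD[OF assms(3)] assms(4)
  by (simp add: gcomm_even gcomm_odd derived_bracket_def)

lemma gcomm_derived_ternary:
  assumes "X \<in> sections B" "Y \<in> sections B" "Z \<in> sections B" "\<And>\<omega>. \<omega> \<in> forms B \<Longrightarrow> R \<omega> \<in> forms B" "\<omega> \<in> forms B"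
  shows "gcomm 0 1 (gcomm 1 1 (gcomm 2 1 R (contract B X)) (contract B Y)) (contract B Z) \<omega> =
    derived_ternary R (contract B X) (contract B Y) (contract B Z) \<omega>"
  using additive_onD[OF contract_additive[OF assms(1)]] additive_onD[OF contract_additive[OF assms(2)]]
    additive_onD[OF contract_additive[OF assms(3)]] assms(4,5) closed
  by (simp add: gcomm_even gcomm_odd derived_ternary_def)

text \<open>Commutators add parities as natural numbers, while the sign rule sees them modulo 2;
  this resets the representative.\<close>

lemma graded_parity: "graded_derivation B s p D \<Longrightarrow> even p = even p' \<Longrightarrow> graded_derivation B s p' D"
proof -
  assume D: "graded_derivation B s p D" and p: "even p = even p'"
  have "(- 1 :: real) ^ (p * k) = (- 1) ^ (p' * k)" for k using p by (simp add: minus_one_power_iff)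
  then show ?thesis using D p unfolding graded_derivation_def by simp
qed

lemma bracket_graded:
  assumes Q: "graded_derivation B 1 1 Q" and X: "X \<in> sections B" "Y \<in> sections B"
  shows "graded_derivation B (- 1) 1 (gcomm 0 1 (gcomm 1 1 (contract B X) Q) (contract B Y))"
proof -
  have "graded_derivation B 0 0 (gcomm 1 1 (contract B X) Q)"
    using graded_parity[OF gcomm_graded[OF contract_graded[OF X(1)] Q], of 0] by simp
  from gcomm_graded[OF this contract_graded[OF X(2)]] show ?thesis by simp
qed

lemma ternary_graded:
  assumes R: "graded_derivation B 2 2 R" and X: "X \<in> sections B" "Y \<in> sections B" "Z \<in> sections B"
  shows "graded_derivation B (- 1) 1 (gcomm 0 1 (gcomm 1 1 (gcomm 2 1 R (contract B X)) (contract B Y))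
      (contract B Z))"
proof -
  have "graded_derivation B 1 1 (gcomm 2 1 R (contract B X))"
    using graded_parity[OF gcomm_graded[OF R contract_graded[OF X(1)]], of 1] by simp
  from graded_parity[OF gcomm_graded[OF this contract_graded[OF X(2)]], of 0]
  have "graded_derivation B 0 0 (gcomm 1 1 (gcomm 2 1 R (contract B X)) (contract B Y))" by simp
  from gcomm_graded[OF this contract_graded[OF X(3)]] show ?thesis by simp
qed

text \<open>Existence is \<open>derivation_contract\<close>, uniqueness the separation of points by
  one-forms. It makes the definite descriptions of the bracket and of the ternary operation
  meaningful.\<close>

lemma derivation_contract_ex1:
  assumes D: "graded_derivation B (- 1) 1 D"
  shows "\<exists>!Z. Z \<in> sections B \<and> (\<forall>\<omega>\<in>forms B. contract B Z \<omega> = D \<omega>)"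
proof -
  obtain Z where "Z \<in> sections B" "\<And>\<omega>. \<omega> \<in> forms B \<Longrightarrow> contract B Z \<omega> = D \<omega>"
    using derivation_contract[OF D] by blast
  then show ?thesis by (intro ex1I[of _ Z]) (auto intro!: section_eqI simp: k_forms_forms)
qed

lemma section_eq_iff:
  assumes "X \<in> sections B" "Y \<in> sections B"
  shows "X = Y \<longleftrightarrow> (\<forall>\<omega>\<in>forms B. contract B X \<omega> = contract B Y \<omega>)"
  using section_eqI[OF assms] k_forms_forms by blast

subsection \<open>The module of sections\<close>

abbreviation "sadd \<equiv> add (section_space B)"
abbreviation "sscl \<equiv> smult (section_space B)"
abbreviation "szero \<equiv> zero (section_space B)"

lemma sections_apply:
  "b \<in> pts (bas B) \<Longrightarrow> sadd X Y b = vadd B (X b) (Y b)"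
  "b \<in> pts (bas B) \<Longrightarrow> sscl a X b = vscl B a (X b)"
  "b \<in> pts (bas B) \<Longrightarrow> szero b = vzer B b"
  by (simp_all add: section_space_def)

lemma sectionI:
  assumes "Z \<in> extensional (pts (bas B))" "\<And>b. b \<in> pts (bas B) \<Longrightarrow> Z b \<in> fibre B b"
    "\<And>\<alpha>. \<alpha> \<in> k_forms B 1 \<Longrightarrow> smooth_fun (bas B) (\<lambda>b. \<alpha> b [Z b])"
  shows "Z \<in> sections B"
  using assms section_smooth[of Z] by (simp add: sections_def)

lemma one_form_section_smooth: "\<alpha> \<in> k_forms B 1 \<Longrightarrow> X \<in> sections B \<Longrightarrow> smooth_fun (bas B) (\<lambda>b. \<alpha> b [X b])"
  using forms_smooth[OF k_forms_forms, of \<alpha> 1 "[X]"] by simp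

lemma one_form_vzer: "\<omega> \<in> forms B \<Longrightarrow> b \<in> pts (bas B) \<Longrightarrow> \<omega> b [vzer B b] = 0"
  using one_form_vadd(2)[OF _ _ vzer_in, of \<omega> b 0] vscl_zero[OF _ vzer_in] by simp

lemma sadd_in: "X \<in> sections B \<Longrightarrow> Y \<in> sections B \<Longrightarrow> sadd X Y \<in> sections B"
proof (rule sectionI)
  fix \<alpha> assume X: "X \<in> sections B" "Y \<in> sections B" and \<alpha>: "\<alpha> \<in> k_forms B 1"
  show "smooth_fun (bas B) (\<lambda>b. \<alpha> b [sadd X Y b])"
    by (rule smooth_map_cong[OF _ smooth_fun_add[OF base(1) one_form_section_smooth[OF \<alpha> X(1)]
        one_form_section_smooth[OF \<alpha> X(2)]]])
      (simp add: sections_apply one_form_vadd[OF k_forms_forms[OF \<alpha>]] section_in X)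
qed (auto simp: section_space_def section_in vadd_in)

lemma sscl_in: "X \<in> sections B \<Longrightarrow> sscl a X \<in> sections B"
proof (rule sectionI)
  fix \<alpha> assume X: "X \<in> sections B" and \<alpha>: "\<alpha> \<in> k_forms B 1"
  show "smooth_fun (bas B) (\<lambda>b. \<alpha> b [sscl a X b])"
    by (rule smooth_map_cong[OF _ smooth_fun_mult[OF base(1) smooth_fun_const[OF base(1), of a]
        one_form_section_smooth[OF \<alpha> X]]])
      (simp add: sections_apply one_form_vadd[OF k_forms_forms[OF \<alpha>]] section_in X)
qed (auto simp: section_space_def section_in vscl_in)

lemma szero_in: "szero \<in> sections B"
proof (rule sectionI)
  fix \<alpha> assume \<alpha>: "\<alpha> \<in> k_forms B 1"
  show "smooth_fun (bas B) (\<lambda>b. \<alpha> b [szero b])"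
    by (rule smooth_map_cong[OF _ smooth_fun_const[OF base(1), of 0]])
      (simp add: sections_apply one_form_vzer[OF k_forms_forms[OF \<alpha>]])
qed (auto simp: section_space_def vzer_in)

lemma contract_functional:
  assumes \<omega>: "\<omega> \<in> forms B" and b: "b \<in> pts (bas B)" and h: "h \<in> fibre B b"
  shows "k \<in> fibre B b \<Longrightarrow> \<omega> b (vadd B h k # hs) = \<omega> b (h # hs) + \<omega> b (k # hs)"
    "\<omega> b (vscl B a h # hs) = a * \<omega> b (h # hs)"
proof -
  show "\<omega> b (vadd B h k # hs) = \<omega> b (h # hs) + \<omega> b (k # hs)" if "k \<in> fibre B b"
  proof (cases "set hs \<subseteq> fibre B b")
    case True
    then show ?thesis using alt_mapD(1)[OF forms_alt[OF \<omega> b], of "[]" hs h k] h that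
        by (auto simp: in_lists_conv_set)
  next
    case False
    then show ?thesis using forms_zero[OF \<omega>] by simp
  qed
  show "\<omega> b (vscl B a h # hs) = a * \<omega> b (h # hs)"
  proof (cases "set hs \<subseteq> fibre B b")
    case True
    then show ?thesis using alt_mapD(2)[OF forms_alt[OF \<omega> b], of "[]" hs h a] h
        by (auto simp: in_lists_conv_set)
  next
    case False
    then show ?thesis using forms_zero[OF \<omega>] by simp
  qed
qed

lemma contract_sadd:
  assumes "X \<in> sections B" "Y \<in> sections B" "\<omega> \<in> forms B"
  shows "contract B (sadd X Y) \<omega> = contract B X \<omega> + contract B Y \<omega>"
  by (intro ext) (use assms in \<open>simp add: contract_def sections_apply contract_functional section_in\<close>)

lemma contract_sscl:
  assumes "X \<in> sections B" "\<omega> \<in> forms B"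
  shows "contract B (sscl a X) \<omega> = (\<lambda>b hs. a * contract B X \<omega> b hs)"
  by (intro ext) (use assms in \<open>simp add: contract_def sections_apply contract_functional section_in\<close>)

lemma contract_szero:
  assumes "\<omega> \<in> forms B"
  shows "contract B szero \<omega> = 0"
proof (intro ext)
  fix b hs
  show "contract B szero \<omega> b hs = 0 b hs"
  proof (cases "b \<in> pts (bas B)")
    case True
    then show ?thesis
      using contract_functional(2)[OF assms True vzer_in[OF True], of 0 hs] vscl_zero[OF True vzer_in[OF
          True]]
      by (simp add: contract_def sections_apply)
  qed (simp add: contract_def)
qed

end

section \<open>Modules over the real numbers\<close>

lemma real_field_cring: "cring real_field"
proof -
  have "\<exists>y. x + y = 0 \<and> y + x = 0" for x :: real by (rule exI[of _ "- x"]) simp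
  then show ?thesis
    by (unfold_locales) (auto simp: real_field_def Units_def algebra_simps)
qed

lemma real_module_facts:
  assumes "Module.module real_field M"
  shows "x \<in> carrier M \<Longrightarrow> \<ominus>\<^bsub>M\<^esub> x = smult M (- 1) x"
    "x \<in> carrier M \<Longrightarrow> y \<in> carrier M \<Longrightarrow> x \<ominus>\<^bsub>M\<^esub> y = add M x (smult M (- 1) y)"
proof -
  interpret Module.module real_field M by fact
  interpret R: cring real_field by (rule real_field_cring)
  have m1: "\<ominus>\<^bsub>real_field\<^esub> \<one>\<^bsub>real_field\<^esub> = - 1"
    by (rule R.minus_equality) (auto simp: real_field_def)
  have 1: "\<ominus>\<^bsub>M\<^esub> x = smult M (- 1) x" if "x \<in> carrier M" for x
    using smult_l_minus[of "\<one>\<^bsub>real_field\<^esub>" x] that m1 by simp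
  then show "x \<in> carrier M \<Longrightarrow> \<ominus>\<^bsub>M\<^esub> x = smult M (- 1) x" .
  show "x \<in> carrier M \<Longrightarrow> y \<in> carrier M \<Longrightarrow> x \<ominus>\<^bsub>M\<^esub> y = add M x (smult M (- 1) y)"
    using 1 by (simp add: a_minus_def)
qed

lemma real_moduleI:
  fixes M :: "(real, 'a) module"
  assumes "zero M \<in> carrier M" "\<And>x y. x \<in> carrier M \<Longrightarrow> y \<in> carrier M \<Longrightarrow> add M x y \<in> carrier M"
    "\<And>a x. x \<in> carrier M \<Longrightarrow> smult M a x \<in> carrier M"
    "\<And>x y z. x \<in> carrier M \<Longrightarrow> y \<in> carrier M \<Longrightarrow> z \<in> carrier M \<Longrightarrow> add M (add M x y) z = add M x (add M y z)"
    "\<And>x y. x \<in> carrier M \<Longrightarrow> y \<in> carrier M \<Longrightarrow> add M x y = add M y x"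
    "\<And>x. x \<in> carrier M \<Longrightarrow> add M (zero M) x = x"
    "\<And>x. x \<in> carrier M \<Longrightarrow> add M (smult M (- 1) x) x = zero M"
    "\<And>a b x. x \<in> carrier M \<Longrightarrow> smult M (a + b) x = add M (smult M a x) (smult M b x)"
    "\<And>a x y. x \<in> carrier M \<Longrightarrow> y \<in> carrier M \<Longrightarrow> smult M a (add M x y) = add M (smult M a x) (smult M a y)"
    "\<And>a b x. x \<in> carrier M \<Longrightarrow> smult M (a * b) x = smult M a (smult M b x)"
    "\<And>x. x \<in> carrier M \<Longrightarrow> smult M 1 x = x"
  shows "Module.module real_field M"
proof (rule module.intro[OF real_field_cring])
  show "abelian_group M"
  proof (rule abelian_groupI)
    show "\<exists>y\<in>carrier M. add M y x = zero M" if "x \<in> carrier M" for x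
      using assms(3,7) that by blast
  qed (use assms in auto)
  show "module_axioms real_field M"
    by unfold_locales (use assms in \<open>auto simp: real_field_def\<close>)
qed

section \<open>Compatible triples of sections\<close>

context vb_gpd
begin

lemma comp_linear:
  "fibre_linear (comp_bundle V) (Hb V) fst fst" "fibre_linear (comp_bundle V) (Hb V) snd snd"
  "fibre_linear (comp_bundle V) (Hb V) (\<lambda>(x, y). mul (Hg V) x y) (\<lambda>(g, h). mul (Gg V) g h)"
proof -
  have *: "fst p \<in> fibre (Hb V) (fst b) \<and> snd p \<in> fibre (Hb V) (snd b)"
    if "p \<in> fibre (comp_bundle V) b" for p b
    using that by (cases p, cases b) (auto simp: comp_fibre fibre_Hb dest: H.composableD)
  show "fibre_linear (comp_bundle V) (Hb V) fst fst" "fibre_linear (comp_bundle V) (Hb V) snd snd"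
    unfolding fibre_linear_def using * by (auto simp: comp_bundle_simps)
  show "fibre_linear (comp_bundle V) (Hb V) (\<lambda>(x, y). mul (Hg V) x y) (\<lambda>(g, h). mul (Gg V) g h)"
    unfolding fibre_linear_def
  proof (intro ballI conjI allI)
    fix b p assume b: "b \<in> pts (bas (comp_bundle V))" and p: "p \<in> fibre (comp_bundle V) b"
    obtain g h where gh: "b = (g, h)" by fastforce
    obtain x y where xy: "p = (x, y)" by fastforce
    have c: "(x, y) \<in> composable (Hg V)" "proj (Hb V) x = g" "proj (Hb V) y = h"
      using p by (auto simp: gh xy comp_fibre)
    show "(\<lambda>(x, y). mul (Hg V) x y) p \<in> fibre (Hb V) ((\<lambda>(g, h). mul (Gg V) g h) b)"
      using c by (simp add: gh xy fibre_Hb H.mul_in proj_mul)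
    show "(\<lambda>(x, y). mul (Hg V) x y) (vscl (comp_bundle V) a p) = vscl (Hb V) a ((\<lambda>(x, y). mul (Hg V) x y) p)"
        for a
      using c by (simp add: xy comp_bundle_simps interchange_scl)
    fix q assume q: "q \<in> fibre (comp_bundle V) b"
    obtain u v where uv: "q = (u, v)" by fastforce
    have d: "(u, v) \<in> composable (Hg V)" "proj (Hb V) u = g" "proj (Hb V) v = h"
      using q by (auto simp: gh uv comp_fibre)
    show "(\<lambda>(x, y). mul (Hg V) x y) (vadd (comp_bundle V) p q) =
      vadd (Hb V) ((\<lambda>(x, y). mul (Hg V) x y) p) ((\<lambda>(x, y). mul (Hg V) x y) q)"
      using c d by (simp add: xy uv comp_bundle_simps interchange)
  qed
qed

lemma comp_smooth:
  "smooth_map (tot (comp_bundle V)) (tot (Hb V)) fst" "smooth_map (bas (comp_bundle V)) (bas (Hb V)) fst"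
  "smooth_map (tot (comp_bundle V)) (tot (Hb V)) snd" "smooth_map (bas (comp_bundle V)) (bas (Hb V)) snd"
  "smooth_map (tot (comp_bundle V)) (tot (Hb V)) (\<lambda>(x, y). mul (Hg V) x y)"
  "smooth_map (bas (comp_bundle V)) (bas (Hb V)) (\<lambda>(g, h). mul (Gg V) g h)"
  unfolding comp_bundle_simps bas_Hb tot_Hb
  by (intro smooth_map_sub smooth_map_fst smooth_map_snd ssp smooth_structure; auto simp: composable_def)+

lemmas pull_defs = pull_fst_def pull_snd_def pull_mul_def

lemma pull_forms:
  assumes "\<omega> \<in> forms (Hb V)"
  shows "pull_fst V \<omega> \<in> forms (comp_bundle V)" "pull_snd V \<omega> \<in> forms (comp_bundle V)"
      "pull_mul V \<omega> \<in> forms (comp_bundle V)"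
  unfolding pull_defs
  by (intro pullback_forms[OF C.framed_bundle_axioms B.framed_bundle_axioms] comp_smooth comp_linear assms)+

text \<open>\<open>D2\<close> on the composable pairs is related to \<open>D1\<close>,
  \<open>D0\<close> and \<open>D\<close> by the two projections and the multiplication. The case of
  three equal operators is multiplicativity; the case D1 = D and D0 = 0 is right invariance.\<close>

definition op_triple where
  "op_triple D1 D0 D D2 \<longleftrightarrow> intertwines (Hb V) (pull_fst V) D1 D2 \<and> intertwines (Hb V) (pull_snd V) D0 D2
    \<and> intertwines (Hb V) (pull_mul V) D D2"

lemma op_triple_gcomm:
  assumes "op_triple D1 D0 D D2" "op_triple D1' D0' D' D2'"
    and "D1 \<in> forms (Hb V) \<rightarrow> forms (Hb V)" "D0 \<in> forms (Hb V) \<rightarrow> forms (Hb V)"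
        "D \<in> forms (Hb V) \<rightarrow> forms (Hb V)"
    and "D1' \<in> forms (Hb V) \<rightarrow> forms (Hb V)" "D0' \<in> forms (Hb V) \<rightarrow> forms (Hb V)"
        "D' \<in> forms (Hb V) \<rightarrow> forms (Hb V)"
  shows "op_triple (gcomm d e D1 D1') (gcomm d e D0 D0') (gcomm d e D D') (gcomm d e D2 D2')"
  using assms unfolding op_triple_def pull_defs by (auto intro!: intertwines_gcomm)

lemma gcomm_forms:
  assumes "D \<in> forms (Hb V) \<rightarrow> forms (Hb V)" "D' \<in> forms (Hb V) \<rightarrow> forms (Hb V)"
  shows "gcomm d e D D' \<in> forms (Hb V) \<rightarrow> forms (Hb V)"
proof
  fix \<omega> assume "\<omega> \<in> forms (Hb V)"
  then show "gcomm d e D D' \<omega> \<in> forms (Hb V)"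
    using assms by (cases "even (d * e)") (auto simp: gcomm_even gcomm_odd simp del: even_mult_iff intro!:
        B.forms_add B.forms_diff)
qed

text \<open>Triples \<open>(X\<^sub>1, X\<^sub>0, X)\<close> such that the section \<open>(X\<^sub>1, X\<^sub>0)\<close> over the composable pairs is related
  to \<open>X\<close> by the multiplication. The bracket and the ternary operation act on them componentwise.\<close>

definition mult_triple where
  "mult_triple X1 X0 X \<longleftrightarrow> X1 \<in> sections (Hb V) \<and> X0 \<in> sections (Hb V) \<and> X \<in> sections (Hb V) \<and>
    (\<forall>g h. (g, h) \<in> composable (Gg V) \<longrightarrow> (X1 g, X0 h) \<in> composable (Hg V) \<and> X (mul (Gg V) g h) = mul (Hg V) (X1
        g) (X0 h))"

lemma section_Hb:
  assumes "X \<in> sections (Hb V)" "g \<in> pts (arr (Gg V))"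
  shows "X g \<in> fibre (Hb V) g" "X g \<in> pts (arr (Hg V))" "proj (Hb V) (X g) = g"
  using B.section_in[OF assms(1), of g] assms(2) by (simp_all add: bas_Hb fibre_Hb)

lemma section_Hb_smooth: "X \<in> sections (Hb V) \<Longrightarrow> smooth_map (arr (Gg V)) (arr (Hg V)) X"
  by (simp add: sections_def bas_Hb tot_Hb)

text \<open>The pair (X1, X0) is a section of the bundle of composable pairs, and sections related
  by a bundle map have related contractions.\<close>

lemma mult_triple_contract:
  assumes t: "mult_triple X1 X0 X"
  obtains P where "P \<in> sections (comp_bundle V)"
    "op_triple (contract (Hb V) X1) (contract (Hb V) X0) (contract (Hb V) X) (contract (comp_bundle V) P)"
proof -
  have X: "X1 \<in> sections (Hb V)" "X0 \<in> sections (Hb V)" "X \<in> sections (Hb V)"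
    and c: "\<And>g h. (g, h) \<in> composable (Gg V) \<Longrightarrow> (X1 g, X0 h) \<in> composable (Hg V) \<and> X (mul (Gg V) g h) =
        mul (Hg V) (X1 g) (X0 h)"
    using t by (auto simp: mult_triple_def)
  define P where "P = restrict (\<lambda>p. (X1 (fst p), X0 (snd p))) (composable (Gg V))"
  have Pf: "P b \<in> fibre (comp_bundle V) b" if "b \<in> pts (bas (comp_bundle V))" for b
    using that c section_Hb(3)[OF X(1)] section_Hb(3)[OF X(2)]
    by (cases b) (auto simp: comp_bundle_simps P_def comp_fibre dest: G.composableD)
  have SC: "composable (Gg V) \<subseteq> pts (arr (Gg V) \<times>\<^sub>M arr (Gg V))" by (auto simp: composable_def)
  have "smooth_map (sub (arr (Gg V) \<times>\<^sub>M arr (Gg V)) (composable (Gg V))) (arr (Hg V) \<times>\<^sub>M arr (Hg V)) (\<lambda>p. (X1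
      (fst p), X0 (snd p)))"
    by (intro smooth_map_Pair smooth_space_sub[OF smooth_space_prod SC] ssp
        smooth_map_compose[OF ssp(2) smooth_map_sub[OF smooth_map_fst SC] section_Hb_smooth[OF X(1)]]
        smooth_map_compose[OF ssp(2) smooth_map_sub[OF smooth_map_snd SC] section_Hb_smooth[OF X(2)]])
  then have "smooth_map (sub (arr (Gg V) \<times>\<^sub>M arr (Gg V)) (composable (Gg V))) (arr (Hg V) \<times>\<^sub>M arr (Hg V)) P"
    by (rule smooth_map_cong[rotated]) (simp add: P_def)
  then have "smooth_map (bas (comp_bundle V)) (tot (comp_bundle V)) P"
    unfolding comp_bundle_simps
    by (rule smooth_map_into_sub) (use c in \<open>auto simp: P_def\<close>)
  then have PS: "P \<in> sections (comp_bundle V)"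
    using Pf by (simp add: sections_def P_def comp_bundle_simps)
  have m: "fst b \<in> pts (bas (Hb V)) \<and> snd b \<in> pts (bas (Hb V)) \<and>
      (\<lambda>(g, h). mul (Gg V) g h) b \<in> pts (bas (Hb V))"
    if "b \<in> pts (bas (comp_bundle V))" for b
    using that by (cases b) (auto simp: comp_bundle_simps bas_Hb G.mul_in dest: G.composableD)
  have P: "fst (P b) = X1 (fst b)" "snd (P b) = X0 (snd b)" "(\<lambda>(x, y). mul (Hg V) x y) (P b) =
      X ((\<lambda>(g, h). mul (Gg V) g h) b)"
    if "b \<in> pts (bas (comp_bundle V))" for b
    using that c by (cases b; simp add: comp_bundle_simps P_def)+
  have "op_triple (contract (Hb V) X1) (contract (Hb V) X0) (contract (Hb V) X) (contract (comp_bundle V) P)"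
    unfolding op_triple_def pull_defs
    by (intro conjI intertwines_contract Pf P) (use m in blast)+
  then show ?thesis using that PS by blast
qed

text \<open>A derivation of degree -1 on the composable pairs is the contraction with a section P.
  Testing P on one-forms pulled back by the projections and by the multiplication identifies its
  components with Z1 and Z0 and their product with Z.\<close>

lemma contract_mult_triple:
  assumes t: "op_triple (contract (Hb V) Z1) (contract (Hb V) Z0) (contract (Hb V) Z) D2"
    and D2: "graded_derivation (comp_bundle V) (- 1) p D2"
    and Z: "Z1 \<in> sections (Hb V)" "Z0 \<in> sections (Hb V)" "Z \<in> sections (Hb V)"
  shows "mult_triple Z1 Z0 Z"
  unfolding mult_triple_def
proof (intro conjI allI impI Z)
  obtain P where P: "P \<in> sections (comp_bundle V)" "\<And>\<omega>. \<omega> \<in> forms (comp_bundle V) \<Longrightarrow>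
      contract (comp_bundle V) P \<omega> = D2 \<omega>"
    using C.derivation_contract[OF D2] by blast
  fix g h assume gh: "(g, h) \<in> composable (Gg V)"
  note g = G.composableD[OF gh]
  have b: "(g, h) \<in> pts (bas (comp_bundle V))" using gh by (simp add: comp_bundle_simps)
  obtain x y where xy: "P (g, h) = (x, y)" by fastforce
  have c: "(x, y) \<in> composable (Hg V)" "proj (Hb V) x = g" "proj (Hb V) y = h"
    using C.section_in[OF P(1) b] by (auto simp: xy comp_fibre)
  have Pf: "set [P (g, h)] \<subseteq> fibre (comp_bundle V) (g, h)" using C.section_in[OF P(1) b] by simp
  have gB: "g \<in> pts (bas (Hb V))" "h \<in> pts (bas (Hb V))" "mul (Gg V) g h \<in> pts (bas (Hb V))"
    using g gh by (auto simp: bas_Hb G.mul_in)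
  have fb: "x \<in> fibre (Hb V) g" "y \<in> fibre (Hb V) h" "mul (Hg V) x y \<in> fibre (Hb V) (mul (Gg V) g h)"
    using c H.composableD[OF c(1)] by (auto simp: fibre_Hb proj_mul H.mul_in)
  have e: "D2 (pull_fst V \<alpha>) = pull_fst V (contract (Hb V) Z1 \<alpha>)" "D2 (pull_snd V \<alpha>) =
      pull_snd V (contract (Hb V) Z0 \<alpha>)"
    "D2 (pull_mul V \<alpha>) = pull_mul V (contract (Hb V) Z \<alpha>)" if "\<alpha> \<in> forms (Hb V)" for \<alpha>
    using t that unfolding op_triple_def intertwines_def by blast+
  have "x = Z1 g"
  proof (rule B.point_eqI[OF gB(1) fb(1) B.section_in[OF Z(1) gB(1)]])
    fix \<alpha> assume "\<alpha> \<in> k_forms (Hb V) 1"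
    then have \<alpha>: "\<alpha> \<in> forms (Hb V)" by (rule B.k_forms_forms)
    have "contract (comp_bundle V) P (pull_fst V \<alpha>) (g, h) [] = pull_fst V (contract (Hb V) Z1 \<alpha>) (g, h) []"
      using P(2)[OF pull_forms(1)[OF \<alpha>]] e(1)[OF \<alpha>] by simp
    then show "\<alpha> g [x] = \<alpha> g [Z1 g]" using b Pf gB(1) by (simp add: contract_def pull_fst_def pullback_def xy)
  qed
  moreover have "y = Z0 h"
  proof (rule B.point_eqI[OF gB(2) fb(2) B.section_in[OF Z(2) gB(2)]])
    fix \<alpha> assume "\<alpha> \<in> k_forms (Hb V) 1"
    then have \<alpha>: "\<alpha> \<in> forms (Hb V)" by (rule B.k_forms_forms)
    have "contract (comp_bundle V) P (pull_snd V \<alpha>) (g, h) [] = pull_snd V (contract (Hb V) Z0 \<alpha>) (g, h) []"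
      using P(2)[OF pull_forms(2)[OF \<alpha>]] e(2)[OF \<alpha>] by simp
    then show "\<alpha> h [y] = \<alpha> h [Z0 h]" using b Pf gB(2) by (simp add: contract_def pull_snd_def pullback_def xy)
  qed
  moreover have "mul (Hg V) x y = Z (mul (Gg V) g h)"
  proof (rule B.point_eqI[OF gB(3) fb(3) B.section_in[OF Z(3) gB(3)]])
    fix \<alpha> assume "\<alpha> \<in> k_forms (Hb V) 1"
    then have \<alpha>: "\<alpha> \<in> forms (Hb V)" by (rule B.k_forms_forms)
    have "contract (comp_bundle V) P (pull_mul V \<alpha>) (g, h) [] = pull_mul V (contract (Hb V) Z \<alpha>) (g, h) []"
      using P(2)[OF pull_forms(3)[OF \<alpha>]] e(3)[OF \<alpha>] by simp
    then show "\<alpha> (mul (Gg V) g h) [mul (Hg V) x y] = \<alpha> (mul (Gg V) g h) [Z (mul (Gg V) g h)]"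
      using b Pf gB(3) by (simp add: contract_def pull_mul_def pullback_def xy)
  qed
  ultimately show "(Z1 g, Z0 h) \<in> composable (Hg V)" "Z (mul (Gg V) g h) = mul (Hg V) (Z1 g) (Z0 h)"
    using c(1) by auto
qed

lemma op_triple_cong:
  assumes "op_triple D1 D0 D D2" "\<And>\<omega>. \<omega> \<in> forms (Hb V) \<Longrightarrow> D1' \<omega> = D1 \<omega>"
    "\<And>\<omega>. \<omega> \<in> forms (Hb V) \<Longrightarrow> D0' \<omega> = D0 \<omega>" "\<And>\<omega>. \<omega> \<in> forms (Hb V) \<Longrightarrow> D' \<omega> = D \<omega>"
  shows "op_triple D1' D0' D' D2"
  using assms unfolding op_triple_def intertwines_def by simp

subsection \<open>Zero, units and inverses\<close>

lemma zero_arr: "g \<in> pts (arr (Gg V)) \<Longrightarrow> vzer (Hb V) g \<in> fibre (Hb V) g"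
  "g \<in> pts (arr (Gg V)) \<Longrightarrow> vzer (Hb V) g \<in> pts (arr (Hg V))" "g \<in> pts (arr (Gg V)) \<Longrightarrow>
      proj (Hb V) (vzer (Hb V) g) = g"
  using B.vzer_in by (auto simp: bas_Hb fibre_Hb)

lemma fibre_linear_zero:
  assumes "framed_bundle B1 r" "framed_bundle B2 r'" "fibre_linear B1 B2 F f" "b \<in> pts (bas B1)"
      "f b \<in> pts (bas B2)"
  shows "F (vzer B1 b) = vzer B2 (f b)"
proof -
  interpret B1: framed_bundle B1 r by fact
  interpret B2: framed_bundle B2 r' by fact
  have z: "vzer B1 b \<in> fibre B1 b" by (rule B1.vzer_in[OF assms(4)])
  then have "F (vscl B1 0 (vzer B1 b)) = vscl B2 0 (F (vzer B1 b))" "F (vzer B1 b) \<in> fibre B2 (f b)"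
    using assms(3,4) unfolding fibre_linear_def by blast+
  then show ?thesis using B1.vscl_zero[OF assms(4) z] B2.vscl_zero[OF assms(5)] by simp
qed

lemma src_zero: "g \<in> pts (arr (Gg V)) \<Longrightarrow> src (Hg V) (vzer (Hb V) g) = vzer (Eb V) (src (Gg V) g)"
  and tgt_zero: "g \<in> pts (arr (Gg V)) \<Longrightarrow> tgt (Hg V) (vzer (Hb V) g) = vzer (Eb V) (tgt (Gg V) g)"
  and unt_zero: "x \<in> pts (obj (Gg V)) \<Longrightarrow> unt (Hg V) (vzer (Eb V) x) = vzer (Hb V) (unt (Gg V) x)"
  using fibre_linear_zero[OF B.framed_bundle_axioms E.framed_bundle_axioms src_linear]
    fibre_linear_zero[OF B.framed_bundle_axioms E.framed_bundle_axioms tgt_linear]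
    fibre_linear_zero[OF E.framed_bundle_axioms B.framed_bundle_axioms unt_linear]
  by (simp_all add: bas_Hb bas_Eb G.src_in G.tgt_in G.unt_in)

lemma src_vscl: "x \<in> fibre (Hb V) g \<Longrightarrow> src (Hg V) (vscl (Hb V) a x) = vscl (Eb V) a (src (Hg V) x)"
  and tgt_vscl: "x \<in> fibre (Hb V) g \<Longrightarrow> tgt (Hg V) (vscl (Hb V) a x) = vscl (Eb V) a (tgt (Hg V) x)"
  and src_fibre: "x \<in> fibre (Hb V) g \<Longrightarrow> src (Hg V) x \<in> fibre (Eb V) (src (Gg V) g)"
  and tgt_fibre: "x \<in> fibre (Hb V) g \<Longrightarrow> tgt (Hg V) x \<in> fibre (Eb V) (tgt (Gg V) g)"
  and src_vadd: "x \<in> fibre (Hb V) g \<Longrightarrow> y \<in> fibre (Hb V) g \<Longrightarrow> src (Hg V) (vadd (Hb V) x y) =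
      vadd (Eb V) (src (Hg V) x) (src (Hg V) y)"
  and tgt_vadd: "x \<in> fibre (Hb V) g \<Longrightarrow> y \<in> fibre (Hb V) g \<Longrightarrow> tgt (Hg V) (vadd (Hb V) x y) =
      vadd (Eb V) (tgt (Hg V) x) (tgt (Hg V) y)"
proof -
  have g: "x \<in> fibre (Hb V) g \<Longrightarrow> g \<in> pts (bas (Hb V))" for x
    using proj_gpd(1) by (auto simp: fibre_Hb bas_Hb)
  show "x \<in> fibre (Hb V) g \<Longrightarrow> src (Hg V) (vscl (Hb V) a x) = vscl (Eb V) a (src (Hg V) x)"
    "x \<in> fibre (Hb V) g \<Longrightarrow> src (Hg V) x \<in> fibre (Eb V) (src (Gg V) g)"
    "x \<in> fibre (Hb V) g \<Longrightarrow> y \<in> fibre (Hb V) g \<Longrightarrow> src (Hg V) (vadd (Hb V) x y) =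
        vadd (Eb V) (src (Hg V) x) (src (Hg V) y)"
    using src_linear g unfolding fibre_linear_def by blast+
  show "x \<in> fibre (Hb V) g \<Longrightarrow> tgt (Hg V) (vscl (Hb V) a x) = vscl (Eb V) a (tgt (Hg V) x)"
    "x \<in> fibre (Hb V) g \<Longrightarrow> tgt (Hg V) x \<in> fibre (Eb V) (tgt (Gg V) g)"
    "x \<in> fibre (Hb V) g \<Longrightarrow> y \<in> fibre (Hb V) g \<Longrightarrow> tgt (Hg V) (vadd (Hb V) x y) =
        vadd (Eb V) (tgt (Hg V) x) (tgt (Hg V) y)"
    using tgt_linear g unfolding fibre_linear_def by blast+
qed

lemma unt_vadd: "e \<in> fibre (Eb V) x \<Longrightarrow> e' \<in> fibre (Eb V) x \<Longrightarrow> unt (Hg V) (vadd (Eb V) e e') =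
    vadd (Hb V) (unt (Hg V) e) (unt (Hg V) e')"
  and unt_vscl: "e \<in> fibre (Eb V) x \<Longrightarrow> unt (Hg V) (vscl (Eb V) a e) = vscl (Hb V) a (unt (Hg V) e)"
  and unt_fibre: "e \<in> fibre (Eb V) x \<Longrightarrow> unt (Hg V) e \<in> fibre (Hb V) (unt (Gg V) x)"
proof -
  have g: "e \<in> fibre (Eb V) x \<Longrightarrow> x \<in> pts (bas (Eb V))" for e
    using proj_gpd(2) by (auto simp: fibre_Eb bas_Eb)
  show "e \<in> fibre (Eb V) x \<Longrightarrow> e' \<in> fibre (Eb V) x \<Longrightarrow> unt (Hg V) (vadd (Eb V) e e') =
      vadd (Hb V) (unt (Hg V) e) (unt (Hg V) e')"
    "e \<in> fibre (Eb V) x \<Longrightarrow> unt (Hg V) (vscl (Eb V) a e) = vscl (Hb V) a (unt (Hg V) e)"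
    "e \<in> fibre (Eb V) x \<Longrightarrow> unt (Hg V) e \<in> fibre (Hb V) (unt (Gg V) x)"
    using unt_linear g unfolding fibre_linear_def by blast+
qed

lemma proj_ivs: "x \<in> pts (arr (Hg V)) \<Longrightarrow> proj (Hb V) (ivs (Hg V) x) = ivs (Gg V) (proj (Hb V) x)"
proof (rule G.inverse_unique)
  assume x: "x \<in> pts (arr (Hg V))"
  have c: "(x, ivs (Hg V) x) \<in> composable (Hg V)" using x
      by (intro H.composableI) (auto simp: H.ivs_in H.tgt_ivs)
  show "(proj (Hb V) x, proj (Hb V) (ivs (Hg V) x)) \<in> composable (Gg V)" by (rule proj_composable[OF c])
  show "mul (Gg V) (proj (Hb V) x) (proj (Hb V) (ivs (Hg V) x)) = unt (Gg V) (tgt (Gg V) (proj (Hb V) x))"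
    using proj_mul[OF c] x by (simp add: H.mul_ivs_right proj_gpd H.tgt_in)
qed

text \<open>By the interchange law and the linearity of units, the sum or multiple of the inverses
  is an inverse of the sum or multiple; inverses are unique.\<close>

lemma ivs_linear: "fibre_linear (Hb V) (Hb V) (ivs (Hg V)) (ivs (Gg V))"
  unfolding fibre_linear_def
proof (intro ballI conjI allI)
  fix g x assume g: "g \<in> pts (bas (Hb V))" and x: "x \<in> fibre (Hb V) g"
  have x': "x \<in> pts (arr (Hg V))" "proj (Hb V) x = g" using x by (auto simp: fibre_Hb)
  have cx: "(x, ivs (Hg V) x) \<in> composable (Hg V)" using x'
      by (intro H.composableI) (auto simp: H.ivs_in H.tgt_ivs)
  show "ivs (Hg V) x \<in> fibre (Hb V) (ivs (Gg V) g)" using x' by (simp add: fibre_Hb proj_ivs H.ivs_in)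
  show "ivs (Hg V) (vscl (Hb V) a x) = vscl (Hb V) a (ivs (Hg V) x)" for a
  proof (rule H.inverse_unique[symmetric])
    show "(vscl (Hb V) a x, vscl (Hb V) a (ivs (Hg V) x)) \<in> composable (Hg V)"
        by (rule interchange_scl(1)[OF cx])
    show "mul (Hg V) (vscl (Hb V) a x) (vscl (Hb V) a (ivs (Hg V) x)) =
        unt (Hg V) (tgt (Hg V) (vscl (Hb V) a x))"
      using interchange_scl(2)[OF cx] H.mul_ivs_right[OF x'(1)] tgt_vscl[OF x] unt_vscl[OF tgt_fibre[OF x]]
          by simp
  qed
  fix y assume y: "y \<in> fibre (Hb V) g"
  have y': "y \<in> pts (arr (Hg V))" "proj (Hb V) y = g" using y by (auto simp: fibre_Hb)
  have cy: "(y, ivs (Hg V) y) \<in> composable (Hg V)" using y'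
      by (intro H.composableI) (auto simp: H.ivs_in H.tgt_ivs)
  have pp: "proj (Hb V) y = proj (Hb V) x" "proj (Hb V) (ivs (Hg V) y) = proj (Hb V) (ivs (Hg V) x)"
      using x' y' by (auto simp: proj_ivs)
  show "ivs (Hg V) (vadd (Hb V) x y) = vadd (Hb V) (ivs (Hg V) x) (ivs (Hg V) y)"
  proof (rule H.inverse_unique[symmetric])
    show "(vadd (Hb V) x y, vadd (Hb V) (ivs (Hg V) x) (ivs (Hg V) y)) \<in> composable (Hg V)"
        by (rule interchange(1)[OF cx cy pp])
    show "mul (Hg V) (vadd (Hb V) x y) (vadd (Hb V) (ivs (Hg V) x) (ivs (Hg V) y)) =
        unt (Hg V) (tgt (Hg V) (vadd (Hb V) x y))"
      using interchange(2)[OF cx cy pp] H.mul_ivs_right[OF x'(1)] H.mul_ivs_right[OF y'(1)] tgt_vadd[OF x y]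
        unt_vadd[OF tgt_fibre[OF x] tgt_fibre[OF y]] by simp
  qed
qed

end

section \<open>The core and multiplicative sections\<close>

context vb_gpd
begin

lemma core_fibre:
  assumes "x \<in> pts (obj (Gg V))"
  shows "c \<in> fibre (core V) x \<longleftrightarrow> c \<in> fibre (Hb V) (unt (Gg V) x) \<and> src (Hg V) c = vzer (Eb V) x"
proof -
  have "src (Gg V) (proj (Hb V) c) = y" if "c \<in> fibre (Hb V) (unt (Gg V) y)" "y \<in> pts (obj (Gg V))" for y
    using that by (simp add: fibre_Hb G.src_unt)
  moreover have "c \<in> fibre (core V) x \<longleftrightarrow> (\<exists>y\<in>pts (obj (Gg V)). c \<in> fibre (Hb V) (unt (Gg V) y) \<and> src (Hg V) c =
      vzer (Eb V) y)
    \<and> src (Gg V) (proj (Hb V) c) = x"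
    unfolding fibre_def[of "core V"] by (simp add: core_def Let_def)
  ultimately show ?thesis using assms by blast
qed

lemma core_section:
  assumes "c \<in> sections (core V)"
  shows "c \<in> extensional (pts (obj (Gg V)))" "smooth_map (obj (Gg V)) (arr (Hg V)) c"
    "x \<in> pts (obj (Gg V)) \<Longrightarrow> c x \<in> fibre (Hb V) (unt (Gg V) x)" "x \<in> pts (obj (Gg V)) \<Longrightarrow> src (Hg V) (c x) =
        vzer (Eb V) x"
    "x \<in> pts (obj (Gg V)) \<Longrightarrow> c x \<in> pts (arr (Hg V))" "x \<in> pts (obj (Gg V)) \<Longrightarrow> proj (Hb V) (c x) = unt (Gg V) x"
proof -
  have b: "bas (core V) = obj (Gg V)" by (simp add: core_def Let_def)
  have f: "c x \<in> fibre (core V) x" if "x \<in> pts (obj (Gg V))" for x using assms that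
      by (simp add: sections_def b)
  show "c \<in> extensional (pts (obj (Gg V)))" using assms by (simp add: sections_def b)
  show "x \<in> pts (obj (Gg V)) \<Longrightarrow> c x \<in> fibre (Hb V) (unt (Gg V) x)" "x \<in> pts (obj (Gg V)) \<Longrightarrow> src (Hg V) (c x) =
      vzer (Eb V) x"
    using f core_fibre by auto
  then show "x \<in> pts (obj (Gg V)) \<Longrightarrow> c x \<in> pts (arr (Hg V))" "x \<in> pts (obj (Gg V)) \<Longrightarrow> proj (Hb V) (c x) =
      unt (Gg V) x"
    by (auto simp: fibre_Hb)
  have "smooth_map (obj (Gg V)) (tot (core V)) c" using assms by (simp add: sections_def b)
  then show "smooth_map (obj (Gg V)) (arr (Hg V)) c"
    unfolding core_def Let_def vbundle.simps by (rule smooth_map_from_sub) (auto simp: fibre_Hb)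
qed

lemma core_sectionI:
  assumes "c \<in> extensional (pts (obj (Gg V)))" "smooth_map (obj (Gg V)) (arr (Hg V)) c"
    "\<And>x. x \<in> pts (obj (Gg V)) \<Longrightarrow> c x \<in> fibre (Hb V) (unt (Gg V) x)" "\<And>x. x \<in> pts (obj (Gg V)) \<Longrightarrow>
        src (Hg V) (c x) = vzer (Eb V) x"
  shows "c \<in> sections (core V)"
proof -
  have b: "bas (core V) = obj (Gg V)" by (simp add: core_def Let_def)
  have "smooth_map (obj (Gg V)) (tot (core V)) c"
    unfolding core_def Let_def vbundle.simps
        by (rule smooth_map_into_sub[OF assms(2)]) (use assms(3,4) in auto)
  then show ?thesis using assms by (simp add: sections_def b core_fibre)
qed

lemma szero_apply: "g \<in> pts (arr (Gg V)) \<Longrightarrow> B.szero g = vzer (Hb V) g"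
  using B.sections_apply(3) by (simp add: bas_Hb)

lemma vzer_smooth: "smooth_map (arr (Gg V)) (arr (Hg V)) (vzer (Hb V))"
  by (rule smooth_map_cong[OF szero_apply section_Hb_smooth[OF B.szero_in]])

lemma mul_smooth:
  assumes f: "smooth_map X (arr (Hg V)) f" "smooth_map X (arr (Hg V)) f'" and X: "smooth_space X"
    and c: "\<And>x. x \<in> pts X \<Longrightarrow> (f x, f' x) \<in> composable (Hg V)"
  shows "smooth_map X (arr (Hg V)) (\<lambda>x. mul (Hg V) (f x) (f' x))"
proof -
  have p: "smooth_map X (sub (arr (Hg V) \<times>\<^sub>M arr (Hg V)) (composable (Hg V))) (\<lambda>x. (f x, f' x))"
    by (rule smooth_map_into_sub[OF smooth_map_Pair[OF X ssp(1) ssp(1) f]]) (use c in auto)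
  have "smooth_space (sub (arr (Hg V) \<times>\<^sub>M arr (Hg V)) (composable (Hg V)))"
    by (intro smooth_space_sub smooth_space_prod ssp) (auto simp: composable_def)
  from smooth_map_compose[OF this p smooth_structure(9)] show ?thesis by simp
qed

lemma sectionI_Hb:
  assumes "smooth_map (arr (Gg V)) (arr (Hg V)) X" "\<And>g. g \<in> pts (arr (Gg V)) \<Longrightarrow> proj (Hb V) (X g) = g"
      "X \<in> extensional (pts (arr (Gg V)))"
  shows "X \<in> sections (Hb V)"
  using assms smooth_map_in[OF assms(1)] by (simp add: sections_def bas_Hb tot_Hb fibre_Hb)

section \<open>Right- and left-invariant extensions of core sections\<close>

lemma right_composable:
  assumes c: "c \<in> sections (core V)" and g: "g \<in> pts (arr (Gg V))"
  shows "(c (tgt (Gg V) g), vzer (Hb V) g) \<in> composable (Hg V)"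
  using core_section[OF c] g by (intro H.composableI) (auto simp: zero_arr tgt_zero G.tgt_in)

lemma left_composable:
  assumes c: "c \<in> sections (core V)" and g: "g \<in> pts (arr (Gg V))"
  shows "(vzer (Hb V) g, ivs (Hg V) (c (src (Gg V) g))) \<in> composable (Hg V)"
  using core_section[OF c] g by (intro H.composableI) (auto simp: zero_arr src_zero G.src_in H.ivs_in
      H.tgt_ivs)

lemma right_inv_apply: "g \<in> pts (arr (Gg V)) \<Longrightarrow> right_inv V c g =
    mul (Hg V) (c (tgt (Gg V) g)) (vzer (Hb V) g)"
  by (simp add: right_inv_def)

lemma left_inv_apply: "g \<in> pts (arr (Gg V)) \<Longrightarrow>
  left_inv V c g = vscl (Hb V) (- 1) (mul (Hg V) (vzer (Hb V) g) (ivs (Hg V) (c (src (Gg V) g))))"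
  by (simp add: left_inv_def)

lemma right_inv_in:
  assumes c: "c \<in> sections (core V)"
  shows "right_inv V c \<in> sections (Hb V)"
proof (rule sectionI_Hb)
  have "smooth_map (arr (Gg V)) (arr (Hg V)) (\<lambda>g. mul (Hg V) (c (tgt (Gg V) g)) (vzer (Hb V) g))"
    by (intro mul_smooth vzer_smooth ssp right_composable c smooth_map_compose[OF ssp(4) smooth_structure(4)
        core_section(2)[OF c]])
  then show "smooth_map (arr (Gg V)) (arr (Hg V)) (right_inv V c)"
    by (rule smooth_map_cong[rotated]) (simp add: right_inv_def)
  show "proj (Hb V) (right_inv V c g) = g" if g: "g \<in> pts (arr (Gg V))" for g
    using g proj_mul[OF right_composable[OF c g]] core_section(6)[OF c]
    by (simp add: right_inv_def zero_arr G.tgt_in G.mul_unt_left)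
qed (simp add: right_inv_def)

lemma left_mul_in:
  assumes c: "c \<in> sections (core V)"
  shows "(\<lambda>g\<in>pts (arr (Gg V)). mul (Hg V) (vzer (Hb V) g) (ivs (Hg V) (c (src (Gg V) g)))) \<in> sections (Hb V)"
      (is "?X \<in> _")
proof (rule sectionI_Hb)
  have "smooth_map (arr (Gg V)) (arr (Hg V)) (\<lambda>g. mul (Hg V) (vzer (Hb V) g) (ivs (Hg V) (c (src (Gg V) g))))"
    by (intro mul_smooth vzer_smooth ssp left_composable c
        smooth_map_compose[OF ssp(1) smooth_map_compose[OF ssp(4) smooth_structure(3) core_section(2)[OF c]]
            smooth_structure(7)])
  then show "smooth_map (arr (Gg V)) (arr (Hg V)) ?X"
    by (rule smooth_map_cong[rotated]) simp
  show "proj (Hb V) (?X g) = g" if g: "g \<in> pts (arr (Gg V))" for g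
    using g proj_mul[OF left_composable[OF c g]] core_section(5,6)[OF c]
    by (simp add: zero_arr G.src_in proj_ivs G.ivs_unt G.mul_unt_right)
qed simp

lemma left_inv_sscl:
  "left_inv V c = B.sscl (- 1) (\<lambda>g\<in>pts (arr (Gg V)). mul (Hg V) (vzer (Hb V) g) (ivs (Hg V) (c (src (Gg V)
      g))))"
  by (auto simp: left_inv_def section_space_def bas_Hb intro!: restrict_ext)

lemma left_inv_in: "c \<in> sections (core V) \<Longrightarrow> left_inv V c \<in> sections (Hb V)"
  unfolding left_inv_sscl by (rule B.sscl_in[OF left_mul_in])

text \<open>(c(t(g)) 0_g) 0_h = c(t(gh)) 0_{gh}, by associativity and because products of zero
  vectors are zero vectors.\<close>

lemma right_inv_triple:
  assumes c: "c \<in> sections (core V)"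
  shows "mult_triple (right_inv V c) B.szero (right_inv V c)"
  unfolding mult_triple_def
proof (intro conjI allI impI right_inv_in c B.szero_in)
  fix g h assume gh: "(g, h) \<in> composable (Gg V)"
  note g = G.composableD[OF gh]
  note rc = right_composable[OF c g(1)]
  have z: "B.szero h = vzer (Hb V) h" by (rule szero_apply[OF g(2)])
  show "(right_inv V c g, B.szero h) \<in> composable (Hg V)"
    unfolding z right_inv_apply[OF g(1)]
    using rc g by (intro H.composableI) (auto simp: H.mul_in H.src_mul zero_arr src_zero tgt_zero)
  show "right_inv V c (mul (Gg V) g h) = mul (Hg V) (right_inv V c g) (B.szero h)"
    using H.mul_assoc[OF rc zero_mul(1)[OF gh]] zero_mul(2)[OF gh] g gh
    by (simp add: z right_inv_apply G.mul_in G.tgt_mul)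
qed

lemma vscl_vzer: "g \<in> pts (arr (Gg V)) \<Longrightarrow> vscl (Hb V) a (vzer (Hb V) g) = vzer (Hb V) g"
proof -
  assume "g \<in> pts (arr (Gg V))"
  then have g: "g \<in> pts (bas (Hb V))" by (simp add: bas_Hb)
  note z = B.vzer_in[OF g]
  have "vscl (Hb V) a (vscl (Hb V) 0 (vzer (Hb V) g)) = vscl (Hb V) 0 (vzer (Hb V) g)"
      using B.vscl_vscl[OF g z] by simp
  then show ?thesis using B.vscl_zero[OF g z] by simp
qed

text \<open>The factor -1 moves onto the inverse because -0_g = 0_g. As a single product, the
  left-invariant extension becomes accessible to associativity.\<close>

lemma left_inv_mul:
  assumes c: "c \<in> sections (core V)" and g: "g \<in> pts (arr (Gg V))"
  shows "(vzer (Hb V) g, vscl (Hb V) (- 1) (ivs (Hg V) (c (src (Gg V) g)))) \<in> composable (Hg V)"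
    "left_inv V c g = mul (Hg V) (vzer (Hb V) g) (vscl (Hb V) (- 1) (ivs (Hg V) (c (src (Gg V) g))))"
  using interchange_scl[OF left_composable[OF c g], of "- 1"] g by (simp_all add: vscl_vzer left_inv_apply)

lemma left_inv_triple:
  assumes c: "c \<in> sections (core V)"
  shows "mult_triple B.szero (left_inv V c) (left_inv V c)"
  unfolding mult_triple_def
proof (intro conjI allI impI left_inv_in c B.szero_in)
  fix g h assume gh: "(g, h) \<in> composable (Gg V)"
  note g = G.composableD[OF gh]
  note lc = left_inv_mul[OF c g(2)]
  have z: "B.szero g = vzer (Hb V) g" by (rule szero_apply[OF g(1)])
  show "(B.szero g, left_inv V c h) \<in> composable (Hg V)"
    unfolding z lc(2)
    using lc(1) g by (intro H.composableI) (auto simp: H.mul_in H.tgt_mul zero_arr src_zero tgt_zero)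
  show "left_inv V c (mul (Gg V) g h) = mul (Hg V) (B.szero g) (left_inv V c h)"
    using H.mul_assoc[OF zero_mul(1)[OF gh] lc(1)] zero_mul(2)[OF gh] g gh left_inv_mul(2)[OF c, of
        "mul (Gg V) g h"]
    by (simp add: z lc(2) G.mul_in G.src_mul)
qed

lemma mul_unit_zero:
  assumes "y \<in> pts (arr (Hg V))" "x \<in> pts (obj (Gg V))"
  shows "src (Hg V) y = vzer (Eb V) x \<Longrightarrow> mul (Hg V) y (vzer (Hb V) (unt (Gg V) x)) = y"
    "tgt (Hg V) y = vzer (Eb V) x \<Longrightarrow> mul (Hg V) (vzer (Hb V) (unt (Gg V) x)) y = y"
  using H.mul_unt_right[OF assms(1)] H.mul_unt_left[OF assms(1)] unt_zero[OF assms(2)] by simp_all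

lemma right_inv_unit:
  assumes c: "c \<in> sections (core V)" and x: "x \<in> pts (obj (Gg V))"
  shows "right_inv V c (unt (Gg V) x) = c x"
  using core_section[OF c] x mul_unit_zero(1)[of "c x" x] by (simp add: right_inv_apply G.unt_in G.tgt_unt)

lemma right_inv_inj:
  assumes "c \<in> sections (core V)" "c' \<in> sections (core V)" "right_inv V c = right_inv V c'"
  shows "c = c'"
  by (rule extensionalityI[OF core_section(1)[OF assms(1)] core_section(1)[OF assms(2)]])
    (metis right_inv_unit assms)

text \<open>Z is recovered from its values at units: Z(g) = Z(1_{t(g)} g) = Z(1_{t(g)}) 0_g.
  Composability of Z(1_x) with the zero vector at 1_x says that Z(1_x) has zero source, so these
  values lie in the core.\<close>

lemma right_triple_core:
  assumes t: "mult_triple Z B.szero Z"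
  obtains c where "c \<in> sections (core V)" "right_inv V c = Z"
proof -
  have Z: "Z \<in> sections (Hb V)" and Zm: "\<And>g h. (g, h) \<in> composable (Gg V) \<Longrightarrow>
    (Z g, vzer (Hb V) h) \<in> composable (Hg V) \<and> Z (mul (Gg V) g h) = mul (Hg V) (Z g) (vzer (Hb V) h)"
    using t szero_apply G.composableD(2) unfolding mult_triple_def by auto
  define c where "c = (\<lambda>x\<in>pts (obj (Gg V)). Z (unt (Gg V) x))"
  have c: "c \<in> sections (core V)"
  proof (rule core_sectionI)
    show "smooth_map (obj (Gg V)) (arr (Hg V)) c"
      by (rule smooth_map_cong[OF _ smooth_map_compose[OF ssp(2) smooth_structure(6) section_Hb_smooth[OF
          Z]]]) (simp add: c_def)
    fix x assume x: "x \<in> pts (obj (Gg V))"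
    show "c x \<in> fibre (Hb V) (unt (Gg V) x)" using section_Hb(1)[OF Z G.unt_in[OF x]] x by (simp add: c_def)
    have "(unt (Gg V) x, unt (Gg V) x) \<in> composable (Gg V)" using x
        by (intro G.composableI) (auto simp: G.unt_in G.src_unt G.tgt_unt)
    from H.composableD(3)[OF conjunct1[OF Zm[OF this]]] show "src (Hg V) (c x) = vzer (Eb V) x"
      using x by (simp add: c_def tgt_zero G.unt_in G.tgt_unt)
  qed (simp add: c_def)
  have "right_inv V c = Z"
  proof (rule extensionalityI)
    show "right_inv V c \<in> extensional (pts (arr (Gg V)))" by (simp add: right_inv_def)
    show "Z \<in> extensional (pts (arr (Gg V)))" using Z by (simp add: sections_def bas_Hb)
    fix g assume g: "g \<in> pts (arr (Gg V))"
    have "(unt (Gg V) (tgt (Gg V) g), g) \<in> composable (Gg V)" using g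
        by (intro G.composableI) (auto simp: G.unt_in G.src_unt G.tgt_in)
    from Zm[OF this] show "right_inv V c g = Z g" using g
        by (simp add: right_inv_apply c_def G.tgt_in G.mul_unt_left)
  qed
  with c show ?thesis using that by blast
qed

lemma mult_triple_sadd:
  assumes "mult_triple X1 X0 X" "mult_triple Y1 Y0 Y"
  shows "mult_triple (B.sadd X1 Y1) (B.sadd X0 Y0) (B.sadd X Y)"
  unfolding mult_triple_def
proof (intro conjI allI impI B.sadd_in)
  fix g h assume gh: "(g, h) \<in> composable (Gg V)"
  note g = G.composableD[OF gh]
  have gB: "g \<in> pts (bas (Hb V))" "h \<in> pts (bas (Hb V))" "mul (Gg V) g h \<in> pts (bas (Hb V))" using g gh
      by (auto simp: bas_Hb G.mul_in)
  have x: "(X1 g, X0 h) \<in> composable (Hg V)" "(Y1 g, Y0 h) \<in> composable (Hg V)" using assms gh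
      by (auto simp: mult_triple_def)
  have p: "proj (Hb V) (Y1 g) = proj (Hb V) (X1 g)" "proj (Hb V) (Y0 h) = proj (Hb V) (X0 h)"
    using assms g by (simp_all add: mult_triple_def section_Hb)
  show "(B.sadd X1 Y1 g, B.sadd X0 Y0 h) \<in> composable (Hg V)"
    "B.sadd X Y (mul (Gg V) g h) = mul (Hg V) (B.sadd X1 Y1 g) (B.sadd X0 Y0 h)"
    using interchange[OF x p] assms gh gB by (simp_all add: B.sections_apply mult_triple_def)
qed (use assms in \<open>auto simp: mult_triple_def\<close>)

lemma mult_triple_sscl:
  assumes "mult_triple X1 X0 X"
  shows "mult_triple (B.sscl a X1) (B.sscl a X0) (B.sscl a X)"
  unfolding mult_triple_def
proof (intro conjI allI impI B.sscl_in)
  fix g h assume gh: "(g, h) \<in> composable (Gg V)"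
  note g = G.composableD[OF gh]
  have gB: "g \<in> pts (bas (Hb V))" "h \<in> pts (bas (Hb V))" "mul (Gg V) g h \<in> pts (bas (Hb V))" using g gh
      by (auto simp: bas_Hb G.mul_in)
  have x: "(X1 g, X0 h) \<in> composable (Hg V)" using assms gh by (auto simp: mult_triple_def)
  show "(B.sscl a X1 g, B.sscl a X0 h) \<in> composable (Hg V)"
    "B.sscl a X (mul (Gg V) g h) = mul (Hg V) (B.sscl a X1 g) (B.sscl a X0 h)"
    using interchange_scl[OF x] assms gh gB by (simp_all add: B.sections_apply mult_triple_def)
qed (use assms in \<open>auto simp: mult_triple_def\<close>)

lemma mult_triple_szero: "mult_triple B.szero B.szero B.szero"
  unfolding mult_triple_def
  using zero_mul B.szero_in G.composableD by (auto simp: szero_apply G.mul_in)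

text \<open>For the converse the base section is x -> s(X(1_x)). The value X(1_x) is idempotent,
  hence a unit, and the source and target of X(g) are read off from its composability with values at
  units.\<close>

lemma mul_sections_iff: "X \<in> mul_sections V \<longleftrightarrow> mult_triple X X X"
proof
  assume "X \<in> mul_sections V"
  then obtain x where X: "X \<in> sections (Hb V)" "gpd_morphism (Gg V) (Hg V) X x"
      by (auto simp: mul_sections_def)
  show "mult_triple X X X"
    unfolding mult_triple_def
  proof (intro conjI allI impI X)
    fix g h assume gh: "(g, h) \<in> composable (Gg V)"
    note g = G.composableD[OF gh]
    show "(X g, X h) \<in> composable (Hg V)"
      using X(2) g section_Hb(2)[OF X(1)] by (intro H.composableI) (auto simp: gpd_morphism_def)
    show "X (mul (Gg V) g h) = mul (Hg V) (X g) (X h)" using X(2) gh by (auto simp: gpd_morphism_def)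
  qed
next
  assume t: "mult_triple X X X"
  have X: "X \<in> sections (Hb V)" using t by (simp add: mult_triple_def)
  have m: "(X g, X h) \<in> composable (Hg V)" "X (mul (Gg V) g h) = mul (Hg V) (X g) (X h)"
      if "(g, h) \<in> composable (Gg V)" for g h
    using t that by (auto simp: mult_triple_def)
  define x where "x = (\<lambda>y\<in>pts (obj (Gg V)). src (Hg V) (X (unt (Gg V) y)))"
  have uu: "(unt (Gg V) y, unt (Gg V) y) \<in> composable (Gg V)" if "y \<in> pts (obj (Gg V))" for y
    using that by (intro G.composableI) (auto simp: G.unt_in G.src_unt G.tgt_unt)
  have gu: "(g, unt (Gg V) (src (Gg V) g)) \<in> composable (Gg V)" if "g \<in> pts (arr (Gg V))" for g
    using that by (intro G.composableI) (auto simp: G.unt_in G.tgt_unt G.src_in)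
  have ug: "(unt (Gg V) (tgt (Gg V) g), g) \<in> composable (Gg V)" if "g \<in> pts (arr (Gg V))" for g
    using that by (intro G.composableI) (auto simp: G.unt_in G.src_unt G.tgt_in)
  have xs: "x \<in> sections (Eb V)"
  proof -
    have "smooth_map (obj (Gg V)) (obj (Hg V)) x"
      by (rule smooth_map_cong[OF _ smooth_map_compose[OF ssp(1) smooth_map_compose[OF ssp(2)
          smooth_structure(6) section_Hb_smooth[OF X]] smooth_structure(1)]])
        (simp add: x_def)
    moreover have "x y \<in> fibre (Eb V) y" if "y \<in> pts (obj (Gg V))" for y
      using src_fibre[OF section_Hb(1)[OF X G.unt_in[OF that]]] that by (simp add: x_def G.src_unt)
    ultimately show ?thesis by (simp add: sections_def bas_Eb tot_Eb x_def)
  qed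
  have "gpd_morphism (Gg V) (Hg V) X x"
    unfolding gpd_morphism_def
  proof (intro conjI ballI)
    show "X \<in> pts (arr (Gg V)) \<rightarrow> pts (arr (Hg V))" using section_Hb(2)[OF X] by auto
    show "x \<in> pts (obj (Gg V)) \<rightarrow> pts (obj (Hg V))" using E.section_in[OF xs] by (auto simp: bas_Eb fibre_Eb)
    show "X (unt (Gg V) y) = unt (Hg V) (x y)" if y: "y \<in> pts (obj (Gg V))" for y
    proof -
      have "mul (Hg V) (X (unt (Gg V) y)) (X (unt (Gg V) y)) = X (unt (Gg V) y)"
        using m(2)[OF uu[OF y]] G.mul_unt_left[OF G.unt_in[OF y]] y by (simp add: G.tgt_unt)
      then show ?thesis using H.idempotent_unit[OF m(1)[OF uu[OF y]]] y by (simp add: x_def)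
    qed
    fix g assume g: "g \<in> pts (arr (Gg V))"
    have t': "tgt (Hg V) (X (unt (Gg V) y)) = x y" if y: "y \<in> pts (obj (Gg V))" for y
      using H.composableD(3)[OF m(1)[OF uu[OF y]]] y by (simp add: x_def)
    show "src (Hg V) (X g) = x (src (Gg V) g)"
      using H.composableD(3)[OF m(1)[OF gu[OF g]]] t'[OF G.src_in[OF g]] by simp
    show "tgt (Hg V) (X g) = x (tgt (Gg V) g)"
      using H.composableD(3)[OF m(1)[OF ug[OF g]]] G.tgt_in[OF g] by (simp add: x_def)
  qed (use m(2) in auto)
  with X xs show "X \<in> mul_sections V" by (auto simp: mul_sections_def)
qed

section \<open>The differential of the complex\<close>

lemma delta_sadd: "delta V u = B.sadd (right_inv V u) (B.sscl (- 1) (left_inv V u))"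
  by (auto simp: delta_def section_space_def bas_Hb intro!: restrict_ext)

text \<open>The differential is a conjugation: delta u (g) = u(t(g)) 0_g u(s(g))^{-1}. The
  interchange law, applied to the products of u^r(g) with the zero vector at 1_{s(g)} and of 0_g
  with u(s(g))^{-1}, turns the defining sum into this product.\<close>

lemma delta_apply:
  assumes u: "u \<in> sections (core V)" and g: "g \<in> pts (arr (Gg V))"
  shows "(right_inv V u g, ivs (Hg V) (u (src (Gg V) g))) \<in> composable (Hg V)"
    "delta V u g = mul (Hg V) (right_inv V u g) (ivs (Hg V) (u (src (Gg V) g)))"
proof -
  let ?i = "ivs (Hg V) (u (src (Gg V) g))" and ?z = "vzer (Hb V) (unt (Gg V) (src (Gg V) g))"
  have gB: "g \<in> pts (bas (Hb V))" and s: "src (Gg V) g \<in> pts (obj (Gg V))" using g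
      by (simp_all add: bas_Hb G.src_in)
  have us: "unt (Gg V) (src (Gg V) g) \<in> pts (bas (Hb V))" using s by (simp add: bas_Hb G.unt_in)
  note rc = right_composable[OF u g] and lc = left_composable[OF u g]
  note cs = core_section[OF u]
  have iin: "?i \<in> pts (arr (Hg V))" using cs(5)[OF s] by (rule H.ivs_in)
  have pi: "proj (Hb V) ?i = unt (Gg V) (src (Gg V) g)" using cs(5,6)[OF s] s
      by (simp add: proj_ivs G.ivs_unt)
  have R: "right_inv V u g \<in> pts (arr (Hg V))" "proj (Hb V) (right_inv V u g) = g"
      using section_Hb[OF right_inv_in[OF u] g] by auto
  have sR: "src (Hg V) (right_inv V u g) = vzer (Eb V) (src (Gg V) g)"
    using H.src_mul[OF rc] g by (simp add: right_inv_apply src_zero)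
  show Ri: "(right_inv V u g, ?i) \<in> composable (Hg V)"
    using R(1) iin sR cs(4,5)[OF s] by (intro H.composableI) (auto simp: H.tgt_ivs)
  have Rz: "(right_inv V u g, ?z) \<in> composable (Hg V)"
    using R(1) sR s by (intro H.composableI) (auto simp: zero_arr tgt_zero G.unt_in G.tgt_unt)
  have L: "mul (Hg V) (vzer (Hb V) g) ?i \<in> fibre (Hb V) g"
    using B.section_in[OF left_mul_in[OF u] gB] g by simp
  have "vscl (Hb V) (- 1) (left_inv V u g) = mul (Hg V) (vzer (Hb V) g) ?i"
    using B.vscl_vscl[OF gB L, of "- 1" "- 1"] B.vscl_one[OF gB L] g by (simp add: left_inv_apply)
  then have "delta V u g = vadd (Hb V) (mul (Hg V) (right_inv V u g) ?z) (mul (Hg V) (vzer (Hb V) g) ?i)"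
    using g mul_unit_zero(1)[OF R(1) s sR] by (simp add: delta_def)
  also have "\<dots> = mul (Hg V) (vadd (Hb V) (right_inv V u g) (vzer (Hb V) g)) (vadd (Hb V) ?z ?i)"
    by (rule interchange(2)[OF Rz lc, symmetric]) (use R pi zero_arr s g in \<open>auto simp: G.unt_in\<close>)
  also have "vadd (Hb V) (right_inv V u g) (vzer (Hb V) g) = right_inv V u g"
    using B.vadd_zero_right[OF gB] R by (simp add: fibre_Hb)
  also have "vadd (Hb V) ?z ?i = ?i" using B.vadd_zero[OF us] iin pi by (simp add: fibre_Hb)
  finally show "delta V u g = mul (Hg V) (right_inv V u g) ?i" .
qed

lemma delta_in: "u \<in> sections (core V) \<Longrightarrow> delta V u \<in> sections (Hb V)"
  unfolding delta_sadd by (intro B.sadd_in B.sscl_in right_inv_in left_inv_in)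

text \<open>In delta u (g) delta u (h) the inner factors u(s(g))^{-1} and u(t(h)) cancel because
  s(g) = t(h). What remains is u(t(g)) 0_g 0_h u(s(h))^{-1}.\<close>

lemma delta_mul:
  assumes u: "u \<in> sections (core V)"
  shows "delta V u \<in> mul_sections V"
  unfolding mul_sections_iff mult_triple_def
proof (intro conjI allI impI delta_in u)
  fix g h assume gh: "(g, h) \<in> composable (Gg V)"
  note g = G.composableD[OF gh]
  let ?x = "src (Gg V) g"
  have x: "?x \<in> pts (obj (Gg V))" "tgt (Gg V) h = ?x" using g G.src_in[OF g(1)] by simp_all
  let ?i = "ivs (Hg V) (u ?x)" and ?j = "ivs (Hg V) (u (src (Gg V) h))"
  note cs = core_section[OF u]
  note dg = delta_apply[OF u g(1)] and dh = delta_apply[OF u g(2)]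
  have ux: "u ?x \<in> pts (arr (Hg V))" by (rule cs(5)[OF x(1)])
  have iu: "(?i, u ?x) \<in> composable (Hg V)" using ux by (intro H.composableI) (auto simp: H.ivs_in H.src_ivs)
  have uz: "(u ?x, vzer (Hb V) h) \<in> composable (Hg V)" using right_composable[OF u g(2)] x(2) by simp
  have rh: "right_inv V u h = mul (Hg V) (u ?x) (vzer (Hb V) h)"
    by (simp only: right_inv_apply[OF g(2)] x(2))
  have iuh: "(?i, right_inv V u h) \<in> composable (Hg V)"
  proof (rule H.composableI)
    show "?i \<in> pts (arr (Hg V))" using ux by (rule H.ivs_in)
    show "right_inv V u h \<in> pts (arr (Hg V))" unfolding rh by (rule H.mul_in[OF uz])
    show "src (Hg V) ?i = tgt (Hg V) (right_inv V u h)"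
      unfolding rh H.tgt_mul[OF uz] using ux by (rule H.src_ivs)
  qed
  have irh: "mul (Hg V) ?i (right_inv V u h) = vzer (Hb V) h"
  proof -
    have "mul (Hg V) ?i (right_inv V u h) = mul (Hg V) (mul (Hg V) ?i (u ?x)) (vzer (Hb V) h)"
      unfolding rh using H.mul_assoc[OF iu uz] by simp
    also have "\<dots> = mul (Hg V) (vzer (Hb V) (unt (Gg V) ?x)) (vzer (Hb V) h)"
      using H.mul_ivs_left[OF ux] cs(4)[OF x(1)] unt_zero[OF x(1)] by simp
    also have "\<dots> = vzer (Hb V) h"
      by (rule mul_unit_zero(2)[OF zero_arr(2)[OF g(2)] x(1)]) (simp only: tgt_zero[OF g(2)] x(2))
    finally show ?thesis .
  qed
  have rj: "(right_inv V u h, ?j) \<in> composable (Hg V)" by (rule dh(1))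
  show c: "(delta V u g, delta V u h) \<in> composable (Hg V)"
    unfolding dg(2) dh(2)
  proof (rule H.composableI)
    show "mul (Hg V) (right_inv V u g) ?i \<in> pts (arr (Hg V))" by (rule H.mul_in[OF dg(1)])
    show "mul (Hg V) (right_inv V u h) ?j \<in> pts (arr (Hg V))" by (rule H.mul_in[OF dh(1)])
    show "src (Hg V) (mul (Hg V) (right_inv V u g) ?i) = tgt (Hg V) (mul (Hg V) (right_inv V u h) ?j)"
      unfolding H.src_mul[OF dg(1)] H.tgt_mul[OF dh(1)] by (rule H.composableD(3)[OF iuh])
  qed
  have idh: "(?i, mul (Hg V) (right_inv V u h) ?j) \<in> composable (Hg V)"
  proof (rule H.composableI)
    show "?i \<in> pts (arr (Hg V))" using ux by (rule H.ivs_in)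
    show "mul (Hg V) (right_inv V u h) ?j \<in> pts (arr (Hg V))" by (rule H.mul_in[OF dh(1)])
    show "src (Hg V) ?i = tgt (Hg V) (mul (Hg V) (right_inv V u h) ?j)"
      unfolding H.tgt_mul[OF dh(1)] by (rule H.composableD(3)[OF iuh])
  qed
  have zj: "(vzer (Hb V) h, ?j) \<in> composable (Hg V)" by (rule left_composable[OF u g(2)])
  have rz: "(right_inv V u g, vzer (Hb V) h) \<in> composable (Hg V)"
    and rgh: "right_inv V u (mul (Gg V) g h) = mul (Hg V) (right_inv V u g) (vzer (Hb V) h)"
  proof -
    have rs: "(right_inv V u g, B.szero h) \<in> composable (Hg V) \<and>
        right_inv V u (mul (Gg V) g h) = mul (Hg V) (right_inv V u g) (B.szero h)"
      using right_inv_triple[OF u] gh unfolding mult_triple_def by blast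
    then show "(right_inv V u g, vzer (Hb V) h) \<in> composable (Hg V)"
      "right_inv V u (mul (Gg V) g h) = mul (Hg V) (right_inv V u g) (vzer (Hb V) h)"
      unfolding szero_apply[OF g(2)] by blast+
  qed
  have "mul (Hg V) (delta V u g) (delta V u h) =
      mul (Hg V) (right_inv V u g) (mul (Hg V) ?i (mul (Hg V) (right_inv V u h) ?j))"
    unfolding dg(2) dh(2) by (rule H.mul_assoc[OF dg(1) idh])
  also have "mul (Hg V) ?i (mul (Hg V) (right_inv V u h) ?j) = mul (Hg V) (vzer (Hb V) h) ?j"
    using H.mul_assoc[OF iuh rj] irh by simp
  also have "mul (Hg V) (right_inv V u g) (mul (Hg V) (vzer (Hb V) h) ?j) =
      mul (Hg V) (right_inv V u (mul (Gg V) g h)) ?j"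
    using H.mul_assoc[OF rz zj] rgh by simp
  also have "\<dots> = delta V u (mul (Gg V) g h)"
    using delta_apply(2)[OF u G.mul_in[OF gh]] G.src_mul[OF gh] by simp
  finally show "delta V u (mul (Gg V) g h) = mul (Hg V) (delta V u g) (delta V u h)" by simp
qed

text \<open>Both sides are delta u at the unit of x, once as a sum and once as the product of u(x)
  with its inverse. The formula allows an inverse in H to be recognized from a sum in a
  fibre.\<close>

lemma core_inverse_sum:
  assumes u: "u \<in> sections (core V)" and x: "x \<in> pts (obj (Gg V))"
  shows "vadd (Hb V) (u x) (ivs (Hg V) (u x)) = unt (Hg V) (tgt (Hg V) (u x))"
proof -
  have ux: "unt (Gg V) x \<in> pts (arr (Gg V))" using x by (simp add: G.unt_in)
  note cs = core_section[OF u]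
  have d: "delta V u (unt (Gg V) x) = mul (Hg V) (u x) (ivs (Hg V) (u x))"
    using delta_apply(2)[OF u ux] right_inv_unit[OF u x] x by (simp add: G.src_unt)
  let ?L = "mul (Hg V) (vzer (Hb V) (unt (Gg V) x)) (ivs (Hg V) (u x))"
  have L: "?L = ivs (Hg V) (u x)"
    using mul_unit_zero(2)[OF H.ivs_in[OF cs(5)[OF x]] x] cs(4,5)[OF x] by (simp add: H.tgt_ivs)
  have f: "ivs (Hg V) (u x) \<in> fibre (Hb V) (unt (Gg V) x)"
    using cs(5,6)[OF x] x by (simp add: fibre_Hb H.ivs_in proj_ivs G.ivs_unt)
  have uB: "unt (Gg V) x \<in> pts (bas (Hb V))" using ux by (simp add: bas_Hb)
  have "delta V u (unt (Gg V) x) = vadd (Hb V) (u x) (ivs (Hg V) (u x))"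
    using ux right_inv_unit[OF u x] x L B.vscl_vscl[OF uB f, of "- 1" "- 1"] B.vscl_one[OF uB f]
    by (simp add: delta_def left_inv_apply G.src_unt)
  then show ?thesis using d H.mul_ivs_right[OF cs(5)[OF x]] by simp
qed

end

section \<open>Brackets on a quasi LA-groupoid\<close>

text \<open>Agreement on forms suffices. This serves to replace a contraction with a bracket inside
  another bracket by the operator expression it equals on forms.\<close>

lemma (in operators) derived_bracket_cong:
  assumes "\<And>\<omega>. \<omega> \<in> F \<Longrightarrow> x \<omega> = x' \<omega>" "\<And>\<omega>. \<omega> \<in> F \<Longrightarrow> y \<omega> = y' \<omega>"
    and "\<And>\<omega>. \<omega> \<in> F \<Longrightarrow> Q \<omega> \<in> F" "\<And>\<omega>. \<omega> \<in> F \<Longrightarrow> x' \<omega> \<in> F" "\<And>\<omega>. \<omega> \<in> F \<Longrightarrow> y' \<omega> \<in> F" "\<omega> \<in> F"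
  shows "derived_bracket Q x y \<omega> = derived_bracket Q x' y' \<omega>"
  unfolding derived_bracket_def using assms by simp

lemma (in operators) derived_ternary_cong:
  assumes "\<And>\<omega>. \<omega> \<in> F \<Longrightarrow> R \<omega> = R' \<omega>" "\<And>\<omega>. \<omega> \<in> F \<Longrightarrow> x \<omega> = x' \<omega>" "\<And>\<omega>. \<omega> \<in> F \<Longrightarrow> y \<omega> = y' \<omega>" "\<And>\<omega>. \<omega> \<in> F \<Longrightarrow> z \<omega> = z' \<omega>"
    and "\<And>\<omega>. \<omega> \<in> F \<Longrightarrow> R' \<omega> \<in> F" "\<And>\<omega>. \<omega> \<in> F \<Longrightarrow> x' \<omega> \<in> F" "\<And>\<omega>. \<omega> \<in> F \<Longrightarrow> y' \<omega> \<in> F" "\<And>\<omega>. \<omega> \<in> F \<Longrightarrow> z' \<omega> \<in> F" "\<omega> \<in> F"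
  shows "derived_ternary R x y z \<omega> = derived_ternary R' x' y' z' \<omega>"
  unfolding derived_ternary_def using assms by simp

lemma contract_0: "contract B X 0 = 0"
  by (intro ext) (simp add: contract_def)

lemma pullback_0: "pullback B F f 0 = 0"
  by (intro ext) (simp add: pullback_def)

lemma fmul_distrib: "fmul f (\<omega> + \<eta>) = fmul f \<omega> + fmul f \<eta>" "fmul f (\<omega> - \<eta>) = fmul f \<omega> - fmul f \<eta>"
    "fmul f (- \<omega>) = - fmul f \<omega>"
  by (intro ext; simp add: fmul_def algebra_simps)+

lemma contract_fmul: "contract B X (fmul f \<omega>) = fmul f (contract B X \<omega>)"
  by (intro ext) (simp add: contract_def fmul_def)

lemma fmul_minus_one: "fmul (\<lambda>_. - 1) \<omega> = - \<omega>"
  by (intro ext) (simp add: fmul_def)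

locale quasi_LA =
  fixes V :: "('h, 'e, 'g, 'm, 'v::euclidean_space) vbg"
    and Q qr :: "('g, 'h) form \<Rightarrow> ('g, 'h) form"
    and q :: "('g, 'h) form \<Rightarrow> ('m, 'e) form"
  assumes qLA: "quasi_LA_groupoid V Q q qr"

sublocale quasi_LA \<subseteq> vb_gpd V
  by unfold_locales (use qLA in \<open>simp add: quasi_LA_groupoid_def\<close>)

context quasi_LA
begin

lemma Q_field: "vector_field (Hb V) 1 Q" and R_field: "vector_field (Hb V) 2 qr"
  using qLA by (auto simp: quasi_LA_groupoid_def multiplicative_vf_def right_extension_def
      right_invariant_vf_def)

lemma Q_graded: "graded_derivation (Hb V) 1 1 Q"
  using B.vector_field_graded[OF Q_field] by simp

lemma R_graded: "graded_derivation (Hb V) 2 2 qr"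
  using B.vector_field_graded[OF R_field] by simp

lemmas Q_additive = B.graded_additive[OF Q_graded]
lemmas R_additive = B.graded_additive[OF R_graded]
lemmas Q_forms = B.graded_derivationD(2)[OF Q_graded]
lemmas R_forms = B.graded_derivationD(2)[OF R_graded]

text \<open>\<open>graded_derivation\<close> records additivity; linearity over real constants is
  taken from \<open>derivation_along\<close>. The homogeneity of the brackets rests on it.\<close>

lemma vector_field_scale:
  assumes "vector_field (Hb V) d D" "\<omega> \<in> forms (Hb V)"
  shows "D (fmul (\<lambda>_. a) \<omega>) = fmul (\<lambda>_. a) (D \<omega>)"
proof -
  have *: "D (\<lambda>b hs. a * \<omega> b hs + (0 :: ('g, 'h) form) b hs) = (\<lambda>b hs. a * D \<omega> b hs + D 0 b hs)"
    using assms B.forms_zero_in unfolding derivation_along_def by blast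
  have "(\<lambda>b hs. a * \<omega> b hs + (0 :: ('g, 'h) form) b hs) = fmul (\<lambda>_. a) \<omega>" by (intro ext) (simp add: fmul_def)
  then have "D (fmul (\<lambda>_. a) \<omega>) = (\<lambda>b hs. a * D \<omega> b hs + D 0 b hs)" using * by simp
  also have "\<dots> = fmul (\<lambda>_. a) (D \<omega>)"
    unfolding B.derivation_zero[OF B.vector_field_graded[OF assms(1)]] by (intro ext) (simp add: fmul_def)
  finally show ?thesis .
qed

lemma Q_triple: "\<exists>Q2. graded_derivation (comp_bundle V) 1 1 Q2 \<and> op_triple Q Q Q Q2"
proof -
  obtain Q2 where "vector_field (comp_bundle V) 1 Q2" "\<forall>\<omega>\<in>forms (Hb V).
        Q2 (pull_fst V \<omega>) = pull_fst V (Q \<omega>) \<and> Q2 (pull_snd V \<omega>) = pull_snd V (Q \<omega>) \<and> Q2 (pull_mul V \<omega>) =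
            pull_mul V (Q \<omega>)"
    using qLA unfolding quasi_LA_groupoid_def multiplicative_vf_def by blast
  then show ?thesis using C.vector_field_graded[of 1 Q2]
      by (intro exI[of _ Q2]) (simp add: op_triple_def intertwines_def)
qed

lemma R_triple: "\<exists>R2. graded_derivation (comp_bundle V) 2 2 R2 \<and> op_triple qr (\<lambda>\<omega>. 0) qr R2"
proof -
  obtain R2 where R2: "vector_field (comp_bundle V) 2 R2" "\<forall>\<omega>\<in>forms (Hb V).
        R2 (pull_fst V \<omega>) = pull_fst V (qr \<omega>) \<and> R2 (pull_snd V \<omega>) = (\<lambda>b hs. 0) \<and> R2 (pull_mul V \<omega>) = pull_mul
            V (qr \<omega>)"
    using qLA unfolding quasi_LA_groupoid_def right_extension_def right_invariant_vf_def by blast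
  have "pull_snd V 0 = (\<lambda>b hs. 0)" unfolding pull_snd_def pullback_0 by (intro ext) simp
  then show ?thesis using C.vector_field_graded[OF R2(1)] R2(2)
    by (intro exI[of _ R2]) (simp add: op_triple_def intertwines_def)
qed

lemma QQ: "\<omega> \<in> forms (Hb V) \<Longrightarrow> Q (Q \<omega>) = - pull_ivs V (qr (pull_ivs V \<omega>)) - qr \<omega>"
proof -
  assume "\<omega> \<in> forms (Hb V)"
  then have "Q (Q \<omega>) = (\<lambda>b hs. left_extension V qr \<omega> b hs - qr \<omega> b hs)"
    using qLA unfolding quasi_LA_groupoid_def by blast
  then show ?thesis by (intro ext) (simp add: left_extension_def)
qed

lemma QR: "\<omega> \<in> forms (Hb V) \<Longrightarrow> qr (Q \<omega>) = Q (qr \<omega>)"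
proof -
  assume \<omega>: "\<omega> \<in> forms (Hb V)"
  then have "gcomm 1 2 Q qr \<omega> = (\<lambda>b hs. 0)" using qLA unfolding quasi_LA_groupoid_def by blast
  then have "Q (qr \<omega>) - qr (Q \<omega>) = 0" by (simp add: gcomm_even zero_fun_def)
  then show ?thesis by simp
qed

section \<open>The bracket and the ternary operation on sections\<close>

abbreviation br where "br \<equiv> LA_bracket V Q"

definition ternary where "ternary X Y Z = (THE W. is_ternary V qr X Y Z W)"

lemma is_LA_bracket_ex1:
  assumes "X \<in> sections (Hb V)" "Y \<in> sections (Hb V)"
  shows "\<exists>!Z. is_LA_bracket V Q X Y Z"
  unfolding is_LA_bracket_def by (rule B.derivation_contract_ex1[OF B.bracket_graded[OF Q_graded assms]])

lemma is_ternary_ex1: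
  assumes "X \<in> sections (Hb V)" "Y \<in> sections (Hb V)" "Z \<in> sections (Hb V)"
  shows "\<exists>!W. is_ternary V qr X Y Z W"
  unfolding is_ternary_def by (rule B.derivation_contract_ex1[OF B.ternary_graded[OF R_graded assms]])

lemma br_in: "X \<in> sections (Hb V) \<Longrightarrow> Y \<in> sections (Hb V) \<Longrightarrow> br X Y \<in> sections (Hb V)"
  and contract_br_gcomm: "X \<in> sections (Hb V) \<Longrightarrow> Y \<in> sections (Hb V) \<Longrightarrow> \<omega> \<in> forms (Hb V) \<Longrightarrow>
    contract (Hb V) (br X Y) \<omega> = gcomm 0 1 (gcomm 1 1 (contract (Hb V) X) Q) (contract (Hb V) Y) \<omega>"
proof -
  have "is_LA_bracket V Q X Y (br X Y)" if "X \<in> sections (Hb V)" "Y \<in> sections (Hb V)"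
    unfolding LA_bracket_def by (rule theI'[OF is_LA_bracket_ex1[OF that]])
  then show "X \<in> sections (Hb V) \<Longrightarrow> Y \<in> sections (Hb V) \<Longrightarrow> br X Y \<in> sections (Hb V)"
    "X \<in> sections (Hb V) \<Longrightarrow> Y \<in> sections (Hb V) \<Longrightarrow> \<omega> \<in> forms (Hb V) \<Longrightarrow>
    contract (Hb V) (br X Y) \<omega> = gcomm 0 1 (gcomm 1 1 (contract (Hb V) X) Q) (contract (Hb V) Y) \<omega>"
    unfolding is_LA_bracket_def by blast+
qed

lemma ternary_in: "X \<in> sections (Hb V) \<Longrightarrow> Y \<in> sections (Hb V) \<Longrightarrow> Z \<in> sections (Hb V) \<Longrightarrow>
    ternary X Y Z \<in> sections (Hb V)"
  and contract_ternary_gcomm: "X \<in> sections (Hb V) \<Longrightarrow> Y \<in> sections (Hb V) \<Longrightarrow> Z \<in> sections (Hb V) \<Longrightarrow>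
      \<omega> \<in> forms (Hb V) \<Longrightarrow>
    contract (Hb V) (ternary X Y Z) \<omega> =
    gcomm 0 1 (gcomm 1 1 (gcomm 2 1 qr (contract (Hb V) X)) (contract (Hb V) Y)) (contract (Hb V) Z) \<omega>"
proof -
  have "is_ternary V qr X Y Z (ternary X Y Z)" if "X \<in> sections (Hb V)" "Y \<in> sections (Hb V)"
      "Z \<in> sections (Hb V)"
    unfolding ternary_def by (rule theI'[OF is_ternary_ex1[OF that]])
  then show "X \<in> sections (Hb V) \<Longrightarrow> Y \<in> sections (Hb V) \<Longrightarrow> Z \<in> sections (Hb V) \<Longrightarrow>
      ternary X Y Z \<in> sections (Hb V)"
    "X \<in> sections (Hb V) \<Longrightarrow> Y \<in> sections (Hb V) \<Longrightarrow> Z \<in> sections (Hb V) \<Longrightarrow> \<omega> \<in> forms (Hb V) \<Longrightarrow>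
    contract (Hb V) (ternary X Y Z) \<omega> =
    gcomm 0 1 (gcomm 1 1 (gcomm 2 1 qr (contract (Hb V) X)) (contract (Hb V) Y)) (contract (Hb V) Z) \<omega>"
    unfolding is_ternary_def by blast+
qed

lemma contract_br:
  assumes "X \<in> sections (Hb V)" "Y \<in> sections (Hb V)" "\<omega> \<in> forms (Hb V)"
  shows "contract (Hb V) (br X Y) \<omega> = derived_bracket Q (contract (Hb V) X) (contract (Hb V) Y) \<omega>"
  using contract_br_gcomm[OF assms] B.gcomm_derived_bracket[OF assms(1,2) Q_additive assms(3)] by simp

lemma contract_ternary:
  assumes "X \<in> sections (Hb V)" "Y \<in> sections (Hb V)" "Z \<in> sections (Hb V)" "\<omega> \<in> forms (Hb V)"
  shows "contract (Hb V) (ternary X Y Z) \<omega> =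
      derived_ternary qr (contract (Hb V) X) (contract (Hb V) Y) (contract (Hb V) Z) \<omega>"
  using contract_ternary_gcomm[OF assms] B.gcomm_derived_ternary[OF assms(1-3) R_forms assms(4)] by simp

lemma funs: "D \<in> forms (Hb V) \<rightarrow> forms (Hb V)" if "\<And>\<omega>. \<omega> \<in> forms (Hb V) \<Longrightarrow> D \<omega> \<in> forms (Hb V)"
  using that by blast

lemma contract_fun: "X \<in> sections (Hb V) \<Longrightarrow> contract (Hb V) X \<in> forms (Hb V) \<rightarrow> forms (Hb V)"
  by (intro funs B.forms_contract)

lemma br_triple:
  assumes X: "mult_triple X1 X0 X" and Y: "mult_triple Y1 Y0 Y"
  shows "mult_triple (br X1 Y1) (br X0 Y0) (br X Y)"
proof -
  have s: "X1 \<in> sections (Hb V)" "X0 \<in> sections (Hb V)" "X \<in> sections (Hb V)"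
    "Y1 \<in> sections (Hb V)" "Y0 \<in> sections (Hb V)" "Y \<in> sections (Hb V)"
    using X Y by (auto simp: mult_triple_def)
  obtain P where P: "P \<in> sections (comp_bundle V)"
    "op_triple (contract (Hb V) X1) (contract (Hb V) X0) (contract (Hb V) X) (contract (comp_bundle V) P)"
    by (rule mult_triple_contract[OF X])
  obtain P' where P': "P' \<in> sections (comp_bundle V)"
    "op_triple (contract (Hb V) Y1) (contract (Hb V) Y0) (contract (Hb V) Y) (contract (comp_bundle V) P')"
    by (rule mult_triple_contract[OF Y])
  obtain Q2 where Q2: "graded_derivation (comp_bundle V) 1 1 Q2" "op_triple Q Q Q Q2" using Q_triple by blast
  have q: "Q \<in> forms (Hb V) \<rightarrow> forms (Hb V)" by (intro funs Q_forms)
  have "op_triple (gcomm 0 1 (gcomm 1 1 (contract (Hb V) X1) Q) (contract (Hb V) Y1))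
    (gcomm 0 1 (gcomm 1 1 (contract (Hb V) X0) Q) (contract (Hb V) Y0))
    (gcomm 0 1 (gcomm 1 1 (contract (Hb V) X) Q) (contract (Hb V) Y))
    (gcomm 0 1 (gcomm 1 1 (contract (comp_bundle V) P) Q2) (contract (comp_bundle V) P'))"
    by (intro op_triple_gcomm P P' Q2 gcomm_forms contract_fun s q)
  then have "op_triple (contract (Hb V) (br X1 Y1)) (contract (Hb V) (br X0 Y0)) (contract (Hb V) (br X Y))
    (gcomm 0 1 (gcomm 1 1 (contract (comp_bundle V) P) Q2) (contract (comp_bundle V) P'))"
    by (rule op_triple_cong) (use s contract_br_gcomm in auto)
  then show ?thesis
    by (rule contract_mult_triple[OF _ C.bracket_graded[OF Q2(1) P(1) P'(1)]]) (intro br_in s)+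
qed

text \<open>On the second factor \<open>qr\<close> is related to the zero operator, so the middle
  component is zero whatever X0, Y0 and Z0 are.\<close>

lemma ternary_triple:
  assumes X: "mult_triple X1 X0 X" and Y: "mult_triple Y1 Y0 Y" and Z: "mult_triple Z1 Z0 Z"
  shows "mult_triple (ternary X1 Y1 Z1) B.szero (ternary X Y Z)"
proof -
  have s: "X1 \<in> sections (Hb V)" "X0 \<in> sections (Hb V)" "X \<in> sections (Hb V)"
    "Y1 \<in> sections (Hb V)" "Y0 \<in> sections (Hb V)" "Y \<in> sections (Hb V)"
    "Z1 \<in> sections (Hb V)" "Z0 \<in> sections (Hb V)" "Z \<in> sections (Hb V)"
    using X Y Z by (auto simp: mult_triple_def)
  obtain P where P: "P \<in> sections (comp_bundle V)"
    "op_triple (contract (Hb V) X1) (contract (Hb V) X0) (contract (Hb V) X) (contract (comp_bundle V) P)"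
    by (rule mult_triple_contract[OF X])
  obtain P' where P': "P' \<in> sections (comp_bundle V)"
    "op_triple (contract (Hb V) Y1) (contract (Hb V) Y0) (contract (Hb V) Y) (contract (comp_bundle V) P')"
    by (rule mult_triple_contract[OF Y])
  obtain P'' where P'': "P'' \<in> sections (comp_bundle V)"
    "op_triple (contract (Hb V) Z1) (contract (Hb V) Z0) (contract (Hb V) Z) (contract (comp_bundle V) P'')"
    by (rule mult_triple_contract[OF Z])
  obtain R2 where R2: "graded_derivation (comp_bundle V) 2 2 R2" "op_triple qr (\<lambda>\<omega>. 0) qr R2" using R_triple
      by blast
  have f: "qr \<in> forms (Hb V) \<rightarrow> forms (Hb V)" "(\<lambda>\<omega>. 0) \<in> forms (Hb V) \<rightarrow> forms (Hb V)"
    using R_forms B.forms_zero_in by auto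
  have "op_triple (gcomm 0 1 (gcomm 1 1 (gcomm 2 1 qr (contract (Hb V) X1)) (contract (Hb V) Y1)) (contract
      (Hb V) Z1))
    (gcomm 0 1 (gcomm 1 1 (gcomm 2 1 (\<lambda>\<omega>. 0) (contract (Hb V) X0)) (contract (Hb V) Y0)) (contract (Hb V) Z0))
    (gcomm 0 1 (gcomm 1 1 (gcomm 2 1 qr (contract (Hb V) X)) (contract (Hb V) Y)) (contract (Hb V) Z))
    (gcomm 0 1 (gcomm 1 1 (gcomm 2 1 R2 (contract (comp_bundle V) P)) (contract (comp_bundle V) P')) (contract
        (comp_bundle V) P''))"
    by (intro op_triple_gcomm P P' P'' R2 gcomm_forms contract_fun s f)
  then have "op_triple (contract (Hb V) (ternary X1 Y1 Z1)) (contract (Hb V) B.szero) (contract (Hb V)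
      (ternary X Y Z))
    (gcomm 0 1 (gcomm 1 1 (gcomm 2 1 R2 (contract (comp_bundle V) P)) (contract (comp_bundle V) P')) (contract
        (comp_bundle V) P''))"
  proof (rule op_triple_cong)
    fix \<omega> assume \<omega>: "\<omega> \<in> forms (Hb V)"
    show "contract (Hb V) B.szero \<omega> =
      gcomm 0 1 (gcomm 1 1 (gcomm 2 1 (\<lambda>\<omega>. 0) (contract (Hb V) X0)) (contract (Hb V) Y0)) (contract (Hb V) Z0)
          \<omega>"
      using B.contract_szero[OF \<omega>] by (simp add: gcomm_even gcomm_odd contract_0)
  qed (use s contract_ternary_gcomm in auto)
  then show ?thesis
    by (rule contract_mult_triple[OF _ C.ternary_graded[OF R2(1) P(1) P'(1) P''(1)]]) (intro ternary_in
        B.szero_in s)+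
qed

subsection \<open>Algebra of the operations on sections\<close>

lemmas op_simps = B.contract_szero B.contract_sadd contract_br contract_ternary
lemmas op_forms = B.forms_contract B.forms_add B.forms_diff B.forms_uminus Q_forms R_forms

lemma section_contractI:
  assumes "X \<in> sections (Hb V)" "Y \<in> sections (Hb V)" "\<And>\<omega>. \<omega> \<in> forms (Hb V) \<Longrightarrow> contract (Hb V) X \<omega> =
      contract (Hb V) Y \<omega>"
  shows "X = Y"
  using B.section_eq_iff[OF assms(1,2)] assms(3) by blast

lemma contract_sscl': "X \<in> sections (Hb V) \<Longrightarrow> \<omega> \<in> forms (Hb V) \<Longrightarrow> contract (Hb V) (B.sscl a X) \<omega> =
    fmul (\<lambda>_. a) (contract (Hb V) X \<omega>)"
  by (simp add: B.contract_sscl fmul_def)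

lemma fmul_const_forms: "\<omega> \<in> forms (Hb V) \<Longrightarrow> fmul (\<lambda>_. a) \<omega> \<in> forms (Hb V)"
  by (intro B.forms_fmul smooth_fun_const B.base)

lemmas contract_linear = B.additive_onD(2-4)[OF B.contract_additive]
lemmas Q_linear = B.additive_onD(2-4)[OF Q_additive] vector_field_scale[OF Q_field]
lemmas R_linear = B.additive_onD(2-4)[OF R_additive] vector_field_scale[OF R_field]

lemma br_sadd:
  assumes "X \<in> sections (Hb V)" "X' \<in> sections (Hb V)" "Y \<in> sections (Hb V)"
  shows "br (B.sadd X X') Y = B.sadd (br X Y) (br X' Y)" "br Y (B.sadd X X') = B.sadd (br Y X) (br Y X')"
  by (rule section_contractI; (intro br_in B.sadd_in assms)?;
      simp add: assms br_in B.sadd_in op_simps derived_bracket_def op_forms contract_linear Q_linear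
          algebra_simps)+

lemma br_sscl:
  assumes "X \<in> sections (Hb V)" "Y \<in> sections (Hb V)"
  shows "br (B.sscl a X) Y = B.sscl a (br X Y)" "br Y (B.sscl a X) = B.sscl a (br Y X)"
  by (rule section_contractI; (intro br_in B.sscl_in assms)?;
      simp add: assms br_in B.sscl_in op_simps contract_sscl' derived_bracket_def op_forms contract_linear
          Q_linear
        contract_fmul fmul_distrib fmul_const_forms)+

lemma ternary_sadd:
  assumes "X \<in> sections (Hb V)" "Y \<in> sections (Hb V)" "Z \<in> sections (Hb V)" "Z' \<in> sections (Hb V)"
  shows "ternary X Y (B.sadd Z Z') = B.sadd (ternary X Y Z) (ternary X Y Z')"
  by (rule section_contractI; (intro ternary_in B.sadd_in assms)?;
      simp add: assms ternary_in B.sadd_in op_simps derived_ternary_def op_forms contract_linear R_linear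
          algebra_simps)

lemma ternary_sscl:
  assumes "X \<in> sections (Hb V)" "Y \<in> sections (Hb V)" "Z \<in> sections (Hb V)"
  shows "ternary X Y (B.sscl a Z) = B.sscl a (ternary X Y Z)"
  by (rule section_contractI; (intro ternary_in B.sscl_in assms)?;
      simp add: assms ternary_in B.sscl_in op_simps contract_sscl' derived_ternary_def op_forms
          contract_linear R_linear
        contract_fmul fmul_distrib fmul_const_forms)

lemma br_skew:
  assumes X: "X \<in> sections (Hb V)" and Y: "Y \<in> sections (Hb V)"
  shows "br Y X = B.sscl (- 1) (br X Y)"
proof (rule section_contractI)
  fix \<omega> assume \<omega>: "\<omega> \<in> forms (Hb V)"
  show "contract (Hb V) (br Y X) \<omega> = contract (Hb V) (B.sscl (- 1) (br X Y)) \<omega>"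
    unfolding contract_sscl'[OF br_in[OF X Y] \<omega>] fmul_minus_one contract_br[OF X Y \<omega>] contract_br[OF Y X \<omega>]
    by (rule B.derived_bracket_skew[OF Q_additive B.contract_additive[OF X] B.contract_additive[OF Y]
        B.contract_anticommute[OF X Y] \<omega>])
qed (intro br_in B.sscl_in X Y)+

lemma ternary_skew:
  assumes X: "X \<in> sections (Hb V)" and Y: "Y \<in> sections (Hb V)" and Z: "Z \<in> sections (Hb V)"
  shows "ternary Y X Z = B.sscl (- 1) (ternary X Y Z)" "ternary X Z Y = B.sscl (- 1) (ternary X Y Z)"
proof -
  note sk = B.derived_ternary_skew[OF R_additive B.contract_additive[OF X] B.contract_additive[OF Y]
      B.contract_additive[OF Z]
      B.contract_anticommute[OF X Y] B.contract_anticommute[OF X Z] B.contract_anticommute[OF Y Z]]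
  show "ternary Y X Z = B.sscl (- 1) (ternary X Y Z)"
  proof (rule section_contractI)
    fix \<omega> assume \<omega>: "\<omega> \<in> forms (Hb V)"
    show "contract (Hb V) (ternary Y X Z) \<omega> = contract (Hb V) (B.sscl (- 1) (ternary X Y Z)) \<omega>"
      unfolding contract_sscl'[OF ternary_in[OF X Y Z] \<omega>] fmul_minus_one contract_ternary[OF X Y Z \<omega>]
          contract_ternary[OF Y X Z \<omega>]
      by (rule sk(1)[OF _ _ _ \<omega>])
  qed (intro ternary_in B.sscl_in X Y Z)+
  show "ternary X Z Y = B.sscl (- 1) (ternary X Y Z)"
  proof (rule section_contractI)
    fix \<omega> assume \<omega>: "\<omega> \<in> forms (Hb V)"
    show "contract (Hb V) (ternary X Z Y) \<omega> = contract (Hb V) (B.sscl (- 1) (ternary X Y Z)) \<omega>"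
      unfolding contract_sscl'[OF ternary_in[OF X Y Z] \<omega>] fmul_minus_one contract_ternary[OF X Y Z \<omega>]
          contract_ternary[OF X Z Y \<omega>]
      by (rule sk(2)[OF _ _ _ \<omega>])
  qed (intro ternary_in B.sscl_in X Y Z)+
qed

lemma sscl_zero: "X \<in> sections (Hb V) \<Longrightarrow> B.sscl 0 X = B.szero"
proof (rule section_contractI)
  fix \<omega> assume X: "X \<in> sections (Hb V)" and \<omega>: "\<omega> \<in> forms (Hb V)"
  show "contract (Hb V) (B.sscl 0 X) \<omega> = contract (Hb V) B.szero \<omega>"
    unfolding contract_sscl'[OF X \<omega>] B.contract_szero[OF \<omega>] by (intro ext) (simp add: fmul_def)
qed (use B.szero_in B.sscl_in in auto)

lemma br_szero:
  assumes "X \<in> sections (Hb V)"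
  shows "br B.szero X = B.szero" "br X B.szero = B.szero"
  using br_sscl[OF B.szero_in assms, of 0] br_in[OF B.szero_in assms] br_in[OF assms B.szero_in] sscl_zero
      B.szero_in by simp_all

lemma ternary_szero:
  assumes "X \<in> sections (Hb V)" "Y \<in> sections (Hb V)"
  shows "ternary X Y B.szero = B.szero"
  using ternary_sscl[OF assms B.szero_in, of 0] ternary_in[OF assms B.szero_in] sscl_zero B.szero_in by simp

end

subsection \<open>Inversion and the Jacobi identity\<close>

context vb_gpd
begin

abbreviation J where "J \<equiv> pull_ivs V"

lemma ivs_fibre: "x \<in> fibre (Hb V) g \<Longrightarrow> ivs (Hg V) x \<in> fibre (Hb V) (ivs (Gg V) g)"
  by (auto simp: fibre_Hb proj_ivs H.ivs_in)

lemma J_forms: "\<omega> \<in> forms (Hb V) \<Longrightarrow> J \<omega> \<in> forms (Hb V)"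
  unfolding pull_ivs_def
  by (rule pullback_forms[OF B.framed_bundle_axioms B.framed_bundle_axioms _ _ ivs_linear])
    (simp_all add: bas_Hb tot_Hb smooth_structure)

lemma J_J:
  assumes \<omega>: "\<omega> \<in> forms (Hb V)"
  shows "J (J \<omega>) = \<omega>"
proof (intro ext)
  fix g hs
  show "J (J \<omega>) g hs = \<omega> g hs"
  proof (cases "g \<in> pts (arr (Gg V)) \<and> set hs \<subseteq> fibre (Hb V) g")
    case True
    then have "map (ivs (Hg V) \<circ> ivs (Hg V)) hs = hs" by (intro map_idI) (auto simp: fibre_Hb H.ivs_ivs)
    moreover have "ivs (Hg V) ` set hs \<subseteq> fibre (Hb V) (ivs (Gg V) g)" using True ivs_fibre by blast
    ultimately show ?thesis using True by (simp add: pull_ivs_def pullback_def bas_Hb G.ivs_in G.ivs_ivs)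
  next
    case False
    then show ?thesis using B.forms_zero[OF \<omega>] by (auto simp: pull_ivs_def pullback_def bas_Hb)
  qed
qed

lemma J_linear: "J (\<omega> + \<eta>) = J \<omega> + J \<eta>" "J (\<omega> - \<eta>) = J \<omega> - J \<eta>" "J (- \<omega>) = - J \<omega>"
  by (intro ext; simp add: pull_ivs_def pullback_def)+

section \<open>Push-forward of sections along the inversion\<close>

definition push_ivs where "push_ivs X = (\<lambda>g\<in>pts (arr (Gg V)). ivs (Hg V) (X (ivs (Gg V) g)))"

lemma push_ivs_in:
  assumes X: "X \<in> sections (Hb V)"
  shows "push_ivs X \<in> sections (Hb V)"
proof (rule sectionI_Hb)
  have "smooth_map (arr (Gg V)) (arr (Hg V)) (\<lambda>g. ivs (Hg V) (X (ivs (Gg V) g)))"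
    by (intro smooth_map_compose[OF ssp(1) _ smooth_structure(7)] smooth_map_compose[OF ssp(2)
        smooth_structure(8)] section_Hb_smooth X)
  then show "smooth_map (arr (Gg V)) (arr (Hg V)) (push_ivs X)"
      by (rule smooth_map_cong[rotated]) (simp add: push_ivs_def)
  show "proj (Hb V) (push_ivs X g) = g" if "g \<in> pts (arr (Gg V))" for g
    using section_Hb[OF X G.ivs_in[OF that]] that by (simp add: push_ivs_def proj_ivs G.ivs_ivs)
qed (simp add: push_ivs_def)

text \<open>The inversion is an involution, so the push-forward acts on contractions by conjugation
  with \<open>J\<close>. In this way the contribution of q^l to the Jacobi identity is expressed by
  the ternary operation of q^r.\<close>

lemma contract_push_ivs:
  assumes X: "X \<in> sections (Hb V)" and \<omega>: "\<omega> \<in> forms (Hb V)"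
  shows "contract (Hb V) (push_ivs X) \<omega> = J (contract (Hb V) X (J \<omega>))"
proof -
  have "intertwines (Hb V) J (contract (Hb V) X) (contract (Hb V) (push_ivs X))"
    unfolding pull_ivs_def
  proof (rule intertwines_contract)
    fix g assume "g \<in> pts (bas (Hb V))"
    then have g: "g \<in> pts (arr (Gg V))" by (simp add: bas_Hb)
    show "push_ivs X g \<in> fibre (Hb V) g" by (rule section_Hb(1)[OF push_ivs_in[OF X] g])
    show "ivs (Hg V) (push_ivs X g) = X (ivs (Gg V) g)" using section_Hb(2)[OF X G.ivs_in[OF g]] g
        by (simp add: push_ivs_def H.ivs_ivs)
    show "ivs (Gg V) g \<in> pts (bas (Hb V))" using g by (simp add: bas_Hb G.ivs_in)
  qed
  then have "contract (Hb V) (push_ivs X) (J (J \<omega>)) = J (contract (Hb V) X (J \<omega>))"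
    using J_forms[OF \<omega>] unfolding intertwines_def by blast
  then show ?thesis by (simp only: J_J[OF \<omega>])
qed

text \<open>Groupoid morphisms commute with inversion: the product X(g^{-1}) X(g) is X(1_{s(g)}),
  which is idempotent and hence a unit.\<close>

lemma push_ivs_multiplicative:
  assumes X: "mult_triple X X X"
  shows "push_ivs X = X"
proof (rule extensionalityI)
  show "push_ivs X \<in> extensional (pts (arr (Gg V)))" by (simp add: push_ivs_def)
  show "X \<in> extensional (pts (arr (Gg V)))" using X by (simp add: mult_triple_def sections_def bas_Hb)
  fix g assume g: "g \<in> pts (arr (Gg V))"
  have Xs: "X \<in> sections (Hb V)" and m: "\<And>g h. (g, h) \<in> composable (Gg V) \<Longrightarrow> (X g, X h) \<in> composable (Hg V) \<and>
      X (mul (Gg V) g h) = mul (Hg V) (X g) (X h)"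
    using X by (auto simp: mult_triple_def)
  have c: "(ivs (Gg V) g, g) \<in> composable (Gg V)"
      "(unt (Gg V) (src (Gg V) g), unt (Gg V) (src (Gg V) g)) \<in> composable (Gg V)"
    using g by (auto intro!: G.composableI simp: G.ivs_in G.src_ivs G.src_in G.unt_in G.src_unt G.tgt_unt)
  have s: "src (Gg V) g \<in> pts (obj (Gg V))" using g by (rule G.src_in)
  have u: "X (unt (Gg V) (src (Gg V) g)) = unt (Hg V) (src (Hg V) (X (unt (Gg V) (src (Gg V) g))))"
    using m[OF c(2)] G.mul_unt_left[OF G.unt_in[OF s]] s by (intro H.idempotent_unit) (auto simp: G.tgt_unt)
  have p: "mul (Hg V) (X (ivs (Gg V) g)) (X g) = X (unt (Gg V) (src (Gg V) g))"
    using m[OF c(1)] g by (simp add: G.mul_ivs_left)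
  have e: "src (Hg V) (X (unt (Gg V) (src (Gg V) g))) = tgt (Hg V) (X (ivs (Gg V) g))"
    using arg_cong[OF u, of "tgt (Hg V)"] H.tgt_mul[OF conjunct1[OF m[OF c(1)]]] p
      section_Hb(2)[OF Xs G.unt_in[OF s]] by (simp add: H.tgt_unt H.src_in)
  have "X g = ivs (Hg V) (X (ivs (Gg V) g))"
    by (rule H.inverse_unique[OF conjunct1[OF m[OF c(1)]]]) (simp only: p u e[symmetric] flip: u)
  then show "push_ivs X g = X g" using g by (simp add: push_ivs_def)
qed

lemma zero_triple:
  assumes "mult_triple B.szero B.szero Z"
  shows "Z = B.szero"
proof (rule extensionalityI)
  show "Z \<in> extensional (pts (arr (Gg V)))" "B.szero \<in> extensional (pts (arr (Gg V)))"
    using assms by (auto simp: mult_triple_def sections_def bas_Hb)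
  fix g assume g: "g \<in> pts (arr (Gg V))"
  have c: "(g, unt (Gg V) (src (Gg V) g)) \<in> composable (Gg V)"
    using g by (intro G.composableI) (auto simp: G.src_in G.unt_in G.tgt_unt)
  have "Z (mul (Gg V) g (unt (Gg V) (src (Gg V) g))) =
      mul (Hg V) (B.szero g) (B.szero (unt (Gg V) (src (Gg V) g)))"
    using assms c unfolding mult_triple_def by blast
  then show "Z g = B.szero g"
    using zero_mul(2)[OF c] g by (simp add: szero_apply G.mul_unt_right G.src_in G.unt_in)
qed

lemma push_ivs_right_inv_apply:
  assumes u: "u \<in> sections (core V)" and g: "g \<in> pts (arr (Gg V))"
  shows "push_ivs (right_inv V u) g = mul (Hg V) (vzer (Hb V) g) (ivs (Hg V) (u (src (Gg V) g)))"
proof -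
  have z: "ivs (Hg V) (vzer (Hb V) (ivs (Gg V) g)) = vzer (Hb V) g"
    using fibre_linear_zero[OF B.framed_bundle_axioms B.framed_bundle_axioms ivs_linear, of "ivs (Gg V) g"] g
    by (simp add: bas_Hb G.ivs_in G.ivs_ivs)
  show ?thesis
    using H.ivs_mul[OF right_composable[OF u G.ivs_in[OF g]]] g z
        by (simp add: push_ivs_def right_inv_apply G.ivs_in G.tgt_ivs)
qed

lemma push_ivs_right_inv:
  assumes u: "u \<in> sections (core V)"
  shows "push_ivs (right_inv V u) = B.sscl (- 1) (left_inv V u)"
proof (rule extensionalityI)
  show "push_ivs (right_inv V u) \<in> extensional (pts (arr (Gg V)))"
      "B.sscl (- 1) (left_inv V u) \<in> extensional (pts (arr (Gg V)))"
    by (simp_all add: push_ivs_def section_space_def bas_Hb)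
  fix g assume g: "g \<in> pts (arr (Gg V))"
  have gB: "g \<in> pts (bas (Hb V))" using g by (simp add: bas_Hb)
  have L: "mul (Hg V) (vzer (Hb V) g) (ivs (Hg V) (u (src (Gg V) g))) \<in> fibre (Hb V) g"
    using B.section_in[OF left_mul_in[OF u] gB] g by simp
  show "push_ivs (right_inv V u) g = B.sscl (- 1) (left_inv V u) g"
    using gB g B.vscl_vscl[OF gB L, of "- 1" "- 1"] B.vscl_one[OF gB L]
    by (simp add: push_ivs_right_inv_apply[OF u] B.sections_apply left_inv_apply)
qed

lemma delta_push_ivs: "u \<in> sections (core V) \<Longrightarrow> delta V u = B.sadd (right_inv V u) (push_ivs (right_inv V u))"
  by (simp add: delta_sadd push_ivs_right_inv)

end

context quasi_LA
begin

lemma contract_push_ivs_J: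
  "X \<in> sections (Hb V) \<Longrightarrow> \<omega> \<in> forms (Hb V) \<Longrightarrow> contract (Hb V) (push_ivs X) (J \<omega>) = J (contract (Hb V) X \<omega>)"
  by (simp add: contract_push_ivs J_forms J_J)

section \<open>Jacobi and coherence identities for contractions\<close>

lemma br_br_contract:
  assumes "X \<in> sections (Hb V)" "Y \<in> sections (Hb V)" "Z \<in> sections (Hb V)" "\<omega> \<in> forms (Hb V)"
  shows "contract (Hb V) (br X (br Y Z)) \<omega> =
      derived_bracket Q (contract (Hb V) X) (derived_bracket Q (contract (Hb V) Y) (contract (Hb V) Z)) \<omega>"
    "contract (Hb V) (br (br X Y) Z) \<omega> =
      derived_bracket Q (derived_bracket Q (contract (Hb V) X) (contract (Hb V) Y)) (contract (Hb V) Z) \<omega>"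
  unfolding contract_br[OF assms(1) br_in[OF assms(2,3)] assms(4)] contract_br[OF br_in[OF assms(1,2)]
      assms(3,4)]
  by (rule B.derived_bracket_cong; use assms in \<open>simp add: contract_br[symmetric] br_in op_forms\<close>;
      use assms in \<open>simp add: contract_br br_in op_forms\<close>)+

text \<open>The Jacobi defect is minus the derived ternary operation of Q^2, and Q^2 = - J q^r J -
  q^r by \<open>QQ\<close>. The summand conjugated by \<open>J\<close> is the push-forward of the
  ternary operation on the pushed-forward sections.\<close>

lemma jacobi_contract:
  assumes X: "X \<in> sections (Hb V)" "Y \<in> sections (Hb V)" "Z \<in> sections (Hb V)" and \<omega>: "\<omega> \<in> forms (Hb V)"
  shows "contract (Hb V) (br X (br Y Z)) \<omega> - contract (Hb V) (br Y (br X Z)) \<omega> - contract (Hb V) (br (br X Y)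
      Z) \<omega>
    = contract (Hb V) (ternary X Y Z) \<omega> + contract (Hb V) (push_ivs (ternary (push_ivs X) (push_ivs Y)
        (push_ivs Z))) \<omega>"
proof -
  let ?x = "contract (Hb V) X" and ?y = "contract (Hb V) Y" and ?z = "contract (Hb V) Z"
  have "derived_ternary (\<lambda>\<omega>. Q (Q \<omega>)) ?x ?y ?z \<omega> =
      - derived_ternary (\<lambda>\<omega>. J (qr (J \<omega>))) ?x ?y ?z \<omega> - derived_ternary qr ?x ?y ?z \<omega>"
    unfolding derived_ternary_def using assms
    by (simp add: QQ op_forms J_forms contract_linear algebra_simps)
  moreover have "derived_ternary (\<lambda>\<omega>. J (qr (J \<omega>))) ?x ?y ?z \<omega> =
      contract (Hb V) (push_ivs (ternary (push_ivs X) (push_ivs Y) (push_ivs Z))) \<omega>"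
  proof -
    have "contract (Hb V) (push_ivs (ternary (push_ivs X) (push_ivs Y) (push_ivs Z))) \<omega> =
        J (derived_ternary qr (contract (Hb V) (push_ivs X)) (contract (Hb V) (push_ivs Y)) (contract (Hb V)
            (push_ivs Z)) (J \<omega>))"
      using assms by (simp add: contract_push_ivs contract_ternary push_ivs_in ternary_in J_forms)
    also have "\<dots> = derived_ternary (\<lambda>\<omega>. J (qr (J \<omega>))) ?x ?y ?z \<omega>"
      unfolding derived_ternary_def using assms
      by (simp add: contract_push_ivs_J contract_push_ivs[of _ "qr _"] contract_push_ivs[of _
          "contract _ _ (qr _)"]
          contract_push_ivs[of _ "contract _ _ (contract _ _ (qr _))"] op_forms push_ivs_in J_forms J_J
              J_linear)
    finally show ?thesis by simp
  qed
  moreover have "contract (Hb V) (br X (br Y Z)) \<omega> - contract (Hb V) (br Y (br X Z)) \<omega> - contract (Hb V) (br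
      (br X Y) Z) \<omega>
    = - derived_ternary (\<lambda>\<omega>. Q (Q \<omega>)) ?x ?y ?z \<omega>"
    unfolding br_br_contract[OF X \<omega>] br_br_contract(1)[OF X(2,1,3) \<omega>]
    by (rule B.derived_jacobi; (intro Q_additive B.contract_additive B.contract_anticommute X \<omega>; assumption)?)
  ultimately show ?thesis using contract_ternary[OF X \<omega>] by simp
qed

lemma ternary_br_contract:
  assumes "W \<in> sections (Hb V)" "X \<in> sections (Hb V)" "Y \<in> sections (Hb V)" "Z \<in> sections (Hb V)"
      "\<omega> \<in> forms (Hb V)"
  shows "contract (Hb V) (br W (ternary X Y Z)) \<omega> =
      derived_bracket Q (contract (Hb V) W) (derived_ternary qr (contract (Hb V) X) (contract (Hb V) Y)
          (contract (Hb V) Z)) \<omega>"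
    "contract (Hb V) (ternary (br W X) Y Z) \<omega> =
      derived_ternary qr (derived_bracket Q (contract (Hb V) W) (contract (Hb V) X)) (contract (Hb V) Y)
          (contract (Hb V) Z) \<omega>"
    "contract (Hb V) (ternary Y (br W X) Z) \<omega> =
      derived_ternary qr (contract (Hb V) Y) (derived_bracket Q (contract (Hb V) W) (contract (Hb V) X))
          (contract (Hb V) Z) \<omega>"
    "contract (Hb V) (ternary Y Z (br W X)) \<omega> =
      derived_ternary qr (contract (Hb V) Y) (contract (Hb V) Z) (derived_bracket Q (contract (Hb V) W)
          (contract (Hb V) X)) \<omega>"
proof -
  note t = ternary_in[OF assms(2-4)] and b = br_in[OF assms(1,2)]
  have tf: "derived_ternary qr (contract (Hb V) X) (contract (Hb V) Y) (contract (Hb V) Z) \<omega> \<in> forms (Hb V)"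
    if "\<omega> \<in> forms (Hb V)" for \<omega>
    using B.forms_contract[OF t that] contract_ternary[OF assms(2-4) that] by simp
  have bf: "derived_bracket Q (contract (Hb V) W) (contract (Hb V) X) \<omega> \<in> forms (Hb V)" if "\<omega> \<in> forms (Hb V)"
      for \<omega>
    using B.forms_contract[OF b that] contract_br[OF assms(1,2) that] by simp
  note B.forms_contract[OF assms(1)] B.forms_contract[OF assms(2)] B.forms_contract[OF assms(3)]
      B.forms_contract[OF assms(4)]
  note f = this Q_forms R_forms tf bf contract_ternary[OF assms(2-4)] contract_br[OF assms(1,2)] assms(5) refl
  show "contract (Hb V) (br W (ternary X Y Z)) \<omega> =
      derived_bracket Q (contract (Hb V) W) (derived_ternary qr (contract (Hb V) X) (contract (Hb V) Y)
          (contract (Hb V) Z)) \<omega>"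
    unfolding contract_br[OF assms(1) t assms(5)] by (rule B.derived_bracket_cong) (rule f; assumption?)+
  show "contract (Hb V) (ternary (br W X) Y Z) \<omega> =
      derived_ternary qr (derived_bracket Q (contract (Hb V) W) (contract (Hb V) X)) (contract (Hb V) Y)
          (contract (Hb V) Z) \<omega>"
    unfolding contract_ternary[OF b assms(3-5)] by (rule B.derived_ternary_cong) (rule f; assumption?)+
  show "contract (Hb V) (ternary Y (br W X) Z) \<omega> =
      derived_ternary qr (contract (Hb V) Y) (derived_bracket Q (contract (Hb V) W) (contract (Hb V) X))
          (contract (Hb V) Z) \<omega>"
    unfolding contract_ternary[OF assms(3) b assms(4,5)]
        by (rule B.derived_ternary_cong) (rule f; assumption?)+
  show "contract (Hb V) (ternary Y Z (br W X)) \<omega> =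
      derived_ternary qr (contract (Hb V) Y) (contract (Hb V) Z) (derived_bracket Q (contract (Hb V) W)
          (contract (Hb V) X)) \<omega>"
    unfolding contract_ternary[OF assms(3,4) b assms(5)]
        by (rule B.derived_ternary_cong) (rule f; assumption?)+
qed

lemma contract_skew:
  assumes "X \<in> sections (Hb V)" "Y \<in> sections (Hb V)" "Z \<in> sections (Hb V)" "\<omega> \<in> forms (Hb V)"
  shows "contract (Hb V) (ternary Y X Z) \<omega> = - contract (Hb V) (ternary X Y Z) \<omega>"
    "contract (Hb V) (ternary X Z Y) \<omega> = - contract (Hb V) (ternary X Y Z) \<omega>"
    "contract (Hb V) (br Y X) \<omega> = - contract (Hb V) (br X Y) \<omega>"
  using ternary_skew[OF assms(1-3)] br_skew[OF assms(1,2)] assms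
  by (simp_all only: contract_sscl' ternary_in br_in fmul_minus_one)

lemma coherence_contract:
  assumes W: "W \<in> sections (Hb V)" and X: "X \<in> sections (Hb V)" and Y: "Y \<in> sections (Hb V)"
      and Z: "Z \<in> sections (Hb V)"
    and \<omega>: "\<omega> \<in> forms (Hb V)"
  shows "contract (Hb V) (br W (ternary X Y Z)) \<omega> - contract (Hb V) (br X (ternary W Y Z)) \<omega>
    + contract (Hb V) (br Y (ternary W X Z)) \<omega> - contract (Hb V) (br Z (ternary W X Y)) \<omega> =
    contract (Hb V) (ternary (br W X) Y Z) \<omega> - contract (Hb V) (ternary (br W Y) X Z) \<omega>
    + contract (Hb V) (ternary (br W Z) X Y) \<omega> + contract (Hb V) (ternary (br X Y) W Z) \<omega>
    - contract (Hb V) (ternary (br X Z) W Y) \<omega> + contract (Hb V) (ternary (br Y Z) W X) \<omega>"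
proof -
  have t: "derived_ternary qr (contract (Hb V) W) (contract (Hb V) X) (contract (Hb V) Y) (contract (Hb V) Z
      \<omega>)
    + contract (Hb V) Z (derived_ternary qr (contract (Hb V) W) (contract (Hb V) X) (contract (Hb V) Y) \<omega>) =
        0"
    if "\<omega> \<in> forms (Hb V)" for \<omega>
    using B.contract_anticommute[OF Z ternary_in[OF W X Y] that] that
    by (simp add: contract_ternary[OF W X Y] B.forms_contract[OF Z])
  have "contract (Hb V) (br W (ternary X Y Z)) \<omega> - contract (Hb V) (br X (ternary W Y Z)) \<omega>
    + contract (Hb V) (br Y (ternary W X Z)) \<omega> - contract (Hb V) (br Z (ternary W X Y)) \<omega> =
    contract (Hb V) (ternary (br W X) Y Z) \<omega> + contract (Hb V) (ternary X (br W Y) Z) \<omega>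
    + contract (Hb V) (ternary X Y (br W Z)) \<omega> + contract (Hb V) (ternary W X (br Y Z)) \<omega>
    - contract (Hb V) (ternary W (br X Y) Z) \<omega> - contract (Hb V) (ternary W Y (br X Z)) \<omega>"
    unfolding ternary_br_contract(1)[OF W X Y Z \<omega>] ternary_br_contract(1)[OF X W Y Z \<omega>]
        ternary_br_contract(1)[OF Y W X Z \<omega>]
      ternary_br_contract(1)[OF Z W X Y \<omega>] ternary_br_contract(2)[OF W X Y Z \<omega>] ternary_br_contract(3)[OF W Y
          X Z \<omega>]
      ternary_br_contract(4)[OF W Z X Y \<omega>] ternary_br_contract(4)[OF Y Z W X \<omega>] ternary_br_contract(3)[OF X Y
          W Z \<omega>]
      ternary_br_contract(4)[OF X Z W Y \<omega>]
    by (rule B.derived_coherence) (rule Q_additive R_additive B.contract_additive[OF W] B.contract_additive[OF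
        X]
        B.contract_additive[OF Y] B.contract_additive[OF Z] B.contract_anticommute W X Y Z QR t \<omega>;
            assumption?)+
  \<comment> \<open>Skewness moves every inner bracket into the first slot, where the coherence
    axiom has it.\<close>
  then show ?thesis
    using contract_skew(1)[OF br_in[OF W Y] X Z \<omega>] contract_skew(1)[OF br_in[OF X Y] W Z \<omega>]
      contract_skew(1)[OF br_in[OF W Z] X Y \<omega>] contract_skew(2)[OF X br_in[OF W Z] Y \<omega>]
      contract_skew(1)[OF br_in[OF Y Z] W X \<omega>] contract_skew(2)[OF W br_in[OF Y Z] X \<omega>]
      contract_skew(1)[OF br_in[OF X Z] W Y \<omega>] contract_skew(2)[OF W br_in[OF X Z] Y \<omega>]
    by simp
qed

end

subsection \<open>The modules of core sections and of multiplicative sections\<close>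

context framed_bundle
begin

lemma contract_eqI:
  assumes "X \<in> sections B" "Y \<in> sections B" "\<And>\<omega> b hs. \<omega> \<in> forms B \<Longrightarrow> contract B X \<omega> b hs = contract B Y \<omega> b hs"
  shows "X = Y"
  using section_eq_iff[OF assms(1,2)] assms(3) by blast

text \<open>Sections are determined by their contractions, and on the values of contractions each
  law is an identity between real numbers.\<close>

lemma section_module_laws:
  assumes "X \<in> sections B"
  shows "Y \<in> sections B \<Longrightarrow> Z \<in> sections B \<Longrightarrow> sadd (sadd X Y) Z = sadd X (sadd Y Z)"
    "Y \<in> sections B \<Longrightarrow> sadd X Y = sadd Y X" "sadd szero X = X" "sadd (sscl (- 1) X) X = szero"
    "sscl (a + b) X = sadd (sscl a X) (sscl b X)" "Y \<in> sections B \<Longrightarrow> sscl a (sadd X Y) =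
        sadd (sscl a X) (sscl a Y)"
    "sscl (a * b) X = sscl a (sscl b X)" "sscl 1 X = X"
  by (rule contract_eqI; use assms in \<open>simp add: contract_sadd contract_sscl contract_szero sadd_in sscl_in
      szero_in algebra_simps\<close>)+

lemma section_submodule:
  assumes S: "S \<subseteq> sections B" and "szero \<in> S" "\<And>X Y. X \<in> S \<Longrightarrow> Y \<in> S \<Longrightarrow> sadd X Y \<in> S" "\<And>a X. X \<in> S \<Longrightarrow>
      sscl a X \<in> S"
  shows "Module.module real_field ((section_space B)\<lparr>carrier := S\<rparr>)"
  by (rule real_moduleI; (simp add: assms section_module_laws(1,3-) subsetD[OF S])?; simp add:
      section_module_laws(2) subsetD[OF S])

end

context vb_gpd
begin

lemma mul_space_simps:
  "carrier (mul_space V) = mul_sections V" "add (mul_space V) = B.sadd" "smult (mul_space V) = B.sscl"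
      "zero (mul_space V) = B.szero"
  by (simp_all add: mul_space_def)

lemma mul_in_sections: "X \<in> mul_sections V \<Longrightarrow> X \<in> sections (Hb V)"
  by (simp add: mul_sections_def)

lemma mul_sections_closed:
  "X \<in> mul_sections V \<Longrightarrow> Y \<in> mul_sections V \<Longrightarrow> B.sadd X Y \<in> mul_sections V"
  "X \<in> mul_sections V \<Longrightarrow> B.sscl a X \<in> mul_sections V" "B.szero \<in> mul_sections V"
  unfolding mul_sections_iff by (intro mult_triple_sadd mult_triple_sscl mult_triple_szero; assumption)+

lemma mul_module: "Module.module real_field (mul_space V)"
  unfolding mul_space_def by (rule B.section_submodule) (auto intro: mul_sections_closed mul_in_sections)

section \<open>The module of core sections\<close>

lemma core_space_simps:
  "carrier (core_space V) = sections (core V)"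
  "add (core_space V) u v = (\<lambda>x\<in>pts (obj (Gg V)). vadd (Hb V) (u x) (v x))"
  "smult (core_space V) a u = (\<lambda>x\<in>pts (obj (Gg V)). vscl (Hb V) a (u x))"
  "zero (core_space V) = (\<lambda>x\<in>pts (obj (Gg V)). vzer (Hb V) (unt (Gg V) x))"
  by (auto simp: core_space_def section_space_def core_def Let_def)

lemma sscl_szero: "B.sscl a B.szero = B.szero"
  by (rule B.contract_eqI) (simp_all add: B.sscl_in B.szero_in B.contract_sscl B.contract_szero)

text \<open>A function on objects given by a pointwise formula has only to agree at units with a
  right-invariant section; that it is a smooth section of the core follows. Sums, multiples and zero
  of core sections are treated this way.\<close>

lemma right_triple_eq:
  assumes t: "mult_triple Z B.szero Z" and u: "u \<in> extensional (pts (obj (Gg V)))" "\<And>x. x \<in> pts (obj (Gg V)) \<Longrightarrow>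
      u x = Z (unt (Gg V) x)"
  shows "u \<in> sections (core V)" "right_inv V u = Z"
proof -
  obtain c where c: "c \<in> sections (core V)" "right_inv V c = Z" by (rule right_triple_core[OF t])
  have "c = u"
    by (rule extensionalityI[OF core_section(1)[OF c(1)] u(1)]) (use c right_inv_unit[OF c(1)] u(2) in simp)
  with c show "u \<in> sections (core V)" "right_inv V u = Z" by simp_all
qed

lemma core_add:
  assumes "u \<in> sections (core V)" "v \<in> sections (core V)"
  shows "add (core_space V) u v \<in> sections (core V)" "right_inv V (add (core_space V) u v) =
      B.sadd (right_inv V u) (right_inv V v)"
proof -
  have "B.sadd B.szero B.szero = B.szero" by (rule B.section_module_laws(3)[OF B.szero_in])
  then have t: "mult_triple (B.sadd (right_inv V u) (right_inv V v)) B.szero (B.sadd (right_inv V u)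
      (right_inv V v))"
    using mult_triple_sadd[OF right_inv_triple[OF assms(1)] right_inv_triple[OF assms(2)]] by simp
  show "add (core_space V) u v \<in> sections (core V)" "right_inv V (add (core_space V) u v) =
      B.sadd (right_inv V u) (right_inv V v)"
    by (rule right_triple_eq[OF t]; use assms in \<open>simp add: core_space_simps B.sections_apply bas_Hb G.unt_in
        right_inv_unit\<close>)+
qed

lemma core_smult:
  assumes "u \<in> sections (core V)"
  shows "smult (core_space V) a u \<in> sections (core V)" "right_inv V (smult (core_space V) a u) =
      B.sscl a (right_inv V u)"
proof -
  have t: "mult_triple (B.sscl a (right_inv V u)) B.szero (B.sscl a (right_inv V u))"
    using mult_triple_sscl[OF right_inv_triple[OF assms(1)]] by (simp add: sscl_szero)
  show "smult (core_space V) a u \<in> sections (core V)" "right_inv V (smult (core_space V) a u) =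
      B.sscl a (right_inv V u)"
    by (rule right_triple_eq[OF t]; use assms in \<open>simp add: core_space_simps B.sections_apply bas_Hb G.unt_in
        right_inv_unit\<close>)+
qed

lemma core_zero: "zero (core_space V) \<in> sections (core V)" "right_inv V (zero (core_space V)) = B.szero"
  by (rule right_triple_eq[OF mult_triple_szero]; simp add: core_space_simps szero_apply G.unt_in)+

text \<open>The map u -> u^r is injective and linear, so the module laws are inherited from the
  sections of H.\<close>

lemma core_module: "Module.module real_field (core_space V)"
  by (rule real_moduleI; unfold core_space_simps(1); (intro core_add core_smult core_zero)?; assumption?;
      rule right_inv_inj; simp add: core_add core_smult core_zero right_inv_in B.section_module_laws)

lemma core_eqI:
  assumes "u \<in> sections (core V)" "v \<in> sections (core V)"
    "\<And>\<omega>. \<omega> \<in> forms (Hb V) \<Longrightarrow> contract (Hb V) (right_inv V u) \<omega> = contract (Hb V) (right_inv V v) \<omega>"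
  shows "u = v"
  by (rule right_inv_inj[OF assms(1,2)]) (use B.section_eq_iff[OF right_inv_in right_inv_in] assms in blast)

lemma push_ivs_right_triple: "u \<in> sections (core V) \<Longrightarrow>
    mult_triple B.szero (push_ivs (right_inv V u)) (push_ivs (right_inv V u))"
  using mult_triple_sscl[OF left_inv_triple, of u "- 1"] by (simp add: push_ivs_right_inv sscl_szero)

lemma push_ivs_sadd: "X \<in> sections (Hb V) \<Longrightarrow> Y \<in> sections (Hb V) \<Longrightarrow> push_ivs (B.sadd X Y) =
    B.sadd (push_ivs X) (push_ivs Y)"
  by (rule B.contract_eqI) (simp_all add: push_ivs_in B.sadd_in contract_push_ivs B.contract_sadd J_forms
      J_linear)

lemma J_scale: "J (\<lambda>b hs. a * \<omega> b hs) = (\<lambda>b hs. a * J \<omega> b hs)"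
  by (intro ext) (simp add: pull_ivs_def pullback_def)

lemma push_ivs_sscl: "X \<in> sections (Hb V) \<Longrightarrow> push_ivs (B.sscl a X) = B.sscl a (push_ivs X)"
  by (rule B.contract_eqI) (simp_all add: push_ivs_in B.sscl_in contract_push_ivs B.contract_sscl J_forms
      J_scale)

lemma J_0: "J 0 = 0"
  by (simp add: pull_ivs_def pullback_0)

lemma push_ivs_szero: "push_ivs B.szero = B.szero"
  by (rule B.contract_eqI) (simp_all add: push_ivs_in B.szero_in contract_push_ivs B.contract_szero J_forms
      J_0)

end

subsection \<open>The \<open>L\<^sub>2\<close>-algebra\<close>

context quasi_LA
begin

text \<open>The triples (X, X, X) and (c^r, 0, c^r) have as bracket a triple with zero middle
  component, so [X, c^r] is right-invariant.\<close>

lemma is_action_ex1: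
  assumes X: "X \<in> mul_sections V" and c: "c \<in> sections (core V)"
  shows "\<exists>!c'. is_action V Q X c c'"
proof -
  have "mult_triple (br X (right_inv V c)) B.szero (br X (right_inv V c))"
    using br_triple[OF X[unfolded mul_sections_iff] right_inv_triple[OF c]]
        by (simp add: br_szero mul_in_sections[OF X])
  then obtain c' where "c' \<in> sections (core V)" "right_inv V c' = br X (right_inv V c)"
      by (rule right_triple_core)
  then show ?thesis by (intro ex1I[of _ c']) (auto simp: is_action_def intro: right_inv_inj)
qed

lemma action_in: "X \<in> mul_sections V \<Longrightarrow> c \<in> sections (core V) \<Longrightarrow> action V Q X c \<in> sections (core V)"
  and right_inv_action: "X \<in> mul_sections V \<Longrightarrow> c \<in> sections (core V) \<Longrightarrow>
    right_inv V (action V Q X c) = br X (right_inv V c)"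
proof -
  have "is_action V Q X c (action V Q X c)" if "X \<in> mul_sections V" "c \<in> sections (core V)"
    unfolding action_def by (rule theI'[OF is_action_ex1[OF that]])
  then show "X \<in> mul_sections V \<Longrightarrow> c \<in> sections (core V) \<Longrightarrow> action V Q X c \<in> sections (core V)"
    "X \<in> mul_sections V \<Longrightarrow> c \<in> sections (core V) \<Longrightarrow> right_inv V (action V Q X c) = br X (right_inv V c)"
    by (simp_all add: is_action_def)
qed

text \<open>The pullback of the linear function of c along the target map of the dual groupoid is
  the linear function of c^r. One-forms supply enough points of the dual bundle to separate the
  vectors of a fibre.\<close>

lemma is_triple_iff:
  assumes X: "X \<in> sections (Hb V)" "Y \<in> sections (Hb V)" "Z \<in> sections (Hb V)"
  shows "is_triple V qr X Y Z c \<longleftrightarrow> c \<in> sections (core V) \<and> right_inv V c = ternary X Y Z"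
proof (cases "c \<in> sections (core V)")
  case c: True
  note T = ternary_in[OF X]
  have "is_triple V qr X Y Z c \<longleftrightarrow> (\<forall>(g, \<xi>)\<in>dual_pts (Hb V). \<xi> (ternary X Y Z g) = \<xi> (right_inv V c g))"
    using c by (auto simp: is_triple_def pi_r_def ternary_def[symmetric] ell_def tgt_dual_def right_inv_apply
        dual_pts_def bas_Hb)
  moreover have "right_inv V c = ternary X Y Z"
    if *: "\<forall>(g, \<xi>)\<in>dual_pts (Hb V). \<xi> (ternary X Y Z g) = \<xi> (right_inv V c g)"
  proof (rule extensionalityI)
    show "right_inv V c \<in> extensional (pts (arr (Gg V)))" "ternary X Y Z \<in> extensional (pts (arr (Gg V)))"
      using right_inv_in[OF c] T by (simp_all add: sections_def bas_Hb)
    fix g assume g: "g \<in> pts (arr (Gg V))"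
    then have gB: "g \<in> pts (bas (Hb V))" by (simp add: bas_Hb)
    show "right_inv V c g = ternary X Y Z g"
    proof (rule B.point_eqI[OF gB B.section_in[OF right_inv_in[OF c] gB] B.section_in[OF T gB]])
      fix \<alpha> assume \<alpha>: "\<alpha> \<in> k_forms (Hb V) 1"
      have "(g, \<lambda>h. \<alpha> g [h]) \<in> dual_pts (Hb V)"
        using B.one_form_vadd[OF B.k_forms_forms[OF \<alpha>] gB] gB by (simp add: dual_pts_def)
      then show "\<alpha> g [right_inv V c g] = \<alpha> g [ternary X Y Z g]" using * by fastforce
    qed
  qed
  ultimately show ?thesis using c by auto
qed (simp add: is_triple_def)

lemma is_triple_ex1:
  assumes X: "X \<in> mul_sections V" "Y \<in> mul_sections V" "Z \<in> mul_sections V"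
  shows "\<exists>!c. is_triple V qr X Y Z c"
proof -
  have "mult_triple (ternary X Y Z) B.szero (ternary X Y Z)"
    using ternary_triple X by (simp add: mul_sections_iff)
  then obtain c where "c \<in> sections (core V)" "right_inv V c = ternary X Y Z" by (rule right_triple_core)
  then show ?thesis
    by (intro ex1I[of _ c]) (auto simp: is_triple_iff X mul_in_sections intro: right_inv_inj)
qed

lemma triple_in: "X \<in> mul_sections V \<Longrightarrow> Y \<in> mul_sections V \<Longrightarrow> Z \<in> mul_sections V \<Longrightarrow>
    triple V qr X Y Z \<in> sections (core V)"
  and right_inv_tri: "X \<in> mul_sections V \<Longrightarrow> Y \<in> mul_sections V \<Longrightarrow> Z \<in> mul_sections V \<Longrightarrow>
    right_inv V (triple V qr X Y Z) = ternary X Y Z"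
proof -
  have "is_triple V qr X Y Z (triple V qr X Y Z)" if "X \<in> mul_sections V" "Y \<in> mul_sections V"
      "Z \<in> mul_sections V"
    unfolding triple_def by (rule theI'[OF is_triple_ex1[OF that]])
  then show "X \<in> mul_sections V \<Longrightarrow> Y \<in> mul_sections V \<Longrightarrow> Z \<in> mul_sections V \<Longrightarrow>
      triple V qr X Y Z \<in> sections (core V)"
    "X \<in> mul_sections V \<Longrightarrow> Y \<in> mul_sections V \<Longrightarrow> Z \<in> mul_sections V \<Longrightarrow> right_inv V (triple V qr X Y Z) =
        ternary X Y Z"
    by (simp_all add: is_triple_iff mul_in_sections)
qed

lemma br_mul: "X \<in> mul_sections V \<Longrightarrow> Y \<in> mul_sections V \<Longrightarrow> br X Y \<in> mul_sections V"
  unfolding mul_sections_iff by (rule br_triple)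

lemma br_left_right:
  assumes "u \<in> sections (core V)" "v \<in> sections (core V)"
  shows "br (push_ivs (right_inv V u)) (right_inv V v) = B.szero"
  using br_triple[OF push_ivs_right_triple[OF assms(1)] right_inv_triple[OF assms(2)]]
  by (intro zero_triple) (simp add: br_szero right_inv_in push_ivs_in assms)

text \<open>The first component of the resulting triple is the ternary operation with 0 in its last
  slot, the middle one is always 0, and \<open>zero_triple\<close> applies.\<close>

lemma ternary_left:
  assumes "X \<in> mul_sections V" "Y \<in> mul_sections V" "u \<in> sections (core V)"
  shows "ternary X Y (push_ivs (right_inv V u)) = B.szero"
  using ternary_triple[OF _ _ push_ivs_right_triple[OF assms(3)], of X X X Y Y Y] assms
  by (intro zero_triple) (simp add: ternary_szero mul_sections_iff[symmetric] mul_in_sections)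

text \<open>Both sides are left-invariant, hence determined by their values at units. There the
  multiplicativity of [X, delta u] = c^r + L decides, where c is the action of X on u and L is the
  left-hand side: a multiplicative section is a unit at units, and the unit over the target of c(x)
  is c(x) + c(x)^{-1}.\<close>

lemma br_push_ivs:
  assumes X: "X \<in> mul_sections V" and u: "u \<in> sections (core V)"
  shows "br X (push_ivs (right_inv V u)) = push_ivs (right_inv V (action V Q X u))"
proof (rule extensionalityI)
  define c where "c = action V Q X u"
  define L where "L = br X (push_ivs (right_inv V u))"
  have c: "c \<in> sections (core V)" "right_inv V c = br X (right_inv V u)"
    unfolding c_def by (rule action_in[OF X u], rule right_inv_action[OF X u])
  note Xs = mul_in_sections[OF X] and hu = push_ivs_in[OF right_inv_in[OF u]]
  have Ls: "L \<in> sections (Hb V)" unfolding L_def by (rule br_in[OF Xs hu])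
  have Lt: "mult_triple B.szero L L"
    unfolding L_def using br_triple[OF X[unfolded mul_sections_iff] push_ivs_right_triple[OF u]]
        by (simp add: br_szero Xs)
  have W: "mult_triple (B.sadd (right_inv V c) L) (B.sadd (right_inv V c) L) (B.sadd (right_inv V c) L)"
    using br_mul[OF X delta_mul[OF u]] br_sadd(2)[OF right_inv_in[OF u] hu Xs]
    unfolding mul_sections_iff L_def c(2) delta_push_ivs[OF u] by simp
  show "br X (push_ivs (right_inv V u)) \<in> extensional (pts (arr (Gg V)))" using Ls
      by (simp add: L_def sections_def bas_Hb)
  show "push_ivs (right_inv V (action V Q X u)) \<in> extensional (pts (arr (Gg V)))" by (simp add: push_ivs_def)
  fix g assume g: "g \<in> pts (arr (Gg V))"
  define x where "x = src (Gg V) g"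
  define e where "e = unt (Gg V) x"
  have x: "x \<in> pts (obj (Gg V))" and e: "e \<in> pts (arr (Gg V))" "e \<in> pts (bas (Hb V))"
    using g by (simp_all add: x_def e_def bas_Hb G.src_in G.unt_in)
  have se: "src (Gg V) e = x" "tgt (Gg V) e = x" using x by (simp_all add: e_def G.src_unt G.tgt_unt)
  have ee: "(e, e) \<in> composable (Gg V)" "mul (Gg V) e e = e"
    using e se G.mul_unt_left[OF e(1)] by (auto simp: e_def intro!: G.composableI)
  have Le: "L e \<in> fibre (Hb V) e" by (rule section_Hb(1)[OF Ls e(1)])
  have ce: "c x \<in> fibre (Hb V) e" "ivs (Hg V) (c x) \<in> fibre (Hb V) e"
    using core_section(5,6)[OF c(1) x] x by (simp_all add: e_def fibre_Hb H.ivs_in proj_ivs G.ivs_unt)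
  have We: "B.sadd (right_inv V c) L e = vadd (Hb V) (c x) (L e)"
    using e right_inv_unit[OF c(1) x] by (simp add: B.sections_apply e_def)
  have "(vzer (Hb V) e, L e) \<in> composable (Hg V)"
    using Lt ee(1) szero_apply[OF e(1)] unfolding mult_triple_def by metis
  then have tL: "tgt (Hg V) (L e) = vzer (Eb V) x"
    using H.composableD(3) src_zero[OF e(1)] se by metis
  have "(B.sadd (right_inv V c) L e, B.sadd (right_inv V c) L e) \<in> composable (Hg V) \<and>
      B.sadd (right_inv V c) L (mul (Gg V) e e) = mul (Hg V) (B.sadd (right_inv V c) L e) (B.sadd (right_inv V
          c) L e)"
    using W ee(1) unfolding mult_triple_def by blast
  note WW = this[unfolded ee(2) We]
  \<comment> \<open>The value of a multiplicative section at a unit is idempotent, hence a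
    unit.\<close>
  have "vadd (Hb V) (c x) (L e) = unt (Hg V) (src (Hg V) (vadd (Hb V) (c x) (L e)))"
    by (rule H.idempotent_unit[OF conjunct1[OF WW] conjunct2[OF WW, symmetric]])
  then have "vadd (Hb V) (c x) (L e) = unt (Hg V) (tgt (Hg V) (vadd (Hb V) (c x) (L e)))"
    by (metis H.tgt_unt H.src_in B.vadd_in[OF e(2) ce(1) Le] fibre_Hb)
  \<comment> \<open>L has zero target at e because it is left-invariant. So the unit in question
    lies over the target of c(x), and \<open>core_inverse_sum\<close> rewrites it as a sum from
    which c(x) can be cancelled.\<close>
  also have "tgt (Hg V) (vadd (Hb V) (c x) (L e)) = tgt (Hg V) (c x)"
    using tgt_vadd[OF ce(1) Le] tL E.vadd_zero_right[of x] tgt_fibre[OF ce(1)] x se by (simp add: bas_Eb)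
  finally have s: "vadd (Hb V) (c x) (L e) = vadd (Hb V) (c x) (ivs (Hg V) (c x))"
    using core_inverse_sum[OF c(1) x] by simp
  have Lc: "L e = ivs (Hg V) (c x)"
  proof (rule B.point_eqI[OF e(2) Le ce(2)])
    fix \<alpha> assume "\<alpha> \<in> k_forms (Hb V) 1"
    then have "\<alpha> \<in> forms (Hb V)" by (rule B.k_forms_forms)
    from B.one_form_vadd(1)[OF this e(2) ce(1) Le] B.one_form_vadd(1)[OF this e(2) ce]
    show "\<alpha> e [L e] = \<alpha> e [ivs (Hg V) (c x)]" using s by simp
  qed
  have "(g, e) \<in> composable (Gg V)" "mul (Gg V) g e = g"
    using g e se by (auto simp: e_def x_def G.mul_unt_right intro!: G.composableI)
  then have "L g = mul (Hg V) (vzer (Hb V) g) (L e)"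
    using Lt szero_apply[OF g] unfolding mult_triple_def by metis
  then show "br X (push_ivs (right_inv V u)) g = push_ivs (right_inv V (action V Q X u)) g"
    unfolding push_ivs_right_inv_apply[OF c(1) g, unfolded c_def] L_def[symmetric] Lc
        by (simp add: c_def x_def)
qed

lemma delta_contract:
  "u \<in> sections (core V) \<Longrightarrow> \<omega> \<in> forms (Hb V) \<Longrightarrow> contract (Hb V) (delta V u) \<omega> =
    contract (Hb V) (right_inv V u) \<omega> + contract (Hb V) (push_ivs (right_inv V u)) \<omega>"
  by (simp add: delta_push_ivs B.contract_sadd right_inv_in push_ivs_in)

lemma contract_uminus: "X \<in> sections (Hb V) \<Longrightarrow> \<omega> \<in> forms (Hb V) \<Longrightarrow> contract (Hb V) (B.sscl (- 1) X) \<omega> =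
    - contract (Hb V) X \<omega>"
  by (simp add: contract_sscl' fmul_minus_one)

lemmas core_minus = real_module_facts[OF core_module, unfolded core_space_simps(1)]
lemmas section_ins = mul_in_sections right_inv_in push_ivs_in delta_in br_in ternary_in B.sadd_in B.sscl_in
    B.szero_in
lemmas core_ins = core_add(1) core_smult(1) action_in triple_in
lemmas right_invs = core_add(2) core_smult(2) right_inv_action right_inv_tri

text \<open>Multiplicative sections are fixed by the push-forward. Hence the two terms of
  \<open>jacobi_contract\<close> are the right-invariant extension of the ternary bracket and its
  image under inversion, and their sum is the differential.\<close>

lemma jacobi_mul:
  assumes X: "X \<in> mul_sections V" "Y \<in> mul_sections V" "Z \<in> mul_sections V"
  shows "delta V (triple V qr X Y Z) = B.sadd (B.sadd (br X (br Y Z)) (br Y (br Z X))) (br Z (br X Y))"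
proof (rule section_contractI)
  note s = mul_in_sections[OF X(1)] mul_in_sections[OF X(2)] mul_in_sections[OF X(3)]
  fix \<omega> assume \<omega>: "\<omega> \<in> forms (Hb V)"
  have h: "push_ivs X = X" "push_ivs Y = Y" "push_ivs Z = Z" using X
      by (simp_all add: push_ivs_multiplicative mul_sections_iff)
  have 1: "contract (Hb V) (br Y (br Z X)) \<omega> = - contract (Hb V) (br Y (br X Z)) \<omega>"
    unfolding br_skew[OF s(1,3)] br_sscl(2)[OF br_in[OF s(1,3)] s(2)]
    by (rule contract_uminus[OF br_in[OF s(2) br_in[OF s(1,3)]] \<omega>])
  have 2: "contract (Hb V) (br Z (br X Y)) \<omega> = - contract (Hb V) (br (br X Y) Z) \<omega>"
    by (rule contract_skew(3)[OF br_in[OF s(1,2)] s(3) s(3) \<omega>])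
  have 3: "contract (Hb V) (B.sadd (B.sadd (br X (br Y Z)) (br Y (br Z X))) (br Z (br X Y))) \<omega> =
    contract (Hb V) (br X (br Y Z)) \<omega> + contract (Hb V) (br Y (br Z X)) \<omega> + contract (Hb V) (br Z (br X Y)) \<omega>"
    using s \<omega> by (simp only: B.contract_sadd section_ins)
  show "contract (Hb V) (delta V (triple V qr X Y Z)) \<omega> =
    contract (Hb V) (B.sadd (B.sadd (br X (br Y Z)) (br Y (br Z X))) (br Z (br X Y))) \<omega>"
    unfolding 3 delta_contract[OF triple_in[OF X] \<omega>] right_inv_tri[OF X]
    using jacobi_contract[OF s \<omega>] unfolding h 1 2 by simp
qed (use X in \<open>simp_all add: section_ins triple_in\<close>)

lemma L2_structure: "L2_algebra (core_space V) (mul_space V) (delta V) br (action V Q) (triple V qr)"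
proof (rule L2_algebra.intro)
  show "Module.module real_field (core_space V)" by (rule core_module)
  show "Module.module real_field (mul_space V)" by (rule mul_module)
  show "linear_on (core_space V) (mul_space V) (delta V)"
    unfolding linear_on_def mul_space_simps core_space_simps(1)
  proof (intro conjI funcsetI ballI allI)
    fix u v a assume u: "u \<in> sections (core V)"
    show "delta V u \<in> mul_sections V" by (rule delta_mul[OF u])
    show "delta V (smult (core_space V) a u) = B.sscl a (delta V u)"
      using u by (simp add: delta_push_ivs core_smult push_ivs_sscl right_inv_in push_ivs_in
          B.section_module_laws)
    assume v: "v \<in> sections (core V)"
    show "delta V (add (core_space V) u v) = B.sadd (delta V u) (delta V v)"
      by (rule section_contractI) (use u v in \<open>simp_all add: delta_contract delta_in core_add push_ivs_sadd
          B.contract_sadd B.sadd_in right_inv_in push_ivs_in algebra_simps\<close>)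
  qed
next
  fix X assume X: "X \<in> carrier (mul_space V)"
  then have X: "X \<in> mul_sections V" by (simp add: mul_space_simps)
  show "linear_on (mul_space V) (mul_space V) (br X)"
    unfolding linear_on_def mul_space_simps using X by (auto simp: br_mul br_sadd br_sscl mul_in_sections)
  show "linear_on (core_space V) (core_space V) (action V Q X)"
    unfolding linear_on_def core_space_simps(1)
    using X by (auto simp: core_ins intro!: right_inv_inj) (simp_all add: right_invs core_ins br_sadd br_sscl
        section_ins)
next
  fix u assume "u \<in> carrier (core_space V)"
  then have u: "u \<in> sections (core V)" by (simp add: core_space_simps)
  show "linear_on (mul_space V) (core_space V) (\<lambda>X. action V Q X u)"
    unfolding linear_on_def mul_space_simps core_space_simps(1)
    using u by (auto simp: core_ins mul_sections_closed intro!: right_inv_inj)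
      (simp_all add: right_invs core_ins mul_sections_closed br_sadd br_sscl section_ins)
next
  fix X Y assume "X \<in> carrier (mul_space V)" "Y \<in> carrier (mul_space V)"
  then have X: "X \<in> mul_sections V" "Y \<in> mul_sections V" by (simp_all add: mul_space_simps)
  show "br Y X = \<ominus>\<^bsub>mul_space V\<^esub> br X Y"
    unfolding real_module_facts(1)[OF mul_module, unfolded mul_space_simps(1), OF br_mul[OF X]]
        mul_space_simps
    by (rule br_skew) (use X mul_in_sections in auto)
  show "linear_on (mul_space V) (core_space V) (triple V qr X Y)"
    unfolding linear_on_def mul_space_simps core_space_simps(1)
    using X by (auto simp: core_ins mul_sections_closed intro!: right_inv_inj)
      (simp_all add: right_invs core_ins mul_sections_closed ternary_sadd ternary_sscl section_ins)
  fix u assume "u \<in> carrier (core_space V)"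
  then have u: "u \<in> sections (core V)" by (simp add: core_space_simps)
  note s = X[THEN mul_in_sections] right_inv_in[OF u]
  have i: "action V Q Y u \<in> sections (core V)" "action V Q X u \<in> sections (core V)" "br X Y \<in> mul_sections V"
    using X u by (simp_all add: core_ins br_mul)
  have h: "push_ivs X = X" "push_ivs Y = Y" using X
      by (simp_all add: push_ivs_multiplicative mul_sections_iff)
  show "triple V qr X Y (delta V u) = action V Q X (action V Q Y u) \<ominus>\<^bsub>core_space V\<^esub> action V Q Y (action V Q X
      u)
      \<ominus>\<^bsub>core_space V\<^esub> action V Q (br X Y) u"
    unfolding core_minus(2)[OF action_in[OF X(1) i(1)] action_in[OF X(2) i(2)]]
  proof (subst core_minus(2), goal_cases)
    case 3
    show ?case
    proof (rule core_eqI)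
      fix \<omega> assume \<omega>: "\<omega> \<in> forms (Hb V)"
      \<comment> \<open>The left-invariant part of delta u contributes 0 by
        \<open>ternary_left\<close>, so u^r may replace delta u in the third slot.\<close>
      have d: "contract (Hb V) (ternary X Y (delta V u)) \<omega> = contract (Hb V) (ternary X Y (right_inv V u)) \<omega>"
        using s \<omega> by (simp add: delta_push_ivs[OF u] ternary_sadd ternary_left[OF X u] push_ivs_in
            B.contract_sadd B.contract_szero ternary_in B.szero_in)
      show "contract (Hb V) (right_inv V (triple V qr X Y (delta V u))) \<omega> = contract (Hb V) (right_inv V
        (add (core_space V) (add (core_space V) (action V Q X (action V Q Y u)) (smult (core_space V) (- 1)
            (action V Q Y (action V Q X u))))
        (smult (core_space V) (- 1) (action V Q (br X Y) u)))) \<omega>"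
        \<comment> \<open>With u^r in the third slot, the pushed-forward term of
          \<open>jacobi_contract\<close> contains the inverted section i_* u^r and vanishes by
          \<open>ternary_left\<close>; only the term of q^r survives.\<close>
        using jacobi_contract[OF s \<omega>] d X u i s \<omega>
        by (simp add: right_invs core_ins delta_mul ternary_left section_ins B.contract_sadd B.contract_szero
            contract_uminus h push_ivs_szero)
    qed (use X u i in \<open>simp_all add: core_ins delta_mul\<close>)
  qed (use X u i in \<open>simp_all add: core_ins\<close>)
next
  fix X Y Z assume "X \<in> carrier (mul_space V)" "Y \<in> carrier (mul_space V)" "Z \<in> carrier (mul_space V)"
  then have X: "X \<in> mul_sections V" "Y \<in> mul_sections V" "Z \<in> mul_sections V"
      by (simp_all add: mul_space_simps)
  show "triple V qr Y X Z = \<ominus>\<^bsub>core_space V\<^esub> triple V qr X Y Z \<and> triple V qr X Z Y =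
      \<ominus>\<^bsub>core_space V\<^esub> triple V qr X Y Z"
    unfolding core_minus(1)[OF triple_in[OF X]]
    by (intro conjI right_inv_inj core_ins X; (simp only: right_invs core_ins X)?; rule ternary_skew; rule
        mul_in_sections X)+
  show "delta V (triple V qr X Y Z) = br X (br Y Z) \<oplus>\<^bsub>mul_space V\<^esub> br Y (br Z X) \<oplus>\<^bsub>mul_space V\<^esub> br Z (br X Y)"
    unfolding mul_space_simps by (rule jacobi_mul[OF X])
next
  fix X u assume "X \<in> carrier (mul_space V)" "u \<in> carrier (core_space V)"
  then have X: "X \<in> mul_sections V" and u: "u \<in> sections (core V)"
      by (simp_all add: mul_space_simps core_space_simps)
  \<comment> \<open>Both sides split into a right-invariant and a left-invariant part; the
    left-invariant parts agree by \<open>br_push_ivs\<close>.\<close>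
  show "delta V (action V Q X u) = br X (delta V u)"
    using X u by (simp add: delta_push_ivs action_in br_sadd section_ins br_push_ivs right_inv_action)
next
  fix u v assume "u \<in> carrier (core_space V)" "v \<in> carrier (core_space V)"
  then have u: "u \<in> sections (core V)" "v \<in> sections (core V)" by (simp_all add: core_space_simps)
  \<comment> \<open>The left-invariant part of delta u has zero bracket with v^r. What remains is
    [u^r, v^r], whose skewness in u and v gives the axiom \<open>act_bd\<close>.\<close>
  have r: "right_inv V (action V Q (delta V u) v) = br (right_inv V u) (right_inv V v)"
    if "u \<in> sections (core V)" "v \<in> sections (core V)" for u v
  proof -
    have "B.sadd (br (right_inv V u) (right_inv V v)) B.szero = br (right_inv V u) (right_inv V v)"
      by (metis B.section_module_laws(2,3) B.szero_in br_in right_inv_in that)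
    then have "br (delta V u) (right_inv V v) = br (right_inv V u) (right_inv V v)"
      using that by (simp add: delta_push_ivs br_sadd right_inv_in push_ivs_in br_left_right)
    then show ?thesis using that by (simp only: right_inv_action delta_mul)
  qed
  show "action V Q (delta V u) v = \<ominus>\<^bsub>core_space V\<^esub> action V Q (delta V v) u"
    unfolding core_minus(1)[OF action_in[OF delta_mul[OF u(2)] u(1)]]
    by (rule right_inv_inj) (use u br_skew[OF right_inv_in right_inv_in, OF u(2,1)] in \<open>simp_all add: core_ins
        delta_mul core_smult r\<close>)
next
  fix W X Y Z assume "W \<in> carrier (mul_space V)" "X \<in> carrier (mul_space V)" "Y \<in> carrier (mul_space V)"
      "Z \<in> carrier (mul_space V)"
  then have m: "W \<in> mul_sections V" "X \<in> mul_sections V" "Y \<in> mul_sections V" "Z \<in> mul_sections V"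
      by (simp_all add: mul_space_simps)
  note ci = core_ins m br_mul
  show "action V Q W (triple V qr X Y Z) \<ominus>\<^bsub>core_space V\<^esub> action V Q X (triple V qr W Y Z) \<oplus>\<^bsub>core_space V\<^esub> action V
      Q Y (triple V qr W X Z)
      \<ominus>\<^bsub>core_space V\<^esub> action V Q Z (triple V qr W X Y) =
      triple V qr (br W X) Y Z \<ominus>\<^bsub>core_space V\<^esub> triple V qr (br W Y) X Z \<oplus>\<^bsub>core_space V\<^esub> triple V qr (br W Z) X Y
      \<oplus>\<^bsub>core_space V\<^esub> triple V qr (br X Y) W Z \<ominus>\<^bsub>core_space V\<^esub> triple V qr (br X Z) W Y \<oplus>\<^bsub>core_space V\<^esub> triple V qr
          (br Y Z) W X"
  proof (rule core_eqI)
    fix \<omega> assume \<omega>: "\<omega> \<in> forms (Hb V)"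
    show "contract (Hb V) (right_inv V (action V Q W (triple V qr X Y Z) \<ominus>\<^bsub>core_space V\<^esub> action V Q X (triple V
        qr W Y Z)
      \<oplus>\<^bsub>core_space V\<^esub> action V Q Y (triple V qr W X Z) \<ominus>\<^bsub>core_space V\<^esub> action V Q Z (triple V qr W X Y))) \<omega> =
      contract (Hb V) (right_inv V (triple V qr (br W X) Y Z \<ominus>\<^bsub>core_space V\<^esub> triple V qr (br W Y) X Z
          \<oplus>\<^bsub>core_space V\<^esub> triple V qr (br W Z) X Y
      \<oplus>\<^bsub>core_space V\<^esub> triple V qr (br X Y) W Z \<ominus>\<^bsub>core_space V\<^esub> triple V qr (br X Z) W Y \<oplus>\<^bsub>core_space V\<^esub> triple V qr
          (br Y Z) W X)) \<omega>"
      using coherence_contract[OF m[THEN mul_in_sections] \<omega>] \<omega>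
      by (simp add: core_minus(2) ci right_invs B.contract_sadd contract_uminus section_ins)
  qed (simp_all add: core_minus(2) ci)
qed

end

text \<open>The operations are definite descriptions; the clauses of unique existence ensure that
  these describe the intended sections, so that the last clause concerns the canonical
  structure.\<close>

theorem proposition3p19:
  fixes V :: "('h, 'e, 'g, 'm, 'v::euclidean_space) vbg"
    and Q qr :: "('g, 'h) form \<Rightarrow> ('g, 'h) form"
    and q :: "('g, 'h) form \<Rightarrow> ('m, 'e) form"
  assumes "quasi_LA_groupoid V Q q qr"
  shows "(\<forall>X\<in>sections (Hb V). \<forall>Y\<in>sections (Hb V). \<exists>!Z. is_LA_bracket V Q X Y Z) \<and>
    (\<forall>X\<in>sections (Hb V). \<forall>Y\<in>sections (Hb V). \<forall>Z\<in>sections (Hb V). \<exists>!W. is_ternary V qr X Y Z W) \<and>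
    (\<forall>X\<in>mul_sections V. \<forall>c\<in>sections (core V). \<exists>!c'. is_action V Q X c c') \<and>
    (\<forall>X\<in>mul_sections V. \<forall>Y\<in>mul_sections V. \<forall>Z\<in>mul_sections V. \<exists>!c. is_triple V qr X Y Z c) \<and>
    L2_algebra (core_space V) (mul_space V) (delta V) (LA_bracket V Q) (action V Q) (triple V qr)"
proof -
  interpret quasi_LA V Q qr q by unfold_locales (rule assms)
  show ?thesis
    by (intro conjI ballI is_LA_bracket_ex1 is_ternary_ex1 is_action_ex1 is_triple_ex1 L2_structure)
qed

end
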